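(* Let $n\ge 3$, $n/2<p<n$ and $s(p):=-1+n/p$. (i) There exists $\delta>0$ such that if $f\in \dot B^{s(p)-2}_{p,\infty}(\mathbb R^n)$ satisfies $\|f\|_{\dot B^{s(p)-2}_{p,\infty}}\le\delta$, then there exists a unique $U\in \dot B^{s(p)}_{p,\infty}$ (unique among solutions of sufficiently small norm in $\dot B^{s(p)}_{p,\infty}$) such that $$U=(-\Delta)^{-1}\mathbb P f-(-\Delta)^{-1}\mathbb P\nabla\cdot(U\otimes U)\quad\text{in }\dot B^{s(p)}_{p,\infty},$$ and $\|U\|_{\dot B^{s(p)}_{p,\infty}}\lesssim\|f\|_{\dot B^{s(p)-2}_{p,\infty}}$. (ii) If in addition $f\in\dot B^{s-2}_{p,\infty}$ for some $s\in(0,1)$ and $\|f\|_{\dot B^{s(p)-2}_{p,\infty}}$ is sufficiently small, then the solution $U$ of (i) also satisfies $\|U\|_{\dot B^{s}_{p,\infty}}\lesssim\|f\|_{\dot B^{s-2}_{p,\infty}}$.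
   Context: $\mathcal S'_h$ denotes the set of tempered distributions $f$ on $\mathbb R^n$ such that $\psi(\lambda D)f:=\mathcal F^{-1}[\psi(\lambda\cdot)\hat f]\to0$ in $L^\infty$ as $\lambda\to\infty$ for every $\psi\in\mathcal S$. Fix $\varphi\in\mathcal S$ with $\operatorname{supp}\varphi\subset\{1/2\le|\xi|\le2\}$ and $\sum_{j\in\mathbb Z}\varphi(\xi/2^j)=1$ for $\xi\ne0$; set $\varphi_j(D)f:=\mathcal F^{-1}[\varphi(\cdot/2^j)\hat f]$. For $s\in\mathbb R$, $p,q\in[1,\infty]$, the homogeneous Besov space is $\dot B^s_{p,q}:=\{f\in\mathcal S'_h:\|f\|_{\dot B^s_{p,q}}:=\|\{2^{js}\|\varphi_j(D)f\|_{L^p}\}_{j\in\mathbb Z}\|_{\ell^q}<\infty\}$. For a smooth function $m$ on $\mathbb R^n\setminus\{0\}$, $m(D)f:=\sum_{j\in\mathbb Z}\mathcal F^{-1}[m\,\varphi(\cdot/2^j)\hat f]$ (convergent in $\mathcal S'$). The Helmholtz projection is $\mathbb P=m(D)$ with matrix symbol $m(\xi)=(\delta_{ij}-\xi_i\xi_j/|\xi|^2)_{i,j}$, and $(-\Delta)^{a/2}:=m(D)$ with $m(\xi)=|\xi|^a$ (so $(-\Delta)^{-1}$ has symbol $|\xi|^{-2}$). For a matrix field $F$, $(\nabla\cdot F)_i=\sum_j\partial_jF_{ij}$, and $(U\otimes U)_{ij}=U_iU_j$. $A\lesssim B$ means $A\le cB$ for a constant $c>0$ independent of the relevant functions. *)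

theory Defs
  imports "HOL-Analysis.Analysis" "HOL-Probability.Essential_Supremum"
begin

text \<open>Test functions and distributions on R^n, with n = CARD('n).
  A (complex) distribution is modelled as a functional on complex-valued functions;
  only its values on Schwartz functions matter.\<close>

type_synonym 'n distr = "((real^'n) \<Rightarrow> complex) \<Rightarrow> complex"

definition pd :: "'n::finite \<Rightarrow> (real^'n \<Rightarrow> complex) \<Rightarrow> real^'n \<Rightarrow> complex" where
  "pd i f x = vector_derivative (\<lambda>t::real. f (x + t *\<^sub>R axis i 1)) (at 0)"

definition dpart :: "'n::finite list \<Rightarrow> (real^'n \<Rightarrow> complex) \<Rightarrow> real^'n \<Rightarrow> complex" where
  "dpart ds f = foldr pd ds f"

definition schwartz :: "(real^'n::finite \<Rightarrow> complex) set" where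
  "schwartz = {\<phi>. \<forall>ds. (\<forall>i x. (\<lambda>t::real. dpart ds \<phi> (x + t *\<^sub>R axis i 1)) differentiable (at 0))
       \<and> (\<forall>k::nat. bounded (range (\<lambda>x. (1 + norm x) ^ k * norm (dpart ds \<phi> x))))}"

definition seminorm :: "nat \<Rightarrow> 'n::finite list \<Rightarrow> (real^'n \<Rightarrow> complex) \<Rightarrow> real" where
  "seminorm k ds \<phi> = (SUP x. (1 + norm x) ^ k * norm (dpart ds \<phi> x))"

definition tempered :: "'n::finite distr \<Rightarrow> bool" where
  "tempered T \<longleftrightarrow>
     (\<forall>\<phi>\<in>schwartz. \<forall>\<psi>\<in>schwartz. \<forall>a b. T (\<lambda>x. a * \<phi> x + b * \<psi> x) = a * T \<phi> + b * T \<psi>)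
   \<and> (\<exists>C N. \<forall>\<phi>\<in>schwartz.
        norm (T \<phi>) \<le> C * (\<Sum>k\<le>N. \<Sum>ds\<in>{ds::'n list. length ds \<le> N}. seminorm k ds \<phi>))"

definition deq :: "'n::finite distr \<Rightarrow> 'n distr \<Rightarrow> bool" where
  "deq T S \<longleftrightarrow> (\<forall>\<phi>\<in>schwartz. T \<phi> = S \<phi>)"

definition ft :: "(real^'n::finite \<Rightarrow> complex) \<Rightarrow> real^'n \<Rightarrow> complex" where
  "ft \<phi> \<xi> = (\<integral>x. cis (- (x \<bullet> \<xi>)) * \<phi> x \<partial>lborel)"

definition ift :: "(real^'n::finite \<Rightarrow> complex) \<Rightarrow> real^'n \<Rightarrow> complex" where
  "ift \<phi> x = complex_of_real (1 / (2 * pi) ^ CARD('n)) * (\<integral>\<xi>. cis (x \<bullet> \<xi>) * \<phi> \<xi> \<partial>lborel)"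

definition dft :: "'n::finite distr \<Rightarrow> 'n distr" where
  "dft T = (\<lambda>\<phi>. T (ft \<phi>))"

definition dift :: "'n::finite distr \<Rightarrow> 'n distr" where
  "dift T = (\<lambda>\<phi>. T (ift \<phi>))"

text \<open>Fourier multiplier with a symbol that is smooth (times a cut-off): F^{-1}[m F T].\<close>
definition fmult :: "(real^'n::finite \<Rightarrow> complex) \<Rightarrow> 'n distr \<Rightarrow> 'n distr" where
  "fmult m T = dift (\<lambda>\<phi>. dft T (\<lambda>\<xi>. m \<xi> * \<phi> \<xi>))"

definition fdist :: "(real^'n::finite \<Rightarrow> complex) \<Rightarrow> 'n distr" where
  "fdist g = (\<lambda>\<phi>. \<integral>x. g x * \<phi> x \<partial>lborel)"

definition represents :: "(real^'n::finite \<Rightarrow> complex) \<Rightarrow> 'n distr \<Rightarrow> bool" where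
  "represents g T \<longleftrightarrow> g \<in> borel_measurable lborel \<and>
     (\<forall>\<phi>\<in>schwartz. integrable lborel (\<lambda>x. g x * \<phi> x) \<and> T \<phi> = (\<integral>x. g x * \<phi> x \<partial>lborel))"

definition rep :: "'n::finite distr \<Rightarrow> real^'n \<Rightarrow> complex" where
  "rep T = (SOME g. represents g T)"

definition Lpn :: "real \<Rightarrow> (real^'n::finite \<Rightarrow> complex) \<Rightarrow> ereal" where
  "Lpn p g = (if integrable lborel (\<lambda>x. norm (g x) powr p)
              then ereal ((\<integral>x. norm (g x) powr p \<partial>lborel) powr (1 / p)) else \<infinity>)"

definition dnorm :: "real \<Rightarrow> 'n::finite distr \<Rightarrow> ereal" where
  "dnorm p T = (if \<exists>g. represents g T then Lpn p (rep T) else \<infinity>)"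

definition dnorm_inf :: "'n::finite distr \<Rightarrow> ereal" where
  "dnorm_inf T = (if \<exists>g. represents g T then esssup lborel (\<lambda>x. ereal (norm (rep T x))) else \<infinity>)"

definition Sh :: "'n::finite distr \<Rightarrow> bool" where
  "Sh T \<longleftrightarrow> tempered T \<and>
     (\<forall>\<psi>\<in>schwartz. ((\<lambda>l::real. dnorm_inf (fmult (\<lambda>\<xi>. \<psi> (l *\<^sub>R \<xi>)) T)) \<longlongrightarrow> 0) at_top)"

definition LP_function :: "(real^'n::finite \<Rightarrow> complex) \<Rightarrow> bool" where
  "LP_function \<phi> \<longleftrightarrow> \<phi> \<in> schwartz
     \<and> (\<forall>\<xi>. \<phi> \<xi> \<noteq> 0 \<longrightarrow> 1/2 \<le> norm \<xi> \<and> norm \<xi> \<le> 2)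
     \<and> (\<forall>\<xi>. \<xi> \<noteq> 0 \<longrightarrow> ((\<lambda>j::int. \<phi> ((2 powr (- real_of_int j)) *\<^sub>R \<xi>)) has_sum 1) UNIV)"

definition LPblock :: "(real^'n::finite \<Rightarrow> complex) \<Rightarrow> int \<Rightarrow> 'n distr \<Rightarrow> 'n distr" where
  "LPblock \<phi> j T = fmult (\<lambda>\<xi>. \<phi> ((2 powr (- real_of_int j)) *\<^sub>R \<xi>)) T"

definition bnorm :: "(real^'n::finite \<Rightarrow> complex) \<Rightarrow> real \<Rightarrow> real \<Rightarrow> 'n distr \<Rightarrow> ereal" where
  "bnorm \<phi> s p T = (SUP j::int. ereal (2 powr (real_of_int j * s)) * dnorm p (LPblock \<phi> j T))"

definition besov :: "(real^'n::finite \<Rightarrow> complex) \<Rightarrow> real \<Rightarrow> real \<Rightarrow> 'n distr \<Rightarrow> bool" where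
  "besov \<phi> s p T \<longleftrightarrow> Sh T \<and> bnorm \<phi> s p T < \<infinity>"

definition vbesov :: "(real^'n::finite \<Rightarrow> complex) \<Rightarrow> real \<Rightarrow> real \<Rightarrow> ('n \<Rightarrow> 'n distr) \<Rightarrow> bool" where
  "vbesov \<phi> s p F \<longleftrightarrow> (\<forall>i. besov \<phi> s p (F i))"

definition vbnorm :: "(real^'n::finite \<Rightarrow> complex) \<Rightarrow> real \<Rightarrow> real \<Rightarrow> ('n \<Rightarrow> 'n distr) \<Rightarrow> ereal" where
  "vbnorm \<phi> s p F = (\<Sum>i\<in>UNIV. bnorm \<phi> s p (F i))"

definition mD :: "(real^'n::finite \<Rightarrow> complex) \<Rightarrow> (real^'n \<Rightarrow> complex) \<Rightarrow> 'n distr \<Rightarrow> 'n distr" where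
  "mD \<phi> m T = (\<lambda>\<psi>. lim (\<lambda>N::nat. \<Sum>j\<in>{- int N..int N}.
       fmult (\<lambda>\<xi>. m \<xi> * \<phi> ((2 powr (- real_of_int j)) *\<^sub>R \<xi>)) T \<psi>))"

definition helmholtz :: "(real^'n::finite \<Rightarrow> complex) \<Rightarrow> ('n \<Rightarrow> 'n distr) \<Rightarrow> ('n \<Rightarrow> 'n distr)" where
  "helmholtz \<phi> G i = (\<lambda>\<psi>. \<Sum>j\<in>UNIV. mD \<phi>
      (\<lambda>\<xi>. complex_of_real ((if i = j then 1 else 0) - (\<xi> $ i) * (\<xi> $ j) / (norm \<xi>)\<^sup>2)) (G j) \<psi>)"

definition invlap :: "(real^'n::finite \<Rightarrow> complex) \<Rightarrow> 'n distr \<Rightarrow> 'n distr" where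
  "invlap \<phi> T = mD \<phi> (\<lambda>\<xi>. complex_of_real (1 / (norm \<xi>)\<^sup>2)) T"

definition dderiv :: "'n::finite \<Rightarrow> 'n distr \<Rightarrow> 'n distr" where
  "dderiv j T = (\<lambda>\<psi>. - T (pd j \<psi>))"

definition divg :: "('n::finite \<Rightarrow> 'n \<Rightarrow> 'n distr) \<Rightarrow> ('n \<Rightarrow> 'n distr)" where
  "divg F i = (\<lambda>\<psi>. \<Sum>j\<in>UNIV. dderiv j (F i j) \<psi>)"

definition tens :: "('n::finite \<Rightarrow> 'n distr) \<Rightarrow> ('n \<Rightarrow> 'n \<Rightarrow> 'n distr)" where
  "tens U i j = fdist (\<lambda>x. rep (U i) x * rep (U j) x)"

definition ns_eq :: "(real^'n::finite \<Rightarrow> complex) \<Rightarrow> ('n \<Rightarrow> 'n distr) \<Rightarrow> ('n \<Rightarrow> 'n distr) \<Rightarrow> bool" where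
  "ns_eq \<phi> f U \<longleftrightarrow> (\<forall>i. deq (U i)
      (\<lambda>\<psi>. invlap \<phi> (helmholtz \<phi> f i) \<psi> - invlap \<phi> (helmholtz \<phi> (divg (tens U)) i) \<psi>))"

end

theory Submission
  imports Defs "HOL-Probability.Probability" "HOL-Real_Asymp.Real_Asymp"
begin

text \<open>
  The equation is solved by Picard iteration, and no paraproduct is needed. For \<open>0 < s < n / p\<close>
  the space \<open>B\<^sup>s\<^sub>p\<^sub>,\<^sub>\<infinity>\<close> embeds into weak \<open>L\<^sup>m\<close> with \<open>1 / m = 1 / p - s / n\<close>. At the critical exponent
  \<open>m = n\<close>, so by weak Hoelder a product of a function in the critical space with one in \<open>B\<^sup>s\<^sub>p\<^sub>,\<^sub>\<infinity>\<close>,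
  \<open>0 < s < 1\<close>, lies in weak \<open>L\<^sup>q\<close> with \<open>1 / q = 1 / n + 1 / m\<close> and \<open>1 < q < p\<close>. Weak \<open>L\<^sup>q\<close> embeds into
  \<open>B\<^sup>s\<^sup>-\<^sup>1\<^sub>p\<^sub>,\<^sub>\<infinity>\<close>, and the symbol of \<open>(-\<Delta>)\<^sup>-\<^sup>1 P \<nabla>\<cdot>\<close> is homogeneous of degree \<open>- 1\<close>, which leads back to \<open>B\<^sup>s\<^sub>p\<^sub>,\<^sub>\<infinity>\<close>.
  The bilinear term is thus bounded on \<open>B\<^sup>s\<^sub>p\<^sub>,\<^sub>\<infinity>\<close> with one factor measured in the critical norm only:
  for critical \<open>s\<close> this gives the contraction, for the other \<open>s\<close> it bounds the iterates uniformly
  in \<open>B\<^sup>s\<^sub>p\<^sub>,\<^sub>\<infinity>\<close>, a bound that survives in the limit.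
\<close>

section \<open>Schwartz functions\<close>

text \<open>The equation is built from total operators: \<open>lim\<close>, the choice
  \<open>rep\<close> and infinite sums. Nothing about it is additive, or even meaningful, until
  convergence is proved. The working notion is therefore \<open>bd p s A T\<close>: \<open>T\<close>
  is the weak sum of its dyadic blocks, and the blocks obey the Besov bound \<open>A\<close>. It
  survives sums, series and the operators, and for \<open>0 < s < n / p\<close> it gives back
  membership in S'_h, because the low blocks are summable in \<open>L\<^sup>\<infinity>\<close>. The
  range of \<open>p\<close> says exactly that the critical regularity \<open>n / p - 1\<close> lies
  between 0 and 1. In the product estimate \<open>1 < q\<close> then follows from
  \<open>1 + n / p - s < 3 \<le> n\<close>, and \<open>q < p\<close> from \<open>s < 1\<close>. With
  quadratic constant \<open>K\<close> and linear term of size \<open>b\<close>, the iterates stay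
  within \<open>2 * b\<close> and contract by one half as soon as \<open>8 * K * b \<le> 1\<close>.
  Every solution of norm at most \<open>1 / (4 * K)\<close> is the limit of these same iterates.
  This gives uniqueness, and it gives part (ii) for every such solution; hence the radius \<epsilon>
  does not depend on \<open>s\<close>, while the smallness of \<open>f\<close> may.\<close>

abbreviation has_pd :: "'n::finite \<Rightarrow> (real^'n \<Rightarrow> complex) \<Rightarrow> real^'n \<Rightarrow> complex \<Rightarrow> bool" where
  "has_pd i f x d \<equiv> ((\<lambda>t::real. f (x + t *\<^sub>R axis i 1)) has_vector_derivative d) (at 0)"

lemma has_pd_imp: "has_pd i f x d \<Longrightarrow> pd i f x = d"
  unfolding pd_def by (rule vector_derivative_at)

lemma has_pd_works: "(\<lambda>t::real. f (x + t *\<^sub>R axis i 1)) differentiable (at 0) \<Longrightarrow> has_pd i f x (pd i f x)"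
  unfolding pd_def by (rule vector_derivative_works[THEN iffD1])

lemma has_pd_diff: "has_pd i f x d \<Longrightarrow> (\<lambda>t::real. f (x + t *\<^sub>R axis i 1)) differentiable (at 0)"
  using differentiableI_vector by blast

lemma has_pd_add: "has_pd i f x d \<Longrightarrow> has_pd i g x e \<Longrightarrow> has_pd i (\<lambda>x. f x + g x) x (d + e)"
  by (rule has_vector_derivative_add)

lemma has_pd_mult:
  "has_pd i f x d \<Longrightarrow> has_pd i g x e \<Longrightarrow> has_pd i (\<lambda>x. f x * g x) x (f x * e + d * g x)"
  using has_vector_derivative_mult[of "\<lambda>t. f (x + t *\<^sub>R axis i 1)" d 0 UNIV "\<lambda>t. g (x + t *\<^sub>R axis i 1)" e]
  by simp

lemma has_pd_const: "has_pd i (\<lambda>x. c) x 0"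
  by simp

lemma has_pd_cmult: "has_pd i f x d \<Longrightarrow> has_pd i (\<lambda>x. c * f x) x (c * d)"
  by (rule has_vector_derivative_mult_right)

text \<open>A directional derivative sees only a neighbourhood, so functions given by different
  formulas on overlapping open sets can be differentiated piece by piece. The two cut-off
  constructions below, near the origin and around the low-frequency ball, rely on it.\<close>

lemma has_pd_transform:
  assumes "has_pd i f x d" "open S" "x \<in> S" "\<And>y. y \<in> S \<Longrightarrow> g y = f y"
  shows "has_pd i g x d"
proof -
  let ?h = "\<lambda>t::real. x + t *\<^sub>R axis i 1"
  have cont: "continuous_on UNIV ?h" by (intro continuous_intros)
  have "open (?h -` S)"
    using assms(2) cont by (metis open_vimage)
  moreover have "0 \<in> ?h -` S" using assms by simp
  ultimately show ?thesis
    using has_vector_derivative_transform_within_open[OF assms(1), of "?h -` S" "\<lambda>t. g (?h t)"] assms(4)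
    by auto
qed

lemma has_pd_shift:
  assumes "has_pd i f (x + a) d" shows "has_pd i (\<lambda>x. f (x + a)) x d"
  using assms by (simp add: algebra_simps)

lemma has_pd_scale:
  fixes c :: real
  assumes "has_pd i f (c *\<^sub>R x) d" shows "has_pd i (\<lambda>x. f (c *\<^sub>R x)) x (c *\<^sub>R d)"
proof -
  have 1: "((\<lambda>t. c * t) has_vector_derivative c) (at 0)"
    by (auto intro!: derivative_eq_intros)
  have 2: "((\<lambda>t. f (c *\<^sub>R x + t *\<^sub>R axis i 1)) has_vector_derivative d) (at (c * 0) within range ((*) c))"
    using assms by (simp add: has_vector_derivative_at_within)
  show ?thesis
    using vector_diff_chain_within[of "\<lambda>t. c * t" c 0 UNIV, OF _ 2] 1
    by (simp add: o_def algebra_simps)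
qed

lemma has_pd_coord: "has_pd i (\<lambda>x. complex_of_real (x $ j)) x (if i = j then 1 else 0)"
  by (cases "i = j") (auto intro!: derivative_eq_intros has_vector_derivative_of_real simp: axis_def)

lemma dpart_Nil [simp]: "dpart [] f = f" and dpart_Cons [simp]: "dpart (i # ds) f = pd i (dpart ds f)"
  and dpart_snoc: "dpart (ds @ [i]) f = dpart ds (pd i f)"
  by (simp_all add: dpart_def)

lemma bounded_range_iff: "bounded (range (\<lambda>x. (1 + norm x) ^ k * norm (f x :: complex))) \<longleftrightarrow>
   (\<exists>C. \<forall>x. (1 + norm x) ^ k * norm (f x) \<le> C)"
  by (auto simp: bounded_iff abs_mult)

text \<open>All iterated derivatives stay in \<open>X\<close> by induction on the list, so
  differentiability and decay are checked for members of \<open>X\<close> only, without any formula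
  for higher derivatives.\<close>

lemma schwartz_coinduct:
  assumes "f \<in> X" "\<And>f i x. f \<in> X \<Longrightarrow> \<exists>d. has_pd i f x d" "\<And>f i. f \<in> X \<Longrightarrow> pd i f \<in> X"
    "\<And>f k. f \<in> X \<Longrightarrow> \<exists>C. \<forall>x. (1 + norm x) ^ k * norm (f x) \<le> C"
  shows "f \<in> schwartz"
proof -
  have "dpart ds f \<in> X" for ds
    using assms(1,3) by (induction ds) auto
  then show ?thesis
    unfolding schwartz_def bounded_range_iff using assms(2,4) has_pd_diff by blast
qed

lemma schwartz_has_pd: "f \<in> schwartz \<Longrightarrow> has_pd i f x (pd i f x)"
  by (rule has_pd_works) (auto simp: schwartz_def dest: spec[of _ "[]"])

lemma schwartz_pd: "f \<in> schwartz \<Longrightarrow> pd i f \<in> schwartz"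
  unfolding schwartz_def by (simp flip: dpart_snoc)

lemma schwartz_dpart: "f \<in> schwartz \<Longrightarrow> dpart ds f \<in> schwartz"
  by (induction ds) (auto intro: schwartz_pd)

lemma schwartz_bound:
  assumes "f \<in> schwartz" obtains C where "C > 0" "\<And>x. (1 + norm x) ^ k * norm (f x) \<le> C"
proof -
  have "bounded (range (\<lambda>x. (1 + norm x) ^ k * norm (dpart [] f x)))"
    using assms unfolding schwartz_def by fast
  then obtain C where C: "\<And>x. (1 + norm x) ^ k * norm (f x) \<le> C"
    unfolding bounded_range_iff by auto
  have "(1 + norm x) ^ k * norm (f x) \<le> max C 1" for x using C[of x] by simp
  then show ?thesis using that[of "max C 1"] by simp
qed

text \<open>The product rule turns one generator into a sum of two, so the invariant set for
  \<open>schwartz_coinduct\<close> must be closed under addition. Scalar factors are absorbed into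
  the generators in each use.\<close>

inductive_set sspan :: "(real^'n::finite \<Rightarrow> complex) set \<Rightarrow> (real^'n \<Rightarrow> complex) set" for B where
  base: "f \<in> B \<Longrightarrow> f \<in> sspan B"
| add: "f \<in> sspan B \<Longrightarrow> g \<in> sspan B \<Longrightarrow> (\<lambda>x. f x + g x) \<in> sspan B"

lemma sspan_schwartz:
  assumes "f \<in> sspan B" "\<And>f i x. f \<in> B \<Longrightarrow> \<exists>d. has_pd i f x d" "\<And>f i. f \<in> B \<Longrightarrow> pd i f \<in> sspan B"
    "\<And>f k. f \<in> B \<Longrightarrow> \<exists>C. \<forall>x. (1 + norm x) ^ k * norm (f x) \<le> C"
  shows "f \<in> schwartz"
proof (rule schwartz_coinduct[OF assms(1)])
  show 1: "\<exists>d. has_pd i f x d" if "f \<in> sspan B" for f i x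
    using that
  proof induction
    case (add f g)
    then obtain d e where "has_pd i f x d" "has_pd i g x e" by auto
    then show ?case using has_pd_add by fast
  qed (use assms(2) in auto)
  show "pd i f \<in> sspan B" if "f \<in> sspan B" for f i
    using that
  proof induction
    case (add f g)
    have "pd i (\<lambda>x. f x + g x) = (\<lambda>x. pd i f x + pd i g x)"
    proof (rule ext, rule has_pd_imp, rule has_pd_add)
      show "has_pd i f x (pd i f x)" "has_pd i g x (pd i g x)" for x
        using 1[OF add(1)] 1[OF add(2)] has_pd_imp by metis+
    qed
    then show ?case using add by (simp add: sspan.add)
  qed (use assms(3) in auto)
  show "\<exists>C. \<forall>x. (1 + norm x) ^ k * norm (f x) \<le> C" if "f \<in> sspan B" for f k
    using that
  proof induction
    case (add f g)
    then obtain C D where "\<forall>x. (1 + norm x) ^ k * norm (f x) \<le> C" "\<forall>x. (1 + norm x) ^ k * norm (g x) \<le> D"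
      by auto
    then have "(1 + norm x) ^ k * norm (f x + g x) \<le> C + D" for x
      by (smt (verit, best) mult_left_mono norm_triangle_ineq distrib_left norm_ge_zero zero_le_power)
    then show ?case by blast
  qed (use assms(4) in auto)
qed

lemma schwartz_add:
  assumes "f \<in> schwartz" "g \<in> schwartz" shows "(\<lambda>x. f x + g x) \<in> schwartz"
proof (rule sspan_schwartz[where B = schwartz])
  show "(\<lambda>x. f x + g x) \<in> sspan schwartz" using assms by (intro sspan.intros)
  show "\<exists>C. \<forall>x. (1 + norm x) ^ k * norm (f x) \<le> C" if "f \<in> schwartz" for f :: "real^'a \<Rightarrow> complex" and k
    using schwartz_bound[OF that] by metis
qed (auto intro: schwartz_has_pd schwartz_pd sspan.base)

lemma schwartz_cmult:
  assumes "f \<in> schwartz" shows "(\<lambda>x. c * f x) \<in> schwartz"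
proof (rule schwartz_coinduct[where X = "(\<lambda>f x. c * f x) ` schwartz"])
  fix h assume "h \<in> (\<lambda>f (x::real^'a). c * f x) ` schwartz"
  then obtain g where g: "g \<in> schwartz" "h = (\<lambda>x. c * g x)" by auto
  have *: "has_pd i h x (c * pd i g x)" for i x
    unfolding g(2) by (rule has_pd_cmult schwartz_has_pd g)+
  show "\<exists>d. has_pd i h x d" for i x by (rule exI, rule *)
  have "pd i h = (\<lambda>x. c * pd i g x)" for i by (rule ext, rule has_pd_imp, rule *)
  then show "pd i h \<in> (\<lambda>f (x::real^'a). c * f x) ` schwartz" for i using schwartz_pd[OF g(1)] by auto
  fix k
  obtain C where "\<And>x. (1 + norm x) ^ k * norm (g x) \<le> C" using schwartz_bound[OF g(1)] by metis
  then have "(1 + norm x) ^ k * norm (h x) \<le> norm c * C" for x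
    using mult_left_mono[of _ C "norm c"] g by (simp add: norm_mult mult.left_commute)
  then show "\<exists>C. \<forall>x. (1 + norm x) ^ k * norm (h x) \<le> C" by blast
qed (rule imageI, rule assms)

lemma pd_add: "f \<in> schwartz \<Longrightarrow> g \<in> schwartz \<Longrightarrow> pd i (\<lambda>x. f x + g x) = (\<lambda>x. pd i f x + pd i g x)"
  by (intro ext has_pd_imp has_pd_add schwartz_has_pd)

lemma pd_cmult: "f \<in> schwartz \<Longrightarrow> pd i (\<lambda>x. c * f x) = (\<lambda>x. c * pd i f x)"
  by (intro ext has_pd_imp has_pd_cmult schwartz_has_pd)

lemma schwartz_uminus: "f \<in> schwartz \<Longrightarrow> (\<lambda>x. - f x) \<in> schwartz"
  using schwartz_cmult[of f "-1"] by simp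

lemma schwartz_diff: "f \<in> schwartz \<Longrightarrow> g \<in> schwartz \<Longrightarrow> (\<lambda>x. f x - g x) \<in> schwartz"
  using schwartz_add[OF _ schwartz_uminus] by auto

lemma schwartz_zero: "(\<lambda>x::real^'n::finite. 0) \<in> schwartz"
  by (rule schwartz_coinduct[where X = "{\<lambda>x. 0}"])
     (auto simp: pd_def fun_eq_iff intro!: exI[of _ 0] vector_derivative_at)

lemma schwartz_sum: "(\<And>j. j \<in> A \<Longrightarrow> f j \<in> schwartz) \<Longrightarrow> (\<lambda>x. \<Sum>j\<in>A. f j x) \<in> schwartz"
  by (induction A rule: infinite_finite_induct) (auto intro: schwartz_add schwartz_zero)

lemma schwartz_mult:
  assumes "f \<in> schwartz" "g \<in> schwartz" shows "(\<lambda>x. f x * g x) \<in> schwartz"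
proof (rule sspan_schwartz[where B = "{\<lambda>x. f x * g x | f g. f \<in> schwartz \<and> g \<in> schwartz}"])
  let ?B = "{\<lambda>x::real^'a. f x * g x | f g. f \<in> schwartz \<and> g \<in> schwartz}"
  show "(\<lambda>x. f x * g x) \<in> sspan ?B"
    by (rule sspan.base, rule CollectI, rule exI[of _ f], rule exI[of _ g]) (simp add: assms)
  fix h assume "h \<in> ?B"
  then obtain f g where h: "h = (\<lambda>x. f x * g x)" "f \<in> schwartz" "g \<in> schwartz" by auto
  have *: "has_pd i h x (f x * pd i g x + pd i f x * g x)" for i x
    unfolding h(1) by (intro has_pd_mult schwartz_has_pd h)
  then show "\<exists>d. has_pd i h x d" for i x by blast
  have "pd i h = (\<lambda>x. f x * pd i g x + pd i f x * g x)" for i by (rule ext, rule has_pd_imp, rule *)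
  also have "\<dots> i \<in> sspan ?B" for i
    by (rule sspan.add; rule sspan.base, rule CollectI, rule exI, rule exI, rule conjI, rule refl)
       (simp_all add: h schwartz_pd)
  finally show "pd i h \<in> sspan ?B" for i .
  fix k
  obtain C D where C: "\<And>x. (1 + norm x) ^ k * norm (f x) \<le> C" and D: "D > 0" "\<And>x. (1 + norm x) ^ 0 * norm (g x) \<le> D"
    using schwartz_bound[OF h(2)] schwartz_bound[OF h(3)] by metis
  have "(1 + norm x) ^ k * norm (h x) \<le> C * D" for x
    unfolding h norm_mult mult.assoc[symmetric]
    using C[of x] D(2)[of x] by (intro mult_mono) (simp_all, meson norm_ge_zero order_trans zero_le_mult_iff zero_le_power add_nonneg_nonneg zero_le_one)
  then show "\<exists>C. \<forall>x. (1 + norm x) ^ k * norm (h x) \<le> C" by blast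
qed

lemma schwartz_coord:
  assumes "f \<in> schwartz" shows "(\<lambda>x. complex_of_real (x $ j) * f x) \<in> schwartz"
\<comment> \<open>The product rule also produces \<open>f\<close> without its coordinate factor, so
  plain Schwartz functions have to be generators too.\<close>
proof (rule sspan_schwartz[where B = "(\<lambda>f x. complex_of_real (x $ j) * f x) ` schwartz \<union> schwartz"])
  let ?m = "\<lambda>f x. complex_of_real (x $ j) * f x"
  let ?B = "?m ` schwartz \<union> schwartz"
  show "(\<lambda>x. complex_of_real (x $ j) * f x) \<in> sspan ?B"
    by (rule sspan.base, rule UnI1, rule imageI, rule assms)
  fix h assume hB: "h \<in> ?B"
  have *: "(\<exists>d. has_pd i h x d) \<and> pd i h \<in> sspan ?B \<and> (\<exists>C. \<forall>x. (1 + norm x) ^ k * norm (h x) \<le> C)" for i k x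
    using hB
  proof
    assume h: "h \<in> schwartz"
    then have "\<exists>C. \<forall>x. (1 + norm x) ^ k * norm (h x) \<le> C" using schwartz_bound[OF h] by metis
    moreover have "\<exists>d. has_pd i h x d" by (rule exI, rule schwartz_has_pd[OF h])
    moreover have "pd i h \<in> sspan ?B" by (rule sspan.base, rule UnI2, rule schwartz_pd[OF h])
    ultimately show ?thesis by blast
  next
    assume "h \<in> ?m ` schwartz"
    then obtain f where h: "h = ?m f" and f: "f \<in> schwartz" by (rule imageE)
    have *: "has_pd i h x (complex_of_real (x $ j) * pd i f x + (if i = j then 1 else 0) * f x)" for i x
      unfolding h by (intro has_pd_mult schwartz_has_pd has_pd_coord f)
    then have "pd i h = (\<lambda>x. ?m (pd i f) x + (if i = j then 1 else 0) * f x)" for i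
      by (intro ext has_pd_imp)
    also have "\<dots> i \<in> sspan ?B" for i
      by (rule sspan.add; rule sspan.base) (intro UnI1 imageI schwartz_pd f, intro UnI2 schwartz_cmult f)
    finally have 2: "pd i h \<in> sspan ?B" for i .
    \<comment> \<open>One extra power of the weight pays for the coordinate factor, which is at most
      \<open>1 + norm x\<close>.\<close>
    obtain C where C: "C > 0" "\<And>x. (1 + norm x) ^ (Suc k) * norm (f x) \<le> C"
      using schwartz_bound[OF f] by metis
    have "(1 + norm x) ^ k * norm (h x) \<le> C" for x
    proof -
      have "(1 + norm x) ^ k * norm (h x) = (1 + norm x) ^ k * norm (f x) * \<bar>x $ j\<bar>"
        by (simp add: h norm_mult)
      also have "\<dots> \<le> (1 + norm x) ^ k * norm (f x) * (1 + norm x)"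
        by (rule mult_left_mono) (use component_le_norm_cart[of x j] in auto)
      also have "\<dots> \<le> C" using C(2)[of x] by (simp add: mult_ac)
      finally show ?thesis .
    qed
    moreover have "\<exists>d. has_pd i h x d" by (rule exI, rule *)
    ultimately show ?thesis using 2 by blast
  qed
  show "\<exists>d. has_pd i h x d" for i x by (rule conjunct1[OF *])
  show "pd i h \<in> sspan ?B" for i by (rule conjunct1[OF conjunct2[OF *]])
  show "\<exists>C. \<forall>x. (1 + norm x) ^ k * norm (h x) \<le> C" for k by (rule conjunct2[OF conjunct2[OF *]])
qed

text \<open>Peetre's inequality: polynomial weights are comparable under translation, at a price
  depending only on the shift. It carries weights through translations, increments and
  convolutions.\<close>

lemma one_norm_shift: "1 + norm (x::'a::real_normed_vector) \<le> (1 + norm (x + a)) * (1 + norm a)"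
proof -
  have "norm x \<le> norm (x + a) + norm a" using norm_triangle_ineq4[of "x + a" a] by simp
  moreover have "0 \<le> norm (x + a) * norm a" by simp
  moreover have "(1 + norm (x + a)) * (1 + norm a) = 1 + norm (x + a) + norm a + norm (x + a) * norm a"
    by (simp add: algebra_simps)
  ultimately show ?thesis by linarith
qed

lemma one_norm_shift_pow: "(1 + norm (x::'a::real_normed_vector)) ^ k \<le> (1 + norm (x + a)) ^ k * (1 + norm a) ^ k"
  unfolding power_mult_distrib[symmetric] by (rule power_mono[OF one_norm_shift]) auto

lemma schwartz_shift:
  assumes "f \<in> schwartz" shows "(\<lambda>x. f (x + a)) \<in> schwartz"
proof (rule schwartz_coinduct[where X = "(\<lambda>f x. f (x + a)) ` schwartz"])
  fix h assume "h \<in> (\<lambda>f (x::real^'a). f (x + a)) ` schwartz"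
  then obtain g where g: "g \<in> schwartz" "h = (\<lambda>x. g (x + a))" by auto
  have *: "has_pd i h x (pd i g (x + a))" for i x
    unfolding g(2) by (rule has_pd_shift schwartz_has_pd g)+
  show "\<exists>d. has_pd i h x d" for i x by (rule exI, rule *)
  have "pd i h = (\<lambda>x. pd i g (x + a))" for i by (rule ext, rule has_pd_imp, rule *)
  then show "pd i h \<in> (\<lambda>f (x::real^'a). f (x + a)) ` schwartz" for i using imageI[OF schwartz_pd[OF g(1)]] by auto
  fix k
  obtain C where C: "C > 0" "\<And>x. (1 + norm x) ^ k * norm (g x) \<le> C"
    using schwartz_bound[OF g(1)] by metis
  have "(1 + norm x) ^ k * norm (h x) \<le> (1 + norm a) ^ k * C" for x
  proof -
    have "(1 + norm x) ^ k * norm (h x) \<le> ((1 + norm (x + a)) ^ k * (1 + norm a) ^ k) * norm (g (x + a))"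
      unfolding g by (intro mult_right_mono one_norm_shift_pow) auto
    also have "\<dots> = (1 + norm a) ^ k * ((1 + norm (x + a)) ^ k * norm (g (x + a)))" by simp
    also have "\<dots> \<le> (1 + norm a) ^ k * C" by (intro mult_left_mono C) auto
    finally show ?thesis .
  qed
  then show "\<exists>C. \<forall>x. (1 + norm x) ^ k * norm (h x) \<le> C" by blast
qed (rule imageI, rule assms)

lemma schwartz_scale:
  fixes c :: real
  assumes "f \<in> schwartz" "c \<noteq> 0" shows "(\<lambda>x. f (c *\<^sub>R x)) \<in> schwartz"
proof (rule schwartz_coinduct[where X = "(\<lambda>f x. f (c *\<^sub>R x)) ` schwartz"])
  fix h assume "h \<in> (\<lambda>f (x::real^'a). f (c *\<^sub>R x)) ` schwartz"
  then obtain g where g: "g \<in> schwartz" "h = (\<lambda>x. g (c *\<^sub>R x))" by auto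
  have *: "has_pd i h x (complex_of_real c * pd i g (c *\<^sub>R x))" for i x
    unfolding g(2) scaleR_conv_of_real[symmetric] by (rule has_pd_scale schwartz_has_pd g)+
  show "\<exists>d. has_pd i h x d" for i x by (rule exI, rule *)
  have "pd i h = (\<lambda>x. complex_of_real c * pd i g (c *\<^sub>R x))" for i by (rule ext, rule has_pd_imp, rule *)
  moreover have "(\<lambda>x. complex_of_real c * pd i g x) \<in> schwartz" for i
    using g by (intro schwartz_cmult schwartz_pd)
  ultimately show "pd i h \<in> (\<lambda>f (x::real^'a). f (c *\<^sub>R x)) ` schwartz" for i using imageI[of "\<lambda>x. complex_of_real c * pd i g x" schwartz "\<lambda>f x. f (c *\<^sub>R x)"] by simp
  fix k
  obtain C where C: "C > 0" "\<And>x. (1 + norm x) ^ k * norm (g x) \<le> C"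
    using schwartz_bound[OF g(1)] by metis
  have "(1 + norm x) ^ k * norm (h x) \<le> (1 + 1/\<bar>c\<bar>) ^ k * C" for x
  proof -
    have "1 + norm x \<le> (1 + 1/\<bar>c\<bar>) * (1 + norm (c *\<^sub>R x))"
      using assms(2) by (simp add: field_simps)
    then have "(1 + norm x) ^ k \<le> ((1 + 1/\<bar>c\<bar>) * (1 + norm (c *\<^sub>R x))) ^ k" by (intro power_mono) auto
    then have "(1 + norm x) ^ k * norm (h x) \<le> ((1 + 1/\<bar>c\<bar>) * (1 + norm (c *\<^sub>R x))) ^ k * norm (h x)"
      by (rule mult_right_mono) simp
    also have "\<dots> = (1 + 1/\<bar>c\<bar>) ^ k * ((1 + norm (c *\<^sub>R x)) ^ k * norm (g (c *\<^sub>R x)))"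
      by (simp add: g power_mult_distrib)
    also have "\<dots> \<le> (1 + 1/\<bar>c\<bar>) ^ k * C" by (intro mult_left_mono C) auto
    finally show ?thesis .
  qed
  then show "\<exists>C. \<forall>x. (1 + norm x) ^ k * norm (h x) \<le> C" by blast
qed (rule imageI, rule assms(1))

lemma schwartz_reflect: "f \<in> schwartz \<Longrightarrow> (\<lambda>x. f (- x)) \<in> schwartz"
  using schwartz_scale[of f "-1"] by simp

lemma schwartz_line:
  assumes "f \<in> schwartz"
  shows "((\<lambda>t. f (x + t *\<^sub>R axis i 1)) has_vector_derivative pd i f (x + s *\<^sub>R axis i 1)) (at s within T)"
proof -
  have "has_pd i f (x + s *\<^sub>R axis i 1) (pd i f (x + s *\<^sub>R axis i 1))" using schwartz_has_pd[OF assms] .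
  then have *: "((\<lambda>u. f ((x + s *\<^sub>R axis i 1) + u *\<^sub>R axis i 1)) has_vector_derivative pd i f (x + s *\<^sub>R axis i 1)) (at (s - s))"
    by simp
  have "((\<lambda>t. t - s) has_vector_derivative 1) (at s)" by (auto intro!: derivative_eq_intros)
  from vector_diff_chain_at[OF this *]
  have "((\<lambda>t. f (x + t *\<^sub>R axis i 1)) has_vector_derivative pd i f (x + s *\<^sub>R axis i 1)) (at s)"
    by (simp add: o_def algebra_simps)
  then show ?thesis by (rule has_vector_derivative_at_within)
qed

text \<open>The mean value inequality on a coordinate segment. Intermediate points differ from
  \<open>x\<close> by at most \<open>\<bar>t\<bar>\<close>, so Peetre's inequality moves the weight
  back to \<open>x\<close> and leaves the factor \<open>(1 + \<bar>t\<bar>) ^ k\<close>.\<close>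

lemma schwartz_line_bound:
  assumes "f \<in> schwartz" and C: "\<And>x. (1 + norm x) ^ k * norm (pd i f x) \<le> C"
  shows "(1 + norm x) ^ k * norm (f (x + t *\<^sub>R axis i 1) - f x) \<le> C * \<bar>t\<bar> * (1 + \<bar>t\<bar>) ^ k"
proof -
  let ?M = "C * (1 + \<bar>t\<bar>) ^ k / (1 + norm x) ^ k"
  have C0: "0 \<le> C" using C[of 0] by (meson norm_ge_zero order_trans zero_le_mult_iff zero_le_power add_nonneg_nonneg zero_le_one)
  have b: "norm (pd i f (x + s *\<^sub>R axis i 1)) \<le> ?M" if "s \<in> closed_segment 0 t" for s
  proof -
    have s: "\<bar>s\<bar> \<le> \<bar>t\<bar>" using that by (auto simp: closed_segment_eq_real_ivl split: if_splits)
    have "(1 + norm x) ^ k \<le> (1 + norm (x + s *\<^sub>R axis i 1)) ^ k * (1 + norm (s *\<^sub>R axis i (1::real))) ^ k"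
      by (rule one_norm_shift_pow)
    also have "\<dots> \<le> (1 + norm (x + s *\<^sub>R axis i 1)) ^ k * (1 + \<bar>t\<bar>) ^ k"
      using s by (intro mult_left_mono power_mono) auto
    finally have "(1 + norm x) ^ k * norm (pd i f (x + s *\<^sub>R axis i 1)) \<le> (1 + norm (x + s *\<^sub>R axis i 1)) ^ k * (1 + \<bar>t\<bar>) ^ k * norm (pd i f (x + s *\<^sub>R axis i 1))"
      by (rule mult_right_mono) simp
    also have "\<dots> = (1 + \<bar>t\<bar>) ^ k * ((1 + norm (x + s *\<^sub>R axis i 1)) ^ k * norm (pd i f (x + s *\<^sub>R axis i 1)))" by simp
    also have "\<dots> \<le> (1 + \<bar>t\<bar>) ^ k * C" by (intro mult_left_mono C) auto
    finally have "(1 + norm x) ^ k * norm (pd i f (x + s *\<^sub>R axis i 1)) \<le> (1 + \<bar>t\<bar>) ^ k * C" .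
    moreover have "(1 + norm x) ^ k > 0" by (intro zero_less_power) (smt (verit) norm_ge_zero)
    ultimately show ?thesis by (simp add: field_simps)
  qed
  have "norm (f (x + t *\<^sub>R axis i 1) - f (x + 0 *\<^sub>R axis i 1)) \<le> ?M * norm (t - 0)"
  proof (rule differentiable_bound[where f' = "\<lambda>s h. h *\<^sub>R pd i f (x + s *\<^sub>R axis i 1)" and S = "closed_segment 0 t"])
    show "((\<lambda>t. f (x + t *\<^sub>R axis i 1)) has_derivative (\<lambda>h. h *\<^sub>R pd i f (x + s *\<^sub>R axis i 1))) (at s within closed_segment 0 t)" for s
      using schwartz_line[OF assms(1)] unfolding has_vector_derivative_def by blast
    show "onorm (\<lambda>h. h *\<^sub>R pd i f (x + s *\<^sub>R axis i 1)) \<le> ?M" if "s \<in> closed_segment 0 t" for s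
      by (rule onorm_le) (use mult_left_mono[OF b[OF that] abs_ge_zero] in \<open>auto simp: mult.commute\<close>)
  qed auto
  moreover have "(1 + norm x) ^ k > 0" by (intro zero_less_power) (smt (verit) norm_ge_zero)
  ultimately show ?thesis by (simp add: field_simps)
qed

text \<open>Only partial derivatives are available, so \<open>x\<close> is joined to
  \<open>x + z\<close> by changing one coordinate at a time. Each leg is controlled by
  \<open>schwartz_line_bound\<close>; moving its weight from the corner back to \<open>x\<close>
  costs a second factor, whence the exponent \<open>2 * k\<close>.\<close>

lemma schwartz_mean_value:
  fixes f :: "real^'n::finite \<Rightarrow> complex"
  assumes "f \<in> schwartz"
  obtains C where "C > 0" "\<And>x z. (1 + norm x) ^ k * norm (f (x + z) - f x) \<le> C * norm z * (1 + norm z) ^ (2 * k)"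
proof -
  have "\<exists>C. \<forall>x. (1 + norm x) ^ k * norm (pd i f x) \<le> C" for i
    using schwartz_bound[OF schwartz_pd[OF assms]] by metis
  then obtain C where C: "\<And>i x. (1 + norm x) ^ k * norm (pd i f x) \<le> C i" by metis
  have C0: "0 \<le> C i" for i using C[of 0 i] by (meson norm_ge_zero order_trans zero_le_mult_iff zero_le_power add_nonneg_nonneg zero_le_one)
  \<comment> \<open>\<open>r A z\<close> is the displacement reached when the coordinates in
    \<open>A\<close> have been changed.\<close>
  define r where "r A z = (\<chi> i. if i \<in> A then z $ i else (0::real))" for A and z :: "real^'n"
  have rn: "norm (r A z) \<le> norm z" for A z
    by (rule norm_le_componentwise_cart) (auto simp: r_def)
  have main: "(1 + norm x) ^ k * norm (f (x + r A z) - f x) \<le> (\<Sum>i\<in>A. C i) * norm z * (1 + norm z) ^ (2 * k)" if "finite A" for A x z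
    using that
  proof induction
    case empty
    have "r {} z = 0" by (simp add: r_def vec_eq_iff)
    then show ?case by simp
  next
    case (insert i A)
    let ?y = "x + r A z"
    have e: "x + r (insert i A) z = ?y + (z $ i) *\<^sub>R axis i 1"
      using insert(2) by (auto simp: r_def vec_eq_iff axis_def)
    have zi: "\<bar>z $ i\<bar> \<le> norm z" by (rule component_le_norm_cart)
    have "(1 + norm x) ^ k * norm (f (?y + (z $ i) *\<^sub>R axis i 1) - f ?y) \<le>
        (1 + norm ?y) ^ k * (1 + norm (r A z)) ^ k * norm (f (?y + (z $ i) *\<^sub>R axis i 1) - f ?y)"
      by (intro mult_right_mono one_norm_shift_pow) auto
    also have "\<dots> \<le> (1 + norm ?y) ^ k * (1 + norm z) ^ k * norm (f (?y + (z $ i) *\<^sub>R axis i 1) - f ?y)"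
      using rn[of A z] by (intro mult_right_mono mult_left_mono power_mono) auto
    also have "\<dots> = (1 + norm z) ^ k * ((1 + norm ?y) ^ k * norm (f (?y + (z $ i) *\<^sub>R axis i 1) - f ?y))" by simp
    also have "\<dots> \<le> (1 + norm z) ^ k * (C i * \<bar>z $ i\<bar> * (1 + \<bar>z $ i\<bar>) ^ k)"
      by (intro mult_left_mono schwartz_line_bound assms C) auto
    also have "\<dots> \<le> (1 + norm z) ^ k * (C i * norm z * (1 + norm z) ^ k)"
      using zi C0 by (intro mult_left_mono mult_mono power_mono) auto
    finally have 1: "(1 + norm x) ^ k * norm (f (?y + (z $ i) *\<^sub>R axis i 1) - f ?y) \<le> C i * norm z * (1 + norm z) ^ (2 * k)"
      by (simp add: mult_2_right power_add mult_ac)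
    have "(1 + norm x) ^ k * norm (f (x + r (insert i A) z) - f x) \<le>
       (1 + norm x) ^ k * (norm (f (?y + (z $ i) *\<^sub>R axis i 1) - f ?y) + norm (f ?y - f x))"
      unfolding e by (intro mult_left_mono) (use norm_triangle_ineq[of "f (?y + (z $ i) *\<^sub>R axis i 1) - f ?y" "f ?y - f x"] in auto)
    also have "\<dots> \<le> C i * norm z * (1 + norm z) ^ (2 * k) + (\<Sum>i\<in>A. C i) * norm z * (1 + norm z) ^ (2 * k)"
      unfolding distrib_left by (intro add_mono 1 insert)
    finally show ?case using insert by (simp add: algebra_simps)
  qed
  have rU: "r UNIV z = z" for z by (simp add: r_def vec_eq_iff)
  show ?thesis
  proof
    show "(1 + norm x) ^ k * norm (f (x + z) - f x) \<le> ((\<Sum>i\<in>UNIV. C i) + 1) * norm z * (1 + norm z) ^ (2 * k)" for x z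
    proof -
      have "(\<Sum>i\<in>UNIV. C i) * norm z * (1 + norm z) ^ (2 * k) \<le> ((\<Sum>i\<in>UNIV. C i) + 1) * norm z * (1 + norm z) ^ (2 * k)"
        by (intro mult_right_mono) auto
      then show ?thesis using main[of UNIV x z] by (simp add: rU)
    qed
    show "(\<Sum>i\<in>UNIV. C i) + 1 > 0" using C0 by (simp add: sum_nonneg add_nonneg_pos)
  qed
qed

text \<open>The definition of \<open>schwartz\<close> speaks of derivatives along coordinate lines
  only; their boundedness makes the function Lipschitz.\<close>

lemma schwartz_continuous: 
  assumes "f \<in> schwartz" shows "continuous_on UNIV f"
proof -
  obtain C where C: "C > 0" "\<And>x z. norm (f (x + z) - f x) \<le> C * norm z"
    using schwartz_mean_value[OF assms, of 0] by auto
  have "norm (f y - f x) \<le> C * norm (y - x)" for x y using C(2)[of x "y - x"] by simp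
  then show ?thesis
    by (intro lipschitz_on_continuous_on[of C]) (use C in \<open>auto simp: lipschitz_on_def dist_norm\<close>)
qed

lemma schwartz_measurable [measurable_dest]: "f \<in> schwartz \<Longrightarrow> f \<in> borel_measurable borel"
  by (rule borel_measurable_continuous_onI[OF schwartz_continuous])

section \<open>Integration on Euclidean space\<close>

text \<open>The forward implication, applied to the inverse affine map, gives the converse. The
  integral formula therefore also covers functions that are not integrable, where both integrals are
  zero.\<close>

lemma lborel_affine_integral:
  fixes f :: "'a::euclidean_space \<Rightarrow> 'b::{banach, second_countable_topology}" and c :: real
  assumes [simp]: "c \<noteq> 0"
  shows lborel_affine_integrable_iff: "integrable lborel (\<lambda>x. f (t + c *\<^sub>R x)) \<longleftrightarrow> integrable lborel f"
    and lborel_affine_integral_eq: "(\<integral>x. f (t + c *\<^sub>R x) \<partial>lborel) = (1 / \<bar>c\<bar> ^ DIM('a)) *\<^sub>R (\<integral>x. f x \<partial>lborel)"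
proof -
  have A: "integrable lborel (\<lambda>x. g (s + d *\<^sub>R x))" if "integrable lborel g" "d \<noteq> 0"
    for g :: "'a \<Rightarrow> 'b" and s d
  proof -
    have [measurable]: "g \<in> borel_measurable borel" using borel_measurable_integrable[OF that(1)] by simp
    have "integrable (density (distr lborel borel (\<lambda>x. s + d *\<^sub>R x)) (\<lambda>_. ennreal (\<bar>d\<bar>^DIM('a)))) g"
      using that(1) lborel_affine[OF that(2), of s] by (simp add: ennreal_power)
    then have "integrable lborel (\<lambda>x. \<bar>d\<bar> ^ DIM('a) *\<^sub>R g (s + d *\<^sub>R x))"
      by (subst (asm) integrable_density) (auto simp: integrable_distr_eq)
    from integrable_scaleR_right[OF this, of "1 / \<bar>d\<bar> ^ DIM('a)"] show ?thesis
      using that(2) by simp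
  qed
  show iff: "integrable lborel (\<lambda>x. f (t + c *\<^sub>R x)) \<longleftrightarrow> integrable lborel f"
  proof
    assume "integrable lborel (\<lambda>x. f (t + c *\<^sub>R x))"
    from A[OF this, of "1 / c" "- (1 / c) *\<^sub>R t"] show "integrable lborel f"
      by (simp add: algebra_simps)
  qed (use A in auto)
  show "(\<integral>x. f (t + c *\<^sub>R x) \<partial>lborel) = (1 / \<bar>c\<bar> ^ DIM('a)) *\<^sub>R (\<integral>x. f x \<partial>lborel)"
  proof (cases "integrable lborel f")
    case True
    have [measurable]: "f \<in> borel_measurable borel" using borel_measurable_integrable[OF True] by simp
    have "(\<integral>x. f x \<partial>lborel) = (\<integral>x. f x \<partial>density (distr lborel borel (\<lambda>x. t + c *\<^sub>R x)) (\<lambda>_. ennreal (\<bar>c\<bar>^DIM('a))))"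
      using lborel_affine[OF assms, of t] by (simp add: ennreal_power)
    also have "\<dots> = \<bar>c\<bar>^DIM('a) *\<^sub>R (\<integral>x. f (t + c *\<^sub>R x) \<partial>lborel)"
      by (subst integral_density) (auto simp: integral_distr)
    finally show ?thesis by simp
  qed (use iff in \<open>simp add: not_integrable_integral_eq\<close>)
qed

lemma lborel_affine_nn_integral:
  fixes f :: "'a::euclidean_space \<Rightarrow> ennreal" and c :: real
  assumes "c \<noteq> 0" and [measurable]: "f \<in> borel_measurable borel"
  shows "(\<integral>\<^sup>+x. f x \<partial>lborel) = ennreal (\<bar>c\<bar> ^ DIM('a)) * (\<integral>\<^sup>+x. f (t + c *\<^sub>R x) \<partial>lborel)"
proof -
  have "(\<integral>\<^sup>+x. f x \<partial>lborel) = (\<integral>\<^sup>+x. f x \<partial>density (distr lborel borel (\<lambda>x. t + c *\<^sub>R x)) (\<lambda>_. ennreal (\<bar>c\<bar>^DIM('a))))"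
    using lborel_affine[OF assms(1), of t] by (simp add: ennreal_power)
  also have "\<dots> = ennreal (\<bar>c\<bar> ^ DIM('a)) * (\<integral>\<^sup>+x. f (t + c *\<^sub>R x) \<partial>lborel)"
    by (subst nn_integral_density) (auto simp: nn_integral_distr nn_integral_cmult)
  finally show ?thesis .
qed

lemma Basis_cart_image: "(Basis :: (real^'n::finite) set) = range (\<lambda>i. axis i 1)"
  by (auto simp: Basis_vec_def)

lemma inj_axis: "inj (\<lambda>i::'n::finite. axis i (1::real))"
  by (auto simp: inj_def axis_eq_axis)

lemma lborel_prod_coord:
  fixes f :: "'n::finite \<Rightarrow> real \<Rightarrow> 'b::{real_normed_field,banach,second_countable_topology}"
  assumes "\<And>i. integrable lborel (f i)"
  shows lborel_prod_coord_integrable: "integrable lborel (\<lambda>x::real^'n. \<Prod>i\<in>UNIV. f i (x $ i))"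
    and lborel_prod_coord_integral: "(\<integral>x. (\<Prod>i\<in>UNIV. f i (x $ i)) \<partial>(lborel :: (real^'n) measure)) = (\<Prod>i\<in>UNIV. \<integral>t. f i t \<partial>lborel)"
proof -
  interpret product_sigma_finite "\<lambda>_::real^'n. lborel :: real measure" ..
  have [measurable]: "f i \<in> borel_measurable borel" for i using borel_measurable_integrable[OF assms[of i]] by simp
  \<comment> \<open>\<open>lborel\<close> is a product measure over \<open>Basis\<close>, so the
    factors are reindexed from coordinates to basis vectors.\<close>
  define g where "g b = f (THE i. b = axis i (1::real))" for b
  have g: "g (axis i 1) = f i" for i by (simp add: g_def axis_eq_axis)
  have gi: "integrable lborel (g b)" if "b \<in> Basis" for b :: "real^'n"
    using that assms g by (auto simp: Basis_cart_image)
  have e: "(\<Prod>i\<in>UNIV. f i (x $ i)) = (\<Prod>b\<in>Basis. g b (x \<bullet> b))" for x :: "real^'n"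
    unfolding Basis_cart_image by (subst prod.reindex[OF inj_axis]) (simp add: g inner_axis)
  have e2: "(\<Prod>b\<in>Basis. g b ((\<Sum>b\<in>Basis. h b *\<^sub>R b) \<bullet> b)) = (\<Prod>b\<in>(Basis::(real^'n) set). g b (h b))" for h
    by (intro prod.cong refl) (simp add: inner_sum_left_Basis)
  have m: "(\<lambda>x::real^'n. \<Prod>i\<in>UNIV. f i (x $ i)) \<in> borel_measurable borel"
    by measurable
  show "integrable lborel (\<lambda>x::real^'n. \<Prod>i\<in>UNIV. f i (x $ i))"
    unfolding e
    by (subst lborel_eq, subst integrable_distr_eq)
       (use m[unfolded e] product_integrable_prod[where f = g, OF finite_Basis gi] in \<open>simp_all only: e2\<close>, measurable)
  have "(\<integral>x. (\<Prod>i\<in>UNIV. f i (x $ i)) \<partial>(lborel :: (real^'n) measure)) = (\<Prod>b\<in>(Basis::(real^'n) set). \<integral>t. g b t \<partial>lborel)"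
    unfolding e
    by (subst lborel_eq, subst integral_distr)
       (use m[unfolded e] product_integral_prod[where f = g, OF finite_Basis gi] in \<open>simp_all only: e2\<close>, measurable)
  also have "\<dots> = (\<Prod>i\<in>UNIV. \<integral>t. f i t \<partial>lborel)"
    unfolding Basis_cart_image by (subst prod.reindex[OF inj_axis]) (simp add: g)
  finally show "(\<integral>x. (\<Prod>i\<in>UNIV. f i (x $ i)) \<partial>(lborel :: (real^'n) measure)) = (\<Prod>i\<in>UNIV. \<integral>t. f i t \<partial>lborel)" .
qed

text \<open>The exponent provides one factor \<open>(1 + norm x)\<^sup>2\<close> per coordinate,
  enough to lie below a product of the integrable functions \<open>1 / (1 + t\<^sup>2)\<close>. All
  decay of Schwartz functions is measured against this weight.\<close>

definition wgt :: "real^'n::finite \<Rightarrow> real" where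
  "wgt x = 1 / (1 + norm x) ^ (2 * CARD('n))"

lemma one_norm_pos [simp]: "0 < 1 + norm x" "1 + norm x \<noteq> 0"
  by (smt (verit) norm_ge_zero)+

lemma wgt_pos [simp]: "wgt x > 0" "wgt x \<ge> 0" "wgt x \<noteq> 0" "\<bar>wgt x\<bar> = wgt x"
  using zero_less_power[OF one_norm_pos(1), of x] by (auto simp: wgt_def)

lemma wgt_le_1: "wgt x \<le> 1"
  by (simp add: wgt_def)

lemma wgt_measurable [measurable]: "wgt \<in> borel_measurable borel"
  unfolding wgt_def[abs_def] by measurable

lemma wgt_bound: "(1 + norm x) ^ (2 * CARD('n)) * a \<le> C \<longleftrightarrow> a \<le> C * wgt (x :: real^'n::finite)"
proof -
  have "(1 + norm x) ^ (2 * CARD('n)) > 0" by simp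
  then show ?thesis by (auto simp add: wgt_def field_simps)
qed

lemma wgt_shift: "wgt x \<le> (1 + norm a) ^ (2 * CARD('n)) * wgt (x + a :: real^'n::finite)"
  unfolding wgt_bound[symmetric] 
  using one_norm_shift_pow[of "x + a" "2 * CARD('n)" "-a"] 
  by (auto simp: wgt_def divide_le_eq field_simps)

lemma integrable_inverse_one_plus_square: "integrable lborel (\<lambda>x::real. 1 / (1 + x\<^sup>2))"
proof -
  have "einterval (-\<infinity>) \<infinity> = (UNIV :: real set)" by (auto simp: einterval_def)
  then show ?thesis
    using integrable_inverse_1_plus_square unfolding set_integrable_def by (simp add: inverse_eq_divide)
qed

lemma wgt_integrable: "integrable lborel (wgt :: real^'n::finite \<Rightarrow> real)"
proof (rule Bochner_Integration.integrable_bound)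
  show "integrable lborel (\<lambda>x::real^'n. \<Prod>i\<in>UNIV. 1 / (1 + (x $ i)\<^sup>2))"
    by (rule lborel_prod_coord_integrable[OF integrable_inverse_one_plus_square])
  show "AE x in lborel. norm (wgt (x::real^'n)) \<le> norm (\<Prod>i\<in>UNIV. 1 / (1 + (x $ i)\<^sup>2))"
  proof (rule AE_I2)
    fix x :: "real^'n"
    have pos: "(\<Prod>i\<in>UNIV. 1 + (x $ i)\<^sup>2) > 0" by (intro prod_pos) (simp add: add_pos_nonneg)
    have "(\<Prod>i\<in>UNIV. 1 + (x $ i)\<^sup>2) \<le> (\<Prod>i\<in>(UNIV::'n set). (1 + norm x)\<^sup>2)"
    proof (intro prod_mono conjI)
      fix i
      have "(x $ i)\<^sup>2 \<le> (norm x)\<^sup>2" using component_le_norm_cart[of x i] by (simp add: abs_le_square_iff[symmetric])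
      then show "1 + (x $ i)\<^sup>2 \<le> (1 + norm x)\<^sup>2"
      proof -
        have "(1 + norm x)\<^sup>2 = 1 + (norm x)\<^sup>2 + 2 * norm x" by (simp add: power2_sum)
        then show ?thesis using \<open>(x $ i)\<^sup>2 \<le> (norm x)\<^sup>2\<close> norm_ge_zero[of x] by linarith
      qed
    qed simp
    also have "\<dots> = (1 + norm x) ^ (2 * CARD('n))" by (simp add: power_mult)
    finally have "wgt x \<le> 1 / (\<Prod>i\<in>UNIV. 1 + (x $ i)\<^sup>2)"
      unfolding wgt_def using pos by (intro divide_left_mono) auto
    then show "norm (wgt x) \<le> norm (\<Prod>i\<in>UNIV. 1 / (1 + (x $ i)\<^sup>2))"
      using pos by (simp add: prod_dividef)
  qed
qed (use borel_measurable_integrable wgt_measurable in auto)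

lemma schwartz_wgt:
  fixes h :: "real^'n::finite \<Rightarrow> complex"
  assumes "h \<in> schwartz" obtains C where "C > 0" "\<And>x. (1 + norm x) ^ k * norm (h x) \<le> C * wgt x"
proof -
  obtain C where "C > 0" "\<And>x. (1 + norm x) ^ (2 * CARD('n) + k) * norm (h x) \<le> C"
    using schwartz_bound[OF assms] by metis
  then show ?thesis using that[of C] by (simp add: wgt_bound power_add mult.assoc)
qed

lemma schwartz_integrable_pow:
  fixes h :: "real^'n::finite \<Rightarrow> complex"
  assumes [measurable_dest]: "h \<in> schwartz" shows "integrable lborel (\<lambda>x. (1 + norm x) ^ k * norm (h x))"
proof -
  obtain C where C: "C > 0" "\<And>x. (1 + norm x) ^ k * norm (h x) \<le> C * wgt x"
    using schwartz_wgt[OF assms] by metis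
  have [measurable]: "h \<in> borel_measurable borel" by (rule schwartz_measurable[OF assms])
  show ?thesis
    by (rule Bochner_Integration.integrable_bound[of _ "\<lambda>x. C * wgt x"])
       (use C wgt_integrable in \<open>auto simp: abs_mult intro!: AE_I2 order_trans[OF C(2)]\<close>)
qed

lemma schwartz_integrable: "h \<in> schwartz \<Longrightarrow> integrable lborel h"
  using schwartz_integrable_pow[of h 0] schwartz_measurable[of h] by (simp add: integrable_norm_iff)

section \<open>Differentiation under the integral sign and Gaussian integrals\<close>

lemma has_vector_derivative_quotient:
  fixes f :: "real \<Rightarrow> 'b::real_normed_vector"
  shows "(f has_vector_derivative d) (at 0) \<longleftrightarrow> ((\<lambda>t. (1/t) *\<^sub>R (f t - f 0)) \<longlongrightarrow> d) (at 0)"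
proof -
  have "((\<lambda>t. (1/t) *\<^sub>R (f t - f 0)) \<longlongrightarrow> d) (at 0) \<longleftrightarrow> ((\<lambda>t. norm ((1/t) *\<^sub>R (f t - f 0) - d)) \<longlongrightarrow> 0) (at 0)"
    by (simp add: tendsto_norm_zero_iff LIM_zero_iff)
  also have "\<dots> \<longleftrightarrow> ((\<lambda>t. norm (f t - f 0 - t *\<^sub>R d) / norm t) \<longlongrightarrow> 0) (at 0)"
  proof (rule filterlim_cong[OF refl refl])
    show "\<forall>\<^sub>F t in at 0. norm ((1/t) *\<^sub>R (f t - f 0) - d) = norm (f t - f 0 - t *\<^sub>R d) / norm t"
    proof (rule eventually_at_topological[THEN iffD2], intro exI[of _ UNIV] conjI ballI impI)
      fix t :: real assume "t \<noteq> 0"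
      then have "(1/t) *\<^sub>R (f t - f 0) - d = (1/t) *\<^sub>R (f t - f 0 - t *\<^sub>R d)" by (simp add: algebra_simps)
      then show "norm ((1/t) *\<^sub>R (f t - f 0) - d) = norm (f t - f 0 - t *\<^sub>R d) / norm t" by simp
    qed auto
  qed
  also have "\<dots> \<longleftrightarrow> (f has_vector_derivative d) (at 0)"
    by (simp add: has_vector_derivative_def has_derivative_iff_norm bounded_linear_scaleR_left)
  finally show ?thesis by simp
qed

text \<open>Dominated convergence works along sequences, so the difference quotients are tested on
  sequences tending to 0. The bound is assumed only for parameters of modulus at most one; a general
  sequence is brought into that range by dropping an initial segment.\<close>

lemma has_vector_derivative_integral:
  fixes F :: "real \<Rightarrow> 'a \<Rightarrow> complex"
  assumes der: "\<And>x. ((\<lambda>t. F t x) has_vector_derivative D x) (at 0)"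
    and bnd: "\<And>t x. \<bar>t\<bar> \<le> 1 \<Longrightarrow> norm (F t x - F 0 x) \<le> \<bar>t\<bar> * B x"
    and B: "integrable M B" and F: "\<And>t. integrable M (F t)"
  shows "((\<lambda>t. \<integral>x. F t x \<partial>M) has_vector_derivative (\<integral>x. D x \<partial>M)) (at 0)" (is ?A)
    and "integrable M D" (is ?B)
proof -
  have seq: "integrable M D \<and> (\<lambda>k. (1 / s k) *\<^sub>R ((\<integral>x. F (s k) x \<partial>M) - (\<integral>x. F 0 x \<partial>M))) \<longlonglongrightarrow> (\<integral>x. D x \<partial>M)"
    if s0: "\<And>k. s k \<noteq> 0" "\<And>k. \<bar>s k\<bar> \<le> 1" and s: "s \<longlonglongrightarrow> 0" for s :: "nat \<Rightarrow> real"
  proof -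
    have lim: "(\<lambda>k. (1 / s k) *\<^sub>R (F (s k) x - F 0 x)) \<longlonglongrightarrow> D x" for x
    proof -
      have "((\<lambda>t. (1/t) *\<^sub>R (F t x - F 0 x)) \<longlongrightarrow> D x) (at 0)"
        using der[of x] by (simp add: has_vector_derivative_quotient)
      then show ?thesis using s s0 by (simp add: tendsto_at_iff_sequentially o_def)
    qed
    have meas: "(\<lambda>x. (1 / s k) *\<^sub>R (F (s k) x - F 0 x)) \<in> borel_measurable M" for k
      using F borel_measurable_integrable by measurable
    have Dm: "D \<in> borel_measurable M"
      by (rule borel_measurable_LIMSEQ_metric[where f = "\<lambda>k x. (1 / s k) *\<^sub>R (F (s k) x - F 0 x)"]) (use lim meas in auto)
    have le: "norm ((1 / s k) *\<^sub>R (F (s k) x - F 0 x)) \<le> B x" for k x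
      using bnd[OF s0(2), of k x] s0[of k] by (simp only: norm_scaleR) (simp add: field_simps)
    have "integrable M D"
      by (rule integrable_dominated_convergence[of D M "\<lambda>k x. (1 / s k) *\<^sub>R (F (s k) x - F 0 x)" B])
         (use Dm meas B lim le in auto)
    moreover have "(\<lambda>k. \<integral>x. (1 / s k) *\<^sub>R (F (s k) x - F 0 x) \<partial>M) \<longlonglongrightarrow> (\<integral>x. D x \<partial>M)"
      by (rule integral_dominated_convergence[of _ _ _ B])
         (use Dm meas B lim le in auto)
    ultimately show ?thesis using F by (simp add: Bochner_Integration.integral_diff)
  qed
  have s1: "(\<lambda>k. 1 / real (Suc k)) \<longlonglongrightarrow> 0" by (rule lim_1_over_n[THEN LIMSEQ_Suc])
  show ?B using seq[OF _ _ s1] by simp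
  have "((\<lambda>t. (1/t) *\<^sub>R ((\<integral>x. F t x \<partial>M) - (\<integral>x. F 0 x \<partial>M))) \<longlongrightarrow> (\<integral>x. D x \<partial>M)) (at 0)"
    unfolding tendsto_at_iff_sequentially o_def
  proof (intro allI impI)
    fix X :: "nat \<Rightarrow> real" assume X: "\<forall>i. X i \<in> UNIV - {0}" "X \<longlonglongrightarrow> 0"
    then have "\<forall>\<^sub>F i in sequentially. \<bar>X i\<bar> < 1" by (metis order_tendsto_iff tendsto_rabs_zero zero_less_one)
    then obtain N where N: "\<And>i. i \<ge> N \<Longrightarrow> \<bar>X i\<bar> < 1" by (auto simp: eventually_sequentially)
    have "(\<lambda>k. (1 / X (k + N)) *\<^sub>R ((\<integral>x. F (X (k + N)) x \<partial>M) - (\<integral>x. F 0 x \<partial>M))) \<longlonglongrightarrow> (\<integral>x. D x \<partial>M)"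
      by (rule seq[THEN conjunct2]) (use X N in \<open>auto intro: LIMSEQ_ignore_initial_segment less_imp_le\<close>)
    then show "(\<lambda>k. (1 / X k) *\<^sub>R ((\<integral>x. F (X k) x \<partial>M) - (\<integral>x. F 0 x \<partial>M))) \<longlonglongrightarrow> (\<integral>x. D x \<partial>M)"
      by (rule LIMSEQ_offset)
  qed
  then show ?A by (simp add: has_vector_derivative_quotient)
qed

lemma measurable_cis [measurable]: "cis \<in> borel_measurable borel"
  by (intro borel_measurable_continuous_onI continuous_intros)

text \<open>The Gaussian factorises over the coordinates, and in one dimension its transform is the
  characteristic function of the standard normal distribution.\<close>

lemma gaussian_integral:
  fixes x :: "real^'n::finite"
  shows "integrable lborel (\<lambda>\<xi>::real^'n. complex_of_real (exp (- (norm \<xi>)\<^sup>2 / 2)))"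
    and "(\<integral>\<xi>. cis (x \<bullet> \<xi>) * complex_of_real (exp (- (norm \<xi>)\<^sup>2 / 2)) \<partial>lborel)
       = complex_of_real (sqrt (2 * pi) ^ CARD('n) * exp (- (norm x)\<^sup>2 / 2))"
proof -
  have 1: "integrable lborel (\<lambda>s. complex_of_real (exp (- s\<^sup>2 / 2)))"
  proof -
    have "integrable lborel (\<lambda>s. sqrt (2 * pi) * std_normal_density s)"
      by (intro integrable_mult_right integrable_normal_density) simp
    then show ?thesis by (simp add: std_normal_density_def integrable_of_real)
  qed
  have 2: "integrable lborel (\<lambda>s. cis (t * s) * complex_of_real (exp (- s\<^sup>2 / 2)))" for t
    by (rule Bochner_Integration.integrable_bound[OF 1]) (auto simp: norm_mult)
  have 3: "(\<integral>s. cis (t * s) * complex_of_real (exp (- s\<^sup>2 / 2)) \<partial>lborel) = complex_of_real (sqrt (2 * pi) * exp (- t\<^sup>2 / 2))" for t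
  proof -
    have "complex_of_real (exp (- t\<^sup>2 / 2)) = char std_normal_distribution t"
      by (simp add: char_std_normal_distribution)
    also have "\<dots> = (\<integral>s. std_normal_density s *\<^sub>R iexp (t * s) \<partial>lborel)"
      unfolding char_def by (subst integral_density) auto
    also have "\<dots> = (\<integral>s. complex_of_real (1 / sqrt (2 * pi)) * (cis (t * s) * complex_of_real (exp (- s\<^sup>2 / 2))) \<partial>lborel)"
      by (intro Bochner_Integration.integral_cong refl)
         (simp add: std_normal_density_def cis_conv_exp scaleR_conv_of_real mult_ac)
    also have "\<dots> = complex_of_real (1 / sqrt (2 * pi)) * (\<integral>s. cis (t * s) * complex_of_real (exp (- s\<^sup>2 / 2)) \<partial>lborel)"
      by simp
    finally show ?thesis by (simp add: field_simps)
  qed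
  have n2: "(norm \<xi>)\<^sup>2 = (\<Sum>i\<in>UNIV. (\<xi> $ i)\<^sup>2)" for \<xi> :: "real^'n"
    unfolding power2_norm_eq_inner inner_vec_def by (simp add: power2_eq_square)
  have e: "complex_of_real (exp (- (norm \<xi>)\<^sup>2 / 2)) = (\<Prod>i\<in>UNIV. complex_of_real (exp (- (\<xi> $ i)\<^sup>2 / 2)))" for \<xi> :: "real^'n"
    unfolding n2 of_real_prod[symmetric] by (simp add: exp_sum[symmetric] sum_negf sum_divide_distrib)
  have c: "cis (x \<bullet> \<xi>) = (\<Prod>i\<in>UNIV. cis (x $ i * \<xi> $ i))" for \<xi> :: "real^'n"
    by (simp add: inner_vec_def cis_conv_exp exp_sum[symmetric] sum_distrib_left)
  show "integrable lborel (\<lambda>\<xi>::real^'n. complex_of_real (exp (- (norm \<xi>)\<^sup>2 / 2)))"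
    unfolding e by (rule lborel_prod_coord_integrable[OF 1])
  have "(\<integral>\<xi>. cis (x \<bullet> \<xi>) * complex_of_real (exp (- (norm \<xi>)\<^sup>2 / 2)) \<partial>lborel) =
    (\<integral>\<xi>. (\<Prod>i\<in>UNIV. cis (x $ i * \<xi> $ i) * complex_of_real (exp (- (\<xi> $ i)\<^sup>2 / 2))) \<partial>lborel)"
    unfolding e c prod.distrib ..
  also have "\<dots> = (\<Prod>i\<in>UNIV. complex_of_real (sqrt (2 * pi) * exp (- (x $ i)\<^sup>2 / 2)))"
    by (subst lborel_prod_coord_integral[OF 2]) (simp only: 3)
  also have "\<dots> = complex_of_real (sqrt (2 * pi) ^ CARD('n) * exp (- (norm x)\<^sup>2 / 2))"
    unfolding of_real_prod[symmetric] prod.distrib n2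
    by (simp add: exp_sum[symmetric] sum_negf sum_divide_distrib)
  finally show "(\<integral>\<xi>. cis (x \<bullet> \<xi>) * complex_of_real (exp (- (norm \<xi>)\<^sup>2 / 2)) \<partial>lborel)
       = complex_of_real (sqrt (2 * pi) ^ CARD('n) * exp (- (norm x)\<^sup>2 / 2))" .
qed

section \<open>The Fourier transform on Schwartz functions\<close>

interpretation lborel_pair: pair_sigma_finite "lborel :: 'a::euclidean_space measure" "lborel :: 'b::euclidean_space measure" ..

lemma integrable_pair_bound:
  fixes f :: "'a::euclidean_space \<Rightarrow> 'b::euclidean_space \<Rightarrow> complex"
  assumes [measurable]: "(\<lambda>(x, y). f x y) \<in> borel_measurable (borel \<Otimes>\<^sub>M borel)"
    and a: "integrable lborel a" and b: "integrable lborel b"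
    and le: "\<And>x y. norm (f x y) \<le> a x * b y"
  shows "integrable (lborel \<Otimes>\<^sub>M lborel) (\<lambda>(x, y). f x y)"
proof (rule Bochner_Integration.integrable_bound)
  have [measurable]: "a \<in> borel_measurable borel" "b \<in> borel_measurable borel"
    using a b borel_measurable_integrable by fastforce+
  show "integrable (lborel \<Otimes>\<^sub>M lborel) (\<lambda>(x, y). a x * b y)"
  proof (rule lborel_pair.Fubini_integrable)
    have "integrable lborel (\<lambda>x. norm (a x) * (\<integral>y. norm (b y) \<partial>lborel))"
      using a by simp
    then show "integrable lborel (\<lambda>x. \<integral>y. norm (case (x, y) of (x, y) \<Rightarrow> a x * b y) \<partial>lborel)"
      by (simp add: abs_mult)
  qed (use a b in auto)
  show "AE x in lborel \<Otimes>\<^sub>M lborel. norm (case x of (x, y) \<Rightarrow> f x y) \<le> norm (case x of (x, y) \<Rightarrow> a x * b y)"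
    using order_trans[OF le abs_ge_self] by (intro AE_I2) auto
qed measurable

lemma integral_swap_bound:
  fixes f :: "'a::euclidean_space \<Rightarrow> 'b::euclidean_space \<Rightarrow> complex"
  assumes "(\<lambda>(x, y). f x y) \<in> borel_measurable (borel \<Otimes>\<^sub>M borel)"
    and "integrable lborel a" and "integrable lborel b" "\<And>x y. norm (f x y) \<le> a x * b y"
  shows "(\<integral>x. (\<integral>y. f x y \<partial>lborel) \<partial>lborel) = (\<integral>y. (\<integral>x. f x y \<partial>lborel) \<partial>lborel)"
  using lborel_pair.Fubini_integral[OF integrable_pair_bound[OF assms]] by simp

lemma cis_diff_le: "norm (cis a - cis b) \<le> \<bar>a - b\<bar>"
proof -
  have "cis a - cis b = cis b * (cis (a - b) - 1)" by (simp add: algebra_simps cis_mult)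
  then have "norm (cis a - cis b) = norm (cis (a - b) - 1)" by (simp add: norm_mult)
  also have "\<dots> \<le> \<bar>a - b\<bar>" using iexp_approx1[of "a - b" 0] by (simp add: cis_conv_exp)
  finally show ?thesis .
qed

lemma ft_integrable: "integrable lborel h \<Longrightarrow> integrable lborel (\<lambda>x. cis (- (x \<bullet> \<xi>)) * h x)"
  by (rule Bochner_Integration.integrable_bound[of _ h])
     (auto simp: norm_mult dest: borel_measurable_integrable)

lemma ft_bound: "norm (ft h \<xi>) \<le> (\<integral>x. norm (h x) \<partial>lborel)"
  unfolding ft_def by (rule order_trans[OF integral_norm_bound]) (simp add: norm_mult)

lemma has_pd_ft:
  fixes h :: "real^'n::finite \<Rightarrow> complex"
  assumes h: "h \<in> schwartz"
  shows "has_pd i (ft h) \<xi> (ft (\<lambda>x. - \<i> * (complex_of_real (x $ i) * h x)) \<xi>)"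
  unfolding ft_def
proof (rule has_vector_derivative_integral(1))
  fix x :: "real^'n"
  have e: "cis (- (x \<bullet> (\<xi> + t *\<^sub>R axis i 1))) = cis (- (x \<bullet> \<xi>)) * exp (complex_of_real t * (- \<i> * complex_of_real (x $ i)))" for t
    by (simp add: cis_conv_exp exp_add[symmetric] inner_add_right inner_axis algebra_simps)
  have 1: "((\<lambda>t. exp (t *\<^sub>R (- \<i> * complex_of_real (x $ i)))) has_vector_derivative (- \<i> * complex_of_real (x $ i))) (at 0)"
    using exp_scaleR_has_vector_derivative_right[of "- \<i> * complex_of_real (x $ i)" 0 UNIV] by simp
  have "((\<lambda>t. cis (- (x \<bullet> \<xi>)) * exp (complex_of_real t * (- \<i> * complex_of_real (x $ i))) * h x) has_vector_derivative
      cis (- (x \<bullet> \<xi>)) * (- \<i> * complex_of_real (x $ i)) * h x) (at 0)"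
    using 1 unfolding scaleR_conv_of_real
    by (intro has_vector_derivative_mult_left has_vector_derivative_mult_right)
  then show "((\<lambda>t. cis (- (x \<bullet> (\<xi> + t *\<^sub>R axis i 1))) * h x) has_vector_derivative
      cis (- (x \<bullet> \<xi>)) * (- \<i> * (complex_of_real (x $ i) * h x))) (at 0)"
    unfolding e by (simp add: mult_ac)
  show "norm (cis (- (x \<bullet> (\<xi> + t *\<^sub>R axis i 1))) * h x - cis (- (x \<bullet> (\<xi> + 0 *\<^sub>R axis i 1))) * h x)
      \<le> \<bar>t\<bar> * norm (complex_of_real (x $ i) * h x)" for t
  proof -
    have "norm (cis (- (x \<bullet> (\<xi> + t *\<^sub>R axis i 1))) - cis (- (x \<bullet> \<xi>))) \<le> \<bar>- (x \<bullet> (\<xi> + t *\<^sub>R axis i 1)) - - (x \<bullet> \<xi>)\<bar>"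
      by (rule cis_diff_le)
    also have "\<dots> = \<bar>t\<bar> * \<bar>x $ i\<bar>" by (simp add: inner_add_right inner_axis abs_mult)
    finally show ?thesis
      using mult_right_mono[OF _ norm_ge_zero[of "h x"]]
      by (simp add: norm_mult left_diff_distrib[symmetric] mult.assoc[symmetric])
  qed
qed (use schwartz_integrable[OF schwartz_coord[OF h]] ft_integrable[OF schwartz_integrable[OF h]] in auto)

lemma pd_ft: "h \<in> schwartz \<Longrightarrow> pd i (ft h) = ft (\<lambda>x. - \<i> * (complex_of_real (x $ i) * h x))"
  by (intro ext has_pd_imp has_pd_ft)

text \<open>This avoids integration by parts: the integral of the translated integrand does not
  depend on the translation, so its derivative vanishes, while differentiation under the integral
  expresses the same derivative by the product rule.\<close>

lemma ft_pd:
  fixes h :: "real^'n::finite \<Rightarrow> complex"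
  assumes h: "h \<in> schwartz"
  shows "ft (pd i h) \<xi> = \<i> * complex_of_real (\<xi> $ i) * ft h \<xi>"
proof -
  let ?e = "axis i (1::real) :: real^'n"
  let ?F = "\<lambda>t x. cis (- ((x + t *\<^sub>R ?e) \<bullet> \<xi>)) * h (x + t *\<^sub>R ?e)"
  let ?D = "\<lambda>x. cis (- (x \<bullet> \<xi>)) * pd i h x + cis (- (x \<bullet> \<xi>)) * (- \<i> * complex_of_real (\<xi> $ i)) * h x"
  obtain C where C: "C > 0" "\<And>x. (1 + norm x) ^ (2 * CARD('n)) * norm (pd i h x) \<le> C"
    using schwartz_bound[OF schwartz_pd[OF h]] by metis
  have int: "integrable lborel (\<lambda>x. cis (- (x \<bullet> \<xi>)) * g x)" if "g \<in> schwartz" for g :: "real^'n \<Rightarrow> complex"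
    using ft_integrable[OF schwartz_integrable[OF that]] .
  have const: "(\<integral>x. ?F t x \<partial>lborel) = ft h \<xi>" for t
    using lborel_affine_integral_eq[of 1 "\<lambda>x. cis (- (x \<bullet> \<xi>)) * h x" "t *\<^sub>R ?e"]
    by (simp add: ft_def add.commute)
  have "((\<lambda>t. \<integral>x. ?F t x \<partial>lborel) has_vector_derivative (\<integral>x. ?D x \<partial>lborel)) (at 0)"
  proof (rule has_vector_derivative_integral(1))
    fix x
    have e: "cis (- ((x + t *\<^sub>R ?e) \<bullet> \<xi>)) = cis (- (x \<bullet> \<xi>)) * exp (t *\<^sub>R (- \<i> * complex_of_real (\<xi> $ i)))" for t
      by (simp add: cis_conv_exp exp_add[symmetric] inner_add_left inner_axis' algebra_simps scaleR_conv_of_real[where 'a = complex])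
    have 1: "((\<lambda>t. exp (t *\<^sub>R (- \<i> * complex_of_real (\<xi> $ i)))) has_vector_derivative (- \<i> * complex_of_real (\<xi> $ i))) (at 0)"
      using exp_scaleR_has_vector_derivative_right[of "- \<i> * complex_of_real (\<xi> $ i)" 0 UNIV] by simp
    have "has_pd i h x (pd i h x)" by (rule schwartz_has_pd[OF h])
    from has_vector_derivative_mult[OF has_vector_derivative_mult_right[OF 1] this, of "cis (- (x \<bullet> \<xi>))"]
    show "((\<lambda>t. ?F t x) has_vector_derivative ?D x) (at 0)"
      unfolding e by simp
  next
    fix t x assume t: "\<bar>t::real\<bar> \<le> 1"
    have "norm (h (x + t *\<^sub>R ?e) - h x) \<le> C * \<bar>t\<bar> * (1 + \<bar>t\<bar>) ^ (2 * CARD('n)) * wgt x"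
      using schwartz_line_bound[OF h C(2), of x t] by (simp add: wgt_bound)
    also have "\<dots> \<le> C * \<bar>t\<bar> * 2 ^ (2 * CARD('n)) * wgt x"
      using t C(1) by (intro mult_right_mono mult_left_mono power_mono) auto
    finally have 1: "norm (h (x + t *\<^sub>R ?e) - h x) \<le> \<bar>t\<bar> * (C * 2 ^ (2 * CARD('n)) * wgt x)" by (simp add: mult_ac)
    have "norm (cis (- ((x + t *\<^sub>R ?e) \<bullet> \<xi>)) - cis (- (x \<bullet> \<xi>))) \<le> \<bar>- ((x + t *\<^sub>R ?e) \<bullet> \<xi>) - - (x \<bullet> \<xi>)\<bar>"
      by (rule cis_diff_le)
    also have "\<dots> = \<bar>t\<bar> * \<bar>\<xi> $ i\<bar>" by (simp add: inner_add_left inner_axis' abs_mult)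
    finally have 2: "norm (cis (- ((x + t *\<^sub>R ?e) \<bullet> \<xi>)) - cis (- (x \<bullet> \<xi>))) * norm (h x) \<le> \<bar>t\<bar> * \<bar>\<xi> $ i\<bar> * norm (h x)"
      by (rule mult_right_mono) simp
    have eq: "?F t x - ?F 0 x = cis (- ((x + t *\<^sub>R ?e) \<bullet> \<xi>)) * (h (x + t *\<^sub>R ?e) - h x) + (cis (- ((x + t *\<^sub>R ?e) \<bullet> \<xi>)) - cis (- (x \<bullet> \<xi>))) * h x"
      by (simp add: algebra_simps)
    have "norm (?F t x - ?F 0 x) \<le> norm (cis (- ((x + t *\<^sub>R ?e) \<bullet> \<xi>)) * (h (x + t *\<^sub>R ?e) - h x)) + norm ((cis (- ((x + t *\<^sub>R ?e) \<bullet> \<xi>)) - cis (- (x \<bullet> \<xi>))) * h x)"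
      unfolding eq by (rule norm_triangle_ineq)
    also have "\<dots> = norm (h (x + t *\<^sub>R ?e) - h x) + norm (cis (- ((x + t *\<^sub>R ?e) \<bullet> \<xi>)) - cis (- (x \<bullet> \<xi>))) * norm (h x)"
      by (simp only: norm_mult norm_cis mult_1)
    also have "\<dots> \<le> \<bar>t\<bar> * (C * 2 ^ (2 * CARD('n)) * wgt x + \<bar>\<xi> $ i\<bar> * norm (h x))"
      using 1 2 by (simp add: algebra_simps)
    finally show "norm (?F t x - ?F 0 x) \<le> \<bar>t\<bar> * (C * 2 ^ (2 * CARD('n)) * wgt x + \<bar>\<xi> $ i\<bar> * norm (h x))" .
  next
    show "integrable lborel (\<lambda>x::real^'n. C * 2 ^ (2 * CARD('n)) * wgt x + \<bar>\<xi> $ i\<bar> * norm (h x))"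
      using wgt_integrable schwartz_integrable[OF h] by auto
    show "integrable lborel (?F t)" for t
      using lborel_affine_integrable_iff[of 1 "\<lambda>x. cis (- (x \<bullet> \<xi>)) * h x" "t *\<^sub>R ?e"] int[OF h]
      by (simp add: add.commute)
  qed
  then have "(\<integral>x. ?D x \<partial>lborel) = 0"
    unfolding const by (rule vector_derivative_unique_at[OF _ has_vector_derivative_const])
  moreover have "(\<integral>x. ?D x \<partial>lborel) = ft (pd i h) \<xi> - \<i> * complex_of_real (\<xi> $ i) * ft h \<xi>"
  proof -
    have "(\<integral>x. ?D x \<partial>lborel) = (\<integral>x. cis (- (x \<bullet> \<xi>)) * pd i h x + (- \<i> * complex_of_real (\<xi> $ i)) * (cis (- (x \<bullet> \<xi>)) * h x) \<partial>lborel)"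
      by (simp add: mult_ac)
    also have "\<dots> = ft (pd i h) \<xi> + (- \<i> * complex_of_real (\<xi> $ i)) * ft h \<xi>"
      unfolding ft_def using int[OF h] int[OF schwartz_pd[OF h]]
      by (subst Bochner_Integration.integral_add) auto
    finally show ?thesis by simp
  qed
  ultimately show ?thesis by simp
qed

text \<open>Each power of \<open>1 + norm \<xi>\<close> is bought with one derivative:
  \<open>norm \<xi>\<close> is at most the sum of the moduli of the coordinates, and a coordinate
  times the transform is, up to \<open>\<i>\<close>, the transform of a partial derivative.\<close>

lemma ft_decay:
  fixes h :: "real^'n::finite \<Rightarrow> complex"
  assumes "h \<in> schwartz" shows "\<exists>C. \<forall>\<xi>. (1 + norm \<xi>) ^ k * norm (ft h \<xi>) \<le> C"
  using assms
proof (induction k arbitrary: h)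
  case 0
  then show ?case using ft_bound[of h] by auto
next
  case (Suc k)
  obtain C where C: "\<And>\<xi>. (1 + norm \<xi>) ^ k * norm (ft h \<xi>) \<le> C" using Suc by metis
  have "\<exists>D. \<forall>\<xi>. (1 + norm \<xi>) ^ k * norm (ft (pd i h) \<xi>) \<le> D" for i using Suc schwartz_pd by blast
  then obtain D where D: "\<And>i \<xi>. (1 + norm \<xi>) ^ k * norm (ft (pd i h) \<xi>) \<le> D i" by metis
  have "(1 + norm \<xi>) ^ Suc k * norm (ft h \<xi>) \<le> C + (\<Sum>i\<in>UNIV. D i)" for \<xi>
  proof -
    have "(1 + norm \<xi>) ^ Suc k * norm (ft h \<xi>) = ((1 + norm \<xi>) ^ k * norm (ft h \<xi>)) * (1 + norm \<xi>)" by simp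
    also have "\<dots> \<le> ((1 + norm \<xi>) ^ k * norm (ft h \<xi>)) * (1 + (\<Sum>i\<in>UNIV. \<bar>\<xi> $ i\<bar>))"
      using norm_le_l1_cart[of \<xi>] by (intro mult_left_mono) auto
    also have "\<dots> = (1 + norm \<xi>) ^ k * norm (ft h \<xi>) + (\<Sum>i\<in>UNIV. (1 + norm \<xi>) ^ k * norm (ft (pd i h) \<xi>))"
      by (simp add: ft_pd[OF Suc(2)] norm_mult distrib_left sum_distrib_left mult_ac)
    also have "\<dots> \<le> C + (\<Sum>i\<in>UNIV. D i)" by (intro add_mono sum_mono C D)
    finally show ?thesis .
  qed
  then show ?case by blast
qed

lemma schwartz_ft: 
  assumes "h \<in> schwartz" shows "ft h \<in> schwartz"
proof (rule schwartz_coinduct[where X = "ft ` schwartz"])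
  fix f :: "real^'a \<Rightarrow> complex" assume "f \<in> ft ` schwartz"
  then obtain g where g: "f = ft g" "g \<in> schwartz" by (rule imageE)
  show "\<exists>d. has_pd i f x d" for i x unfolding g(1) by (rule exI, rule has_pd_ft[OF g(2)])
  show "pd i f \<in> ft ` schwartz" for i
    unfolding g(1) pd_ft[OF g(2)] by (intro imageI schwartz_cmult schwartz_coord g)
  show "\<exists>C. \<forall>x. (1 + norm x) ^ k * norm (f x) \<le> C" for k
    unfolding g(1) by (rule ft_decay[OF g(2)])
qed (rule imageI, rule assms)

text \<open>The type argument carries the dimension, on which the normalising constant of the
  inverse transform depends.\<close>

definition ftc :: "'n::finite itself \<Rightarrow> complex" where
  "ftc _ = complex_of_real (1 / (2 * pi) ^ CARD('n))"

lemma ftc_nonzero [simp]: "ftc TYPE('n::finite) \<noteq> 0"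
  by (simp add: ftc_def)

lemma ift_conv_ft: "ift h x = ftc TYPE('n) * ft h (- x :: real^'n::finite)"
  by (simp add: ift_def ft_def ftc_def inner_commute)

lemma schwartz_ift: "h \<in> schwartz \<Longrightarrow> ift (h :: real^'n::finite \<Rightarrow> complex) \<in> schwartz"
  unfolding ift_conv_ft[abs_def] by (intro schwartz_cmult schwartz_reflect schwartz_ft)

lemma ft_reflect: "ft (\<lambda>x. h (- x)) \<xi> = ft h (- \<xi>)"
  using lborel_affine_integral_eq[of "-1" "\<lambda>x. cis (- (x \<bullet> (- \<xi>))) * h x" 0]
  by (simp add: ft_def)

lemma ft_cmult: "ft (\<lambda>x. c * h x) \<xi> = c * ft h \<xi>"
proof (cases "c = 0")
  case False
  have "ft (\<lambda>x. c * h x) \<xi> = (\<integral>x. c * (cis (- (x \<bullet> \<xi>)) * h x) \<partial>lborel)"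
    by (simp add: ft_def mult_ac)
  then show ?thesis using False by (simp add: ft_def)
qed (simp add: ft_def)

lemma ft_add: "f \<in> schwartz \<Longrightarrow> g \<in> schwartz \<Longrightarrow> ft (\<lambda>x. f x + g x) \<xi> = ft f \<xi> + ft g \<xi>"
  unfolding ft_def distrib_left
  by (intro Bochner_Integration.integral_add ft_integrable schwartz_integrable)

text \<open>The inversion integral is damped by a Gaussian. As the damping disappears, dominated
  convergence recovers the inversion integral; by Fubini the damped integral is also a Gaussian
  average of \<open>h\<close> around \<open>x\<close> at scale \<open>\<epsilon> k\<close>, which
  tends to a multiple of \<open>h x\<close> by continuity.\<close>

theorem ift_ft:
  fixes h :: "real^'n::finite \<Rightarrow> complex"
  assumes h: "h \<in> schwartz" shows "ift (ft h) x = h x"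
proof -
  define \<gamma> where "\<gamma> = (\<lambda>\<xi>::real^'n. complex_of_real (exp (- (norm \<xi>)\<^sup>2 / 2)))"
  have \<gamma>_int: "integrable lborel \<gamma>" unfolding \<gamma>_def by (rule gaussian_integral(1))
  have [measurable]: "\<gamma> \<in> borel_measurable borel" using borel_measurable_integrable[OF \<gamma>_int] by simp
  have [measurable]: "h \<in> borel_measurable borel" "ft h \<in> borel_measurable borel"
    using schwartz_measurable h schwartz_ft by blast+
  have \<gamma>1: "norm (\<gamma> \<xi>) \<le> 1" for \<xi> by (simp add: \<gamma>_def)
  have h_int: "integrable lborel h" "integrable lborel (ft h)" using h schwartz_integrable schwartz_ft by blast+
  define s where "s = complex_of_real (sqrt (2 * pi) ^ CARD('n))"
  \<comment> \<open>\<open>s\<close> occurs once as the constant of the Gaussian's transform and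
    once as its total mass; the product cancels the normalisation.\<close>
  have ss: "s * s * ftc TYPE('n) = 1"
  proof -
    have "s * s = complex_of_real ((sqrt (2 * pi) * sqrt (2 * pi)) ^ CARD('n))"
      unfolding s_def power_mult_distrib of_real_mult ..
    also have "\<dots> = complex_of_real ((2 * pi) ^ CARD('n))" by simp
    finally show ?thesis by (simp add: ftc_def)
  qed
  define \<epsilon> where "\<epsilon> k = 1 / real (Suc k)" for k
  have \<epsilon>: "\<epsilon> k > 0" for k by (simp add: \<epsilon>_def)
  have \<epsilon>0: "\<epsilon> \<longlonglongrightarrow> 0" unfolding \<epsilon>_def by (rule lim_1_over_n[THEN LIMSEQ_Suc])
  define A where "A k = (\<integral>\<xi>. \<gamma> (\<epsilon> k *\<^sub>R \<xi>) * cis (x \<bullet> \<xi>) * ft h \<xi> \<partial>lborel)" for k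
  have "A \<longlonglongrightarrow> (\<integral>\<xi>. 1 * cis (x \<bullet> \<xi>) * ft h \<xi> \<partial>lborel)"
    unfolding A_def
  proof (rule integral_dominated_convergence[of _ _ _ "\<lambda>\<xi>. norm (ft h \<xi>)"])
    show "AE \<xi> in lborel. (\<lambda>k. \<gamma> (\<epsilon> k *\<^sub>R \<xi>) * cis (x \<bullet> \<xi>) * ft h \<xi>) \<longlonglongrightarrow> 1 * cis (x \<bullet> \<xi>) * ft h \<xi>"
    proof (rule AE_I2)
      fix \<xi>
      have "(\<lambda>k. \<gamma> (\<epsilon> k *\<^sub>R \<xi>)) \<longlonglongrightarrow> complex_of_real (exp (- (norm (0 *\<^sub>R \<xi>))\<^sup>2 / 2))"
        unfolding \<gamma>_def by (intro tendsto_intros \<epsilon>0) auto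
      then show "(\<lambda>k. \<gamma> (\<epsilon> k *\<^sub>R \<xi>) * cis (x \<bullet> \<xi>) * ft h \<xi>) \<longlonglongrightarrow> 1 * cis (x \<bullet> \<xi>) * ft h \<xi>"
        by (intro tendsto_mult tendsto_const) simp
    qed
    show "AE \<xi> in lborel. norm (\<gamma> (\<epsilon> k *\<^sub>R \<xi>) * cis (x \<bullet> \<xi>) * ft h \<xi>) \<le> norm (ft h \<xi>)" for k
      using mult_right_mono[OF \<gamma>1 norm_ge_zero] by (auto simp: norm_mult intro!: AE_I2)
  qed (use h_int in auto)
  also have "(\<integral>\<xi>. 1 * cis (x \<bullet> \<xi>) * ft h \<xi> \<partial>lborel) = (1 / ftc TYPE('n)) * ift (ft h) x"
    by (simp add: ift_def ftc_def)
  finally have lim1: "A \<longlonglongrightarrow> (1 / ftc TYPE('n)) * ift (ft h) x" .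
  have A_eq: "A k = (\<integral>z. s * (\<gamma> z * h (x + \<epsilon> k *\<^sub>R z)) \<partial>lborel)" for k
  proof -
    have ek: "\<epsilon> k \<noteq> 0" "\<bar>\<epsilon> k\<bar> = \<epsilon> k" using \<epsilon>[of k] by auto
    have "A k = (\<integral>\<xi>. (\<integral>y. \<gamma> (\<epsilon> k *\<^sub>R \<xi>) * cis (x \<bullet> \<xi>) * (cis (- (y \<bullet> \<xi>)) * h y) \<partial>lborel) \<partial>lborel)"
      unfolding A_def ft_def using ft_integrable[OF h_int(1)] by simp
    also have "\<dots> = (\<integral>y. (\<integral>\<xi>. \<gamma> (\<epsilon> k *\<^sub>R \<xi>) * cis (x \<bullet> \<xi>) * (cis (- (y \<bullet> \<xi>)) * h y) \<partial>lborel) \<partial>lborel)"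
    proof (rule integral_swap_bound[where a = "\<lambda>\<xi>. norm (\<gamma> (\<epsilon> k *\<^sub>R \<xi>))" and b = "\<lambda>y. norm (h y)"])
      show "integrable lborel (\<lambda>\<xi>. norm (\<gamma> (\<epsilon> k *\<^sub>R \<xi>)))"
        using lborel_affine_integrable_iff[OF ek(1), of \<gamma> 0] \<gamma>_int by simp
      show "norm (\<gamma> (\<epsilon> k *\<^sub>R \<xi>) * cis (x \<bullet> \<xi>) * (cis (- (y \<bullet> \<xi>)) * h y)) \<le> norm (\<gamma> (\<epsilon> k *\<^sub>R \<xi>)) * norm (h y)" for \<xi> y
        by (simp add: norm_mult)
    qed (use h_int in auto)
    also have "\<dots> = (\<integral>y. complex_of_real (1 / \<epsilon> k ^ CARD('n)) * s * \<gamma> ((1 / \<epsilon> k) *\<^sub>R (x - y)) * h y \<partial>lborel)"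
    proof (rule Bochner_Integration.integral_cong[OF refl])
      fix y
      have e: "\<gamma> (\<epsilon> k *\<^sub>R \<xi>) * cis (x \<bullet> \<xi>) * (cis (- (y \<bullet> \<xi>)) * h y) = (cis (((1 / \<epsilon> k) *\<^sub>R (x - y)) \<bullet> (0 + \<epsilon> k *\<^sub>R \<xi>)) * \<gamma> (0 + \<epsilon> k *\<^sub>R \<xi>)) * h y" for \<xi>
        using ek by (simp add: cis_mult inner_diff_left mult_ac)
      have "(\<integral>\<xi>. \<gamma> (\<epsilon> k *\<^sub>R \<xi>) * cis (x \<bullet> \<xi>) * (cis (- (y \<bullet> \<xi>)) * h y) \<partial>lborel) =
         (\<integral>\<xi>. cis (((1 / \<epsilon> k) *\<^sub>R (x - y)) \<bullet> (0 + \<epsilon> k *\<^sub>R \<xi>)) * \<gamma> (0 + \<epsilon> k *\<^sub>R \<xi>) \<partial>lborel) * h y"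
        unfolding e by simp
      also have "\<dots> = (1 / \<epsilon> k ^ CARD('n)) *\<^sub>R (s * \<gamma> ((1 / \<epsilon> k) *\<^sub>R (x - y))) * h y"
        by (subst lborel_affine_integral_eq[OF ek(1)])
           (use gaussian_integral(2)[of "(1 / \<epsilon> k) *\<^sub>R (x - y)"] ek in \<open>simp add: \<gamma>_def s_def\<close>)
      finally show "(\<integral>\<xi>. \<gamma> (\<epsilon> k *\<^sub>R \<xi>) * cis (x \<bullet> \<xi>) * (cis (- (y \<bullet> \<xi>)) * h y) \<partial>lborel) =
         complex_of_real (1 / \<epsilon> k ^ CARD('n)) * s * \<gamma> ((1 / \<epsilon> k) *\<^sub>R (x - y)) * h y"
        by (simp only: scaleR_conv_of_real mult.assoc)
    qed
    also have "\<dots> = (\<epsilon> k ^ CARD('n)) *\<^sub>R (\<integral>z. complex_of_real (1 / \<epsilon> k ^ CARD('n)) * s * \<gamma> ((1 / \<epsilon> k) *\<^sub>R (x - (x + \<epsilon> k *\<^sub>R z))) * h (x + \<epsilon> k *\<^sub>R z) \<partial>lborel)"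
      by (subst lborel_affine_integral_eq[OF ek(1), where t = x and f = "\<lambda>y. complex_of_real (1 / \<epsilon> k ^ CARD('n)) * s * \<gamma> ((1 / \<epsilon> k) *\<^sub>R (x - y)) * h y"])
         (use ek in simp)
    also have "\<dots> = (\<integral>z. (\<epsilon> k ^ CARD('n)) *\<^sub>R (complex_of_real (1 / \<epsilon> k ^ CARD('n)) * s * \<gamma> ((1 / \<epsilon> k) *\<^sub>R (x - (x + \<epsilon> k *\<^sub>R z))) * h (x + \<epsilon> k *\<^sub>R z)) \<partial>lborel)"
      using ek by (simp only: integral_scaleR_right)
    also have "\<dots> = (\<integral>z. s * (\<gamma> z * h (x + \<epsilon> k *\<^sub>R z)) \<partial>lborel)"
      using ek by (intro Bochner_Integration.integral_cong refl) (simp add: scaleR_conv_of_real[where 'a = complex] \<gamma>_def)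
    finally show ?thesis .
  qed
  obtain B where B: "B > 0" "\<And>x. norm (h x) \<le> B" using schwartz_bound[OF h, of 0] by auto
  have "(\<lambda>k. \<integral>z. s * (\<gamma> z * h (x + \<epsilon> k *\<^sub>R z)) \<partial>lborel) \<longlonglongrightarrow> (\<integral>z. s * (\<gamma> z * h x) \<partial>lborel)"
  proof (rule integral_dominated_convergence[of _ _ _ "\<lambda>z. norm s * (norm (\<gamma> z) * B)"])
    show "AE z in lborel. (\<lambda>k. s * (\<gamma> z * h (x + \<epsilon> k *\<^sub>R z))) \<longlonglongrightarrow> s * (\<gamma> z * h x)"
    proof (rule AE_I2)
      fix z
      have "(\<lambda>k. h (x + \<epsilon> k *\<^sub>R z)) \<longlonglongrightarrow> h (x + 0 *\<^sub>R z)"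
        by (rule continuous_on_tendsto_compose[OF schwartz_continuous[OF h]]) (rule tendsto_intros \<epsilon>0 | simp)+
      then show "(\<lambda>k. s * (\<gamma> z * h (x + \<epsilon> k *\<^sub>R z))) \<longlonglongrightarrow> s * (\<gamma> z * h x)"
        by (intro tendsto_mult tendsto_const) simp
    qed
    show "AE z in lborel. norm (s * (\<gamma> z * h (x + \<epsilon> k *\<^sub>R z))) \<le> norm s * (norm (\<gamma> z) * B)" for k
      using B by (auto simp: norm_mult intro!: AE_I2 mult_left_mono)
  qed (use \<gamma>_int in auto)
  also have "(\<integral>z. s * (\<gamma> z * h x) \<partial>lborel) = s * (\<integral>z. \<gamma> z \<partial>lborel) * h x"
    using \<gamma>_int by (simp add: mult_ac)
  also have "(\<integral>z. \<gamma> z \<partial>lborel) = s"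
    using gaussian_integral(2)[of "0::real^'n"] by (simp add: \<gamma>_def s_def)
  finally have "A \<longlonglongrightarrow> s * s * h x" unfolding A_eq .
  with lim1 have "(1 / ftc TYPE('n)) * ift (ft h) x = s * s * h x" by (rule LIMSEQ_unique)
  then have "ift (ft h) x = (s * s * ftc TYPE('n)) * h x" by (simp add: field_simps)
  then show ?thesis by (simp add: ss)
qed

lemma ft_ift:
  fixes h :: "real^'n::finite \<Rightarrow> complex"
  assumes h: "h \<in> schwartz" shows "ft (ift h) x = h x"
proof -
  have "ft (ift h) x = ftc TYPE('n) * ft (\<lambda>y. ft h (- y)) x"
    unfolding ift_conv_ft[abs_def] by (rule ft_cmult)
  also have "\<dots> = ift (ft h) x" by (simp add: ft_reflect ift_conv_ft)
  finally show ?thesis using ift_ft[OF h] by simp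
qed

section \<open>Convolution and Fourier multipliers\<close>

definition cnv :: "(real^'n::finite \<Rightarrow> complex) \<Rightarrow> (real^'n \<Rightarrow> complex) \<Rightarrow> real^'n \<Rightarrow> complex" where
  "cnv K g y = (\<integral>x. K (y - x) * g x \<partial>lborel)"

text \<open>The class of densities that can be paired and convolved with Schwartz functions. It
  contains bounded functions, \<open>L\<^sup>p\<close> for \<open>p \<ge> 1\<close>, weak
  \<open>L\<^sup>q\<close> for \<open>q > 1\<close>, and sums of these, so the distributional
  arguments run without regard to the exponent.\<close>

definition moderate :: "(real^'n::finite \<Rightarrow> complex) \<Rightarrow> bool" where
  "moderate g \<longleftrightarrow> g \<in> borel_measurable borel \<and> integrable lborel (\<lambda>x. wgt x * norm (g x))"

lemma moderate_measurable: "moderate g \<Longrightarrow> g \<in> borel_measurable borel"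
  by (simp add: moderate_def)

lemma moderate_add:
  assumes "moderate f" "moderate g" shows "moderate (\<lambda>x. f x + g x)"
  unfolding moderate_def
proof
  have [measurable]: "f \<in> borel_measurable borel" "g \<in> borel_measurable borel" using assms by (auto simp: moderate_def)
  show "(\<lambda>x. f x + g x) \<in> borel_measurable borel" by measurable
  show "integrable lborel (\<lambda>x. wgt x * norm (f x + g x))"
  proof (rule Bochner_Integration.integrable_bound)
    show "integrable lborel (\<lambda>x. wgt x * norm (f x) + wgt x * norm (g x))"
      using assms by (auto simp: moderate_def)
    show "AE x in lborel. norm (wgt x * norm (f x + g x)) \<le> norm (wgt x * norm (f x) + wgt x * norm (g x))"
      by (intro AE_I2) (simp add: abs_mult distrib_left[symmetric] mult_left_mono norm_triangle_ineq)
  qed measurable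
qed

lemma moderate_bounded:
  assumes [measurable]: "g \<in> borel_measurable borel" and "AE x in lborel. norm (g x) \<le> C"
  shows "moderate g"
  unfolding moderate_def
proof
  show "integrable lborel (\<lambda>x. wgt x * norm (g x))"
    by (rule Bochner_Integration.integrable_bound[of _ "\<lambda>x. C * wgt x"])
       (use wgt_integrable assms(2) in \<open>auto elim!: eventually_mono simp: abs_mult mult.commute intro!: mult_mono\<close>)
qed fact

lemma moderate_powr:
  assumes [measurable]: "g \<in> borel_measurable borel" and "integrable lborel (\<lambda>x. norm (g x) powr p)" "p \<ge> 1"
  shows "moderate g"
  unfolding moderate_def
proof
  have *: "norm (g x) \<le> 1 + norm (g x) powr p" for x
  proof (cases "norm (g x) \<le> 1")
    case False
    then have "norm (g x) powr 1 \<le> norm (g x) powr p" using assms(3) by (intro powr_mono) auto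
    then show ?thesis using False by simp
  qed (simp add: add_increasing2)
  show "integrable lborel (\<lambda>x. wgt x * norm (g x))"
  proof (rule Bochner_Integration.integrable_bound[of _ "\<lambda>x. wgt x + norm (g x) powr p"])
    show "AE x in lborel. norm (wgt x * norm (g x)) \<le> norm (wgt x + norm (g x) powr p)"
    proof (rule AE_I2)
      fix x
      have "wgt x * norm (g x) \<le> wgt x * (1 + norm (g x) powr p)" by (intro mult_left_mono *) simp
      also have "\<dots> \<le> wgt x + 1 * norm (g x) powr p"
        unfolding distrib_left by (intro add_mono mult_right_mono wgt_le_1) auto
      finally show "norm (wgt x * norm (g x)) \<le> norm (wgt x + norm (g x) powr p)" by (simp add: abs_mult)
    qed
  qed (use wgt_integrable assms(2) in auto)
qed fact

lemma moderate_schwartz_integrable: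
  assumes g: "moderate g" and \<psi>: "\<psi> \<in> schwartz" shows "integrable lborel (\<lambda>x. g x * \<psi> x)"
proof -
  obtain C where C: "C > 0" "\<And>x. (1 + norm x) ^ 0 * norm (\<psi> x) \<le> C * wgt x" using schwartz_wgt[OF \<psi>] by metis
  have [measurable]: "g \<in> borel_measurable borel" "\<psi> \<in> borel_measurable borel"
    using g \<psi> schwartz_measurable by (auto simp: moderate_def)
  show ?thesis
  proof (rule Bochner_Integration.integrable_bound[of _ "\<lambda>x. C * (wgt x * norm (g x))"])
    show "AE x in lborel. norm (g x * \<psi> x) \<le> norm (C * (wgt x * norm (g x)))"
    proof (rule AE_I2)
      fix x
      have "norm (g x) * norm (\<psi> x) \<le> norm (g x) * (C * wgt x)" using C(2)[of x] by (intro mult_left_mono) auto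
      then show "norm (g x * \<psi> x) \<le> norm (C * (wgt x * norm (g x)))" using C(1) by (simp add: norm_mult abs_mult mult_ac)
    qed
  qed (use g in \<open>auto simp: moderate_def\<close>)
qed

lemma represents_moderate:
  assumes "moderate g" "\<And>\<psi>. \<psi> \<in> schwartz \<Longrightarrow> T \<psi> = (\<integral>x. g x * \<psi> x \<partial>lborel)" shows "represents g T"
  using assms moderate_schwartz_integrable by (auto simp: represents_def moderate_def)

lemma wgt_minus: "wgt (y - x) \<le> (1 + norm y) ^ (2 * CARD('n)) * wgt (x :: real^'n::finite)"
proof -
  have "wgt (- x) = wgt x" by (simp add: wgt_def)
  then show ?thesis using wgt_shift[of "y - x" "- y"] by simp
qed

lemma schwartz_minus_bound:
  fixes K :: "real^'n::finite \<Rightarrow> complex"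
  assumes "K \<in> schwartz" obtains C where "C > 0" "\<And>x y. norm (K (y - x)) \<le> C * (1 + norm y) ^ (2 * CARD('n)) * wgt x"
proof -
  obtain C where C: "C > 0" "\<And>x. (1 + norm x) ^ 0 * norm (K x) \<le> C * wgt x" using schwartz_wgt[OF assms] by metis
  have "norm (K (y - x)) \<le> C * ((1 + norm y) ^ (2 * CARD('n)) * wgt x)" for x y
    using C(2)[of "y - x"] by (intro order_trans[OF _ mult_left_mono[OF wgt_minus[of y x], of C]]) (use C(1) in auto)
  then show ?thesis using that[of C] C(1) by (simp add: mult_ac)
qed

text \<open>Peetre's inequality separates the variables of \<open>K (y - x)\<close>: the growing
  factor in \<open>y\<close> is absorbed by \<open>\<psi>\<close>, the decaying factor in
  \<open>x\<close> by the moderate \<open>g\<close>.\<close>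

lemma cnv_pair_integrable:
  fixes K g \<psi> :: "real^'n::finite \<Rightarrow> complex"
  assumes K: "K \<in> schwartz" and g: "moderate g" and \<psi>: "\<psi> \<in> schwartz"
  shows "integrable (lborel \<Otimes>\<^sub>M lborel) (\<lambda>(x, y). g x * (\<psi> y * K (y - x)))"
proof -
  obtain C where C: "C > 0" "\<And>x y. norm (K (y - x)) \<le> C * (1 + norm y) ^ (2 * CARD('n)) * wgt x"
    using schwartz_minus_bound[OF K] by metis
  have [measurable]: "g \<in> borel_measurable borel" "\<psi> \<in> borel_measurable borel" "K \<in> borel_measurable borel"
    using g \<psi> K schwartz_measurable by (auto simp: moderate_def)
  show ?thesis
  proof (rule integrable_pair_bound)
    show "integrable lborel (\<lambda>x. C * (wgt x * norm (g x)))" using g by (auto simp: moderate_def)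
    show "integrable lborel (\<lambda>y. (1 + norm y) ^ (2 * CARD('n)) * norm (\<psi> y))" by (rule schwartz_integrable_pow[OF \<psi>])
    fix x y
    have "norm (g x * (\<psi> y * K (y - x))) = norm (g x) * norm (\<psi> y) * norm (K (y - x))" by (simp add: norm_mult)
    also have "\<dots> \<le> norm (g x) * norm (\<psi> y) * (C * (1 + norm y) ^ (2 * CARD('n)) * wgt x)"
      by (intro mult_left_mono C) auto
    finally show "norm (g x * (\<psi> y * K (y - x))) \<le> C * (wgt x * norm (g x)) * ((1 + norm y) ^ (2 * CARD('n)) * norm (\<psi> y))"
      by (simp add: mult_ac)
  qed measurable
qed

lemma cnv_measurable:
  assumes "K \<in> borel_measurable borel" "g \<in> borel_measurable borel"
  shows "cnv K g \<in> borel_measurable borel"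
proof -
  have [measurable]: "g \<in> borel_measurable borel" "K \<in> borel_measurable borel" by fact+
  have "cnv K g \<in> borel_measurable lborel"
    unfolding cnv_def[abs_def] by (rule lborel.borel_measurable_lebesgue_integral) measurable
  then show ?thesis by simp
qed

lemma cnv_integrable:
  assumes K: "K \<in> schwartz" and g: "moderate g" shows "integrable lborel (\<lambda>x. K (y - x) * g x)"
  using moderate_schwartz_integrable[OF g schwartz_scale[OF schwartz_shift[OF K, of y], of "-1"]]
  by (simp add: mult.commute)

text \<open>A multiplier acts on a distribution by changing the test function. Fubini shows that the
  changed test function is \<open>\<psi>\<close> integrated against the shifted kernel
  \<open>ift m\<close>, which identifies multipliers with convolutions in
  \<open>represents_fmult\<close>.\<close>

lemma ft_mult_ift:
  fixes m \<psi> :: "real^'n::finite \<Rightarrow> complex"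
  assumes m: "m \<in> schwartz" and \<psi>: "\<psi> \<in> schwartz"
  shows "ft (\<lambda>\<xi>. m \<xi> * ift \<psi> \<xi>) x = (\<integral>y. \<psi> y * ift m (y - x) \<partial>lborel)"
proof -
  have [measurable]: "m \<in> borel_measurable borel" "\<psi> \<in> borel_measurable borel"
    using m \<psi> schwartz_measurable by auto
  have "ft (\<lambda>\<xi>. m \<xi> * ift \<psi> \<xi>) x = (\<integral>\<xi>. (\<integral>y. ftc TYPE('n) * (cis (- (x \<bullet> \<xi>)) * m \<xi> * (cis (\<xi> \<bullet> y) * \<psi> y)) \<partial>lborel) \<partial>lborel)"
    unfolding ft_def
  proof (rule Bochner_Integration.integral_cong[OF refl])
    fix \<xi>
    have "(\<integral>y. ftc TYPE('n) * (cis (- (x \<bullet> \<xi>)) * m \<xi> * (cis (\<xi> \<bullet> y) * \<psi> y)) \<partial>lborel) =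
      (\<integral>y. (ftc TYPE('n) * (cis (- (x \<bullet> \<xi>)) * m \<xi>)) * (cis (\<xi> \<bullet> y) * \<psi> y) \<partial>lborel)"
      by (simp only: mult.assoc)
    also have "\<dots> = cis (- (\<xi> \<bullet> x)) * (m \<xi> * ift \<psi> \<xi>)"
      unfolding integral_mult_right_zero ift_def ftc_def by (simp only: mult_ac inner_commute)
    finally show "cis (- (\<xi> \<bullet> x)) * (m \<xi> * ift \<psi> \<xi>) =
      (\<integral>y. ftc TYPE('n) * (cis (- (x \<bullet> \<xi>)) * m \<xi> * (cis (\<xi> \<bullet> y) * \<psi> y)) \<partial>lborel)" by (rule sym)
  qed
  also have "\<dots> = (\<integral>y. (\<integral>\<xi>. ftc TYPE('n) * (cis (- (x \<bullet> \<xi>)) * m \<xi> * (cis (\<xi> \<bullet> y) * \<psi> y)) \<partial>lborel) \<partial>lborel)"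
    by (rule integral_swap_bound[where a = "\<lambda>\<xi>. norm (ftc TYPE('n)) * norm (m \<xi>)" and b = "\<lambda>y. norm (\<psi> y)"])
       (use schwartz_integrable[OF m] schwartz_integrable[OF \<psi>] in \<open>auto simp: norm_mult\<close>)
  also have "\<dots> = (\<integral>y. \<psi> y * ift m (y - x) \<partial>lborel)"
  proof (rule Bochner_Integration.integral_cong[OF refl])
    fix y
    have e: "ftc TYPE('n) * (cis (- (x \<bullet> \<xi>)) * m \<xi> * (cis (\<xi> \<bullet> y) * \<psi> y)) = (ftc TYPE('n) * \<psi> y) * (cis ((y - x) \<bullet> \<xi>) * m \<xi>)" for \<xi>
    proof -
      have "cis ((y - x) \<bullet> \<xi>) = cis (\<xi> \<bullet> y) * cis (- (x \<bullet> \<xi>))"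
        by (simp add: cis_mult inner_diff_left inner_diff_right inner_commute)
      then show ?thesis by (simp only: mult_ac)
    qed
    show "(\<integral>\<xi>. ftc TYPE('n) * (cis (- (x \<bullet> \<xi>)) * m \<xi> * (cis (\<xi> \<bullet> y) * \<psi> y)) \<partial>lborel) = \<psi> y * ift m (y - x)"
      unfolding e ift_def by (simp add: ftc_def)
  qed
  finally show ?thesis .
qed

lemma fmult_eq: "fmult m T \<psi> = T (ft (\<lambda>\<xi>. m \<xi> * ift \<psi> \<xi>))"
  by (simp add: fmult_def dift_def dft_def)

lemma schwartz_ft_mult_ift: "m \<in> schwartz \<Longrightarrow> \<psi> \<in> schwartz \<Longrightarrow> ft (\<lambda>\<xi>. m \<xi> * ift \<psi> \<xi>) \<in> schwartz"
  by (intro schwartz_ft schwartz_mult schwartz_ift)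

lemma cnv_schwartz_integral:
  fixes K g \<psi> :: "real^'n::finite \<Rightarrow> complex"
  assumes K: "K \<in> schwartz" and g: "moderate g" and \<psi>: "\<psi> \<in> schwartz"
  shows "integrable lborel (\<lambda>y. cnv K g y * \<psi> y)"
    and "(\<integral>y. cnv K g y * \<psi> y \<partial>lborel) = (\<integral>x. g x * (\<integral>y. \<psi> y * K (y - x) \<partial>lborel) \<partial>lborel)"
proof -
  note I = cnv_pair_integrable[OF K g \<psi>]
  have e: "cnv K g y * \<psi> y = (\<integral>x. g x * (\<psi> y * K (y - x)) \<partial>lborel)" for y
    unfolding cnv_def by (subst integral_mult_left_zero[symmetric]) (simp add: mult_ac)
  show "integrable lborel (\<lambda>y. cnv K g y * \<psi> y)"
    unfolding e using lborel_pair.integrable_snd[OF I] by simp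
  show "(\<integral>y. cnv K g y * \<psi> y \<partial>lborel) = (\<integral>x. g x * (\<integral>y. \<psi> y * K (y - x) \<partial>lborel) \<partial>lborel)"
    unfolding e using lborel_pair.Fubini_integral[OF I] by simp
qed

lemma represents_fmult:
  assumes m: "m \<in> schwartz" and g: "moderate g" and T: "represents g T"
  shows "represents (cnv (ift m) g) (fmult m T)"
  unfolding represents_def
proof (intro conjI ballI)
  show "cnv (ift m) g \<in> borel_measurable lborel"
    using cnv_measurable schwartz_measurable[OF schwartz_ift[OF m]] g by (auto simp: moderate_def)
  fix \<psi> :: "real^'a \<Rightarrow> complex" assume \<psi>: "\<psi> \<in> schwartz"
  note C = cnv_schwartz_integral[OF schwartz_ift[OF m] g \<psi>]
  show "integrable lborel (\<lambda>x. cnv (ift m) g x * \<psi> x)" by (rule C)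
  show "fmult m T \<psi> = (\<integral>x. cnv (ift m) g x * \<psi> x \<partial>lborel)"
    using T schwartz_ft_mult_ift[OF m \<psi>] unfolding C(2) fmult_eq represents_def by (simp add: ft_mult_ift[OF m \<psi>])
qed

lemma ift_scale:
  fixes m :: "real^'n::finite \<Rightarrow> complex" and c :: real
  assumes "c > 0"
  shows "ift (\<lambda>\<xi>. m (c *\<^sub>R \<xi>)) x = complex_of_real (1 / c ^ CARD('n)) * ift m ((1 / c) *\<^sub>R x)"
  using assms lborel_affine_integral_eq[of c "\<lambda>\<xi>. cis (((1 / c) *\<^sub>R x) \<bullet> \<xi>) * m \<xi>" 0]
  by (simp add: ift_def scaleR_conv_of_real[where 'a = complex])

section \<open>Littlewood--Paley functions and uniqueness of densities\<close>

lemma has_pd_inverse_norm: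
  fixes \<xi> :: "real^'n::finite"
  assumes "\<xi> \<noteq> 0"
  shows "has_pd i (\<lambda>\<xi>. complex_of_real (1 / (norm \<xi>)\<^sup>2)) \<xi> (complex_of_real (- 2 * \<xi> $ i * (1 / (norm \<xi>)\<^sup>2)\<^sup>2))"
proof -
  have e: "(norm (\<xi> + t *\<^sub>R axis i 1))\<^sup>2 = (norm \<xi>)\<^sup>2 + 2 * t * \<xi> $ i + t\<^sup>2" for t :: real
    unfolding power2_norm_eq_inner by (simp add: inner_add_left inner_add_right inner_axis inner_axis' inner_commute power2_eq_square algebra_simps)
  have n: "(norm \<xi>)\<^sup>2 \<noteq> 0" using assms by simp
  have "((\<lambda>t. 1 / ((norm \<xi>)\<^sup>2 + 2 * t * \<xi> $ i + t\<^sup>2)) has_real_derivative (- 2 * \<xi> $ i * (1 / (norm \<xi>)\<^sup>2)\<^sup>2)) (at 0)"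
    using n by (auto intro!: derivative_eq_intros simp: power2_eq_square field_simps)
  then have "((\<lambda>t. complex_of_real (1 / ((norm \<xi>)\<^sup>2 + 2 * t * \<xi> $ i + t\<^sup>2))) has_vector_derivative
     complex_of_real (- 2 * \<xi> $ i * (1 / (norm \<xi>)\<^sup>2)\<^sup>2)) (at 0)"
    by (intro has_vector_derivative_of_real) (simp add: has_real_derivative_iff_has_vector_derivative)
  then show ?thesis unfolding e .
qed

lemma has_pd_power:
  assumes "has_pd i f x d" shows "has_pd i (\<lambda>x. f x ^ k) x (of_nat k * f x ^ (k - 1) * d)"
proof (induction k)
  case (Suc k)
  have "has_pd i (\<lambda>x. f x * f x ^ k) x (f x * (of_nat k * f x ^ (k - 1) * d) + d * f x ^ k)"
    by (rule has_pd_mult[OF assms Suc])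
  moreover have "f x * (of_nat k * f x ^ (k - 1) * d) + d * f x ^ k = of_nat (Suc k) * f x ^ (Suc k - 1) * d"
    by (cases k) (auto simp: algebra_simps)
  ultimately show ?case unfolding power_Suc by (simp only:)
qed simp

lemma schwartz_zero_pd:
  assumes "h \<in> schwartz" "open S" "\<And>\<xi>. \<xi> \<in> S \<Longrightarrow> h \<xi> = c" "\<xi> \<in> S" shows "pd i h \<xi> = 0"
  by (rule has_pd_imp, rule has_pd_transform[OF has_pd_const assms(2,4)], rule assms(3))

lemma open_norm_less: "open {\<xi>::'a::real_normed_vector. norm \<xi> < r}"
  and open_norm_greater: "open {\<xi>::'a::real_normed_vector. norm \<xi> > r}"
  by (auto intro!: open_Collect_less continuous_intros)

text \<open>Differentiating a power of \<open>1 / (norm \<xi>)\<^sup>2\<close> raises it by one and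
  produces a coordinate. So the products of such powers with Schwartz functions vanishing near the
  origin are closed under \<open>pd\<close> up to sums, and the vanishing keeps the powers bounded
  by powers of \<open>1 / r\<^sup>2\<close>.\<close>

lemma schwartz_inverse_norm:
  fixes h :: "real^'n::finite \<Rightarrow> complex"
  assumes h: "h \<in> schwartz" "\<And>\<xi>. norm \<xi> < r \<Longrightarrow> h \<xi> = 0" and r: "r > 0"
  shows "(\<lambda>\<xi>. complex_of_real (1 / (norm \<xi>)\<^sup>2) * h \<xi>) \<in> schwartz"
proof -
  define A where "A = {h :: real^'n \<Rightarrow> complex. h \<in> schwartz \<and> (\<forall>\<xi>. norm \<xi> < r \<longrightarrow> h \<xi> = 0)}"
  define q where "q \<xi> = complex_of_real (1 / (norm \<xi>)\<^sup>2)" for \<xi> :: "real^'n"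
  define F where "F = (\<lambda>(k::nat, h) \<xi>. q \<xi> ^ k * h \<xi> :: complex)"
  have pdA: "pd i h \<in> A" if "h \<in> A" for h i
    using that schwartz_pd schwartz_zero_pd[OF _ open_norm_less[of r], of h 0] by (auto simp: A_def)
  have "F (1, h) \<in> schwartz"
  proof (rule sspan_schwartz[where B = "F ` (UNIV \<times> A)"])
    show "F (1, h) \<in> sspan (F ` (UNIV \<times> A))"
      by (rule sspan.base, rule imageI) (use h in \<open>auto simp: A_def\<close>)
    fix f assume "f \<in> F ` (UNIV \<times> A)"
    then obtain k g where f: "f = F (k, g)" and gA: "g \<in> A" by auto
    then have g: "g \<in> schwartz" "\<And>\<xi>. norm \<xi> < r \<Longrightarrow> g \<xi> = 0" by (auto simp: A_def)
    let ?g = "\<lambda>i \<xi>. (- 2 * of_nat k) * (complex_of_real (\<xi> $ i) * g \<xi>)"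
    have gi: "?g i \<in> A" for i
      using g by (auto simp: A_def intro!: schwartz_cmult[where c = "- 2 * of_nat k", simplified] schwartz_coord)
    have *: "has_pd i f \<xi> (F (k, pd i g) \<xi> + F (Suc k, ?g i) \<xi>)" for i \<xi>
    proof (cases "norm \<xi> < r")
      case True
      have "has_pd i f \<xi> 0"
        by (rule has_pd_transform[OF has_pd_const[of 0] open_norm_less[of r]]) (use True g in \<open>auto simp: f F_def\<close>)
      moreover have "F (k, pd i g) \<xi> + F (Suc k, ?g i) \<xi> = 0"
        using True g(2) pdA[OF gA, of i] by (auto simp: F_def A_def)
      ultimately show ?thesis by simp
    next
      case False
      then have "\<xi> \<noteq> 0" using r by auto
      then have 1: "has_pd i q \<xi> (complex_of_real (- 2 * \<xi> $ i * (1 / (norm \<xi>)\<^sup>2)\<^sup>2))"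
        unfolding q_def by (rule has_pd_inverse_norm)
      have "has_pd i (\<lambda>\<xi>. q \<xi> ^ k * g \<xi>) \<xi> (q \<xi> ^ k * pd i g \<xi> + of_nat k * q \<xi> ^ (k - 1) * complex_of_real (- 2 * \<xi> $ i * (1 / (norm \<xi>)\<^sup>2)\<^sup>2) * g \<xi>)"
        by (intro has_pd_mult has_pd_power 1 schwartz_has_pd g)
      also have "complex_of_real (- 2 * \<xi> $ i * (1 / (norm \<xi>)\<^sup>2)\<^sup>2) = - 2 * complex_of_real (\<xi> $ i) * (q \<xi> * q \<xi>)"
        by (simp add: q_def power2_eq_square)
      \<comment> \<open>For \<open>k = 0\<close> the truncated exponent \<open>k - 1\<close> is
        harmless, since the factor \<open>of_nat k\<close> vanishes.\<close>
      also have "of_nat k * q \<xi> ^ (k - 1) * (- 2 * complex_of_real (\<xi> $ i) * (q \<xi> * q \<xi>)) * g \<xi> = F (Suc k, ?g i) \<xi>"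
        by (cases k) (simp_all add: F_def algebra_simps)
      finally show ?thesis by (simp add: f F_def)
    qed
    show "\<exists>d. has_pd i f \<xi> d" for i \<xi> by (rule exI, rule *)
    have "pd i f = (\<lambda>\<xi>. F (k, pd i g) \<xi> + F (Suc k, ?g i) \<xi>)" for i by (rule ext, rule has_pd_imp, rule *)
    moreover have "(\<lambda>\<xi>. F (k, pd i g) \<xi> + F (Suc k, ?g i) \<xi>) \<in> sspan (F ` (UNIV \<times> A))" for i
      by (rule sspan.add; rule sspan.base, rule imageI) (use gi pdA[OF gA] in auto)
    ultimately show "pd i f \<in> sspan (F ` (UNIV \<times> A))" for i by simp
    fix l
    obtain C where C: "C > 0" "\<And>x. (1 + norm x) ^ l * norm (g x) \<le> C" using schwartz_bound[OF g(1)] by metis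
    have "(1 + norm x) ^ l * norm (f x) \<le> (1 / r\<^sup>2) ^ k * C" for x
    proof (cases "norm x < r")
      case True then show ?thesis using g C r by (simp add: f F_def)
    next
      case False
      then have "r\<^sup>2 \<le> (norm x)\<^sup>2" using r by (intro power_mono) auto
      moreover have "norm (q x) = 1 / (norm x)\<^sup>2" by (simp add: q_def norm_divide norm_power)
      ultimately have "norm (q x) \<le> 1 / r\<^sup>2" using r False
        by (auto intro!: divide_left_mono mult_pos_pos zero_less_power)
      then have "norm (q x) ^ k \<le> (1 / r\<^sup>2) ^ k" by (intro power_mono) auto
      then have "norm (q x) ^ k * ((1 + norm x) ^ l * norm (g x)) \<le> (1 / r\<^sup>2) ^ k * C"
        by (intro mult_mono C) auto
      then show ?thesis by (simp add: f F_def norm_mult norm_power mult_ac)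
    qed
    then show "\<exists>C. \<forall>x. (1 + norm x) ^ l * norm (f x) \<le> C" by blast
  qed
  then show ?thesis by (simp add: F_def q_def)
qed

locale littlewood_paley =
  fixes \<phi> :: "real^'n::finite \<Rightarrow> complex"
  assumes LP: "LP_function \<phi>"
begin

definition phi :: "int \<Rightarrow> real^'n \<Rightarrow> complex" where
  "phi j \<xi> = \<phi> ((2 powr (- real_of_int j)) *\<^sub>R \<xi>)"

lemma LPblock_eq: "LPblock \<phi> j T = fmult (phi j) T"
  by (simp add: LPblock_def phi_def[abs_def])

lemma phi_schwartz: "phi j \<in> schwartz"
  using LP unfolding phi_def[abs_def] LP_function_def by (intro schwartz_scale) auto

lemma phi_add: "phi (j + k) \<xi> = phi j ((2 powr (- real_of_int k)) *\<^sub>R \<xi>)"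
  by (simp add: phi_def powr_add[symmetric])

lemma phi_diff: "phi (j - k) \<xi> = phi j ((2 powr (real_of_int k)) *\<^sub>R \<xi>)"
  using phi_add[of j "- k"] by simp

lemma phi_supp:
  assumes "phi j \<xi> \<noteq> 0"
  shows "2 powr (real_of_int j - 1) \<le> norm \<xi>" "norm \<xi> \<le> 2 powr (real_of_int j + 1)"
proof -
  have *: "1/2 \<le> norm ((2 powr (- real_of_int j)) *\<^sub>R \<xi>)" "norm ((2 powr (- real_of_int j)) *\<^sub>R \<xi>) \<le> 2"
    using LP assms by (auto simp: phi_def LP_function_def)
  show "2 powr (real_of_int j - 1) \<le> norm \<xi>" "norm \<xi> \<le> 2 powr (real_of_int j + 1)"
    using * by (simp_all add: powr_minus powr_add powr_diff field_simps)
qed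

lemma phi_0 [simp]: "phi j 0 = 0"
proof (rule ccontr)
  assume "phi j 0 \<noteq> 0"
  from phi_supp(1)[OF this] show False by (simp add: not_le)
qed

text \<open>As closed annuli, supports at distance two still share a sphere, so disjointness starts
  at distance three. This fixes the windows of five indices used later.\<close>

lemma phi_far: "\<bar>j - k\<bar> \<ge> 3 \<Longrightarrow> phi j \<xi> \<noteq> 0 \<Longrightarrow> phi k \<xi> = 0"
proof (rule ccontr)
  assume *: "\<bar>j - k\<bar> \<ge> 3" "phi j \<xi> \<noteq> 0" "phi k \<xi> \<noteq> 0"
  have "2 powr (real_of_int j - 1) \<le> (2::real) powr (real_of_int k + 1)" "2 powr (real_of_int k - 1) \<le> (2::real) powr (real_of_int j + 1)"
    by (rule order_trans[OF phi_supp(1)[OF *(2)] phi_supp(2)[OF *(3)]],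
        rule order_trans[OF phi_supp(1)[OF *(3)] phi_supp(2)[OF *(2)]])
  then show False using *(1) by simp
qed

lemma phi_has_sum: "\<xi> \<noteq> 0 \<Longrightarrow> ((\<lambda>j. phi j \<xi>) has_sum 1) UNIV"
  using LP by (simp add: LP_function_def phi_def)

lemma phi_sum_eq_1:
  assumes "\<xi> \<noteq> 0" "finite A" "\<And>j. j \<notin> A \<Longrightarrow> phi j \<xi> = 0" shows "(\<Sum>j\<in>A. phi j \<xi>) = 1"
proof -
  have "((\<lambda>j. phi j \<xi>) has_sum (\<Sum>j\<in>A. phi j \<xi>)) UNIV"
    by (rule has_sum_finite_neutralI[OF assms(2)]) (use assms in auto)
  then show ?thesis using phi_has_sum[OF assms(1)] has_sum_unique by blast
qed

text \<open>A fattened block, equal to one wherever \<open>phi j\<close> is nonzero. It allows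
  frequency localisation to be recorded as a reproducing identity.\<close>

definition phit :: "int \<Rightarrow> real^'n \<Rightarrow> complex" where
  "phit j \<xi> = (\<Sum>k\<in>{j-2..j+2}. phi k \<xi>)"

lemma phit_schwartz: "phit j \<in> schwartz"
  unfolding phit_def[abs_def] by (intro schwartz_sum phi_schwartz)

lemma phit_phi: "phit j \<xi> * phi j \<xi> = phi j \<xi>"
proof (cases "phi j \<xi> = 0")
  case False
  then have "\<xi> \<noteq> 0" by auto
  then have "phit j \<xi> = 1" unfolding phit_def
    by (rule phi_sum_eq_1) (use False phi_far[of j] in fastforce)+
  then show ?thesis by simp
qed simp

lemma phit_scale: "phit j \<xi> = phit 0 ((2 powr (- real_of_int j)) *\<^sub>R \<xi>)"
proof -
  have "phit j \<xi> = (\<Sum>k\<in>{-2..2}. phi (k + j) \<xi>)"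
    unfolding phit_def by (rule sum.reindex_bij_witness[of _ "\<lambda>k. k + j" "\<lambda>k. k - j"]) auto
  then show ?thesis by (simp add: phit_def phi_add)
qed

lemma sum_phi_phi:
  assumes "int N \<ge> \<bar>k\<bar> + 2" shows "(\<Sum>j\<in>{- int N..int N}. phi j \<xi>) * phi k \<xi> = phi k \<xi>"
proof (cases "phi k \<xi> = 0")
  case False
  then have "\<xi> \<noteq> 0" by auto
  then have "(\<Sum>j\<in>{- int N..int N}. phi j \<xi>) = 1"
  proof (rule phi_sum_eq_1)
    fix j assume "j \<notin> {- int N..int N}"
    then have "\<bar>k - j\<bar> \<ge> 3" using assms by auto
    then show "phi j \<xi> = 0" using phi_far False by blast
  qed simp
  then show ?thesis by simp
qed simp

text \<open>Away from the origin this is the sum of the blocks of index at most 0. Taking the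
  complement of the high blocks also gives the value 1 at the origin, and with it smoothness
  there.\<close>

definition low :: "real^'n \<Rightarrow> complex" where
  "low \<xi> = 1 - infsum (\<lambda>j. phi j \<xi>) {1..}"

lemma phi_finite_supp: "finite {j. phi j \<xi> \<noteq> 0}"
proof (cases "\<exists>j. phi j \<xi> \<noteq> 0")
  case True
  then obtain j where j: "phi j \<xi> \<noteq> 0" by auto
  have "{j. phi j \<xi> \<noteq> 0} \<subseteq> {j-2..j+2}"
  proof (rule subsetI, rule ccontr)
    fix k assume "k \<in> {j. phi j \<xi> \<noteq> 0}" "k \<notin> {j-2..j+2}"
    then show False using phi_far[OF _ j, of k] by auto
  qed
  then show ?thesis by (rule finite_subset) simp
qed simp

lemma phi_summable: "(\<lambda>j. phi j \<xi>) summable_on A"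
proof -
  have "((\<lambda>j. phi j \<xi>) has_sum (\<Sum>j\<in>{j\<in>A. phi j \<xi> \<noteq> 0}. phi j \<xi>)) A"
    by (rule has_sum_finite_neutralI) (use finite_subset[OF _ phi_finite_supp[of \<xi>], of "{j\<in>A. phi j \<xi> \<noteq> 0}"] in auto)
  then show ?thesis by (auto simp: summable_on_def)
qed

lemma low_eq:
  assumes "norm \<xi> < 2 ^ N" shows "low \<xi> = 1 - (\<Sum>j\<in>{1..int N}. phi j \<xi>)"
proof -
  have "infsum (\<lambda>j. phi j \<xi>) {1..} = infsum (\<lambda>j. phi j \<xi>) {1..int N}"
  proof (rule infsum_cong_neutral)
    fix j assume "j \<in> {1..} - {1..int N}"
    then have j: "j > int N" by auto
    show "phi j \<xi> = 0"
    proof (rule ccontr)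
      assume "phi j \<xi> \<noteq> 0"
      from phi_supp(1)[OF this] assms have "(2::real) powr (real_of_int j - 1) < 2 powr (real N)"
        by (simp add: powr_realpow)
      then show False using j by simp
    qed
  qed auto
  then show ?thesis by (simp add: low_def)
qed

lemma low_zero:
  assumes "norm \<xi> > 2" shows "low \<xi> = 0"
proof -
  have "infsum (\<lambda>j. phi j \<xi>) {1..} = infsum (\<lambda>j. phi j \<xi>) UNIV"
  proof (rule infsum_cong_neutral)
    fix j :: int assume "j \<in> UNIV - {1..}"
    then have j: "j \<le> 0" by auto
    show "phi j \<xi> = 0"
    proof (rule ccontr)
      assume "phi j \<xi> \<noteq> 0"
      from phi_supp(2)[OF this] assms have "(2::real) powr 1 < 2 powr (real_of_int j + 1)" by simp
      then show False using j by (simp only: powr_less_cancel_iff)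
    qed
  qed auto
  also have "\<dots> = 1" by (rule infsumI, rule phi_has_sum) (use assms in auto)
  finally show ?thesis by (simp add: low_def)
qed

lemma low_one: "norm \<xi> < 1 \<Longrightarrow> low \<xi> = 1"
  using low_eq[of \<xi> 0] by simp

text \<open>Dilation shifts the block index: off the origin the first dilate of \<open>low\<close>
  keeps the blocks up to \<open>N\<close>, the second those up to \<open>- N - 1\<close>. The shift
  is \<open>Suc N\<close> because \<open>low\<close> itself includes the block of index 0.\<close>

lemma low_diff:
  "(\<Sum>j\<in>{- int N..int N}. phi j \<xi>) = low ((2 powr (- real N)) *\<^sub>R \<xi>) - low ((2 powr (real (Suc N))) *\<^sub>R \<xi>)"
proof -
  have 1: "infsum (\<lambda>j. phi j ((2 powr (- real N)) *\<^sub>R \<xi>)) {1..} = infsum (\<lambda>j. phi j \<xi>) {int N + 1..}"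
    by (rule infsum_reindex_bij_witness[of _ "\<lambda>j. j - int N" "\<lambda>j. j + int N"]) (auto simp: phi_add)
  have 2: "infsum (\<lambda>j. phi j ((2 powr (real (Suc N))) *\<^sub>R \<xi>)) {1..} = infsum (\<lambda>j. phi j \<xi>) {- int N..}"
    by (rule infsum_reindex_bij_witness[of _ "\<lambda>j. j + int (Suc N)" "\<lambda>j. j - int (Suc N)"]) (auto simp: phi_diff simp del: of_nat_Suc)
  have "{- int N..} = {- int N..int N} \<union> {int N + 1..}" by auto
  then have "infsum (\<lambda>j. phi j \<xi>) {- int N..} = (\<Sum>j\<in>{- int N..int N}. phi j \<xi>) + infsum (\<lambda>j. phi j \<xi>) {int N + 1..}"
    using infsum_Un_disjoint[OF phi_summable[of \<xi> "{- int N..int N}"] phi_summable[of \<xi> "{int N + 1..}"]] by auto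
  then show ?thesis unfolding low_def 1 2 by simp
qed

text \<open>Below radius 4 \<open>low\<close> is \<open>1 - P\<close> with \<open>P\<close>
  Schwartz, above radius 2 it vanishes. Its derivatives are thus those of \<open>- P\<close> cut off
  at radius 3, inside a shell where they vanish anyway. The invariant set consists of
  \<open>low\<close> and of such cut-offs.\<close>

lemma low_schwartz: "low \<in> schwartz"
proof -
  define P where "P = (\<lambda>\<xi>. \<Sum>j\<in>{1..int 2}. phi j \<xi>)"
  have P: "P \<in> schwartz" unfolding P_def by (intro schwartz_sum phi_schwartz)
  have lowP: "low \<xi> = 1 - P \<xi>" if "norm \<xi> < 4" for \<xi> using low_eq[of \<xi> 2] that by (simp add: P_def)
  have P1: "P \<xi> = 1" if "2 < norm \<xi>" "norm \<xi> < 4" for \<xi> using lowP[OF that(2)] low_zero[OF that(1)] by simp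
  define A where "A = {h :: real^'n \<Rightarrow> complex. h \<in> schwartz \<and> (\<forall>\<xi>. 2 < norm \<xi> \<and> norm \<xi> < 4 \<longrightarrow> h \<xi> = 0)}"
  define cut where "cut = (\<lambda>h (\<xi> :: real^'n). if norm \<xi> < 3 then h \<xi> else (0::complex))"
  have o: "open {\<xi>::real^'n. 2 < norm \<xi> \<and> norm \<xi> < 4}"
    using open_Int[OF open_norm_greater[of 2] open_norm_less[of 4]] by (simp add: Int_def)
  have cut_pd: "has_pd i (cut h) \<xi> (cut (pd i h) \<xi>)" if "h \<in> A" for h i \<xi>
  proof (cases "norm \<xi> < 3")
    case True
    have "has_pd i h \<xi> (pd i h \<xi>)" using that schwartz_has_pd by (auto simp: A_def)
    then have "has_pd i (cut h) \<xi> (pd i h \<xi>)"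
      by (rule has_pd_transform[OF _ open_norm_less[of 3]]) (use True in \<open>auto simp: cut_def\<close>)
    then show ?thesis using True by (simp add: cut_def)
  next
    case False
    have "has_pd i (cut h) \<xi> 0"
      by (rule has_pd_transform[OF has_pd_const[of 0] open_norm_greater[of 2]]) (use False that in \<open>auto simp: cut_def A_def\<close>)
    then show ?thesis using False by (simp add: cut_def)
  qed
  have Apd: "pd i h \<in> A" if "h \<in> A" for h i
    using that schwartz_pd schwartz_zero_pd[OF _ o, of h 0] by (auto simp: A_def)
  have pdP: "(\<lambda>\<xi>. - pd i P \<xi>) \<in> A" for i
    using schwartz_uminus[OF schwartz_pd[OF P]] schwartz_zero_pd[OF P o, of 1] P1 by (auto simp: A_def)
  have lowpd: "has_pd i low \<xi> (cut (\<lambda>\<xi>. - pd i P \<xi>) \<xi>)" for i \<xi>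
  proof (cases "norm \<xi> < 3")
    case True
    have "has_pd i (\<lambda>\<xi>. 1 + (- 1) * P \<xi>) \<xi> (0 + (- 1) * pd i P \<xi>)"
      by (intro has_pd_add has_pd_const has_pd_cmult schwartz_has_pd P)
    then have "has_pd i low \<xi> (0 + (- 1) * pd i P \<xi>)"
      by (rule has_pd_transform[OF _ open_norm_less[of 4]]) (use True lowP in auto)
    then show ?thesis using True by (simp add: cut_def)
  next
    case False
    have "has_pd i low \<xi> 0"
      by (rule has_pd_transform[OF has_pd_const[of 0] open_norm_greater[of 2]]) (use False low_zero in auto)
    then show ?thesis using False by (simp add: cut_def)
  qed
  show ?thesis
  proof (rule schwartz_coinduct[where X = "insert low (cut ` A)"])
    show "low \<in> insert low (cut ` A)" by simp
    fix f assume f: "f \<in> insert low (cut ` A)"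
    show "\<exists>d. has_pd i f x d" for i x
      using f
    proof
      assume "f = low" then show ?thesis using lowpd by blast
    next
      assume "f \<in> cut ` A"
      then obtain h where "f = cut h" "h \<in> A" by (rule imageE)
      then show ?thesis using cut_pd by blast
    qed
    show "pd i f \<in> insert low (cut ` A)" for i
      using f
    proof
      assume "f = low"
      then have "pd i f = cut (\<lambda>\<xi>. - pd i P \<xi>)" by (metis ext has_pd_imp[OF lowpd])
      then show ?thesis using imageI[OF pdP[of i], of cut] by simp
    next
      assume "f \<in> cut ` A"
      then obtain h where h: "f = cut h" "h \<in> A" by (rule imageE)
      then have "pd i f = cut (pd i h)" using has_pd_imp[OF cut_pd[OF h(2)]] by (intro ext) simp
      then show ?thesis using imageI[OF Apd[OF h(2), of i], of cut] by simp
    qed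
    fix k
    show "\<exists>C. \<forall>x. (1 + norm x) ^ k * norm (f x) \<le> C"
      using f
    proof
      assume f: "f = low"
      obtain C where C: "C > 0" "\<And>x. (1 + norm x) ^ k * norm (P x) \<le> C" using schwartz_bound[OF P] by metis
      have "(1 + norm x) ^ k * norm (low x) \<le> 4 ^ k + C" for x
      proof (cases "norm x < 3")
        case True
        have "(1 + norm x) ^ k * norm (low x) \<le> (1 + norm x) ^ k * (1 + norm (P x))"
          using lowP[of x] True norm_triangle_ineq4[of 1 "P x"] by (intro mult_left_mono) auto
        also have "\<dots> \<le> 4 ^ k + C"
          unfolding distrib_left using True C(2)[of x] power_mono[of "1 + norm x" 4 k] by auto
        finally show ?thesis .
      qed (use low_zero[of x] C in \<open>auto intro: add_nonneg_nonneg\<close>)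
      then show ?thesis using f by blast
    next
      assume "f \<in> cut ` A"
      then obtain h where h: "f = cut h" "h \<in> A" by (rule imageE)
      then have "h \<in> schwartz" by (simp add: A_def)
      then obtain C where C: "C > 0" "\<And>x. (1 + norm x) ^ k * norm (h x) \<le> C" using schwartz_bound by metis
      then have "(1 + norm x) ^ k * norm (cut h x) \<le> C" for x by (auto simp: cut_def intro: less_imp_le)
      then show ?thesis using h by blast
    qed
  qed
qed

text \<open>Fourier inversion for \<open>low\<close>, read at the origin. It makes the rescaled
  kernels \<open>ift low\<close> an approximate identity.\<close>

lemma ift_low_integral: "(\<integral>x. ift low x \<partial>lborel) = 1"
  using ft_ift[OF low_schwartz, of 0] low_one[of 0] by (simp add: ft_def)

end

text \<open>Indicators of open sets are limits of the continuous functions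
  \<open>min 1 (k * infdist x (- S))\<close>, and the open sets are an intersection-stable
  generator; so the integral of \<open>D\<close> over every Borel set vanishes.\<close>

lemma integral_bounded_continuous_zero:
  fixes D :: "'a::euclidean_space \<Rightarrow> complex"
  assumes D: "integrable lborel D"
    and zero: "\<And>c :: 'a \<Rightarrow> complex. continuous_on UNIV c \<Longrightarrow> (\<And>x. norm (c x) \<le> 1) \<Longrightarrow> (\<integral>x. D x * c x \<partial>lborel) = 0"
  shows "AE x in lborel. D x = 0"
proof (rule sigma_finite_measure.density_zero[OF sigma_finite_lborel D])
  have [measurable]: "D \<in> borel_measurable borel" using borel_measurable_integrable[OF D] by simp
  have si: "set_integrable lborel A D" if "A \<in> sets borel" for A
    using integrable_mult_indicator[OF _ D, of A] that by (simp add: set_integrable_def)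
  have total: "(\<integral>x. D x \<partial>lborel) = 0" using zero[of "\<lambda>_. 1"] by simp
  have op: "set_lebesgue_integral lborel S D = 0" if "open S" for S
  proof (cases "S = UNIV")
    case False
    define c where "c k x = complex_of_real (min 1 (real k * infdist x (- S)))" for k x
    have cl: "closed (- S)" "- S \<noteq> {}" using that False by auto
    have c: "continuous_on UNIV (c k)" "norm (c k x) \<le> 1" for k x
      unfolding c_def by (auto intro!: continuous_intros simp: infdist_nonneg)
    have [measurable]: "c k \<in> borel_measurable borel" for k by (rule borel_measurable_continuous_onI[OF c(1)])
    have [measurable]: "S \<in> sets borel" using that by simp
    have lim: "(\<lambda>k. D x * c k x) \<longlonglongrightarrow> indicator S x *\<^sub>R D x" for x
    proof (cases "x \<in> S")
      case True
      then have d: "infdist x (- S) > 0" using cl in_closed_iff_infdist_zero[OF cl, of x] infdist_nonneg[of x "- S"] by auto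
      obtain K where K: "1 / infdist x (- S) < real K" using reals_Archimedean2 by blast
      have "c k x = 1" if "k \<ge> K" for k
      proof -
        have "1 / infdist x (- S) \<le> real k" using K that by linarith
        then show ?thesis using d by (simp add: c_def field_simps)
      qed
      then have "\<forall>\<^sub>F k in sequentially. D x * c k x = indicator S x *\<^sub>R D x"
        using True by (auto simp: eventually_sequentially)
      then show ?thesis by (rule tendsto_eventually)
    next
      case False
      then have "infdist x (- S) = 0" by simp
      then show ?thesis using False by (simp add: c_def)
    qed
    have "(\<lambda>k. \<integral>x. D x * c k x \<partial>lborel) \<longlonglongrightarrow> (\<integral>x. indicator S x *\<^sub>R D x \<partial>lborel)"
      by (rule integral_dominated_convergence[of _ _ _ "\<lambda>x. norm (D x)"])
         (use D lim c(2) in \<open>auto simp: norm_mult intro!: AE_I2 mult_left_le\<close>)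
    moreover have "(\<integral>x. D x * c k x \<partial>lborel) = 0" for k by (rule zero[OF c])
    ultimately have "(\<lambda>k. 0) \<longlonglongrightarrow> (\<integral>x. indicator S x *\<^sub>R D x \<partial>lborel)" by (simp only:)
    then show ?thesis by (simp add: LIMSEQ_const_iff set_lebesgue_integral_def)
  qed (use total in \<open>simp add: set_lebesgue_integral_def\<close>)
  fix A assume "A \<in> sets (lborel :: 'a measure)"
  then have A: "A \<in> sigma_sets UNIV {S. open S}" by (simp add: borel_def)
  have "Int_stable {S :: 'a set. open S}" "{S :: 'a set. open S} \<subseteq> Pow UNIV" by (auto simp: Int_stable_def)
  from this A show "set_lebesgue_integral lborel A D = 0"
  proof (induction rule: sigma_sets_induct_disjoint)
    case (compl A)
    have "A \<in> sets borel" using compl(1) by (simp add: borel_def)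
    then have "set_lebesgue_integral lborel (A \<union> (UNIV - A)) D = set_lebesgue_integral lborel A D + set_lebesgue_integral lborel (UNIV - A) D"
      by (intro set_integral_Un si) auto
    then show ?case using compl total by (simp add: set_lebesgue_integral_def)
  next
    case (union A)
    have A: "A i \<in> sets borel" for i using union(2) by (auto simp: borel_def)
    have "set_lebesgue_integral lborel (\<Union>i. A i) D = (\<Sum>i. set_lebesgue_integral lborel (A i) D)"
      using A union(1) by (intro lebesgue_integral_countable_add si) (auto simp: disjoint_family_on_def)
    then show ?case using union by simp
  qed (use op in auto)
qed

context littlewood_paley
begin

text \<open>The difference \<open>d\<close> is made integrable by a Schwartz factor
  \<open>\<eta>\<close>. A bounded continuous function, weighted by \<open>wgt\<close>, is mollified
  with rescaled \<open>ift low\<close>. Fubini moves the mollifier next to \<open>\<eta>\<close>,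
  giving a Schwartz function on which \<open>d\<close> vanishes at every scale; dominated
  convergence then removes the mollifier.\<close>

lemma represents_unique:
  fixes g h :: "real^'n \<Rightarrow> complex"
  assumes g: "represents g T" and h: "represents h T"
  shows "AE x in lborel. g x = h x"
proof -
  define d where "d x = g x - h x" for x
  have [measurable]: "g \<in> borel_measurable borel" "h \<in> borel_measurable borel"
    using g h by (auto simp: represents_def)
  have [measurable]: "d \<in> borel_measurable borel" unfolding d_def by measurable
  have d_int: "integrable lborel (\<lambda>x. d x * \<psi> x)" and d_zero: "(\<integral>x. d x * \<psi> x \<partial>lborel) = 0" if "\<psi> \<in> schwartz" for \<psi>
    using g h that unfolding represents_def d_def left_diff_distrib by auto
  define k0 where "k0 = ift low"
  have k0: "k0 \<in> schwartz" unfolding k0_def by (rule schwartz_ift[OF low_schwartz])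
  have [measurable]: "k0 \<in> borel_measurable borel" by (rule schwartz_measurable[OF k0])
  obtain B where B: "B > 0" "\<And>x. norm (k0 x) \<le> B" using schwartz_bound[OF k0, of 0] by auto
  define \<epsilon> where "\<epsilon> k = 1 / real (Suc k)" for k
  have \<epsilon>: "\<epsilon> k > 0" for k by (simp add: \<epsilon>_def)
  have \<epsilon>0: "\<epsilon> \<longlonglongrightarrow> 0" unfolding \<epsilon>_def by (rule lim_1_over_n[THEN LIMSEQ_Suc])
  have main: "AE x in lborel. d x * \<eta> x * wgt x = 0" if \<eta>: "\<eta> \<in> schwartz" for \<eta>
  proof (rule integral_bounded_continuous_zero)
    have [measurable]: "\<eta> \<in> borel_measurable borel" by (rule schwartz_measurable[OF \<eta>])
    show "integrable lborel (\<lambda>x. d x * \<eta> x * wgt x)"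
      by (rule Bochner_Integration.integrable_bound[OF d_int[OF \<eta>]])
         (auto simp: norm_mult intro!: AE_I2 mult_left_le wgt_le_1)
    fix c :: "real^'n \<Rightarrow> complex" assume c: "continuous_on UNIV c" "\<And>x. norm (c x) \<le> 1"
    have [measurable]: "c \<in> borel_measurable borel" by (rule borel_measurable_continuous_onI[OF c(1)])
    \<comment> \<open>The weight makes the test function integrable, as Fubini requires in the
      variable \<open>x\<close>.\<close>
    define w where "w x = c x * wgt x" for x
    have w_cont: "continuous_on UNIV w" unfolding w_def wgt_def by (intro continuous_intros c) auto
    have w_le: "norm (w x) \<le> wgt x" for x using mult_right_mono[OF c(2)[of x], of "wgt x"] by (simp add: w_def norm_mult)
    have w_le1: "norm (w x) \<le> 1" for x using order_trans[OF w_le wgt_le_1] .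
    have [measurable]: "w \<in> borel_measurable borel" unfolding w_def by measurable
    have zero: "(\<integral>y. d y * \<eta> y * (\<integral>z. w (y + \<epsilon> k *\<^sub>R z) * k0 z \<partial>lborel) \<partial>lborel) = 0" for k
    proof -
      have ek: "\<epsilon> k \<noteq> 0" "\<bar>\<epsilon> k\<bar> = \<epsilon> k" using \<epsilon>[of k] by auto
      have "(\<integral>y. d y * \<eta> y * (\<integral>z. w (y + \<epsilon> k *\<^sub>R z) * k0 z \<partial>lborel) \<partial>lborel)
          = (\<integral>y. (1 / \<epsilon> k ^ CARD('n)) *\<^sub>R (\<integral>x. d y * \<eta> y * w x * k0 ((1 / \<epsilon> k) *\<^sub>R (x - y)) \<partial>lborel) \<partial>lborel)"
      proof (rule Bochner_Integration.integral_cong[OF refl])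
        fix y
        have "(\<integral>z. w (y + \<epsilon> k *\<^sub>R z) * k0 z \<partial>lborel) = (\<integral>z. w (y + \<epsilon> k *\<^sub>R z) * k0 ((1 / \<epsilon> k) *\<^sub>R ((y + \<epsilon> k *\<^sub>R z) - y)) \<partial>lborel)"
          using ek by simp
        also have "\<dots> = (1 / \<epsilon> k ^ CARD('n)) *\<^sub>R (\<integral>x. w x * k0 ((1 / \<epsilon> k) *\<^sub>R (x - y)) \<partial>lborel)"
          by (subst lborel_affine_integral_eq[OF ek(1), where t = y and f = "\<lambda>x. w x * k0 ((1 / \<epsilon> k) *\<^sub>R (x - y))"])
             (use ek in simp)
        finally show "d y * \<eta> y * (\<integral>z. w (y + \<epsilon> k *\<^sub>R z) * k0 z \<partial>lborel) =
            (1 / \<epsilon> k ^ CARD('n)) *\<^sub>R (\<integral>x. d y * \<eta> y * w x * k0 ((1 / \<epsilon> k) *\<^sub>R (x - y)) \<partial>lborel)"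
          by (simp add: mult.assoc)
      qed
      also have "\<dots> = (1 / \<epsilon> k ^ CARD('n)) *\<^sub>R (\<integral>y. (\<integral>x. d y * \<eta> y * w x * k0 ((1 / \<epsilon> k) *\<^sub>R (x - y)) \<partial>lborel) \<partial>lborel)"
        by simp
      also have "(\<integral>y. (\<integral>x. d y * \<eta> y * w x * k0 ((1 / \<epsilon> k) *\<^sub>R (x - y)) \<partial>lborel) \<partial>lborel) =
        (\<integral>x. (\<integral>y. d y * \<eta> y * w x * k0 ((1 / \<epsilon> k) *\<^sub>R (x - y)) \<partial>lborel) \<partial>lborel)"
      proof (rule integral_swap_bound)
        show "integrable lborel (\<lambda>y. norm (d y * \<eta> y))" using d_int[OF \<eta>] by (rule integrable_norm)
        show "integrable lborel (\<lambda>x::real^'n. wgt x * B)" by (intro integrable_mult_left wgt_integrable)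
        show "norm (d y * \<eta> y * w x * k0 ((1 / \<epsilon> k) *\<^sub>R (x - y))) \<le> norm (d y * \<eta> y) * (wgt x * B)" for x y
          unfolding norm_mult[of "d y * \<eta> y * w x"] norm_mult[of "d y * \<eta> y"] mult.assoc[of "norm (d y * \<eta> y)"]
          by (intro mult_left_mono mult_mono w_le B) auto
      qed measurable
      also have "\<dots> = (\<integral>x. w x * (\<integral>y. d y * (\<eta> y * k0 ((1 / \<epsilon> k) *\<^sub>R (x - y))) \<partial>lborel) \<partial>lborel)"
        by (subst integral_mult_right_zero[symmetric]) (simp add: mult_ac)
      also have "\<dots> = (\<integral>x. w x * 0 \<partial>(lborel :: (real^'n) measure))"
      proof (intro Bochner_Integration.integral_cong refl arg_cong2[where f = "(*)"] d_zero)
        fix x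
        have "(\<lambda>y. k0 ((- 1 / \<epsilon> k) *\<^sub>R y + (1 / \<epsilon> k) *\<^sub>R x)) \<in> schwartz"
          by (rule schwartz_scale[OF schwartz_shift[OF k0]]) (use ek in simp)
        then show "(\<lambda>y. \<eta> y * k0 ((1 / \<epsilon> k) *\<^sub>R (x - y))) \<in> schwartz"
          by (intro schwartz_mult \<eta>) (simp add: algebra_simps)
      qed
      finally show ?thesis by simp
    qed
    have inner: "(\<lambda>k. \<integral>z. w (y + \<epsilon> k *\<^sub>R z) * k0 z \<partial>lborel) \<longlonglongrightarrow> (\<integral>z. w y * k0 z \<partial>lborel)" for y
    proof (rule integral_dominated_convergence[of _ _ _ "\<lambda>z. norm (k0 z)"])
      show "AE z in lborel. (\<lambda>k. w (y + \<epsilon> k *\<^sub>R z) * k0 z) \<longlonglongrightarrow> w y * k0 z"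
      proof (rule AE_I2)
        fix z
        have "(\<lambda>k. y + \<epsilon> k *\<^sub>R z) \<longlonglongrightarrow> y + 0 *\<^sub>R z" by (intro tendsto_intros \<epsilon>0)
        then have "(\<lambda>k. w (y + \<epsilon> k *\<^sub>R z)) \<longlonglongrightarrow> w y"
          by (intro continuous_on_tendsto_compose[OF w_cont]) auto
        then show "(\<lambda>k. w (y + \<epsilon> k *\<^sub>R z) * k0 z) \<longlonglongrightarrow> w y * k0 z" by (intro tendsto_mult tendsto_const)
      qed
      show "AE z in lborel. norm (w (y + \<epsilon> k *\<^sub>R z) * k0 z) \<le> norm (k0 z)" for k
        using w_le1 by (auto simp: norm_mult intro!: AE_I2 mult_left_le_one_le)
    qed (use schwartz_integrable[OF k0] in auto)
    define J where "J = (\<integral>z. norm (k0 z) \<partial>lborel)"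
    have J: "norm (\<integral>z. w (y + \<epsilon> k *\<^sub>R z) * k0 z \<partial>lborel) \<le> J" for y k
      unfolding J_def
    proof (rule Bochner_Integration.integral_norm_bound_integral)
      show "integrable lborel (\<lambda>z. w (y + \<epsilon> k *\<^sub>R z) * k0 z)"
        by (rule Bochner_Integration.integrable_bound[OF schwartz_integrable[OF k0]])
           (use w_le1 in \<open>auto simp: norm_mult intro!: AE_I2 mult_left_le_one_le\<close>)
    qed (use w_le1 schwartz_integrable[OF k0] in \<open>auto simp: norm_mult intro!: mult_left_le_one_le\<close>)
    have "(\<lambda>k. \<integral>y. d y * \<eta> y * (\<integral>z. w (y + \<epsilon> k *\<^sub>R z) * k0 z \<partial>lborel) \<partial>lborel) \<longlonglongrightarrow> (\<integral>y. d y * \<eta> y * (\<integral>z. w y * k0 z \<partial>lborel) \<partial>lborel)"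
    proof (rule integral_dominated_convergence[of _ _ _ "\<lambda>y. norm (d y * \<eta> y) * J"])
      show "(\<lambda>y. d y * \<eta> y * (\<integral>z. w (y + \<epsilon> k *\<^sub>R z) * k0 z \<partial>lborel)) \<in> borel_measurable lborel" for k
        by measurable
      show "(\<lambda>y. d y * \<eta> y * (\<integral>z. w y * k0 z \<partial>lborel)) \<in> borel_measurable lborel" by measurable
      show "AE y in lborel. norm (d y * \<eta> y * (\<integral>z. w (y + \<epsilon> k *\<^sub>R z) * k0 z \<partial>lborel)) \<le> norm (d y * \<eta> y) * J" for k
        by (rule AE_I2) (simp only: norm_mult[of "d _ * \<eta> _"], intro mult_left_mono J norm_ge_zero)
      show "integrable lborel (\<lambda>y. norm (d y * \<eta> y) * J)" using d_int[OF \<eta>] by auto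
      show "AE y in lborel. (\<lambda>k. d y * \<eta> y * (\<integral>z. w (y + \<epsilon> k *\<^sub>R z) * k0 z \<partial>lborel)) \<longlonglongrightarrow> d y * \<eta> y * (\<integral>z. w y * k0 z \<partial>lborel)"
        by (rule AE_I2) (intro tendsto_mult tendsto_const inner)
    qed
    then have "(\<integral>y. d y * \<eta> y * (\<integral>z. w y * k0 z \<partial>lborel) \<partial>lborel) = 0"
      unfolding zero by (simp add: LIMSEQ_const_iff)
    moreover have "(\<integral>z. w y * k0 z \<partial>lborel) = w y" for y
      using ift_low_integral by (simp add: k0_def)
    ultimately have "(\<integral>y. d y * \<eta> y * w y \<partial>lborel) = 0" by (simp only:)
    then show "(\<integral>y. d y * \<eta> y * wgt y * c y \<partial>lborel) = 0" by (simp add: w_def mult_ac)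
  qed
  \<comment> \<open>The dilates of \<open>low\<close> equal one on balls exhausting the space, so
    countably many \<open>\<eta>\<close> suffice.\<close>
  have "AE x in lborel. \<forall>N. d x * low ((1 / real (Suc N)) *\<^sub>R x) * wgt x = 0"
    unfolding AE_all_countable by (intro allI main schwartz_scale low_schwartz) simp
  then show ?thesis
  proof eventually_elim
    case (elim x)
    obtain N where "norm x < real N" using reals_Archimedean2 by blast
    then have "norm ((1 / real (Suc N)) *\<^sub>R x) < 1" by simp
    then have "low ((1 / real (Suc N)) *\<^sub>R x) = 1" by (rule low_one)
    then show ?case using elim[rule_format, of N] by (simp add: d_def)
  qed
qed

end

section \<open>Lebesgue and weak Lebesgue bounds\<close>

text \<open>Young's inequality for \<open>b / t\<close>, with equality at \<open>b = t\<close>. The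
  bound is affine in \<open>b powr p\<close> and can be integrated termwise; optimising in
  \<open>t\<close> afterwards takes the place of the inequalities of Jensen, Minkowski and
  Hoelder.\<close>

lemma powr_tangent:
  fixes b t p :: real
  assumes "b \<ge> 0" "t > 0" "p \<ge> 1"
  shows "b \<le> (1/p) * t powr (1 - p) * b powr p + (1 - 1/p) * t"
proof (cases "b = 0")
  case False
  have "((b / t) powr p) powr (1/p) * 1 powr (1 - 1/p) \<le> (1/p) * (b / t) powr p + (1 - 1/p) * 1"
    by (rule Youngs_inequality_0) (use assms False in auto)
  then have "b / t \<le> (1/p) * (b / t) powr p + (1 - 1/p)"
    using assms False by (simp add: powr_powr)
  then have "t * (b / t) \<le> t * ((1/p) * (b / t) powr p + (1 - 1/p))"
    using assms(2) by (intro mult_left_mono) auto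
  moreover have "t * (b / t) powr p = t powr (1 - p) * b powr p"
    using assms by (simp add: powr_divide powr_diff)
  ultimately show ?thesis using assms(2) by (simp add: algebra_simps)
qed (use assms in simp)

text \<open>Optimising the tangent inequality in \<open>t\<close> yields Jensen's inequality for \<open>x powr p\<close>.\<close>

lemma powr_optimize:
  fixes c I \<alpha> p :: real
  assumes "c \<ge> 0" "I \<ge> 0" "\<alpha> > 0" "p \<ge> 1"
    and le: "\<And>t. t > 0 \<Longrightarrow> c \<le> (1/p) * t powr (1 - p) * I + (1 - 1/p) * t * \<alpha>"
  shows "c powr p \<le> \<alpha> powr (p - 1) * I"
proof (cases "I = 0")
  case True
  have "c \<le> 0 + e" if "e > 0" for e
  proof -
    \<comment> \<open>For \<open>I = 0\<close> the optimal \<open>t\<close> would be 0, so small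
      positive values are used instead.\<close>
    have "c \<le> (1 - 1/p) * (e / \<alpha>) * \<alpha>" using le[of "e / \<alpha>"] True that assms by simp
    also have "\<dots> \<le> 1 * e" using assms that by (simp add: mult_le_cancel_right)
    finally show ?thesis by simp
  qed
  then have "c \<le> 0" by (rule field_le_epsilon)
  then show ?thesis using assms True by simp
next
  case False
  then have I: "I > 0" using assms by simp
  \<comment> \<open>The minimiser: with it both terms of the bound become multiples of
    \<open>t * \<alpha>\<close>.\<close>
  define t where "t = (I / \<alpha>) powr (1/p)"
  have t: "t > 0" using I assms by (simp add: t_def)
  have tp: "t powr p = I / \<alpha>" using I assms by (simp add: t_def powr_powr)
  have "t powr (1 - p) * I = t * \<alpha>" using tp t assms I by (simp add: powr_diff)
  then have "c \<le> (1/p) * (t * \<alpha>) + (1 - 1/p) * t * \<alpha>" using le[OF t] by (simp add: mult.assoc)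
  also have "\<dots> = t * \<alpha>" by (simp add: algebra_simps)
  finally have "c powr p \<le> (t * \<alpha>) powr p" using assms by (intro powr_mono2) auto
  also have "\<dots> = \<alpha> powr (p - 1) * I" using t assms by (simp add: powr_mult tp powr_diff)
  finally show ?thesis .
qed

text \<open>Norm bounds are kept as predicates on an upper bound \<open>A\<close>, stated for the
  \<open>p\<close>-th power of the norm. The nonnegative integral carries finiteness and the
  estimate together, and monotone convergence applies to it directly.\<close>

definition Lpb :: "real \<Rightarrow> real \<Rightarrow> ('a::euclidean_space \<Rightarrow> 'b::{real_normed_vector, second_countable_topology}) \<Rightarrow> bool" where
  "Lpb p A g \<longleftrightarrow> g \<in> borel_measurable borel \<and> (\<integral>\<^sup>+x. ennreal (norm (g x) powr p) \<partial>lborel) \<le> ennreal (A powr p)"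

lemma Lpb_measurable: "Lpb p A g \<Longrightarrow> g \<in> borel_measurable borel"
  by (simp add: Lpb_def)

lemma Lpb_mono: "Lpb p A g \<Longrightarrow> A \<le> B \<Longrightarrow> 0 \<le> A \<Longrightarrow> 0 \<le> p \<Longrightarrow> Lpb p B g"
  unfolding Lpb_def by (auto elim!: order_trans intro!: ennreal_leI powr_mono2)

lemma Lpb_le_AE:
  assumes "Lpb p A g" "AE x in lborel. norm (h x) \<le> norm (g x)" "h \<in> borel_measurable borel" "0 \<le> p"
  shows "Lpb p A h"
proof -
  have "(\<integral>\<^sup>+x. ennreal (norm (h x) powr p) \<partial>lborel) \<le> (\<integral>\<^sup>+x. ennreal (norm (g x) powr p) \<partial>lborel)"
    using assms(2) by (intro nn_integral_mono_AE) (auto elim!: eventually_mono intro!: ennreal_leI powr_mono2 assms)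
  then show ?thesis using assms unfolding Lpb_def by auto
qed

lemma Lpb_cong_AE:
  assumes "Lpb p A g" "AE x in lborel. h x = g x" "h \<in> borel_measurable borel" "0 \<le> p"
  shows "Lpb p A h"
  by (rule Lpb_le_AE[OF assms(1)]) (use assms in \<open>auto elim: eventually_mono\<close>)

lemma Lpb_integrable: 
  assumes "Lpb p A g" shows "integrable lborel (\<lambda>x. norm (g x) powr p)" and "(\<integral>x. norm (g x) powr p \<partial>lborel) \<le> A powr p"
proof -
  have [measurable]: "g \<in> borel_measurable borel" using assms by (simp add: Lpb_def)
  show I: "integrable lborel (\<lambda>x. norm (g x) powr p)"
    using assms le_less_trans[OF _ ennreal_less_top] by (auto simp: integrable_iff_bounded Lpb_def)
  have "ennreal (\<integral>x. norm (g x) powr p \<partial>lborel) \<le> ennreal (A powr p)"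
    using assms by (subst nn_integral_eq_integral[OF I, symmetric]) (auto simp: Lpb_def)
  then show "(\<integral>x. norm (g x) powr p \<partial>lborel) \<le> A powr p" by simp
qed

lemma Lpb_iff_integral:
  "Lpb p A g \<longleftrightarrow> g \<in> borel_measurable borel \<and> integrable lborel (\<lambda>x. norm (g x) powr p) \<and>
     (\<integral>x. norm (g x) powr p \<partial>lborel) \<le> A powr p"
proof (intro iffI conjI)
  assume R: "g \<in> borel_measurable borel \<and> integrable lborel (\<lambda>x. norm (g x) powr p) \<and>
     (\<integral>x. norm (g x) powr p \<partial>lborel) \<le> A powr p"
  then have "(\<integral>\<^sup>+x. ennreal (norm (g x) powr p) \<partial>lborel) = ennreal (\<integral>x. norm (g x) powr p \<partial>lborel)"
    by (intro nn_integral_eq_integral) auto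
  with R show "Lpb p A g" by (simp add: Lpb_def ennreal_leI)
qed (rule Lpb_measurable Lpb_integrable, assumption)+

lemma Lpb_moderate: "Lpb p A g \<Longrightarrow> p \<ge> 1 \<Longrightarrow> moderate g"
  using Lpb_integrable(1) Lpb_measurable moderate_powr by blast

text \<open>Bounds survive decreasing limits of the constant. This admits the constant 0 in
  arguments that divide by it, and it absorbs arbitrarily small errors.\<close>

lemma Lpb_closed:
  assumes "A \<ge> 0" "p > 0" and le: "\<And>e. e > 0 \<Longrightarrow> Lpb p (A + e) g" shows "Lpb p A g"
proof -
  have "((\<lambda>e. (A + e) powr p) \<longlongrightarrow> (A + 0) powr p) (at_right 0)"
    using assms by (intro tendsto_powr' tendsto_intros) (auto intro: eventually_mono[OF eventually_at_right_less])
  then have "((\<lambda>e. ennreal ((A + e) powr p)) \<longlongrightarrow> ennreal (A powr p)) (at_right 0)"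
    by (intro tendsto_ennrealI) simp
  moreover have "\<forall>\<^sub>F e in at_right 0. (\<integral>\<^sup>+x. ennreal (norm (g x) powr p) \<partial>lborel) \<le> ennreal ((A + e) powr p)"
    using le by (auto simp: Lpb_def eventually_at_right_field intro!: exI[of _ 1])
  ultimately have "(\<integral>\<^sup>+x. ennreal (norm (g x) powr p) \<partial>lborel) \<le> ennreal (A powr p)"
    by (rule tendsto_lowerbound) simp
  then show ?thesis using le[of 1] by (simp add: Lpb_def)
qed

lemma Lpb_cmult:
  fixes g :: "'a::euclidean_space \<Rightarrow> complex"
  assumes "Lpb p A g" "A \<ge> 0" shows "Lpb p (norm c * A) (\<lambda>x. c * g x)"
proof -
  have [measurable]: "g \<in> borel_measurable borel" using assms by (simp add: Lpb_def)
  have "(\<integral>\<^sup>+x. ennreal (norm (c * g x) powr p) \<partial>lborel) = ennreal (norm c powr p) * (\<integral>\<^sup>+x. ennreal (norm (g x) powr p) \<partial>lborel)"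
    by (simp add: norm_mult powr_mult ennreal_mult nn_integral_cmult)
  also have "\<dots> \<le> ennreal (norm c powr p) * ennreal (A powr p)"
    using assms by (intro mult_left_mono) (auto simp: Lpb_def)
  finally show ?thesis using assms by (simp add: Lpb_def powr_mult ennreal_mult)
qed

text \<open>Minkowski's inequality. The tangent bound is applied to \<open>f\<close> at
  \<open>t * A\<close> and to \<open>g\<close> at \<open>t * B\<close>; optimising in
  \<open>t\<close> gives a pointwise convexity estimate whose integral is at most
  \<open>(A + B) powr p\<close>.\<close>

lemma Lpb_add_pos:
  fixes f g :: "'a::euclidean_space \<Rightarrow> 'b::{real_normed_vector, second_countable_topology}"
  assumes f: "Lpb p A f" and g: "Lpb p B g" and AB: "A > 0" "B > 0" "p \<ge> 1"
  shows "Lpb p (A + B) (\<lambda>x. f x + g x)"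
proof -
  have [measurable]: "f \<in> borel_measurable borel" "g \<in> borel_measurable borel" using f g by (auto simp: Lpb_def)
  have pw: "norm (f x + g x) powr p \<le> (A + B) powr (p - 1) * (A powr (1 - p) * norm (f x) powr p + B powr (1 - p) * norm (g x) powr p)" for x
  proof (rule powr_optimize)
    fix t :: real assume t: "t > 0"
    have "norm (f x + g x) \<le> norm (f x) + norm (g x)" by (rule norm_triangle_ineq)
    also have "\<dots> \<le> ((1/p) * (t * A) powr (1 - p) * norm (f x) powr p + (1 - 1/p) * (t * A)) +
       ((1/p) * (t * B) powr (1 - p) * norm (g x) powr p + (1 - 1/p) * (t * B))"
      by (intro add_mono powr_tangent) (use t AB in auto)
    also have "\<dots> = (1/p) * t powr (1 - p) * (A powr (1 - p) * norm (f x) powr p + B powr (1 - p) * norm (g x) powr p) + (1 - 1/p) * t * (A + B)"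
      using t AB by (simp add: powr_mult algebra_simps add_divide_distrib)
    finally show "norm (f x + g x) \<le> \<dots>" .
  qed (use AB in auto)
  have "(\<integral>\<^sup>+x. ennreal (norm (f x + g x) powr p) \<partial>lborel) \<le>
      (\<integral>\<^sup>+x. ennreal ((A + B) powr (p - 1)) * (ennreal (A powr (1 - p)) * ennreal (norm (f x) powr p) + ennreal (B powr (1 - p)) * ennreal (norm (g x) powr p)) \<partial>lborel)"
    by (intro nn_integral_mono) (use pw in \<open>simp add: ennreal_mult[symmetric] ennreal_plus[symmetric] del: ennreal_plus\<close>)
  also have "\<dots> = ennreal ((A + B) powr (p - 1)) * (ennreal (A powr (1 - p)) * (\<integral>\<^sup>+x. ennreal (norm (f x) powr p) \<partial>lborel)
      + ennreal (B powr (1 - p)) * (\<integral>\<^sup>+x. ennreal (norm (g x) powr p) \<partial>lborel))"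
    by (simp add: nn_integral_cmult nn_integral_add)
  also have "\<dots> \<le> ennreal ((A + B) powr (p - 1)) * (ennreal (A powr (1 - p)) * ennreal (A powr p) + ennreal (B powr (1 - p)) * ennreal (B powr p))"
    using f g by (intro mult_left_mono add_mono) (auto simp: Lpb_def)
  also have "\<dots> = ennreal ((A + B) powr (p - 1) * (A powr (1 - p) * A powr p + B powr (1 - p) * B powr p))"
    by (simp add: ennreal_mult[symmetric] ennreal_plus[symmetric] del: ennreal_plus)
  also have "(A + B) powr (p - 1) * (A powr (1 - p) * A powr p + B powr (1 - p) * B powr p) = (A + B) powr p"
    using AB by (simp add: powr_add[symmetric] powr_diff)
  finally show ?thesis by (simp add: Lpb_def)
qed

lemma Lpb_add:
  fixes f g :: "'a::euclidean_space \<Rightarrow> 'b::{real_normed_vector, second_countable_topology}"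
  assumes f: "Lpb p A f" and g: "Lpb p B g" and AB: "A \<ge> 0" "B \<ge> 0" "p \<ge> 1"
  shows "Lpb p (A + B) (\<lambda>x. f x + g x)"
proof (rule Lpb_closed)
  fix e :: real assume e: "e > 0"
  have "Lpb p ((A + e/2) + (B + e/2)) (\<lambda>x. f x + g x)"
    using e AB by (intro Lpb_add_pos Lpb_mono[OF f] Lpb_mono[OF g]) auto
  then show "Lpb p (A + B + e) (\<lambda>x. f x + g x)" by (simp add: algebra_simps)
qed (use AB in auto)

lemma Lpb_zero: "Lpb p A (\<lambda>x. 0)"
  by (simp add: Lpb_def)

lemma Lpb_sum:
  fixes f :: "'i \<Rightarrow> 'a::euclidean_space \<Rightarrow> 'b::{real_normed_vector, second_countable_topology}"
  assumes "\<And>i. i \<in> I \<Longrightarrow> Lpb p (A i) (f i)" "\<And>i. i \<in> I \<Longrightarrow> A i \<ge> 0" "p \<ge> 1"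
  shows "Lpb p (\<Sum>i\<in>I. A i) (\<lambda>x. \<Sum>i\<in>I. f i x)"
  using assms by (induction I rule: infinite_finite_induct) (auto intro!: Lpb_add Lpb_zero sum_nonneg)

text \<open>The partial sums of the norms increase and have uniformly bounded \<open>p\<close>-th
  power integrals, so monotone convergence bounds the integral of the supremum \<open>h\<close>. Its
  finiteness almost everywhere yields summability, and \<open>h\<close> dominates the
  \<open>p\<close>-th power of the sum.\<close>

lemma Lpb_suminf:
  fixes f :: "nat \<Rightarrow> 'a::euclidean_space \<Rightarrow> complex"
  assumes f: "\<And>i. Lpb p (A i) (f i)" and A: "\<And>i. A i \<ge> 0" "summable A" and p: "p \<ge> 1"
  shows "AE x in lborel. summable (\<lambda>i. norm (f i x))" and "Lpb p (\<Sum>i. A i) (\<lambda>x. \<Sum>i. norm (f i x))"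
    and "Lpb p (\<Sum>i. A i) (\<lambda>x. \<Sum>i. f i x)"
proof -
  have [measurable]: "f i \<in> borel_measurable borel" for i using f by (auto simp: Lpb_def)
  define S where "S = (\<Sum>i. A i)"
  define s where "s N x = (\<Sum>i<N. norm (f i x))" for N x
  have s0: "s N x \<ge> 0" for N x by (simp add: s_def sum_nonneg)
  have s_mono: "s N x \<le> s M x" if "N \<le> M" for N M x unfolding s_def by (rule sum_mono2) (use that in auto)
  have [measurable]: "s N \<in> borel_measurable borel" for N unfolding s_def by measurable
  have sN: "(\<integral>\<^sup>+x. ennreal (s N x powr p) \<partial>lborel) \<le> ennreal (S powr p)" for N
  proof -
    have "Lpb p (A i) (\<lambda>x. norm (f i x))" for i using f by (simp add: Lpb_def)
    then have "Lpb p (\<Sum>i<N. A i) (s N)" unfolding s_def by (intro Lpb_sum A p)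
    then have "Lpb p S (s N)"
      by (rule Lpb_mono) (use A p in \<open>auto simp: S_def intro!: sum_le_suminf sum_nonneg\<close>)
    then show ?thesis using s0 by (simp add: Lpb_def)
  qed
  define h where "h x = (SUP N. ennreal (s N x powr p))" for x
  have "(\<integral>\<^sup>+x. h x \<partial>lborel) = (SUP N. \<integral>\<^sup>+x. ennreal (s N x powr p) \<partial>lborel)"
    unfolding h_def
    by (rule nn_integral_monotone_convergence_SUP)
       (use s0 s_mono p in \<open>auto simp: incseq_def le_fun_def intro!: ennreal_leI powr_mono2\<close>)
  then have h: "(\<integral>\<^sup>+x. h x \<partial>lborel) \<le> ennreal (S powr p)" using sN by (auto intro: SUP_least)
  have [measurable]: "h \<in> borel_measurable borel" unfolding h_def by measurable
  have "AE x in lborel. h x \<noteq> \<infinity>"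
    by (rule nn_integral_noteq_infinite) (use h ennreal_less_top neq_top_trans in \<open>auto simp: top_unique\<close>)
  then show sm: "AE x in lborel. summable (\<lambda>i. norm (f i x))"
  proof eventually_elim
    case (elim x)
    then obtain r where r: "h x = ennreal r" "r \<ge> 0" by (cases "h x") auto
    have "s N x \<le> r powr (1/p)" for N
    proof -
      have "ennreal (s N x powr p) \<le> ennreal r" using r(1) unfolding h_def by (metis SUP_upper UNIV_I)
      then have "s N x powr p \<le> r" using r by simp
      then have "(s N x powr p) powr (1/p) \<le> r powr (1/p)" using p by (intro powr_mono2) auto
      then show ?thesis using s0[of N x] p by (simp add: powr_powr)
    qed
    then show ?case unfolding s_def by (intro bounded_imp_summable[where B = "r powr (1/p)"])
       (auto simp: lessThan_Suc_atMost[symmetric] simp del: lessThan_Suc_atMost sum.lessThan_Suc)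
  qed
  have "AE x in lborel. ennreal (norm (\<Sum>i. norm (f i x)) powr p) \<le> h x"
    using sm
  proof eventually_elim
    case (elim x)
    have "(\<lambda>N. s N x) \<longlonglongrightarrow> (\<Sum>i. norm (f i x))" using summable_LIMSEQ[OF elim] by (simp add: s_def)
    moreover have "(\<Sum>i. norm (f i x)) \<ge> 0" using elim by (intro suminf_nonneg) auto
    ultimately have "(\<lambda>N. ennreal (s N x powr p)) \<longlonglongrightarrow> ennreal (norm (\<Sum>i. norm (f i x)) powr p)"
      using p s0 by (intro tendsto_ennrealI tendsto_powr' tendsto_const) auto
    then show ?case by (rule LIMSEQ_le_const2) (auto simp: h_def intro!: SUP_upper)
  qed
  then have "(\<integral>\<^sup>+x. ennreal (norm (\<Sum>i. norm (f i x)) powr p) \<partial>lborel) \<le> (\<integral>\<^sup>+x. h x \<partial>lborel)"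
    by (rule nn_integral_mono_AE)
  with h show L: "Lpb p (\<Sum>i. A i) (\<lambda>x. \<Sum>i. norm (f i x))" by (auto simp: Lpb_def S_def)
  show "Lpb p (\<Sum>i. A i) (\<lambda>x. \<Sum>i. f i x)"
  proof (rule Lpb_le_AE[OF L])
    show "AE x in lborel. norm (\<Sum>i. f i x) \<le> norm (\<Sum>i. norm (f i x))"
      using sm by eventually_elim (auto intro!: order_trans[OF summable_norm] abs_ge_self)
  qed (use p in auto)
qed

lemma Lpb_chebyshev:
  assumes "Lpb p A g" "t > 0" "p > 0" "A \<ge> 0"
  shows "emeasure lborel {x. norm (g x) > t} \<le> ennreal ((A / t) powr p)"
proof -
  have [measurable]: "g \<in> borel_measurable borel" using assms by (simp add: Lpb_def)
  have "emeasure lborel {x. norm (g x) > t} = (\<integral>\<^sup>+x. indicator {x. norm (g x) > t} x \<partial>lborel)"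
    by (subst nn_integral_indicator) auto
  also have "\<dots> \<le> (\<integral>\<^sup>+x. ennreal (t powr (- p)) * ennreal (norm (g x) powr p) \<partial>lborel)"
  proof (rule nn_integral_mono)
    fix x
    have "1 \<le> t powr (- p) * norm (g x) powr p" if "norm (g x) > t"
    proof -
      have "t powr (- p) * t powr p \<le> t powr (- p) * norm (g x) powr p"
        using assms that by (intro mult_left_mono powr_mono2) auto
      then show ?thesis using assms by (simp add: powr_add[symmetric])
    qed
    then show "indicator {x. norm (g x) > t} x \<le> ennreal (t powr (- p)) * ennreal (norm (g x) powr p)"
      by (auto simp: indicator_def ennreal_mult[symmetric] ennreal_1[symmetric] simp del: ennreal_1 intro!: ennreal_leI)
  qed
  also have "\<dots> \<le> ennreal (t powr (- p)) * ennreal (A powr p)"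
    using assms by (subst nn_integral_cmult) (auto simp: Lpb_def intro!: mult_left_mono)
  also have "\<dots> = ennreal ((A / t) powr p)"
    using assms by (simp add: ennreal_mult[symmetric] powr_divide powr_minus_divide)
  finally show ?thesis .
qed

text \<open>Both cases of Young's inequality, \<open>L\<^sup>1 * L\<^sup>p\<close> and \<open>L\<^sup>p * L\<^sup>1\<close>, are instances.\<close>

lemma Lpb_kernel:
  fixes w b :: "'a::euclidean_space \<Rightarrow> 'a \<Rightarrow> real" and F :: "'a \<Rightarrow> complex"
  assumes [measurable]: "(\<lambda>(y, x). w y x) \<in> borel_measurable (borel \<Otimes>\<^sub>M borel)"
     "(\<lambda>(y, x). b y x) \<in> borel_measurable (borel \<Otimes>\<^sub>M borel)" "F \<in> borel_measurable borel"
    and pos: "\<And>y x. w y x \<ge> 0" "\<And>y x. b y x \<ge> 0"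
    and F: "\<And>y. norm (F y) \<le> (\<integral>x. w y x * b y x \<partial>lborel)" 
    and int: "\<And>y. integrable lborel (\<lambda>x. w y x * b y x)" "\<And>y. integrable lborel (w y)"
    and \<alpha>: "\<And>y. (\<integral>x. w y x \<partial>lborel) \<le> \<alpha>" "\<alpha> > 0" and p: "p \<ge> 1" and B: "B \<ge> 0"
    and bnd: "(\<integral>\<^sup>+y. (\<integral>\<^sup>+x. ennreal (w y x * b y x powr p) \<partial>lborel) \<partial>lborel) \<le> ennreal (\<alpha> * B powr p)"
  shows "Lpb p (\<alpha> * B) F"
proof -
  have pw: "ennreal (norm (F y) powr p) \<le> ennreal (\<alpha> powr (p - 1)) * (\<integral>\<^sup>+x. ennreal (w y x * b y x powr p) \<partial>lborel)" for y
  proof (cases "(\<integral>\<^sup>+x. ennreal (w y x * b y x powr p) \<partial>lborel) = \<infinity>")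
    case True then show ?thesis using \<alpha>(2) by (simp add: ennreal_mult_top)
  next
    case False
    have ib: "integrable lborel (\<lambda>x. w y x * b y x powr p)"
      by (rule integrableI_nonneg) (use False pos in \<open>auto simp: less_top\<close>)
    \<comment> \<open>Jensen's inequality for the measure with density \<open>w y\<close>, of mass
      at most \<open>\<alpha>\<close>: the tangent bound is integrated against \<open>w y\<close>
      and then optimised.\<close>
    have "norm (F y) powr p \<le> \<alpha> powr (p - 1) * (\<integral>x. w y x * b y x powr p \<partial>lborel)"
    proof (rule powr_optimize)
      fix t :: real assume t: "t > 0"
      have "norm (F y) \<le> (\<integral>x. w y x * b y x \<partial>lborel)" by (rule F)
      also have "\<dots> \<le> (\<integral>x. (1/p) * t powr (1 - p) * (w y x * b y x powr p) + (1 - 1/p) * t * w y x \<partial>lborel)"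
      proof (rule integral_mono)
        fix x
        have "w y x * b y x \<le> w y x * ((1/p) * t powr (1 - p) * b y x powr p + (1 - 1/p) * t)"
          by (intro mult_left_mono powr_tangent pos t p)
        then show "w y x * b y x \<le> (1/p) * t powr (1 - p) * (w y x * b y x powr p) + (1 - 1/p) * t * w y x"
          by (simp add: algebra_simps)
      qed (use int ib in auto)
      also have "\<dots> = (1/p) * t powr (1 - p) * (\<integral>x. w y x * b y x powr p \<partial>lborel) + (1 - 1/p) * t * (\<integral>x. w y x \<partial>lborel)"
        using int ib by simp
      also have "\<dots> \<le> (1/p) * t powr (1 - p) * (\<integral>x. w y x * b y x powr p \<partial>lborel) + (1 - 1/p) * t * \<alpha>"
        using t p by (intro add_left_mono mult_left_mono \<alpha>(1)) auto
      finally show "norm (F y) \<le> \<dots>" .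
    qed (use \<alpha> p pos in \<open>auto intro!: integral_nonneg_AE\<close>)
    then have "ennreal (norm (F y) powr p) \<le> ennreal (\<alpha> powr (p - 1) * (\<integral>x. w y x * b y x powr p \<partial>lborel))"
      by (rule ennreal_leI)
    also have "\<dots> = ennreal (\<alpha> powr (p - 1)) * (\<integral>\<^sup>+x. ennreal (w y x * b y x powr p) \<partial>lborel)"
      using ib pos by (subst nn_integral_eq_integral) (auto simp: ennreal_mult intro!: integral_nonneg_AE)
    finally show ?thesis .
  qed
  have "(\<integral>\<^sup>+y. ennreal (norm (F y) powr p) \<partial>lborel) \<le> (\<integral>\<^sup>+y. ennreal (\<alpha> powr (p - 1)) * (\<integral>\<^sup>+x. ennreal (w y x * b y x powr p) \<partial>lborel) \<partial>lborel)"
    by (intro nn_integral_mono pw)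
  also have "\<dots> = ennreal (\<alpha> powr (p - 1)) * (\<integral>\<^sup>+y. (\<integral>\<^sup>+x. ennreal (w y x * b y x powr p) \<partial>lborel) \<partial>lborel)"
    by (rule nn_integral_cmult) measurable
  also have "\<dots> \<le> ennreal (\<alpha> powr (p - 1)) * ennreal (\<alpha> * B powr p)"
    by (intro mult_left_mono bnd) auto
  also have "\<dots> = ennreal ((\<alpha> * B) powr p)"
    using \<alpha>(2) B by (simp add: ennreal_mult[symmetric] powr_mult powr_diff)
  finally show ?thesis by (simp add: Lpb_def)
qed

section \<open>Convolution bounds in Lebesgue spaces\<close>

lemma norm_cnv_le: "norm (cnv K g y) \<le> (\<integral>x. norm (K (y - x)) * norm (g x) \<partial>lborel)"
  unfolding cnv_def norm_mult[symmetric] by (rule integral_norm_bound)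

lemma nn_integral_minus:
  fixes f :: "'a::euclidean_space \<Rightarrow> ennreal"
  assumes "f \<in> borel_measurable borel"
  shows "(\<integral>\<^sup>+x. f (y - x) \<partial>lborel) = (\<integral>\<^sup>+x. f x \<partial>lborel)" "(\<integral>\<^sup>+x. f (x - y) \<partial>lborel) = (\<integral>\<^sup>+x. f x \<partial>lborel)"
  using lborel_affine_nn_integral[of "-1" f y] lborel_affine_nn_integral[of "1" f "- y"] assms by auto

lemma integral_minus:
  fixes f :: "'a::euclidean_space \<Rightarrow> 'b::{banach, second_countable_topology}"
  shows "integrable lborel (\<lambda>x. f (y - x)) \<longleftrightarrow> integrable lborel f" "(\<integral>x. f (y - x) \<partial>lborel) = (\<integral>x. f x \<partial>lborel)"
  using lborel_affine_integrable_iff[of "-1" f y] lborel_affine_integral_eq[of "-1" f y] by auto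

lemma Lpb_cnv_L1:
  fixes K g :: "real^'n::finite \<Rightarrow> complex"
  assumes K: "K \<in> schwartz" "(\<integral>x. norm (K x) \<partial>lborel) \<le> \<alpha>" "\<alpha> > 0" and g: "Lpb p B g" "p \<ge> 1" "B \<ge> 0"
  shows "Lpb p (\<alpha> * B) (cnv K g)"
proof (rule Lpb_kernel[where w = "\<lambda>y x. norm (K (y - x))" and b = "\<lambda>y x. norm (g x)"])
  have [measurable]: "K \<in> borel_measurable borel" "g \<in> borel_measurable borel"
    using schwartz_measurable K Lpb_measurable g by auto
  show "(\<lambda>(y, x). norm (K (y - x))) \<in> borel_measurable (borel \<Otimes>\<^sub>M borel)" by measurable
  show "(\<lambda>(y, x). norm (g x)) \<in> borel_measurable (borel \<Otimes>\<^sub>M borel)" by measurable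
  show "cnv K g \<in> borel_measurable borel" by (intro cnv_measurable) auto
  show "integrable lborel (\<lambda>x. norm (K (y - x)) * norm (g x))" for y
    using integrable_norm[OF cnv_integrable[OF K(1) Lpb_moderate[OF g(1,2)]]] by (simp add: norm_mult)
  show "integrable lborel (\<lambda>x. norm (K (y - x)))" for y
    using integral_minus(1)[of "\<lambda>x. norm (K x)"] schwartz_integrable[OF K(1)] by auto
  show "(\<integral>x. norm (K (y - x)) \<partial>lborel) \<le> \<alpha>" for y using K(2) integral_minus(2)[of "\<lambda>x. norm (K x)"] by simp
  have nK: "(\<integral>\<^sup>+x. ennreal (norm (K x)) \<partial>lborel) \<le> ennreal \<alpha>"
    using ennreal_leI[OF K(2)] by (subst nn_integral_eq_integral) (use schwartz_integrable[OF K(1)] in auto)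
  have "(\<integral>\<^sup>+y. (\<integral>\<^sup>+x. ennreal (norm (K (y - x)) * norm (g x) powr p) \<partial>lborel) \<partial>lborel) =
     (\<integral>\<^sup>+x. (\<integral>\<^sup>+y. ennreal (norm (g x) powr p) * ennreal (norm (K (y - x))) \<partial>lborel) \<partial>lborel)"
    by (subst lborel_pair.Fubini') (auto simp: ennreal_mult[symmetric] mult.commute)
  also have "\<dots> = (\<integral>\<^sup>+x. ennreal (norm (g x) powr p) * (\<integral>\<^sup>+y. ennreal (norm (K y)) \<partial>lborel) \<partial>lborel)"
    by (subst nn_integral_cmult) (auto simp: nn_integral_minus(2)[of "\<lambda>x. ennreal (norm (K x))"])
  also have "\<dots> = (\<integral>\<^sup>+x. ennreal (norm (g x) powr p) \<partial>lborel) * (\<integral>\<^sup>+y. ennreal (norm (K y)) \<partial>lborel)"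
    by (rule nn_integral_multc) auto
  also have "\<dots> \<le> ennreal (B powr p) * ennreal \<alpha>" using g nK by (intro mult_mono) (auto simp: Lpb_def)
  finally show "(\<integral>\<^sup>+y. (\<integral>\<^sup>+x. ennreal (norm (K (y - x)) * norm (g x) powr p) \<partial>lborel) \<partial>lborel) \<le> ennreal (\<alpha> * B powr p)"
    using K(3) by (simp add: ennreal_mult[symmetric] mult.commute)
qed (use K g in \<open>auto intro: norm_cnv_le\<close>)

text \<open>Here the integrable \<open>g\<close> supplies the weight of \<open>Lpb_kernel\<close>;
  in \<open>Lpb_cnv_L1\<close> it is the translated kernel.\<close>

lemma Lpb_cnv_Lp:
  fixes K g :: "real^'n::finite \<Rightarrow> complex"
  assumes K: "K \<in> schwartz" "Lpb p B K" and g: "Lpb 1 \<alpha> g" "\<alpha> > 0" "p \<ge> 1" "B \<ge> 0"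
  shows "Lpb p (\<alpha> * B) (cnv K g)"
proof (rule Lpb_kernel[where w = "\<lambda>y x. norm (g x)" and b = "\<lambda>y x. norm (K (y - x))"])
  have [measurable]: "K \<in> borel_measurable borel" "g \<in> borel_measurable borel"
    using schwartz_measurable K Lpb_measurable g by auto
  show "(\<lambda>(y, x). norm (K (y - x))) \<in> borel_measurable (borel \<Otimes>\<^sub>M borel)" by measurable
  show "(\<lambda>(y, x). norm (g x)) \<in> borel_measurable (borel \<Otimes>\<^sub>M borel)" by measurable
  show "cnv K g \<in> borel_measurable borel" by (intro cnv_measurable) auto
  show "integrable lborel (\<lambda>x. norm (g x) * norm (K (y - x)))" for y
    using integrable_norm[OF cnv_integrable[OF K(1) Lpb_moderate[OF g(1)]]] by (simp add: norm_mult mult.commute)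
  show "integrable lborel (\<lambda>x. norm (g x))" "(\<integral>x. norm (g x) \<partial>lborel) \<le> \<alpha>"
    using Lpb_integrable[OF g(1)] g(2) by (auto simp: abs_of_pos)
  have "(\<integral>\<^sup>+y. (\<integral>\<^sup>+x. ennreal (norm (g x) * norm (K (y - x)) powr p) \<partial>lborel) \<partial>lborel) =
     (\<integral>\<^sup>+x. (\<integral>\<^sup>+y. ennreal (norm (g x)) * ennreal (norm (K (y - x)) powr p) \<partial>lborel) \<partial>lborel)"
    by (subst lborel_pair.Fubini') (auto simp: ennreal_mult[symmetric])
  also have "\<dots> = (\<integral>\<^sup>+x. ennreal (norm (g x)) * (\<integral>\<^sup>+y. ennreal (norm (K y) powr p) \<partial>lborel) \<partial>lborel)"
    by (subst nn_integral_cmult) (auto simp: nn_integral_minus(2)[of "\<lambda>x. ennreal (norm (K x) powr p)"])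
  also have "\<dots> = (\<integral>\<^sup>+x. ennreal (norm (g x)) \<partial>lborel) * (\<integral>\<^sup>+y. ennreal (norm (K y) powr p) \<partial>lborel)"
    by (rule nn_integral_multc) auto
  also have "\<dots> \<le> ennreal \<alpha> * ennreal (B powr p)" using g K by (intro mult_mono) (auto simp: Lpb_def)
  finally show "(\<integral>\<^sup>+y. (\<integral>\<^sup>+x. ennreal (norm (g x) * norm (K (y - x)) powr p) \<partial>lborel) \<partial>lborel) \<le> ennreal (\<alpha> * B powr p)"
    using g(2) by (simp add: ennreal_mult[symmetric])
qed (use K g norm_cnv_le[of K g] in \<open>auto simp: mult.commute\<close>)

text \<open>In place of Hoelder's inequality, values of \<open>g\<close> are bounded through
  \<open>a \<le> t + t powr (1 - p) * a powr p\<close>. The height \<open>t\<close> stays free, so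
  that each use can balance the two terms in its own way.\<close>

lemma cnv_sup_bound:
  fixes K g :: "real^'n::finite \<Rightarrow> complex"
  assumes K: "K \<in> schwartz" "\<And>x. norm (K x) \<le> M" and g: "Lpb p B g" "p \<ge> 1" and t: "t > 0"
  shows "norm (cnv K g y) \<le> t * (\<integral>x. norm (K x) \<partial>lborel) + t powr (1 - p) * M * B powr p"
proof -
  have M: "M \<ge> 0" using K(2)[of 0] norm_ge_zero order_trans by blast
  have le: "a \<le> t + t powr (1 - p) * a powr p" if "a \<ge> 0" for a
  proof (cases "a \<le> t")
    case False
    then have "(a / t) powr 1 \<le> (a / t) powr p" using t g by (intro powr_mono) auto
    then have "t * (a / t) \<le> t * (a / t) powr p" using t False by (intro mult_left_mono) auto
    then show ?thesis using t that by (simp add: powr_divide powr_diff)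
  qed (use t in \<open>simp add: add_increasing2\<close>)
  have "norm (cnv K g y) \<le> (\<integral>x. norm (K (y - x)) * norm (g x) \<partial>lborel)" by (rule norm_cnv_le)
  also have "\<dots> \<le> (\<integral>x. t * norm (K (y - x)) + t powr (1 - p) * M * norm (g x) powr p \<partial>lborel)"
  proof (rule integral_mono)
    show "integrable lborel (\<lambda>x. norm (K (y - x)) * norm (g x))"
      using integrable_norm[OF cnv_integrable[OF K(1) Lpb_moderate[OF g(1,2)]]] by (simp add: norm_mult)
    show "integrable lborel (\<lambda>x. t * norm (K (y - x)) + t powr (1 - p) * M * norm (g x) powr p)"
      using integral_minus(1)[of "\<lambda>x. norm (K x)"] schwartz_integrable[OF K(1)] Lpb_integrable(1)[OF g(1)] by auto
    fix x
    have "norm (K (y - x)) * norm (g x) \<le> norm (K (y - x)) * (t + t powr (1 - p) * norm (g x) powr p)"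
      by (intro mult_left_mono le) auto
    also have "\<dots> \<le> t * norm (K (y - x)) + M * (t powr (1 - p) * norm (g x) powr p)"
      unfolding distrib_left by (intro add_mono mult_right_mono K) (auto simp: mult.commute)
    finally show "norm (K (y - x)) * norm (g x) \<le> t * norm (K (y - x)) + t powr (1 - p) * M * norm (g x) powr p"
      by (simp add: mult_ac)
  qed
  also have "\<dots> = t * (\<integral>x. norm (K x) \<partial>lborel) + t powr (1 - p) * M * (\<integral>x. norm (g x) powr p \<partial>lborel)"
    using integral_minus[of "\<lambda>x. norm (K x)"] schwartz_integrable[OF K(1)] Lpb_integrable(1)[OF g(1)] by simp
  also have "\<dots> \<le> t * (\<integral>x. norm (K x) \<partial>lborel) + t powr (1 - p) * M * B powr p"
    using M by (intro add_left_mono mult_left_mono Lpb_integrable(2)[OF g(1)]) auto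
  finally show ?thesis .
qed

lemma cnv_bounded:
  fixes K g :: "real^'n::finite \<Rightarrow> complex"
  assumes K: "K \<in> schwartz" and g: "g \<in> borel_measurable borel" "AE x in lborel. norm (g x) \<le> B"
  shows "norm (cnv K g y) \<le> B * (\<integral>x. norm (K x) \<partial>lborel)"
proof -
  have [measurable]: "K \<in> borel_measurable borel" "g \<in> borel_measurable borel" using schwartz_measurable K g by auto
  have "norm (cnv K g y) \<le> (\<integral>x. norm (K (y - x)) * norm (g x) \<partial>lborel)" by (rule norm_cnv_le)
  also have "\<dots> \<le> (\<integral>x. B * norm (K (y - x)) \<partial>lborel)"
  proof (rule integral_mono_AE)
    show "integrable lborel (\<lambda>x. norm (K (y - x)) * norm (g x))"
      using integrable_norm[OF cnv_integrable[OF K moderate_bounded[OF g]]] by (simp add: norm_mult)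
    show "integrable lborel (\<lambda>x. B * norm (K (y - x)))"
      using integral_minus(1)[of "\<lambda>x. norm (K x)"] schwartz_integrable[OF K] by auto
    show "AE x in lborel. norm (K (y - x)) * norm (g x) \<le> B * norm (K (y - x))"
      using g(2) by eventually_elim (simp add: mult.commute mult_right_mono)
  qed
  also have "\<dots> = B * (\<integral>x. norm (K x) \<partial>lborel)" using integral_minus[of "\<lambda>x. norm (K x)"] by simp
  finally show ?thesis .
qed

lemma cnv_add:
  assumes "K \<in> schwartz" "moderate f" "moderate g"
  shows "cnv K (\<lambda>x. f x + g x) y = cnv K f y + cnv K g y"
  unfolding cnv_def distrib_left by (intro Bochner_Integration.integral_add cnv_integrable assms)

lemma cnv_cong_AE:
  assumes [measurable]: "K \<in> borel_measurable borel" "f \<in> borel_measurable borel" "g \<in> borel_measurable borel" 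
    and "AE x in lborel. f x = g x"
  shows "cnv K f y = cnv K g y"
  unfolding cnv_def by (rule integral_cong_AE) (use assms(4) in \<open>auto elim: eventually_mono\<close>)

section \<open>Weak Lebesgue spaces\<close>

definition WL :: "real \<Rightarrow> real \<Rightarrow> (real^'n::finite \<Rightarrow> complex) \<Rightarrow> bool" where
  "WL q A h \<longleftrightarrow> h \<in> borel_measurable borel \<and>
     (\<forall>t>0. emeasure lborel {x. norm (h x) > t} \<le> ennreal ((A / t) powr q))"

text \<open>Where the product exceeds \<open>t\<close>, either \<open>u\<close> exceeds a level
  \<open>\<sigma>\<close> or \<open>v\<close> exceeds \<open>t / \<sigma>\<close>. The factor
  \<open>2 powr (1 / q)\<close> pays for the two sets.\<close>

lemma WL_mult:
  assumes u: "WL a A u" and v: "WL b B v" and pos: "A > 0" "B > 0" "a > 0" "b > 0"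
    and q: "1 / q = 1 / a + 1 / b"
  shows "WL q (2 powr (1 / q) * A * B) (\<lambda>x. u x * v x)"
  unfolding WL_def
proof (intro conjI allI impI)
  have [measurable]: "u \<in> borel_measurable borel" "v \<in> borel_measurable borel" using u v by (auto simp: WL_def)
  show "(\<lambda>x. u x * v x) \<in> borel_measurable borel" by measurable
  fix t :: real assume t: "t > 0"
  have q0: "q > 0" using q pos by (metis add_pos_pos zero_less_divide_1_iff)
  define Q where "Q = A * B / t"
  have Q: "Q > 0" using pos t by (simp add: Q_def)
  \<comment> \<open>This level makes the two distribution bounds equal: each becomes
    \<open>Q powr q\<close>.\<close>
  define \<sigma> where "\<sigma> = A * Q powr (- q / a)"
  have \<sigma>: "\<sigma> > 0" using pos Q by (simp add: \<sigma>_def)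
  have 1: "(A / \<sigma>) powr a = Q powr q"
    using pos Q by (simp add: \<sigma>_def powr_minus_divide powr_powr)
  have e: "1 + - q / a = q / b" using q q0 pos by (simp add: field_simps)
  have "B / (t / \<sigma>) = Q powr 1 * Q powr (- q / a)" using t Q pos by (simp add: \<sigma>_def Q_def)
  also have "\<dots> = Q powr (q / b)" unfolding powr_add[symmetric] e ..
  finally have 2: "(B / (t / \<sigma>)) powr b = Q powr q" using pos by (simp add: powr_powr)
  have "{x. norm (u x * v x) > t} \<subseteq> {x. norm (u x) > \<sigma>} \<union> {x. norm (v x) > t / \<sigma>}"
  proof
    fix x assume x: "x \<in> {x. norm (u x * v x) > t}"
    show "x \<in> {x. norm (u x) > \<sigma>} \<union> {x. norm (v x) > t / \<sigma>}"
    proof (rule ccontr)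
      assume "x \<notin> {x. norm (u x) > \<sigma>} \<union> {x. norm (v x) > t / \<sigma>}"
      then have "norm (u x) * norm (v x) \<le> \<sigma> * (t / \<sigma>)" using \<sigma> by (intro mult_mono) auto
      then show False using x \<sigma> by (simp add: norm_mult)
    qed
  qed
  then have "emeasure lborel {x. norm (u x * v x) > t} \<le> emeasure lborel ({x. norm (u x) > \<sigma>} \<union> {x. norm (v x) > t / \<sigma>})"
    by (rule emeasure_mono) measurable
  also have "\<dots> \<le> emeasure lborel {x. norm (u x) > \<sigma>} + emeasure lborel {x. norm (v x) > t / \<sigma>}"
    by (rule emeasure_subadditive) measurable
  also have "\<dots> \<le> ennreal ((A / \<sigma>) powr a) + ennreal ((B / (t / \<sigma>)) powr b)"
  proof (rule add_mono)
    have "t / \<sigma> > 0" using t \<sigma> by simp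
    with v show "emeasure lborel {x. norm (v x) > t / \<sigma>} \<le> ennreal ((B / (t / \<sigma>)) powr b)"
      unfolding WL_def by blast
  qed (use u \<sigma> in \<open>simp add: WL_def\<close>)
  also have "\<dots> = ennreal (2 * Q powr q)" unfolding 1 2 by (simp add: ennreal_plus[symmetric] del: ennreal_plus)
  also have "2 * Q powr q = (2 powr (1 / q) * A * B / t) powr q"
  proof -
    have "(2 powr (1 / q) * A * B / t) powr q = (2 powr (1 / q) * Q) powr q" by (simp add: Q_def mult.assoc)
    also have "\<dots> = 2 * Q powr q" using q0 Q by (simp add: powr_mult powr_powr)
    finally show ?thesis by simp
  qed
  finally show "emeasure lborel {x. norm (u x * v x) > t} \<le> ennreal ((2 powr (1 / q) * A * B / t) powr q)" .
qed

lemma dyadic_above: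
  fixes t y :: real assumes "0 < t" "t < y" obtains k :: nat where "2 ^ k * t < y" "y \<le> 2 ^ Suc k * t"
proof -
  obtain N :: nat where "y / t < 2 ^ N" using real_arch_pow[of 2] by auto
  then have ex: "y \<le> 2 ^ Suc N * t" using assms by (simp add: field_simps)
  define k where "k = (LEAST k. y \<le> 2 ^ Suc k * t)"
  have k: "y \<le> 2 ^ Suc k * t" unfolding k_def by (rule LeastI) (rule ex)
  have "2 ^ k * t < y"
  proof (cases k)
    case (Suc j)
    have "\<not> y \<le> 2 ^ Suc j * t" by (rule not_less_Least) (use Suc in \<open>simp add: k_def\<close>)
    then show ?thesis using Suc by simp
  qed (use assms in simp)
  then show ?thesis using k that by blast
qed

lemma dyadic_below:
  fixes t y :: real assumes "0 < y" "y \<le> t" obtains k :: nat where "t / 2 ^ Suc k < y" "y \<le> t / 2 ^ k"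
proof -
  obtain N :: nat where "t / y < 2 ^ N" using real_arch_pow[of 2] by auto
  moreover have "(2::real) ^ N \<le> 2 ^ Suc N" by simp
  ultimately have ex: "t / 2 ^ Suc N < y" using assms by (simp add: field_simps)
  define k where "k = (LEAST k. t / 2 ^ Suc k < y)"
  have k: "t / 2 ^ Suc k < y" unfolding k_def by (rule LeastI) (rule ex)
  have "y \<le> t / 2 ^ k"
  proof (cases k)
    case (Suc j)
    have "\<not> t / 2 ^ Suc j < y" by (rule not_less_Least) (use Suc in \<open>simp add: k_def\<close>)
    then show ?thesis using Suc by simp
  qed (use assms in simp)
  then show ?thesis using k that by blast
qed

text \<open>A layer-cake bound. The sets \<open>S k\<close> may overlap, as superlevel sets do: a
  point needs one layer on which \<open>F\<close> is below \<open>c k\<close>, and surplus layers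
  merely enlarge the sum.\<close>

lemma nn_integral_layers:
  fixes F :: "'a::euclidean_space \<Rightarrow> ennreal" and S :: "nat \<Rightarrow> 'a set"
  assumes le: "\<And>x. F x \<noteq> 0 \<Longrightarrow> \<exists>k. x \<in> S k \<and> F x \<le> ennreal (c k)"
    and [measurable]: "\<And>k. S k \<in> sets borel"
    and m: "\<And>k. emeasure lborel (S k) \<le> ennreal (m k)" "\<And>k. c k \<ge> 0" "\<And>k. m k \<ge> 0"
    and sums: "(\<lambda>k. c k * m k) sums I"
  shows "(\<integral>\<^sup>+x. F x \<partial>lborel) \<le> ennreal I"
proof -
  have "(\<integral>\<^sup>+x. F x \<partial>lborel) \<le> (\<integral>\<^sup>+x. (\<Sum>k. ennreal (c k) * indicator (S k) x) \<partial>lborel)"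
  proof (rule nn_integral_mono)
    fix x
    show "F x \<le> (\<Sum>k. ennreal (c k) * indicator (S k) x)"
    proof (cases "F x = 0")
      case False
      then obtain k where k: "x \<in> S k" "F x \<le> ennreal (c k)" using le by blast
      have "F x \<le> (\<Sum>k\<in>{k}. ennreal (c k) * indicator (S k) x)" using k by simp
      also have "\<dots> \<le> (\<Sum>k. ennreal (c k) * indicator (S k) x)" by (rule sum_le_suminf) auto
      finally show ?thesis .
    qed simp
  qed
  also have "\<dots> = (\<Sum>k. ennreal (c k) * emeasure lborel (S k))"
    by (subst nn_integral_suminf) (auto simp: nn_integral_cmult_indicator)
  also have "\<dots> \<le> (\<Sum>k. ennreal (c k * m k))"
    by (intro suminf_le) (auto simp: ennreal_mult m intro!: mult_left_mono)
  also have "\<dots> = ennreal I"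
    using sums m by (intro suminf_ennreal_eq) auto
  finally show ?thesis .
qed

text \<open>The layer where \<open>norm (h x)\<close> lies between \<open>2 ^ k * t\<close> and
  \<open>2 ^ Suc k * t\<close> contributes a term of ratio \<open>2 powr (1 - q)\<close>; the
  geometric series converges because \<open>q > 1\<close>.\<close>

lemma WL_truncate_above:
  fixes h :: "real^'n::finite \<Rightarrow> complex"
  assumes h: "WL q A h" and q: "q > 1" and t: "t > 0" and A: "A > 0"
  shows "Lpb 1 (2 / (1 - 2 powr (1 - q)) * t powr (1 - q) * A powr q) (\<lambda>x. if norm (h x) > t then h x else 0)"
proof -
  have [measurable]: "h \<in> borel_measurable borel" using h by (simp add: WL_def)
  define r :: real where "r = 2 powr (1 - q)"
  have r: "0 < r" "r < 1" using q powr_less_mono[of "1 - q" 0 2] by (auto simp: r_def)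
  have rk: "r ^ k = 2 powr (real k * (1 - q))" for k unfolding r_def by (simp add: powr_power)
  have "(\<lambda>k. (2 * t powr (1 - q) * A powr q) * r ^ k) sums ((2 * t powr (1 - q) * A powr q) * (1 / (1 - r)))"
    using r by (intro sums_mult geometric_sums) auto
  moreover have "2 ^ Suc k * t * (A / (2 ^ k * t)) powr q = (2 * t powr (1 - q) * A powr q) * r ^ k" for k
  proof -
    have "(2::real) ^ k = 2 powr real k" by (simp add: powr_realpow)
    then have "(2 ^ k * t) powr q = 2 powr (real k * q) * t powr q" using t by (simp add: powr_mult powr_powr)
    moreover have "(2::real) ^ Suc k = 2 * 2 powr real k" by (simp add: powr_realpow)
    ultimately show ?thesis using t A
      by (simp add: powr_divide rk powr_diff right_diff_distrib mult_ac)
  qed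
  ultimately have sums: "(\<lambda>k. 2 ^ Suc k * t * (A / (2 ^ k * t)) powr q) sums ((2 * t powr (1 - q) * A powr q) * (1 / (1 - r)))"
    by (simp only:)
  have "(\<integral>\<^sup>+x. ennreal (norm (if norm (h x) > t then h x else 0) powr 1) \<partial>lborel) \<le> ennreal ((2 * t powr (1 - q) * A powr q) * (1 / (1 - r)))"
  proof (rule nn_integral_layers[OF _ _ _ _ _ sums, where S = "\<lambda>k. {x. norm (h x) > 2 ^ k * t}"])
    fix x assume "ennreal (norm (if norm (h x) > t then h x else 0) powr 1) \<noteq> 0"
    then have x: "norm (h x) > t" by (auto split: if_splits)
    obtain k where "2 ^ k * t < norm (h x)" "norm (h x) \<le> 2 ^ Suc k * t" using dyadic_above[OF t x] by blast
    then show "\<exists>k. x \<in> {x. norm (h x) > 2 ^ k * t} \<and> ennreal (norm (if norm (h x) > t then h x else 0) powr 1) \<le> ennreal (2 ^ Suc k * t)"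
      using x by (intro exI[of _ k]) (auto intro!: ennreal_leI)
  next
    fix k
    show "emeasure lborel {x. norm (h x) > 2 ^ k * t} \<le> ennreal ((A / (2 ^ k * t)) powr q)"
      using h t by (simp add: WL_def)
  qed (use t in auto)
  moreover have "(2 * t powr (1 - q) * A powr q) * (1 / (1 - r)) = 2 / (1 - r) * t powr (1 - q) * A powr q" by simp
  ultimately show ?thesis using r unfolding Lpb_def r_def[symmetric] by auto
qed

text \<open>The layers now descend to 0, and their ratio \<open>2 powr (q - p)\<close> is below one
  because \<open>q < p\<close>. The factor \<open>2 powr q\<close> arises because layer
  \<open>k\<close> is measured by the superlevel set at its lower end
  \<open>t / 2 ^ Suc k\<close>.\<close>

lemma WL_truncate_below:
  fixes h :: "real^'n::finite \<Rightarrow> complex"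
  assumes h: "WL q A h" and q: "0 < q" "q < p" and t: "t > 0" and A: "A > 0"
  shows "Lpb p ((2 powr q / (1 - 2 powr (q - p)) * t powr (p - q) * A powr q) powr (1/p)) (\<lambda>x. if norm (h x) > t then 0 else h x)"
proof -
  have [measurable]: "h \<in> borel_measurable borel" using h by (simp add: WL_def)
  define r :: real where "r = 2 powr (q - p)"
  have r: "0 < r" "r < 1" using q powr_less_mono[of "q - p" 0 2] by (auto simp: r_def)
  have rk: "r ^ k = 2 powr (real k * (q - p))" for k unfolding r_def by (simp add: powr_power)
  have "(\<lambda>k. (2 powr q * t powr (p - q) * A powr q) * r ^ k) sums ((2 powr q * t powr (p - q) * A powr q) * (1 / (1 - r)))"
    using r by (intro sums_mult geometric_sums) auto
  moreover have "(t / 2 ^ k) powr p * (A / (t / 2 ^ Suc k)) powr q = (2 powr q * t powr (p - q) * A powr q) * r ^ k" for k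
  proof -
    have "(2::real) ^ k = 2 powr real k" by (simp add: powr_realpow)
    then have "(t / 2 ^ k) powr p = t powr p / 2 powr (real k * p)" using t by (simp add: powr_divide powr_powr)
    moreover have "(2::real) ^ Suc k = 2 powr (1 + real k)" by (simp add: powr_realpow powr_add)
    then have "(A / (t / 2 ^ Suc k)) powr q = A powr q * (2 powr (q + real k * q)) / t powr q"
      using t A by (simp add: powr_divide powr_mult powr_powr algebra_simps)
    ultimately show ?thesis using t A
      by (simp add: rk powr_diff powr_add right_diff_distrib mult_ac)
  qed
  ultimately have sums: "(\<lambda>k. (t / 2 ^ k) powr p * (A / (t / 2 ^ Suc k)) powr q) sums ((2 powr q * t powr (p - q) * A powr q) * (1 / (1 - r)))"
    by (simp only:)
  let ?I = "(2 powr q * t powr (p - q) * A powr q) * (1 / (1 - r))"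
  have "(\<integral>\<^sup>+x. ennreal (norm (if norm (h x) > t then 0 else h x) powr p) \<partial>lborel) \<le> ennreal ?I"
  proof (rule nn_integral_layers[OF _ _ _ _ _ sums, where S = "\<lambda>k. {x. norm (h x) > t / 2 ^ Suc k}"])
    fix x assume "ennreal (norm (if norm (h x) > t then 0 else h x) powr p) \<noteq> 0"
    then have x: "0 < norm (h x)" "norm (h x) \<le> t" by (auto split: if_splits)
    obtain k where "t / 2 ^ Suc k < norm (h x)" "norm (h x) \<le> t / 2 ^ k" using dyadic_below[OF x] by blast
    then show "\<exists>k. x \<in> {x. norm (h x) > t / 2 ^ Suc k} \<and> ennreal (norm (if norm (h x) > t then 0 else h x) powr p) \<le> ennreal ((t / 2 ^ k) powr p)"
      using x q by (intro exI[of _ k]) (auto intro!: ennreal_leI powr_mono2)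
  next
    fix k
    show "emeasure lborel {x. norm (h x) > t / 2 ^ Suc k} \<le> ennreal ((A / (t / 2 ^ Suc k)) powr q)"
    proof -
      have "t / 2 ^ Suc k > 0" using t by simp
      with h show ?thesis unfolding WL_def by blast
    qed
  qed (use t in auto)
  moreover have "?I = 2 powr q / (1 - r) * t powr (p - q) * A powr q" by simp
  moreover have "(x powr (1/p)) powr p = x" if "x \<ge> 0" for x using that q by (simp add: powr_powr)
  ultimately show ?thesis using r unfolding Lpb_def r_def[symmetric] by auto
qed

text \<open>Real interpolation: for each level \<open>t\<close> the split \<open>l\<close> is taken
  as large as possible with the bounded part at most \<open>t / 2\<close>. Then only the
  \<open>L\<^sup>p\<close> part can carry \<open>g\<close> above \<open>t\<close>, and Chebyshev's
  inequality applies to it.\<close>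

lemma WL_of_decomposition:
  fixes g :: "real^'n::finite \<Rightarrow> complex" and C \<alpha> s p :: real
  assumes g: "g \<in> borel_measurable borel" and pos: "C > 0" "\<alpha> > 0" "s > 0" "p > 0"
    and dec: "\<And>l::int. \<exists>g1 g2. (AE x in lborel. g x = g1 x + g2 x) \<and> (AE x in lborel. norm (g1 x) \<le> C * 2 powr (l * \<alpha>))
       \<and> g1 \<in> borel_measurable borel \<and> Lpb p (C * 2 powr (- real_of_int l * s)) g2"
  shows "WL (p * (\<alpha> + s) / \<alpha>) (2 powr (1 + s * p / (p * (\<alpha> + s) / \<alpha>)) * C) g"
  unfolding WL_def
proof (intro conjI allI impI g)
  fix t :: real assume t: "t > 0"
  have [measurable]: "g \<in> borel_measurable borel" by fact
  define m where "m = p * (\<alpha> + s) / \<alpha>"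
  have m: "m > 0" using pos by (simp add: m_def)
  define y where "y = t / (2 * C)"
  have y: "y > 0" using t pos by (simp add: y_def)
  \<comment> \<open>Rounding down keeps the bounded part below \<open>t / 2\<close> and loses at
    most the factor \<open>2 powr s\<close> in the other bound, the source of
    \<open>2 powr (s * p / m)\<close> in the final constant.\<close>
  define l where "l = \<lfloor>log 2 y / \<alpha>\<rfloor>"
  have l1: "real_of_int l * \<alpha> \<le> log 2 y" using pos by (simp add: l_def pos_le_divide_eq[symmetric])
  have l2: "- real_of_int l \<le> 1 - log 2 y / \<alpha>" unfolding l_def by linarith
  obtain g1 g2 where d: "AE x in lborel. g x = g1 x + g2 x" "AE x in lborel. norm (g1 x) \<le> C * 2 powr (l * \<alpha>)"
     "g1 \<in> borel_measurable borel" "Lpb p (C * 2 powr (- real_of_int l * s)) g2" using dec by blast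
  have [measurable]: "g1 \<in> borel_measurable borel" "g2 \<in> borel_measurable borel" using d by (auto simp: Lpb_def)
  have "2 powr (l * \<alpha>) \<le> 2 powr (log 2 y)" using l1 by simp
  also have "\<dots> = y" using y by simp
  finally have "C * 2 powr (l * \<alpha>) \<le> C * y" using pos by simp
  then have c1: "C * 2 powr (l * \<alpha>) \<le> t / 2" using pos by (simp add: y_def)
  have "emeasure lborel {x. norm (g x) > t} \<le> emeasure lborel {x. norm (g2 x) > t / 2}"
  proof (rule emeasure_mono_AE)
    show "AE x in lborel. x \<in> {x. norm (g x) > t} \<longrightarrow> x \<in> {x. norm (g2 x) > t / 2}"
      using d(1,2)
    proof eventually_elim
      case (elim x)
      have "norm (g x) \<le> norm (g1 x) + norm (g2 x)" unfolding elim(1) by (rule norm_triangle_ineq)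
      then show ?case using elim(2) c1 by auto
    qed
  qed measurable
  also have "\<dots> \<le> ennreal ((C * 2 powr (- real_of_int l * s) / (t / 2)) powr p)"
    by (rule Lpb_chebyshev[OF d(4)]) (use t pos in auto)
  also have "\<dots> \<le> ennreal ((2 powr (1 + s * p / m) * C / t) powr m)"
  proof (rule ennreal_leI)
    have "C * 2 powr (- real_of_int l * s) / (t / 2) = 2 powr (- real_of_int l * s) / y" by (simp add: y_def)
    also have "\<dots> \<le> 2 powr ((1 - log 2 y / \<alpha>) * s) / y"
      using y pos mult_right_mono[OF l2, of s] by (intro divide_right_mono powr_mono) auto
    also have "2 powr ((1 - log 2 y / \<alpha>) * s) = 2 powr s * (2 powr (log 2 y)) powr (- s / \<alpha>)"
      by (simp add: powr_powr powr_add[symmetric] algebra_simps)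
    also have "2 powr (log 2 y) = y" using y by simp
    also have "2 powr s * y powr (- s / \<alpha>) / y = 2 powr s * y powr (- (m / p))"
    proof -
      have "- (m / p) = - s / \<alpha> - 1" using pos by (simp add: m_def field_simps)
      then show ?thesis using y by (simp add: powr_diff)
    qed
    finally have "(C * 2 powr (- real_of_int l * s) / (t / 2)) powr p \<le> (2 powr s * y powr (- (m / p))) powr p"
      using pos t by (intro powr_mono2) auto
    also have "\<dots> = 2 powr (s * p) * (1 / y) powr m" using pos y
      by (simp add: powr_mult powr_powr powr_minus_divide powr_divide)
    also have "\<dots> = (2 powr (s * p / m)) powr m * (1 / y) powr m" using m by (simp add: powr_powr)
    also have "\<dots> = (2 powr (s * p / m) * (1 / y)) powr m" using y by (subst powr_mult) auto
    also have "2 powr (s * p / m) * (1 / y) = 2 powr (1 + s * p / m) * C / t" by (simp add: y_def powr_add)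
    finally show "(C * 2 powr (- real_of_int l * s) / (t / 2)) powr p \<le> (2 powr (1 + s * p / m) * C / t) powr m" .
  qed
  finally show "emeasure lborel {x. norm (g x) > t} \<le> ennreal ((2 powr (1 + s * p / (p * (\<alpha> + s) / \<alpha>)) * C / t) powr (p * (\<alpha> + s) / \<alpha>))"
    unfolding m_def .
qed

lemma WL_cong_AE:
  assumes "WL q A g" "AE x in lborel. h x = g x" "h \<in> borel_measurable borel" shows "WL q A h"
  unfolding WL_def
proof (intro conjI allI impI assms)
  fix t :: real assume t: "t > 0"
  have [measurable]: "g \<in> borel_measurable borel" "h \<in> borel_measurable borel" using assms by (auto simp: WL_def)
  have "emeasure lborel {x. norm (h x) > t} \<le> emeasure lborel {x. norm (g x) > t}"
    by (rule emeasure_mono_AE) (use assms(2) in \<open>auto elim!: eventually_mono\<close>)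
  then show "emeasure lborel {x. norm (h x) > t} \<le> ennreal ((A / t) powr q)"
    using assms(1) t unfolding WL_def by (meson order_trans)
qed

text \<open>Dilation normalised to preserve the \<open>L\<^sup>1\<close> norm. This is the effect on
  the kernel of rescaling a symbol, see \<open>ift_dil\<close>.\<close>

definition dil :: "int \<Rightarrow> (real^'n::finite \<Rightarrow> complex) \<Rightarrow> real^'n \<Rightarrow> complex" where
  "dil l K x = complex_of_real (2 powr (real_of_int l * CARD('n))) * K ((2 powr real_of_int l) *\<^sub>R x)"

lemma dil_schwartz: "K \<in> schwartz \<Longrightarrow> dil l K \<in> schwartz"
  unfolding dil_def[abs_def] by (intro schwartz_cmult schwartz_scale) auto

lemma ift_dil: "ift (\<lambda>\<xi>. m ((2 powr (- real_of_int l)) *\<^sub>R \<xi>)) = dil l (ift (m :: real^'n::finite \<Rightarrow> complex))"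
proof
  fix x
  have "((2::real) powr (- real_of_int l)) ^ CARD('n) = 2 powr (- (real_of_int l * CARD('n)))"
    by (simp add: powr_power mult.commute)
  then have "1 / ((2::real) powr (- real_of_int l)) ^ CARD('n) = 2 powr (real_of_int l * CARD('n))"
    by (simp only: powr_minus_divide) simp
  then show "ift (\<lambda>\<xi>. m ((2 powr (- real_of_int l)) *\<^sub>R \<xi>)) x = dil l (ift m) x"
    by (subst ift_scale) (simp_all add: dil_def powr_minus_divide)
qed

lemma dil_integral: "(\<integral>x. norm (dil l K x) \<partial>lborel) = (\<integral>x. norm (K x) \<partial>(lborel :: (real^'n::finite) measure))"
proof -
  have "(2 powr real_of_int l) ^ CARD('n) = 2 powr (real_of_int l * CARD('n))"
    by (simp add: powr_power mult.commute)
  then show ?thesis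
    using lborel_affine_integral_eq[of "2 powr real_of_int l" "\<lambda>x. norm (K x)" 0] by (simp add: dil_def norm_mult)
qed

lemma dil_bound: "(\<And>x. norm (K x) \<le> M) \<Longrightarrow> norm (dil l K x) \<le> 2 powr (real_of_int l * CARD('n)) * M"
  for K :: "real^'n::finite \<Rightarrow> complex"
  by (simp add: dil_def norm_mult)

lemma dil_Lpb:
  fixes K :: "real^'n::finite \<Rightarrow> complex"
  assumes K: "Lpb p B K" "B \<ge> 0" "p > 0"
  shows "Lpb p (2 powr (real_of_int l * CARD('n) * (1 - 1/p)) * B) (dil l K)"
proof -
  have [measurable]: "K \<in> borel_measurable borel" using K by (simp add: Lpb_def)
  let ?c = "2 powr real_of_int l" and ?d = "2 powr (real_of_int l * CARD('n))"
  have c: "?c ^ CARD('n) = ?d" by (simp add: powr_power mult.commute)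
  have n: "(\<integral>\<^sup>+x. ennreal (norm (K x) powr p) \<partial>lborel) = ennreal ?d * (\<integral>\<^sup>+x. ennreal (norm (K (?c *\<^sub>R x)) powr p) \<partial>lborel)"
    using lborel_affine_nn_integral[of ?c "\<lambda>x. ennreal (norm (K x) powr p)" 0] c by simp
  have "(\<integral>\<^sup>+x. ennreal (norm (dil l K x) powr p) \<partial>lborel) = ennreal (?d powr p) * (\<integral>\<^sup>+x. ennreal (norm (K (?c *\<^sub>R x)) powr p) \<partial>lborel)"
    by (simp add: dil_def norm_mult powr_mult ennreal_mult nn_integral_cmult)
  also have "ennreal (?d powr p) = ennreal (?d powr (p - 1)) * ennreal ?d"
    by (simp add: ennreal_mult[symmetric] powr_diff)
  also have "\<dots> * (\<integral>\<^sup>+x. ennreal (norm (K (?c *\<^sub>R x)) powr p) \<partial>lborel) = ennreal (?d powr (p - 1)) * (\<integral>\<^sup>+x. ennreal (norm (K x) powr p) \<partial>lborel)"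
    unfolding n by (simp add: mult.assoc)
  also have "\<dots> \<le> ennreal (?d powr (p - 1)) * ennreal (B powr p)"
    using K by (intro mult_left_mono) (auto simp: Lpb_def)
  also have "\<dots> = ennreal ((2 powr (real_of_int l * CARD('n) * (1 - 1/p)) * B) powr p)"
  proof -
    have "real_of_int l * CARD('n) * (1 - 1/p) * p = real_of_int l * CARD('n) * (p - 1)"
      using K(3) by (simp add: field_simps)
    then show ?thesis using K
      by (simp only: ennreal_mult[symmetric] powr_mult powr_powr powr_ge_zero)
  qed
  finally show ?thesis by (simp add: Lpb_def dil_def[abs_def])
qed

lemma schwartz_Lpb:
  fixes K :: "real^'n::finite \<Rightarrow> complex"
  assumes K: "K \<in> schwartz" "p \<ge> 1" obtains B where "B > 0" "Lpb p B K"
proof -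
  obtain M where M: "M > 0" "\<And>x. norm (K x) \<le> M" using schwartz_bound[OF K(1), of 0] by auto
  have [measurable]: "K \<in> borel_measurable borel" by (rule schwartz_measurable[OF K(1)])
  \<comment> \<open>A bounded integrable function lies in \<open>L\<^sup>p\<close>: one factor is
    kept and the other \<open>p - 1\<close> powers are bounded by \<open>M\<close>.\<close>
  have pw: "norm (K x) powr p \<le> M powr (p - 1) * norm (K x)" for x
  proof (cases "K x = 0")
    case False
    then have "norm (K x) powr p = norm (K x) powr (p - 1) * norm (K x)" by (simp add: powr_diff)
    also have "\<dots> \<le> M powr (p - 1) * norm (K x)" by (intro mult_right_mono powr_mono2) (use K M in auto)
    finally show ?thesis .
  qed (use M in simp)
  define I where "I = (\<integral>x. norm (K x) powr p \<partial>lborel)"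
  have int: "integrable lborel (\<lambda>x. norm (K x) powr p)"
    by (rule Bochner_Integration.integrable_bound[of _ "\<lambda>x. M powr (p - 1) * norm (K x)"])
       (use pw schwartz_integrable[OF K(1)] in \<open>auto intro!: AE_I2\<close>)
  have I: "I \<ge> 0" unfolding I_def by (rule integral_nonneg_AE) simp
  have "((I + 1) powr (1/p)) powr p = I + 1" using I K(2) by (simp add: powr_powr)
  then have "Lpb p ((I + 1) powr (1/p)) K"
    unfolding Lpb_iff_integral using int by (simp add: I_def)
  then show ?thesis using that[of "(I + 1) powr (1/p)"] I by simp
qed

text \<open>Truncation at height 1 splits the function into an integrable part and a bounded
  part.\<close>

lemma WL_moderate:
  assumes "WL q A h" "q > 1" "A > 0" shows "moderate h"
proof -
  have [measurable]: "h \<in> borel_measurable borel" using assms by (simp add: WL_def)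
  have 1: "moderate (\<lambda>x. if norm (h x) > 1 then h x else 0)"
    by (rule Lpb_moderate[OF WL_truncate_above[OF assms(1,2) zero_less_one assms(3)]]) simp
  have 2: "moderate (\<lambda>x. if norm (h x) > 1 then 0 else h x)"
    by (rule moderate_bounded[of _ 1]) auto
  have "(\<lambda>x. (if norm (h x) > 1 then h x else 0) + (if norm (h x) > 1 then 0 else h x)) = h" by auto
  then show ?thesis using moderate_add[OF 1 2] by simp
qed

text \<open>The embedding of weak \<open>L\<^sup>q\<close> into a Besov space of negative order, obtained by
  truncating at height \<open>A 2\<^bsup>ln/q\<^esup>\<close>.\<close>

lemma WL_cnv:
  fixes K :: "real^'n::finite \<Rightarrow> complex"
  assumes K: "K \<in> schwartz" and q: "1 < q" "q < p"
  shows "\<exists>C>0. \<forall>A h l. A > 0 \<longrightarrow> WL q A h \<longrightarrow>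
    Lpb p (C * A * 2 powr (real_of_int l * CARD('n) * (1 / q - 1 / p))) (cnv (dil l K) h)"
proof -
  have p: "p \<ge> 1" using q by simp
  obtain B where B: "B > 0" "Lpb p B K" using schwartz_Lpb[OF K p] by blast
  define J where "J = (\<integral>x. norm (K x) \<partial>lborel) + 1"
  have J: "J > 0" unfolding J_def by (intro add_nonneg_pos integral_nonneg_AE) auto
  define C1 where "C1 = 2 / (1 - (2::real) powr (1 - q))"
  define C2 where "C2 = 2 powr q / (1 - (2::real) powr (q - p))"
  have "(2::real) powr (1 - q) < 1" "(2::real) powr (q - p) < 1"
    using q powr_less_mono[of "1 - q" 0 "2::real"] powr_less_mono[of "q - p" 0 "2::real"] by auto
  then have C12: "C1 > 0" "C2 > 0" by (auto simp: C1_def C2_def)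
  define C where "C = C1 * B + J * C2 powr (1/p)"
  have C: "C > 0" using C12 B J by (simp add: C_def add_pos_pos)
  show ?thesis
  proof (intro exI[of _ C] conjI allI impI C)
    fix A :: real and h :: "real^'n \<Rightarrow> complex" and l :: int
    assume A: "A > 0" and h: "WL q A h"
    have [measurable]: "h \<in> borel_measurable borel" using h by (simp add: WL_def)
    define L where "L = real_of_int l * CARD('n)"
    \<comment> \<open>At this height the convolutions of the large part, bounded in
      \<open>L\<^sup>1\<close>, and of the small part, bounded in \<open>L\<^sup>p\<close>, both
      scale like \<open>A * 2 powr (L * (1 / q - 1 / p))\<close>.\<close>
    define t where "t = A * 2 powr (L / q)"
    have t: "t > 0" using A by (simp add: t_def)
    let ?h1 = "\<lambda>x. if norm (h x) > t then h x else 0" and ?h2 = "\<lambda>x. if norm (h x) > t then 0 else h x"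
    have dK: "dil l K \<in> schwartz" by (rule dil_schwartz[OF K])
    have h1: "Lpb 1 (C1 * t powr (1 - q) * A powr q) ?h1"
      unfolding C1_def by (rule WL_truncate_above[OF h q(1) t A])
    have h2: "Lpb p ((C2 * t powr (p - q) * A powr q) powr (1/p)) ?h2"
      unfolding C2_def by (rule WL_truncate_below[OF h _ q(2) t A]) (use q in simp)
    have 1: "Lpb p ((C1 * t powr (1 - q) * A powr q) * (2 powr (L * (1 - 1/p)) * B)) (cnv (dil l K) ?h1)"
      unfolding L_def by (rule Lpb_cnv_Lp[OF dK dil_Lpb[OF B(2)] h1]) (use B p t A C12 in auto)
    have 2: "Lpb p (J * (C2 * t powr (p - q) * A powr q) powr (1/p)) (cnv (dil l K) ?h2)"
      by (rule Lpb_cnv_L1[OF dK _ J h2]) (use p in \<open>auto simp: dil_integral J_def\<close>)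
    have e: "(\<lambda>x. ?h1 x + ?h2 x) = h" by auto
    have "cnv (dil l K) h = (\<lambda>y. cnv (dil l K) ?h1 y + cnv (dil l K) ?h2 y)"
      using cnv_add[OF dK Lpb_moderate[OF h1] Lpb_moderate[OF h2 p]] unfolding e by (intro ext) simp
    then have "Lpb p ((C1 * t powr (1 - q) * A powr q) * (2 powr (L * (1 - 1/p)) * B) + J * (C2 * t powr (p - q) * A powr q) powr (1/p)) (cnv (dil l K) h)"
      using Lpb_add[OF 1 2] B J A C12 p t by simp
    moreover have "(C1 * t powr (1 - q) * A powr q) * (2 powr (L * (1 - 1/p)) * B) = C1 * B * (A * 2 powr (L * (1 / q - 1 / p)))"
    proof -
      have "t powr (1 - q) * A powr q = A * 2 powr (L / q * (1 - q))"
      proof -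
        have "t powr (1 - q) = A powr (1 - q) * 2 powr (L / q * (1 - q))"
          using A by (simp only: t_def powr_mult powr_powr powr_ge_zero less_imp_le)
        moreover have "A powr (1 - q) * A powr q = A" using A by (simp add: powr_add[symmetric])
        moreover have "A powr (1 - q) * 2 powr (L / q * (1 - q)) * A powr q = (A powr (1 - q) * A powr q) * 2 powr (L / q * (1 - q))"
          by (simp only: mult_ac)
        ultimately show ?thesis by simp
      qed
      moreover have "L / q * (1 - q) + L * (1 - 1/p) = L * (1 / q - 1 / p)" using q by (simp add: field_simps)
      moreover have "(C1 * t powr (1 - q) * A powr q) * (2 powr (L * (1 - 1/p)) * B) =
         C1 * B * ((t powr (1 - q) * A powr q) * 2 powr (L * (1 - 1/p)))" by (simp only: mult_ac)
      ultimately show ?thesis by (simp only: mult.assoc powr_add[symmetric])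
    qed
    moreover have "(C2 * t powr (p - q) * A powr q) powr (1/p) = C2 powr (1/p) * (A * 2 powr (L * (1 / q - 1 / p)))"
    proof -
      have "t powr (p - q) * A powr q = A powr p * 2 powr (L / q * (p - q))"
      proof -
        have "t powr (p - q) = A powr (p - q) * 2 powr (L / q * (p - q))"
          using A by (simp only: t_def powr_mult powr_powr powr_ge_zero less_imp_le)
        moreover have "A powr (p - q) * A powr q = A powr p" using A by (simp add: powr_add[symmetric])
        moreover have "A powr (p - q) * 2 powr (L / q * (p - q)) * A powr q = (A powr (p - q) * A powr q) * 2 powr (L / q * (p - q))"
          by (simp only: mult_ac)
        ultimately show ?thesis by simp
      qed
      moreover have "L / q * (p - q) * (1/p) = L * (1 / q - 1 / p)" using q by (simp add: field_simps)
      ultimately show ?thesis using A C12 q by (simp add: powr_mult powr_powr mult.assoc)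
    qed
    ultimately have "Lpb p (C1 * B * (A * 2 powr (L * (1 / q - 1 / p))) + J * (C2 powr (1/p) * (A * 2 powr (L * (1 / q - 1 / p))))) (cnv (dil l K) h)"
      by (simp only:)
    moreover have "C1 * B * (A * E) + J * (C2 powr (1/p) * (A * E)) = C * A * E" for E
      by (simp add: C_def algebra_simps)
    ultimately show "Lpb p (C * A * 2 powr (real_of_int l * CARD('n) * (1 / q - 1 / p))) (cnv (dil l K) h)"
      by (simp only: L_def)
  qed
qed

section \<open>Littlewood--Paley reconstruction\<close>

text \<open>Continuity of a distribution enters in \<open>fmult_scaled_low_tendsto\<close>. The
  functionals produced by \<open>lim\<close> and by infinite series are handled through linearity
  and their block expansion.\<close>

definition dlin :: "'n::finite distr \<Rightarrow> bool" where
  "dlin T \<longleftrightarrow> (\<forall>\<phi>\<in>schwartz. \<forall>\<psi>\<in>schwartz. \<forall>a b. T (\<lambda>x. a * \<phi> x + b * \<psi> x) = a * T \<phi> + b * T \<psi>)"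

lemma dlinD: "dlin T \<Longrightarrow> f \<in> schwartz \<Longrightarrow> g \<in> schwartz \<Longrightarrow> T (\<lambda>x. a * f x + b * g x) = a * T f + b * T g"
  by (simp add: dlin_def)

lemma dlin_add: "dlin T \<Longrightarrow> f \<in> schwartz \<Longrightarrow> g \<in> schwartz \<Longrightarrow> T (\<lambda>x. f x + g x) = T f + T g"
  using dlinD[of T f g 1 1] by simp

lemma dlin_diff: "dlin T \<Longrightarrow> f \<in> schwartz \<Longrightarrow> g \<in> schwartz \<Longrightarrow> T (\<lambda>x. f x - g x) = T f - T g"
  using dlinD[of T f g 1 "-1"] by simp

lemma dlin_cmult: "dlin T \<Longrightarrow> f \<in> schwartz \<Longrightarrow> T (\<lambda>x. c * f x) = c * T f"
  using dlinD[of T f f c 0] by simp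

lemma dlin_zero: "dlin T \<Longrightarrow> T (\<lambda>x. 0) = 0"
  using dlin_cmult[of T "\<lambda>x. 0" 0] schwartz_zero by simp

lemma dlin_sum: "dlin T \<Longrightarrow> (\<And>j. j \<in> A \<Longrightarrow> f j \<in> schwartz) \<Longrightarrow> T (\<lambda>x. \<Sum>j\<in>A. f j x) = (\<Sum>j\<in>A. T (f j))"
proof (induction A rule: infinite_finite_induct)
  case (insert i A)
  have "T (\<lambda>x. f i x + (\<Sum>j\<in>A. f j x)) = T (f i) + T (\<lambda>x. \<Sum>j\<in>A. f j x)"
    by (rule dlin_add[OF insert(4)]) (use insert(5) in \<open>auto intro: schwartz_sum\<close>)
  then show ?case using insert by simp
qed (auto simp: dlin_zero)

lemma ft_diff: "f \<in> schwartz \<Longrightarrow> g \<in> schwartz \<Longrightarrow> ft (\<lambda>x. f x - g x) = (\<lambda>\<xi>. ft f \<xi> - ft g \<xi>)"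
  unfolding ft_def[abs_def] right_diff_distrib
  by (intro ext Bochner_Integration.integral_diff ft_integrable schwartz_integrable)

lemma ft_zero: "ft (\<lambda>x. 0) = (\<lambda>\<xi>. 0)"
  by (simp add: ft_def[abs_def])

lemma ft_sum: "(\<And>j. j \<in> A \<Longrightarrow> f j \<in> schwartz) \<Longrightarrow> ft (\<lambda>x. \<Sum>j\<in>A. f j x) = (\<lambda>\<xi>. \<Sum>j\<in>A. ft (f j) \<xi>)"
  by (induction A rule: infinite_finite_induct) (auto simp: ft_zero ft_add schwartz_sum)

lemma fmult_fmult:
  assumes "m1 \<in> schwartz" "m2 \<in> schwartz" "\<psi> \<in> schwartz"
  shows "fmult m1 (fmult m2 T) \<psi> = fmult (\<lambda>\<xi>. m2 \<xi> * m1 \<xi>) T \<psi>"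
proof -
  have "ift (ft (\<lambda>\<xi>. m1 \<xi> * ift \<psi> \<xi>)) = (\<lambda>\<xi>. m1 \<xi> * ift \<psi> \<xi>)"
    using assms by (intro ext ift_ft schwartz_mult schwartz_ift)
  then show ?thesis by (simp add: fmult_eq mult.assoc)
qed

lemma represents_rep: "represents g T \<Longrightarrow> represents (rep T) T"
  unfolding rep_def by (rule someI[of "\<lambda>g. represents g T"])

section \<open>Averages of Schwartz functions at small scales\<close>

lemma pd_average:
  fixes h k :: "real^'n::finite \<Rightarrow> complex"
  assumes h: "h \<in> schwartz" and k: "k \<in> schwartz"
  shows "has_pd i (\<lambda>x. \<integral>z. h (x + \<epsilon> *\<^sub>R z) * k z \<partial>lborel) x (\<integral>z. pd i h (x + \<epsilon> *\<^sub>R z) * k z \<partial>lborel)"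
proof -
  have [measurable]: "h \<in> borel_measurable borel" "k \<in> borel_measurable borel" using schwartz_measurable h k by auto
  obtain C where C: "\<And>x. (1 + norm x) ^ 0 * norm (pd i h x) \<le> C" using schwartz_bound[OF schwartz_pd[OF h]] by metis
  show ?thesis
  proof (rule has_vector_derivative_integral(1)[where B = "\<lambda>z. C * norm (k z)"])
  fix z
  have "has_pd i (\<lambda>x. h (x + \<epsilon> *\<^sub>R z)) x (pd i h (x + \<epsilon> *\<^sub>R z))" by (intro has_pd_shift schwartz_has_pd h)
  then show "((\<lambda>t. h (x + t *\<^sub>R axis i 1 + \<epsilon> *\<^sub>R z) * k z) has_vector_derivative pd i h (x + \<epsilon> *\<^sub>R z) * k z) (at 0)"
    by (rule has_vector_derivative_mult_left)
  show "norm (h (x + t *\<^sub>R axis i 1 + \<epsilon> *\<^sub>R z) * k z - h (x + 0 *\<^sub>R axis i 1 + \<epsilon> *\<^sub>R z) * k z) \<le> \<bar>t\<bar> * (C * norm (k z))" for t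
  proof -
    have "norm (h ((x + \<epsilon> *\<^sub>R z) + t *\<^sub>R axis i 1) - h (x + \<epsilon> *\<^sub>R z)) \<le> C * \<bar>t\<bar>"
      using schwartz_line_bound[OF h C, of "x + \<epsilon> *\<^sub>R z" t] by simp
    then have "norm (h ((x + \<epsilon> *\<^sub>R z) + t *\<^sub>R axis i 1) - h (x + \<epsilon> *\<^sub>R z)) * norm (k z) \<le> C * \<bar>t\<bar> * norm (k z)"
      by (rule mult_right_mono) simp
    then show ?thesis by (simp only: norm_mult[symmetric] left_diff_distrib) (simp add: add_ac mult_ac)
  qed
  show "integrable lborel (\<lambda>z. C * norm (k z))" using schwartz_integrable[OF k] by simp
  obtain B where B: "\<And>x. norm (h x) \<le> B" using schwartz_bound[OF h, of 0] by auto
  show "integrable lborel (\<lambda>z. h (x + t *\<^sub>R axis i 1 + \<epsilon> *\<^sub>R z) * k z)" for t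
    by (rule Bochner_Integration.integrable_bound[of _ "\<lambda>z. B * norm (k z)"])
       (use schwartz_integrable[OF k] B order_trans[OF norm_ge_zero B] in \<open>auto simp: norm_mult abs_mult intro!: AE_I2 mult_right_mono\<close>)
  qed
qed

lemma dpart_average:
  fixes h k :: "real^'n::finite \<Rightarrow> complex"
  assumes h: "h \<in> schwartz" and k: "k \<in> schwartz"
  shows "dpart ds (\<lambda>x. \<integral>z. h (x + \<epsilon> *\<^sub>R z) * k z \<partial>lborel) = (\<lambda>x. \<integral>z. dpart ds h (x + \<epsilon> *\<^sub>R z) * k z \<partial>lborel)"
  by (induction ds) (auto intro!: has_pd_imp pd_average schwartz_dpart h k)

lemma dpart_diff: "f \<in> schwartz \<Longrightarrow> g \<in> schwartz \<Longrightarrow> dpart ds (\<lambda>x. f x - g x) = (\<lambda>x. dpart ds f x - dpart ds g x)"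
proof (induction ds)
  case (Cons i ds)
  then have "pd i (\<lambda>x. dpart ds f x + (-1) * dpart ds g x) = (\<lambda>x. pd i (dpart ds f) x + (-1) * pd i (dpart ds g) x)"
    by (intro ext has_pd_imp has_pd_add has_pd_cmult schwartz_has_pd schwartz_dpart)
  then show ?case using Cons by simp
qed simp

lemma seminorm_le: "(\<And>x. (1 + norm x) ^ k * norm (dpart ds f x) \<le> C) \<Longrightarrow> seminorm k ds f \<le> C"
  unfolding seminorm_def by (rule cSUP_least) auto

lemma seminorm_nonneg: 
  assumes "f \<in> schwartz" shows "seminorm k ds f \<ge> 0"
proof -
  have "bdd_above (range (\<lambda>x. (1 + norm x) ^ k * norm (dpart ds f x)))"
    using assms by (intro bounded_imp_bdd_above) (auto simp: schwartz_def)
  then have "norm (dpart ds f 0) \<le> seminorm k ds f"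
    using cSUP_upper[of 0 UNIV "\<lambda>x. (1 + norm x) ^ k * norm (dpart ds f x)"] by (simp add: seminorm_def)
  then show ?thesis using norm_ge_zero order_trans by blast
qed

text \<open>Averaging commutes with derivatives, so each seminorm reduces to the increments of one
  derivative. \<open>schwartz_mean_value\<close> yields a factor \<open>\<epsilon>\<close> and a
  polynomial in \<open>z\<close> that the moments of \<open>k\<close> absorb.\<close>

lemma seminorm_average:
  fixes h k :: "real^'n::finite \<Rightarrow> complex"
  assumes h: "h \<in> schwartz" and k: "k \<in> schwartz" "(\<integral>z. k z \<partial>lborel) = 1"
    and av: "\<And>\<epsilon>. \<epsilon> > 0 \<Longrightarrow> (\<lambda>x. \<integral>z. h (x + \<epsilon> *\<^sub>R z) * k z \<partial>lborel) \<in> schwartz"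
  shows "\<exists>C. \<forall>\<epsilon>. 0 < \<epsilon> \<and> \<epsilon> \<le> 1 \<longrightarrow> seminorm m ds (\<lambda>x. (\<integral>z. h (x + \<epsilon> *\<^sub>R z) * k z \<partial>lborel) - h x) \<le> C * \<epsilon>"
proof -
  have [measurable]: "k \<in> borel_measurable borel" by (rule schwartz_measurable[OF k(1)])
  define H where "H = dpart ds h"
  have H: "H \<in> schwartz" unfolding H_def by (rule schwartz_dpart[OF h])
  have [measurable]: "H \<in> borel_measurable borel" by (rule schwartz_measurable[OF H])
  obtain C where C: "C > 0" "\<And>x z. (1 + norm x) ^ m * norm (H (x + z) - H x) \<le> C * norm z * (1 + norm z) ^ (2 * m)"
    using schwartz_mean_value[OF H] by metis
  obtain B where B: "\<And>x. norm (H x) \<le> B" using schwartz_bound[OF H, of 0] by auto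
  define J where "J = (\<integral>z. (1 + norm z) ^ Suc (2 * m) * norm (k z) \<partial>lborel)"
  show ?thesis
  proof (intro exI[of _ "C * J"] allI impI)
    fix \<epsilon> :: real assume \<epsilon>: "0 < \<epsilon> \<and> \<epsilon> \<le> 1"
    show "seminorm m ds (\<lambda>x. (\<integral>z. h (x + \<epsilon> *\<^sub>R z) * k z \<partial>lborel) - h x) \<le> C * J * \<epsilon>"
    proof (rule seminorm_le)
      fix x
      have int: "integrable lborel (\<lambda>z. H (x + \<epsilon> *\<^sub>R z) * k z)"
        by (rule Bochner_Integration.integrable_bound[of _ "\<lambda>z. B * norm (k z)"])
           (use schwartz_integrable[OF k(1)] B order_trans[OF norm_ge_zero B] in \<open>auto simp: norm_mult abs_mult intro!: AE_I2 mult_right_mono\<close>)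
      have "dpart ds (\<lambda>x. (\<integral>z. h (x + \<epsilon> *\<^sub>R z) * k z \<partial>lborel) - h x) x = (\<integral>z. H (x + \<epsilon> *\<^sub>R z) * k z \<partial>lborel) - H x"
        using av[of \<epsilon>] \<epsilon> h by (subst dpart_diff) (auto simp: dpart_average[OF h k(1)] H_def)
      also have "\<dots> = (\<integral>z. (H (x + \<epsilon> *\<^sub>R z) - H x) * k z \<partial>lborel)"
        using int schwartz_integrable[OF k(1)] k(2) by (simp add: left_diff_distrib)
      finally have eq: "dpart ds (\<lambda>x. (\<integral>z. h (x + \<epsilon> *\<^sub>R z) * k z \<partial>lborel) - h x) x = (\<integral>z. (H (x + \<epsilon> *\<^sub>R z) - H x) * k z \<partial>lborel)" .
      define r where "r = (1 + norm x) ^ m"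
      have r: "r \<ge> 0" by (simp add: r_def)
      have "r * norm (\<integral>z. (H (x + \<epsilon> *\<^sub>R z) - H x) * k z \<partial>lborel) = norm (\<integral>z. complex_of_real r * ((H (x + \<epsilon> *\<^sub>R z) - H x) * k z) \<partial>lborel)"
        using r by (simp add: norm_mult)
      also have "\<dots> \<le> (\<integral>z. (C * \<epsilon>) * ((1 + norm z) ^ Suc (2 * m) * norm (k z)) \<partial>lborel)"
      proof (rule Bochner_Integration.integral_norm_bound_integral)
        show "integrable lborel (\<lambda>z. complex_of_real r * ((H (x + \<epsilon> *\<^sub>R z) - H x) * k z))"
          using int schwartz_integrable[OF k(1)] by (simp add: left_diff_distrib)
        show "integrable lborel (\<lambda>z. (C * \<epsilon>) * ((1 + norm z) ^ Suc (2 * m) * norm (k z)))"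
          using schwartz_integrable_pow[OF k(1), of "Suc (2 * m)"] by (rule integrable_mult_right)
        fix z
        have "r * norm (H (x + \<epsilon> *\<^sub>R z) - H x) \<le> C * norm (\<epsilon> *\<^sub>R z) * (1 + norm (\<epsilon> *\<^sub>R z)) ^ (2 * m)"
          unfolding r_def by (rule C)
        also have "\<dots> \<le> C * (\<epsilon> * (1 + norm z)) * (1 + norm z) ^ (2 * m)"
          using C(1) \<epsilon> by (intro mult_mono mult_left_mono power_mono) (auto intro: mult_left_le_one_le)
        finally have "(r * norm (H (x + \<epsilon> *\<^sub>R z) - H x)) * norm (k z) \<le> C * (\<epsilon> * (1 + norm z)) * (1 + norm z) ^ (2 * m) * norm (k z)"
          by (rule mult_right_mono) simp
        then show "norm (complex_of_real r * ((H (x + \<epsilon> *\<^sub>R z) - H x) * k z)) \<le> (C * \<epsilon>) * ((1 + norm z) ^ Suc (2 * m) * norm (k z))"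
          using r by (simp add: norm_mult mult_ac)
      qed
      also have "\<dots> = C * J * \<epsilon>" by (simp add: J_def)
      finally show "(1 + norm x) ^ m * norm (dpart ds (\<lambda>x. (\<integral>z. h (x + \<epsilon> *\<^sub>R z) * k z \<partial>lborel) - h x) x) \<le> C * J * \<epsilon>"
        unfolding eq r_def .
    qed
  qed
qed

section \<open>Convergence of the Littlewood--Paley expansion\<close>

context littlewood_paley
begin

text \<open>The expansion property that the iteration needs from S'_h. It fails for nonzero
  polynomials, whose blocks all vanish.\<close>

definition rec :: "'n distr \<Rightarrow> bool" where
  "rec T \<longleftrightarrow> dlin T \<and> (\<forall>\<psi>\<in>schwartz. (\<lambda>N. \<Sum>j\<in>{- int N..int N}. fmult (phi j) T \<psi>) \<longlonglongrightarrow> T \<psi>)"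

text \<open>On the test function the cut-off is an average with kernel \<open>ift low\<close> at
  scale \<open>2 powr (- N)\<close>. By \<open>seminorm_average\<close> the error is of that order
  in each of the finitely many seminorms that control \<open>T\<close>.\<close>

lemma fmult_scaled_low_tendsto:
  assumes T: "tempered T" and \<psi>: "\<psi> \<in> schwartz"
  shows "(\<lambda>N. fmult (\<lambda>\<xi>. low ((2 powr (- real N)) *\<^sub>R \<xi>)) T \<psi>) \<longlonglongrightarrow> T \<psi>"
proof -
  define k where "k = ift low"
  have k: "k \<in> schwartz" "(\<integral>z. k z \<partial>lborel) = 1"
    using schwartz_ift[OF low_schwartz] ift_low_integral by (auto simp: k_def)
  have low_s: "(\<lambda>\<xi>. low (\<epsilon> *\<^sub>R \<xi>)) \<in> schwartz" if "\<epsilon> \<noteq> 0" for \<epsilon> :: real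
    by (rule schwartz_scale[OF low_schwartz that])
  have avp: "ft (\<lambda>\<xi>. low (\<epsilon> *\<^sub>R \<xi>) * ift \<psi> \<xi>) = (\<lambda>x. \<integral>z. \<psi> (x + \<epsilon> *\<^sub>R z) * k z \<partial>lborel)" if \<epsilon>: "\<epsilon> > 0" for \<epsilon> :: real
  proof
    fix x
    have "ft (\<lambda>\<xi>. low (\<epsilon> *\<^sub>R \<xi>) * ift \<psi> \<xi>) x = (\<integral>y. \<psi> y * (complex_of_real (1 / \<epsilon> ^ CARD('n)) * k ((1 / \<epsilon>) *\<^sub>R (y - x))) \<partial>lborel)"
      using \<epsilon> by (subst ft_mult_ift[OF low_s \<psi>]) (simp_all add: ift_scale[OF \<epsilon>] k_def)
    also have "\<dots> = (\<epsilon> ^ CARD('n)) *\<^sub>R (\<integral>z. \<psi> (x + \<epsilon> *\<^sub>R z) * (complex_of_real (1 / \<epsilon> ^ CARD('n)) * k ((1 / \<epsilon>) *\<^sub>R ((x + \<epsilon> *\<^sub>R z) - x))) \<partial>lborel)"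
      by (subst lborel_affine_integral_eq[where c = \<epsilon> and t = x and f = "\<lambda>y. \<psi> y * (complex_of_real (1 / \<epsilon> ^ CARD('n)) * k ((1 / \<epsilon>) *\<^sub>R (y - x)))"])
         (use \<epsilon> in simp_all)
    also have "\<dots> = (\<integral>z. (\<epsilon> ^ CARD('n)) *\<^sub>R (\<psi> (x + \<epsilon> *\<^sub>R z) * (complex_of_real (1 / \<epsilon> ^ CARD('n)) * k ((1 / \<epsilon>) *\<^sub>R ((x + \<epsilon> *\<^sub>R z) - x)))) \<partial>lborel)"
      by (simp only: integral_scaleR_right)
    also have "\<dots> = (\<integral>z. \<psi> (x + \<epsilon> *\<^sub>R z) * k z \<partial>lborel)"
      using \<epsilon> by (intro Bochner_Integration.integral_cong refl) (simp add: scaleR_conv_of_real[where 'a = complex])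
    finally show "ft (\<lambda>\<xi>. low (\<epsilon> *\<^sub>R \<xi>) * ift \<psi> \<xi>) x = (\<integral>z. \<psi> (x + \<epsilon> *\<^sub>R z) * k z \<partial>lborel)" .
  qed
  have av: "(\<lambda>x. \<integral>z. \<psi> (x + \<epsilon> *\<^sub>R z) * k z \<partial>lborel) \<in> schwartz" if "\<epsilon> > 0" for \<epsilon> :: real
    using schwartz_ft_mult_ift[OF low_s \<psi>, of \<epsilon>] that unfolding avp[OF that] by simp
  obtain C0 N0 where T0: "\<And>f. f \<in> schwartz \<Longrightarrow> norm (T f) \<le> C0 * (\<Sum>m\<le>N0. \<Sum>ds\<in>{ds::'n list. length ds \<le> N0}. seminorm m ds f)"
    and lin: "dlin T" using T unfolding tempered_def dlin_def by blast
  have ex: "\<exists>C. \<forall>\<epsilon>. 0 < \<epsilon> \<and> \<epsilon> \<le> 1 \<longrightarrow> seminorm m ds (\<lambda>x. (\<integral>z. \<psi> (x + \<epsilon> *\<^sub>R z) * k z \<partial>lborel) - \<psi> x) \<le> C * \<epsilon>" for m ds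
    by (rule seminorm_average[OF \<psi> k av])
  define C where "C m ds = (SOME C. \<forall>\<epsilon>. 0 < \<epsilon> \<and> \<epsilon> \<le> 1 \<longrightarrow> seminorm m ds (\<lambda>x. (\<integral>z. \<psi> (x + \<epsilon> *\<^sub>R z) * k z \<partial>lborel) - \<psi> x) \<le> C * \<epsilon>)" for m ds
  have C: "seminorm m ds (\<lambda>x. (\<integral>z. \<psi> (x + \<epsilon> *\<^sub>R z) * k z \<partial>lborel) - \<psi> x) \<le> C m ds * \<epsilon>" if "0 < \<epsilon>" "\<epsilon> \<le> 1" for m ds \<epsilon>
    using someI_ex[OF ex[of m ds]] that unfolding C_def by blast
  define S where "S = (\<Sum>m\<le>N0. \<Sum>ds\<in>{ds::'n list. length ds \<le> N0}. C m ds)"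
  have bound: "norm (fmult (\<lambda>\<xi>. low (\<epsilon> *\<^sub>R \<xi>)) T \<psi> - T \<psi>) \<le> \<bar>C0\<bar> * S * \<epsilon>" if \<epsilon>: "0 < \<epsilon>" "\<epsilon> \<le> 1" for \<epsilon> :: real
  proof -
    let ?f = "\<lambda>x. (\<integral>z. \<psi> (x + \<epsilon> *\<^sub>R z) * k z \<partial>lborel) - \<psi> x"
    have f: "?f \<in> schwartz" by (rule schwartz_diff[OF av[OF \<epsilon>(1)] \<psi>])
    have "fmult (\<lambda>\<xi>. low (\<epsilon> *\<^sub>R \<xi>)) T \<psi> - T \<psi> = T ?f"
      unfolding fmult_eq avp[OF \<epsilon>(1)] by (rule dlin_diff[OF lin av[OF \<epsilon>(1)] \<psi>, symmetric])
    also have "norm \<dots> \<le> C0 * (\<Sum>m\<le>N0. \<Sum>ds\<in>{ds::'n list. length ds \<le> N0}. seminorm m ds ?f)" by (rule T0[OF f])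
    also have "\<dots> \<le> \<bar>C0\<bar> * (\<Sum>m\<le>N0. \<Sum>ds\<in>{ds::'n list. length ds \<le> N0}. seminorm m ds ?f)"
      by (intro mult_right_mono sum_nonneg seminorm_nonneg f) auto
    also have "\<dots> \<le> \<bar>C0\<bar> * (\<Sum>m\<le>N0. \<Sum>ds\<in>{ds::'n list. length ds \<le> N0}. C m ds * \<epsilon>)"
      by (intro mult_left_mono sum_mono C \<epsilon>) auto
    also have "\<dots> = \<bar>C0\<bar> * S * \<epsilon>" by (simp add: S_def sum_distrib_right)
    finally show ?thesis .
  qed
  have "(\<lambda>N. \<bar>C0\<bar> * S * 2 powr (- real N)) \<longlonglongrightarrow> \<bar>C0\<bar> * S * 0"
    by (intro tendsto_mult tendsto_const) real_asymp
  then have "(\<lambda>N. \<bar>C0\<bar> * S * 2 powr (- real N)) \<longlonglongrightarrow> 0" by simp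
  then have "(\<lambda>N. fmult (\<lambda>\<xi>. low ((2 powr (- real N)) *\<^sub>R \<xi>)) T \<psi> - T \<psi>) \<longlonglongrightarrow> 0"
    by (rule Lim_null_comparison[rotated]) (auto intro!: always_eventually bound simp: powr_minus inverse_le_1_iff ge_one_powr_ge_zero)
  then show ?thesis by (rule LIM_zero_cancel)
qed

lemma dnorm_inf_less_AE:
  assumes "dnorm_inf T < ereal \<eta>" shows "represents (rep T) T" "AE x in lborel. norm (rep T x) \<le> \<eta>"
proof -
  show r: "represents (rep T) T"
    using assms represents_rep unfolding dnorm_inf_def by (auto split: if_splits)
  then have less: "esssup lborel (\<lambda>x. ereal (norm (rep T x))) < ereal \<eta>"
    using assms unfolding dnorm_inf_def by (auto split: if_splits)
  show "AE x in lborel. norm (rep T x) \<le> \<eta>"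
    using esssup_AE[of "\<lambda>x. ereal (norm (rep T x))" lborel]
  proof eventually_elim
    case (elim x)
    then show ?case
      using le_less_trans[OF elim less] by simp
  qed
qed

lemma dnorm_inf_tendsto_pairing:
  assumes lim: "(\<lambda>N. dnorm_inf (S N)) \<longlonglongrightarrow> 0" and \<psi>: "\<psi> \<in> schwartz"
  shows "(\<lambda>N. S N \<psi>) \<longlonglongrightarrow> 0"
proof (rule LIMSEQ_I)
  fix r :: real assume r: "r > 0"
  define J where "J = (\<integral>x. norm (\<psi> x) \<partial>lborel) + 1"
  have J: "J > 0" unfolding J_def by (intro add_nonneg_pos integral_nonneg_AE) auto
  have "\<forall>\<^sub>F N in sequentially. dnorm_inf (S N) < ereal (r / J)"
    using lim r J by (intro order_tendstoD(2)[OF lim]) auto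
  then obtain N0 where N0: "\<And>N. N \<ge> N0 \<Longrightarrow> dnorm_inf (S N) < ereal (r / J)" by (auto simp: eventually_sequentially)
  have "norm (S N \<psi> - 0) < r" if "N \<ge> N0" for N
  proof -
    note R = dnorm_inf_less_AE[OF N0[OF that]]
    have [measurable]: "rep (S N) \<in> borel_measurable borel" "\<psi> \<in> borel_measurable borel"
      using R(1) schwartz_measurable[OF \<psi>] by (auto simp: represents_def)
    have "norm (S N \<psi>) = norm (\<integral>x. rep (S N) x * \<psi> x \<partial>lborel)" using R(1) \<psi> by (simp add: represents_def)
    also have "\<dots> \<le> (\<integral>x. norm (rep (S N) x * \<psi> x) \<partial>lborel)" by (rule integral_norm_bound)
    also have "\<dots> \<le> (\<integral>x. (r / J) * norm (\<psi> x) \<partial>lborel)"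
    proof (rule integral_mono_AE)
      show "integrable lborel (\<lambda>x. norm (rep (S N) x * \<psi> x))" using R(1) \<psi> by (intro integrable_norm) (simp add: represents_def)
      show "AE x in lborel. norm (rep (S N) x * \<psi> x) \<le> (r / J) * norm (\<psi> x)"
        using R(2) by eventually_elim (simp only: norm_mult mult_right_mono norm_ge_zero)
    qed (use schwartz_integrable[OF \<psi>] in auto)
    also have "\<dots> = (r / J) * (J - 1)" by (simp add: J_def)
    also have "\<dots> < r" using r J by (simp add: field_simps)
    finally show ?thesis by simp
  qed
  then show "\<exists>N0. \<forall>N\<ge>N0. norm (S N \<psi> - 0) < r" by blast
qed

text \<open>By \<open>low_diff\<close> a symmetric partial sum is the difference of two
  low-frequency cut-offs. The first tends to \<open>T\<close> by continuity, the second to 0 by the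
  definition of S'_h with \<open>low\<close> as test symbol.\<close>

lemma Sh_rec:
  assumes "Sh T" shows "rec T"
  unfolding rec_def
proof (intro conjI ballI)
  have T: "tempered T" using assms by (simp add: Sh_def)
  then show lin: "dlin T" unfolding tempered_def dlin_def by blast
  fix \<psi> :: "real^'n \<Rightarrow> complex" assume \<psi>: "\<psi> \<in> schwartz"
  have low_s: "(\<lambda>\<xi>. low (\<epsilon> *\<^sub>R \<xi>)) \<in> schwartz" if "\<epsilon> \<noteq> 0" for \<epsilon> :: real
    by (rule schwartz_scale[OF low_schwartz that])
  have eq: "(\<Sum>j\<in>{- int N..int N}. fmult (phi j) T \<psi>) =
      fmult (\<lambda>\<xi>. low ((2 powr (- real N)) *\<^sub>R \<xi>)) T \<psi> - fmult (\<lambda>\<xi>. low ((2 powr (real (Suc N))) *\<^sub>R \<xi>)) T \<psi>" for N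
  proof -
    have "(\<Sum>j\<in>{- int N..int N}. fmult (phi j) T \<psi>) = T (\<lambda>x. \<Sum>j\<in>{- int N..int N}. ft (\<lambda>\<xi>. phi j \<xi> * ift \<psi> \<xi>) x)"
      unfolding fmult_eq by (rule dlin_sum[OF lin, symmetric]) (rule schwartz_ft_mult_ift[OF phi_schwartz \<psi>])
    also have "(\<lambda>x. \<Sum>j\<in>{- int N..int N}. ft (\<lambda>\<xi>. phi j \<xi> * ift \<psi> \<xi>) x) = ft (\<lambda>\<xi>. \<Sum>j\<in>{- int N..int N}. phi j \<xi> * ift \<psi> \<xi>)"
      by (rule ft_sum[symmetric]) (intro schwartz_mult phi_schwartz schwartz_ift \<psi>)
    also have "\<dots> = ft (\<lambda>\<xi>. low ((2 powr (- real N)) *\<^sub>R \<xi>) * ift \<psi> \<xi> - low ((2 powr (real (Suc N))) *\<^sub>R \<xi>) * ift \<psi> \<xi>)"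
      unfolding sum_distrib_right[symmetric] low_diff left_diff_distrib ..
    also have "\<dots> = (\<lambda>x. ft (\<lambda>\<xi>. low ((2 powr (- real N)) *\<^sub>R \<xi>) * ift \<psi> \<xi>) x - ft (\<lambda>\<xi>. low ((2 powr (real (Suc N))) *\<^sub>R \<xi>) * ift \<psi> \<xi>) x)"
      by (rule ft_diff) (intro schwartz_mult low_s schwartz_ift \<psi>; simp)+
    also have "T \<dots> = T (ft (\<lambda>\<xi>. low ((2 powr (- real N)) *\<^sub>R \<xi>) * ift \<psi> \<xi>)) - T (ft (\<lambda>\<xi>. low ((2 powr (real (Suc N))) *\<^sub>R \<xi>) * ift \<psi> \<xi>))"
      by (rule dlin_diff[OF lin]) (intro schwartz_ft_mult_ift low_s \<psi>; simp)+
    finally show ?thesis by (simp only: fmult_eq)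
  qed
  have "filterlim (\<lambda>N. 2 powr (real (Suc N))) at_top sequentially" by real_asymp
  moreover have "((\<lambda>l::real. dnorm_inf (fmult (\<lambda>\<xi>. low (l *\<^sub>R \<xi>)) T)) \<longlongrightarrow> 0) at_top"
    using assms low_schwartz by (simp add: Sh_def)
  ultimately have "(\<lambda>N. dnorm_inf (fmult (\<lambda>\<xi>. low ((2 powr (real (Suc N))) *\<^sub>R \<xi>)) T)) \<longlonglongrightarrow> 0"
    by (rule filterlim_compose[rotated])
  then have "(\<lambda>N. fmult (\<lambda>\<xi>. low ((2 powr (real (Suc N))) *\<^sub>R \<xi>)) T \<psi>) \<longlonglongrightarrow> 0"
    by (rule dnorm_inf_tendsto_pairing[OF _ \<psi>])
  then show "(\<lambda>N. \<Sum>j\<in>{- int N..int N}. fmult (phi j) T \<psi>) \<longlonglongrightarrow> T \<psi>"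
    unfolding eq using tendsto_diff[OF fmult_scaled_low_tendsto[OF T \<psi>]] by fastforce
qed

end

section \<open>Functions of positive regularity as sums of their Littlewood--Paley blocks\<close>

text \<open>Symmetric partial sums become two one-sided ones, because low and high blocks converge
  in different norms and at different rates.\<close>

lemma sum_int_split:
  fixes f :: "int \<Rightarrow> 'b::comm_monoid_add"
  assumes "\<bar>l\<bar> \<le> int N"
  shows "(\<Sum>j\<in>{- int N..int N}. f j) = (\<Sum>k<nat (int N + l + 1). f (l - int k)) + (\<Sum>k<nat (int N - l). f (l + 1 + int k))"
proof -
  have "{- int N..int N} = {- int N..l} \<union> {l + 1..int N}" using assms by auto
  then have "(\<Sum>j\<in>{- int N..int N}. f j) = (\<Sum>j\<in>{- int N..l}. f j) + (\<Sum>j\<in>{l + 1..int N}. f j)"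
    by (simp add: sum.union_disjoint)
  also have "(\<Sum>j\<in>{- int N..l}. f j) = (\<Sum>k<nat (int N + l + 1). f (l - int k))"
    by (rule sum.reindex_bij_witness[of _ "\<lambda>k. l - int k" "\<lambda>j. nat (l - j)"]) auto
  also have "(\<Sum>j\<in>{l + 1..int N}. f j) = (\<Sum>k<nat (int N - l). f (l + 1 + int k))"
    by (rule sum.reindex_bij_witness[of _ "\<lambda>k. l + 1 + int k" "\<lambda>j. nat (j - l - 1)"]) auto
  finally show ?thesis .
qed

lemma filterlim_nat_shift: "filterlim (\<lambda>N. nat (int N + l)) at_top sequentially"
  unfolding filterlim_at_top eventually_sequentially
proof
  fix Z :: nat
  show "\<exists>N. \<forall>n\<ge>N. Z \<le> nat (int n + l)" by (rule exI[of _ "nat (int Z + \<bar>l\<bar>)"]) auto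
qed

lemma powr2_geometric:
  fixes a :: real assumes "a > 0"
  shows "(\<lambda>k. 2 powr (- real k * a)) sums (1 / (1 - 2 powr (- a)))" and "(2::real) powr (- a) < 1"
proof -
  show l: "(2::real) powr (- a) < 1" using assms powr_less_mono[of "- a" 0 "2::real"] by simp
  have "2 powr (- real k * a) = (2 powr (- a)) ^ k" for k by (simp add: powr_power)
  then show "(\<lambda>k. 2 powr (- real k * a)) sums (1 / (1 - 2 powr (- a)))"
    using geometric_sums[of "2 powr (- a)"] l by simp
qed

lemma powr2_geometric_le: "a > 0 \<Longrightarrow> (\<Sum>k<N. 2 powr (- real k * a)) \<le> 1 / (1 - 2 powr (- a))"
  using sum_le_suminf[OF sums_summable[OF powr2_geometric(1)[of a]], of "{..<N}"] sums_unique[OF powr2_geometric(1)[of a]]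
  by simp

text \<open>The pairing is a convolution with the reflected \<open>\<psi>\<close>, evaluated at 0.
  The free height of \<open>cnv_sup_bound\<close> is set to the norm bound \<open>t\<close>, which
  makes both terms linear in it.\<close>

lemma Lpb_pairing:
  fixes w \<psi> :: "real^'n::finite \<Rightarrow> complex"
  assumes w: "Lpb p t w" "p \<ge> 1" "t > 0" and \<psi>: "\<psi> \<in> schwartz" "\<And>x. norm (\<psi> x) \<le> M"
  shows "norm (\<integral>x. w x * \<psi> x \<partial>lborel) \<le> t * ((\<integral>x. norm (\<psi> x) \<partial>lborel) + M)"
proof -
  have "norm (cnv (\<lambda>x. \<psi> (- x)) w 0) \<le> t * (\<integral>x. norm (\<psi> (- x)) \<partial>lborel) + t powr (1 - p) * M * t powr p"
    by (rule cnv_sup_bound[OF schwartz_reflect[OF \<psi>(1)] _ w(1,2,3)]) (rule \<psi>)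
  moreover have "(\<integral>x. norm (\<psi> (- x)) \<partial>lborel) = (\<integral>x. norm (\<psi> x) \<partial>lborel)"
    using integral_minus(2)[of "\<lambda>x. norm (\<psi> x)" 0] by simp
  moreover have "t powr (1 - p) * M * t powr p = t * M" using w(3) by (simp add: powr_diff)
  ultimately have "norm (cnv (\<lambda>x. \<psi> (- x)) w 0) \<le> t * (\<integral>x. norm (\<psi> x) \<partial>lborel) + t * M" by (simp only:)
  then show ?thesis by (simp add: cnv_def mult.commute distrib_left)
qed

lemma bounded_pairing:
  fixes w \<psi> :: "real^'n::finite \<Rightarrow> complex"
  assumes w: "w \<in> borel_measurable borel" "AE x in lborel. norm (w x) \<le> B" and \<psi>: "\<psi> \<in> schwartz"
  shows "norm (\<integral>x. w x * \<psi> x \<partial>lborel) \<le> B * (\<integral>x. norm (\<psi> x) \<partial>lborel)"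
  using cnv_bounded[OF schwartz_reflect[OF \<psi>] w, of 0] integral_minus(2)[of "\<lambda>x. norm (\<psi> x)" 0]
  by (simp add: cnv_def mult.commute)

text \<open>The sum of the norms is itself in \<open>L\<^sup>p\<close>, hence an integrable majorant
  once multiplied by \<open>\<psi>\<close>.\<close>

lemma Lpb_suminf_pairing:
  fixes f :: "nat \<Rightarrow> real^'n::finite \<Rightarrow> complex"
  assumes f: "\<And>i. Lpb p (A i) (f i)" and A: "\<And>i. A i \<ge> 0" "summable A" and p: "p \<ge> 1" and \<psi>: "\<psi> \<in> schwartz"
  shows "(\<lambda>i. \<integral>x. f i x * \<psi> x \<partial>lborel) sums (\<integral>x. (\<Sum>i. f i x) * \<psi> x \<partial>lborel)"
  unfolding sums_def
proof -
  have [measurable]: "f i \<in> borel_measurable borel" for i using f by (rule Lpb_measurable)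
  have [measurable]: "\<psi> \<in> borel_measurable borel" by (rule schwartz_measurable[OF \<psi>])
  note L = Lpb_suminf[OF f A p]
  define H where "H x = (\<Sum>i. norm (f i x))" for x
  have H: "Lpb p (\<Sum>i. A i) H" unfolding H_def by (rule L(2))
  have [measurable]: "H \<in> borel_measurable borel" using H by (rule Lpb_measurable)
  have "Lpb p (\<Sum>i. A i) (\<lambda>x. complex_of_real (H x))"
    by (rule Lpb_le_AE[OF H]) (use p in auto)
  then have iH: "integrable lborel (\<lambda>x. complex_of_real (H x) * \<psi> x)"
    using Lpb_moderate[OF _ p] moderate_schwartz_integrable[OF _ \<psi>] by blast
  have "(\<lambda>N. \<integral>x. (\<Sum>i<N. f i x) * \<psi> x \<partial>lborel) \<longlonglongrightarrow> (\<integral>x. (\<Sum>i. f i x) * \<psi> x \<partial>lborel)"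
  proof (rule integral_dominated_convergence[of _ _ _ "\<lambda>x. norm (complex_of_real (H x) * \<psi> x)"])
    show "AE x in lborel. (\<lambda>N. (\<Sum>i<N. f i x) * \<psi> x) \<longlonglongrightarrow> (\<Sum>i. f i x) * \<psi> x"
      using L(1)
    proof eventually_elim
      case (elim x)
      show ?case
        by (rule tendsto_mult[OF summable_LIMSEQ[OF summable_norm_cancel[OF elim]] tendsto_const])
    qed
    show "AE x in lborel. norm ((\<Sum>i<N. f i x) * \<psi> x) \<le> norm (complex_of_real (H x) * \<psi> x)" for N
      using L(1)
    proof eventually_elim
      case (elim x)
      have "norm (\<Sum>i<N. f i x) \<le> (\<Sum>i<N. norm (f i x))" by (rule norm_sum)
      also have "\<dots> \<le> H x" unfolding H_def by (rule sum_le_suminf[OF elim]) auto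
      finally show ?case unfolding norm_mult by (intro mult_right_mono) auto
    qed
    show "integrable lborel (\<lambda>x. norm (complex_of_real (H x) * \<psi> x))" using iH by (rule integrable_norm)
  qed measurable
  moreover have "(\<integral>x. (\<Sum>i<N. f i x) * \<psi> x \<partial>lborel) = (\<Sum>i<N. \<integral>x. f i x * \<psi> x \<partial>lborel)" for N
    unfolding sum_distrib_right
    by (intro Bochner_Integration.integral_sum moderate_schwartz_integrable[OF Lpb_moderate[OF f p] \<psi>])
  ultimately show "(\<lambda>N. \<Sum>i<N. \<integral>x. f i x * \<psi> x \<partial>lborel) \<longlonglongrightarrow> (\<integral>x. (\<Sum>i. f i x) * \<psi> x \<partial>lborel)"
    by (simp only:)
qed

context littlewood_paley
begin

text \<open>Frequency localisation expressed on densities: convolution with the kernel of the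
  fattened block reproduces \<open>w j\<close>.\<close>

definition band :: "(int \<Rightarrow> real^'n \<Rightarrow> complex) \<Rightarrow> bool" where
  "band w \<longleftrightarrow> (\<forall>j. AE x in lborel. w j x = cnv (ift (phit j)) (w j) x)"

definition blocks :: "real \<Rightarrow> real \<Rightarrow> real \<Rightarrow> (int \<Rightarrow> real^'n \<Rightarrow> complex) \<Rightarrow> bool" where
  "blocks p s A w \<longleftrightarrow> (\<forall>j. Lpb p (A * 2 powr (- real_of_int j * s)) (w j))"

lemma phit_dil: "ift (phit j) = dil j (ift (phit 0))"
proof -
  have "ift (phit j) = ift (\<lambda>\<xi>. phit 0 ((2 powr (- real_of_int j)) *\<^sub>R \<xi>))"
    by (rule arg_cong[where f = ift], rule ext, rule phit_scale)
  then show ?thesis by (simp only: ift_dil)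
qed

text \<open>Bernstein's inequality, from the reproducing kernel and \<open>cnv_sup_bound\<close>.
  The height \<open>t\<close> is the expected size of the block, which turns the two terms of that
  bound into \<open>J * t\<close> and \<open>M * t\<close>.\<close>

lemma band_sup_bound:
  assumes p: "p \<ge> 1"
  obtains C where "C > 0" "\<And>A w j. A > 0 \<Longrightarrow> blocks p s A w \<Longrightarrow> band w \<Longrightarrow>
    AE x in lborel. norm (w j x) \<le> C * A * 2 powr (real_of_int j * (CARD('n) / p - s))"
proof -
  define k where "k = ift (phit 0)"
  have k: "k \<in> schwartz" unfolding k_def by (intro schwartz_ift phit_schwartz)
  obtain M where M: "M > 0" "\<And>x. norm (k x) \<le> M" using schwartz_bound[OF k, of 0] by auto
  define J where "J = (\<integral>x. norm (k x) \<partial>lborel)"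
  have J: "J \<ge> 0" unfolding J_def by (rule integral_nonneg_AE) simp
  show ?thesis
  proof
    show "J + M > 0" using J M by simp
    fix A w j assume A: "A > 0" and w: "blocks p s A w" and b: "band w"
    define t where "t = A * 2 powr (real_of_int j * (CARD('n) / p - s))"
    have t: "t > 0" using A by (simp add: t_def)
    have "norm (cnv (dil j k) (w j) x) \<le> (J + M) * t" for x
    proof -
      have "norm (cnv (dil j k) (w j) x) \<le> t * (\<integral>x. norm (dil j k x) \<partial>lborel) + t powr (1 - p) * (2 powr (real_of_int j * CARD('n)) * M) * (A * 2 powr (- real_of_int j * s)) powr p"
        by (rule cnv_sup_bound[OF dil_schwartz[OF k] dil_bound[OF M(2)] _ p t]) (use w in \<open>simp add: blocks_def\<close>)
      also have "t powr (1 - p) * (2 powr (real_of_int j * CARD('n)) * M) * (A * 2 powr (- real_of_int j * s)) powr p = M * t"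
      proof -
        have "2 powr (real_of_int j * CARD('n)) * (A * 2 powr (- real_of_int j * s)) powr p = A powr p * (2 powr (real_of_int j * CARD('n)) * 2 powr (- real_of_int j * s * p))"
          using A by (simp add: powr_mult powr_powr)
        also have "\<dots> = A powr p * 2 powr (real_of_int j * (CARD('n) / p - s) * p)"
        proof -
          have e: "real_of_int j * CARD('n) + - real_of_int j * s * p = real_of_int j * (CARD('n) / p - s) * p"
            using p by (simp add: field_simps)
          show ?thesis unfolding powr_add[symmetric] e ..
        qed
        also have "\<dots> = t powr p" using A by (simp only: t_def powr_mult powr_powr powr_ge_zero less_imp_le)
        finally have "2 powr (real_of_int j * CARD('n)) * (A * 2 powr (- real_of_int j * s)) powr p = t powr p" .
        then have "t powr (1 - p) * (2 powr (real_of_int j * CARD('n)) * M) * (A * 2 powr (- real_of_int j * s)) powr p = M * (t powr (1 - p) * t powr p)"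
          by (simp only: mult_ac)
        also have "t powr (1 - p) * t powr p = t" using t by (simp add: powr_add[symmetric])
        finally show ?thesis .
      qed
      finally show ?thesis by (simp add: dil_integral J_def algebra_simps)
    qed
    moreover have "AE x in lborel. w j x = cnv (dil j k) (w j) x"
      using b unfolding k_def phit_dil[of j, symmetric] band_def by blast
    ultimately show "AE x in lborel. norm (w j x) \<le> (J + M) * A * 2 powr (real_of_int j * (CARD('n) / p - s))"
      unfolding t_def mult.assoc[symmetric] by (auto elim: eventually_mono)
  qed
qed

text \<open>The blocks of frequency at most \<open>2 ^ l\<close> are summed in \<open>L\<^sup>\<infinity>\<close>, the others in \<open>L\<^sup>p\<close>.\<close>

lemma block_sum:
  fixes w :: "int \<Rightarrow> real^'n \<Rightarrow> complex"
  assumes p: "p \<ge> 1" and s: "s > 0" and \<alpha>: "\<alpha> > 0" and A: "A > 0" and C: "C > 0"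
    and w: "blocks p s A w" and sup: "\<And>j. AE x in lborel. norm (w j x) \<le> C * A * 2 powr (real_of_int j * \<alpha>)"
  defines "G1 \<equiv> \<lambda>l x. \<Sum>k. w (l - int k) x" and "G2 \<equiv> \<lambda>l x. \<Sum>k. w (l + 1 + int k) x"
  shows "G1 l \<in> borel_measurable borel"
    and "AE x in lborel. norm (G1 l x) \<le> C / (1 - 2 powr (- \<alpha>)) * A * 2 powr (real_of_int l * \<alpha>)"
    and "Lpb p (2 powr (- s) / (1 - 2 powr (- s)) * A * 2 powr (- real_of_int l * s)) (G2 l)"
    and "\<psi> \<in> schwartz \<Longrightarrow> (\<lambda>N. \<Sum>j\<in>{- int N..int N}. \<integral>x. w j x * \<psi> x \<partial>lborel) \<longlonglongrightarrow> (\<integral>x. (G1 l x + G2 l x) * \<psi> x \<partial>lborel)"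
proof -
  have wL: "Lpb p (A * 2 powr (- real_of_int j * s)) (w j)" for j using w by (simp add: blocks_def)
  have [measurable]: "w j \<in> borel_measurable borel" for j using wL by (rule Lpb_measurable)
  have wmod: "moderate (w j)" for j by (rule Lpb_moderate[OF wL p])
  show m1: "G1 l \<in> borel_measurable borel" unfolding G1_def by measurable
  have m2: "G2 l \<in> borel_measurable borel" unfolding G2_def by measurable
  let ?B = "C / (1 - 2 powr (- \<alpha>)) * A * 2 powr (real_of_int l * \<alpha>)"
  have s1: "(\<lambda>k. C * A * 2 powr (real_of_int (l - int k) * \<alpha>)) sums ?B"
  proof -
    have e: "C * A * 2 powr (real_of_int (l - int k) * \<alpha>) = (C * A * 2 powr (real_of_int l * \<alpha>)) * 2 powr (- real k * \<alpha>)" for k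
      by (simp add: left_diff_distrib powr_diff powr_minus_divide)
    show ?thesis unfolding e using sums_mult[OF powr2_geometric(1)[OF \<alpha>], of "C * A * 2 powr (real_of_int l * \<alpha>)"] by (simp add: mult_ac)
  qed
  have ae1: "AE x in lborel. \<forall>k. norm (w (l - int k) x) \<le> C * A * 2 powr (real_of_int (l - int k) * \<alpha>)"
    unfolding AE_all_countable by (intro allI sup)
  have part1: "norm (\<Sum>k<N. w (l - int k) x) \<le> ?B \<and> (\<lambda>N. \<Sum>k<N. w (l - int k) x) \<longlonglongrightarrow> G1 l x \<and> norm (G1 l x) \<le> ?B"
    if "\<forall>k. norm (w (l - int k) x) \<le> C * A * 2 powr (real_of_int (l - int k) * \<alpha>)" for x N
  proof -
    have summ: "summable (\<lambda>k. w (l - int k) x)"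
      by (rule summable_comparison_test[OF _ sums_summable[OF s1]]) (use that in auto)
    have b: "norm (\<Sum>k<M. w (l - int k) x) \<le> ?B" for M
    proof -
      have "norm (\<Sum>k<M. w (l - int k) x) \<le> (\<Sum>k<M. C * A * 2 powr (real_of_int (l - int k) * \<alpha>))"
        by (rule sum_norm_le) (use that in auto)
      also have "\<dots> \<le> (\<Sum>k. C * A * 2 powr (real_of_int (l - int k) * \<alpha>))"
        by (rule sum_le_suminf[OF sums_summable[OF s1]]) (use A C in auto)
      finally show ?thesis using sums_unique[OF s1] by simp
    qed
    have lim: "(\<lambda>N. \<Sum>k<N. w (l - int k) x) \<longlonglongrightarrow> G1 l x"
      using summable_LIMSEQ[OF summ] by (simp add: G1_def)
    then have "norm (G1 l x) \<le> ?B"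
      by (rule Lim_bounded[OF tendsto_norm, of _ _ 0]) (use b in auto)
    then show ?thesis using b lim by blast
  qed
  show b1: "AE x in lborel. norm (G1 l x) \<le> ?B"
    using ae1 by eventually_elim (use part1 in blast)
  let ?D = "2 powr (- s) / (1 - 2 powr (- s)) * A * 2 powr (- real_of_int l * s)"
  have s2: "(\<lambda>k. A * 2 powr (- real_of_int (l + 1 + int k) * s)) sums ?D"
  proof -
    have e: "A * 2 powr (- real_of_int (l + 1 + int k) * s) = (2 powr (- s) * A * 2 powr (- real_of_int l * s)) * 2 powr (- real k * s)" for k
      by (simp add: powr_add[symmetric] algebra_simps)
    show ?thesis unfolding e using sums_mult[OF powr2_geometric(1)[OF s], of "2 powr (- s) * A * 2 powr (- real_of_int l * s)"] by (simp add: mult_ac)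
  qed
  note L2 = Lpb_suminf[where f = "\<lambda>k. w (l + 1 + int k)", OF wL _ sums_summable[OF s2] p, folded sums_unique[OF s2]]
  have A0: "0 \<le> A * 2 powr (- real_of_int (l + 1 + int k) * s)" for k using A by simp
  show g2: "Lpb p ?D (G2 l)" unfolding G2_def by (rule L2(3)[OF A0])
  assume \<psi>: "\<psi> \<in> schwartz"
  have [measurable]: "\<psi> \<in> borel_measurable borel" by (rule schwartz_measurable[OF \<psi>])
  have int: "integrable lborel (\<lambda>x. w j x * \<psi> x)" for j by (rule moderate_schwartz_integrable[OF wmod \<psi>])
  have lim1: "(\<lambda>N. \<Sum>k<N. \<integral>x. w (l - int k) x * \<psi> x \<partial>lborel) \<longlonglongrightarrow> (\<integral>x. G1 l x * \<psi> x \<partial>lborel)"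
  proof -
    have "(\<lambda>N. \<integral>x. (\<Sum>k<N. w (l - int k) x) * \<psi> x \<partial>lborel) \<longlonglongrightarrow> (\<integral>x. G1 l x * \<psi> x \<partial>lborel)"
    proof (rule integral_dominated_convergence[of _ _ _ "\<lambda>x. ?B * norm (\<psi> x)"])
      show "AE x in lborel. (\<lambda>N. (\<Sum>k<N. w (l - int k) x) * \<psi> x) \<longlonglongrightarrow> G1 l x * \<psi> x"
        using ae1
      proof eventually_elim
        case (elim x)
        show ?case by (rule tendsto_mult[OF _ tendsto_const]) (use part1[OF elim] in blast)
      qed
      show "AE x in lborel. norm ((\<Sum>k<N. w (l - int k) x) * \<psi> x) \<le> ?B * norm (\<psi> x)" for N
        using ae1
      proof eventually_elim
        case (elim x)
        then show ?case using part1[OF elim, of N] unfolding norm_mult by (intro mult_right_mono) auto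
      qed
    qed (use m1 schwartz_integrable[OF \<psi>] in auto)
    moreover have "(\<integral>x. (\<Sum>k<N. w (l - int k) x) * \<psi> x \<partial>lborel) = (\<Sum>k<N. \<integral>x. w (l - int k) x * \<psi> x \<partial>lborel)" for N
      unfolding sum_distrib_right using int by (intro Bochner_Integration.integral_sum) auto
    ultimately show ?thesis by (simp only:)
  qed
  have lim2: "(\<lambda>N. \<Sum>k<N. \<integral>x. w (l + 1 + int k) x * \<psi> x \<partial>lborel) \<longlonglongrightarrow> (\<integral>x. G2 l x * \<psi> x \<partial>lborel)"
    unfolding G2_def sums_def[symmetric]
    by (rule Lpb_suminf_pairing[OF wL A0 sums_summable[OF s2] p \<psi>])
  have iG: "integrable lborel (\<lambda>x. G1 l x * \<psi> x)" "integrable lborel (\<lambda>x. G2 l x * \<psi> x)"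
    using moderate_schwartz_integrable[OF moderate_bounded[OF m1 b1] \<psi>]
      moderate_schwartz_integrable[OF Lpb_moderate[OF g2 p] \<psi>] by auto
  have "(\<lambda>N. (\<Sum>k<nat (int N + (l + 1)). \<integral>x. w (l - int k) x * \<psi> x \<partial>lborel) + (\<Sum>k<nat (int N + (- l)). \<integral>x. w (l + 1 + int k) x * \<psi> x \<partial>lborel))
      \<longlonglongrightarrow> (\<integral>x. G1 l x * \<psi> x \<partial>lborel) + (\<integral>x. G2 l x * \<psi> x \<partial>lborel)"
    by (intro tendsto_add filterlim_compose[OF lim1] filterlim_compose[OF lim2] filterlim_nat_shift)
  \<comment> \<open>Once \<open>N\<close> is at least \<open>\<bar>l\<bar>\<close>, the split at
    \<open>l\<close> is valid and both ranges have the right length.\<close>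
  moreover have "\<forall>\<^sub>F N in sequentially. (\<Sum>k<nat (int N + (l + 1)). \<integral>x. w (l - int k) x * \<psi> x \<partial>lborel) + (\<Sum>k<nat (int N + (- l)). \<integral>x. w (l + 1 + int k) x * \<psi> x \<partial>lborel)
       = (\<Sum>j\<in>{- int N..int N}. \<integral>x. w j x * \<psi> x \<partial>lborel)"
    unfolding eventually_sequentially
    by (rule exI[of _ "nat \<bar>l\<bar>"]) (auto simp: sum_int_split[of l] algebra_simps)
  ultimately have "(\<lambda>N. \<Sum>j\<in>{- int N..int N}. \<integral>x. w j x * \<psi> x \<partial>lborel) \<longlonglongrightarrow> (\<integral>x. G1 l x * \<psi> x \<partial>lborel) + (\<integral>x. G2 l x * \<psi> x \<partial>lborel)"
    by (rule Lim_transform_eventually)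
  then show "(\<lambda>N. \<Sum>j\<in>{- int N..int N}. \<integral>x. w j x * \<psi> x \<partial>lborel) \<longlonglongrightarrow> (\<integral>x. (G1 l x + G2 l x) * \<psi> x \<partial>lborel)"
    using iG by (simp add: distrib_right)
qed

text \<open>Uniformity in \<open>N\<close> and linearity in \<open>A\<close> are the point: the
  bound becomes the Tannery majorant when the block expansion is exchanged with a series of
  distributions. Low blocks are paired through their sup bounds, high ones through
  \<open>L\<^sup>p\<close>.\<close>

lemma pairing_uniform_bound:
  assumes p: "p \<ge> 1" and s: "0 < s" "s < CARD('n) / p" and \<psi>: "\<psi> \<in> schwartz"
  obtains c where "c > 0" "\<And>A w N. A > 0 \<Longrightarrow> blocks p s A w \<Longrightarrow> band w \<Longrightarrow>
     norm (\<Sum>j\<in>{- int N..int N}. \<integral>x. w j x * \<psi> x \<partial>lborel) \<le> c * A"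
proof -
  define \<alpha> where "\<alpha> = CARD('n) / p - s"
  have \<alpha>: "\<alpha> > 0" using s by (simp add: \<alpha>_def)
  obtain C where C: "C > 0" "\<And>A w j. A > 0 \<Longrightarrow> blocks p s A w \<Longrightarrow> band w \<Longrightarrow>
    AE x in lborel. norm (w j x) \<le> C * A * 2 powr (real_of_int j * \<alpha>)" using band_sup_bound[OF p] unfolding \<alpha>_def by metis
  obtain M where M: "M > 0" "\<And>x. norm (\<psi> x) \<le> M" using schwartz_bound[OF \<psi>, of 0] by auto
  define J where "J = (\<integral>x. norm (\<psi> x) \<partial>lborel)"
  have J: "J \<ge> 0" unfolding J_def by (rule integral_nonneg_AE) simp
  define c1 where "c1 = C * J * (1 / (1 - 2 powr (- \<alpha>)))"
  define c2 where "c2 = (J + M) * (1 / (1 - 2 powr (- s)))"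
  show ?thesis
  proof
    show "c1 + c2 > 0"
      using C J M powr2_geometric(2)[OF \<alpha>] powr2_geometric(2)[OF s(1)] unfolding c1_def c2_def
      by (intro add_nonneg_pos mult_nonneg_nonneg mult_pos_pos) auto
    fix A w N assume A: "A > 0" and w: "blocks p s A w" and b: "band w"
    have wL: "Lpb p (A * 2 powr (- real_of_int j * s)) (w j)" for j using w by (simp add: blocks_def)
    let ?I = "\<lambda>j. \<integral>x. w j x * \<psi> x \<partial>lborel"
    have I1: "norm (?I (0 - int k)) \<le> (C * A * J) * 2 powr (- real k * \<alpha>)" for k
      using bounded_pairing[OF Lpb_measurable[OF wL] C(2)[OF A w b] \<psi>, of "- int k"] by (simp add: J_def mult_ac)
    have I2: "norm (?I (0 + 1 + int k)) \<le> (A * (J + M)) * 2 powr (- real k * s)" for k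
    proof -
      have "norm (?I (1 + int k)) \<le> A * 2 powr (- real_of_int (1 + int k) * s) * (J + M)"
        unfolding J_def by (rule Lpb_pairing[OF wL p _ \<psi> M(2)]) (use A in simp)
      also have "\<dots> \<le> A * 2 powr (- real k * s) * (J + M)"
        using A J M s by (intro mult_right_mono mult_left_mono powr_mono) auto
      finally show ?thesis by (simp add: mult_ac)
    qed
    have "norm (\<Sum>j\<in>{- int N..int N}. ?I j) \<le> norm (\<Sum>k<nat (int N + 0 + 1). ?I (0 - int k)) + norm (\<Sum>k<nat (int N - 0). ?I (0 + 1 + int k))"
      by (subst sum_int_split[of 0]) (auto intro: norm_triangle_ineq)
    also have "\<dots> \<le> (\<Sum>k<nat (int N + 0 + 1). (C * A * J) * 2 powr (- real k * \<alpha>)) + (\<Sum>k<nat (int N - 0). (A * (J + M)) * 2 powr (- real k * s))"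
      by (intro add_mono sum_norm_le I1 I2)
    also have "\<dots> \<le> (C * A * J) * (1 / (1 - 2 powr (- \<alpha>))) + (A * (J + M)) * (1 / (1 - 2 powr (- s)))"
      unfolding sum_distrib_left[symmetric]
      using A C J M
      by (intro add_mono mult_left_mono powr2_geometric_le \<alpha> s) auto
    also have "\<dots> = (c1 + c2) * A" by (simp add: c1_def c2_def algebra_simps)
    finally show "norm (\<Sum>j\<in>{- int N..int N}. ?I j) \<le> (c1 + c2) * A" .
  qed
qed

text \<open>Each split \<open>l\<close> yields its own sum function, but all of them represent the
  limit of the same partial sums and so agree almost everywhere. One function thus has all the
  decompositions at once, as the embedding into weak \<open>L\<^sup>m\<close> and the proof of S'_h
  both require.\<close>

lemma block_sum_function:
  assumes p: "p \<ge> 1" and s: "0 < s" "s < CARD('n) / p"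
  obtains C where "C > 0" "\<And>A w. A > 0 \<Longrightarrow> blocks p s A w \<Longrightarrow> band w \<Longrightarrow>
    \<exists>g. moderate g \<and> (\<forall>\<psi>\<in>schwartz. (\<lambda>N. \<Sum>j\<in>{- int N..int N}. \<integral>x. w j x * \<psi> x \<partial>lborel) \<longlonglongrightarrow> (\<integral>x. g x * \<psi> x \<partial>lborel)) \<and>
     (\<forall>l. \<exists>g1 g2. (AE x in lborel. g x = g1 x + g2 x) \<and> (AE x in lborel. norm (g1 x) \<le> C * A * 2 powr (real_of_int l * (CARD('n) / p - s)))
       \<and> g1 \<in> borel_measurable borel \<and> Lpb p (C * A * 2 powr (- real_of_int l * s)) g2)"
proof -
  define \<alpha> where "\<alpha> = CARD('n) / p - s"
  have \<alpha>: "\<alpha> > 0" using s by (simp add: \<alpha>_def)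
  obtain C where C: "C > 0" "\<And>A w j. A > 0 \<Longrightarrow> blocks p s A w \<Longrightarrow> band w \<Longrightarrow>
    AE x in lborel. norm (w j x) \<le> C * A * 2 powr (real_of_int j * \<alpha>)" using band_sup_bound[OF p] unfolding \<alpha>_def by metis
  define c1 where "c1 = C / (1 - 2 powr (- \<alpha>))"
  define c2 where "c2 = 2 powr (- s) / (1 - 2 powr (- s))"
  have c: "c1 > 0" "c2 > 0"
    using C powr2_geometric(2)[OF \<alpha>] powr2_geometric(2)[OF s(1)] by (auto simp: c1_def c2_def)
  show ?thesis
  proof (rule that[of "c1 + c2"])
    show "c1 + c2 > 0" using c by simp
    fix A w assume A: "A > 0" and w: "blocks p s A w" and b: "band w"
    define G1 where "G1 l x = (\<Sum>k. w (l - int k) x)" for l x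
    define G2 where "G2 l x = (\<Sum>k. w (l + 1 + int k) x)" for l x
    note B = block_sum[OF p s(1) \<alpha> A C(1) w C(2)[OF A w b], folded G1_def G2_def c1_def c2_def]
    have B1: "G1 l \<in> borel_measurable borel" for l using B(1)[of l] by (simp add: G1_def[abs_def])
    have B2: "AE x in lborel. norm (G1 l x) \<le> c1 * A * 2 powr (real_of_int l * \<alpha>)" for l using B(2)[of l] by simp
    have B3: "Lpb p (c2 * A * 2 powr (- real_of_int l * s)) (G2 l)" for l using B(3)[of l] by (simp add: G2_def[abs_def])
    have mod: "moderate (\<lambda>x. G1 l x + G2 l x)" for l
      by (intro moderate_add moderate_bounded[OF B1 B2] Lpb_moderate[OF B3 p])
    \<comment> \<open>The distribution is fixed through the split at 0; uniqueness of limits shows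
      that every other split represents it as well.\<close>
    define T where "T = fdist (\<lambda>x. G1 0 x + G2 0 x)"
    have rep: "represents (\<lambda>x. G1 l x + G2 l x) T" for l
    proof (rule represents_moderate[OF mod])
      fix \<psi> :: "real^'n \<Rightarrow> complex" assume "\<psi> \<in> schwartz"
      from LIMSEQ_unique[OF B(4)[OF this, of 0] B(4)[OF this, of l]]
      show "T \<psi> = (\<integral>x. (G1 l x + G2 l x) * \<psi> x \<partial>lborel)" by (simp add: T_def fdist_def)
    qed
    show "\<exists>g. moderate g \<and> (\<forall>\<psi>\<in>schwartz. (\<lambda>N. \<Sum>j\<in>{- int N..int N}. \<integral>x. w j x * \<psi> x \<partial>lborel) \<longlonglongrightarrow> (\<integral>x. g x * \<psi> x \<partial>lborel)) \<and>
     (\<forall>l. \<exists>g1 g2. (AE x in lborel. g x = g1 x + g2 x) \<and> (AE x in lborel. norm (g1 x) \<le> (c1 + c2) * A * 2 powr (real_of_int l * (CARD('n) / p - s)))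
       \<and> g1 \<in> borel_measurable borel \<and> Lpb p ((c1 + c2) * A * 2 powr (- real_of_int l * s)) g2)"
    proof (rule exI[of _ "\<lambda>x. G1 0 x + G2 0 x"], intro conjI ballI allI)
      show "moderate (\<lambda>x. G1 0 x + G2 0 x)" by (rule mod)
      show "(\<lambda>N. \<Sum>j\<in>{- int N..int N}. \<integral>x. w j x * \<psi> x \<partial>lborel) \<longlonglongrightarrow> (\<integral>x. (G1 0 x + G2 0 x) * \<psi> x \<partial>lborel)" if "\<psi> \<in> schwartz" for \<psi>
        by (rule B(4)[OF that])
      fix l
      show "\<exists>g1 g2. (AE x in lborel. G1 0 x + G2 0 x = g1 x + g2 x) \<and> (AE x in lborel. norm (g1 x) \<le> (c1 + c2) * A * 2 powr (real_of_int l * (CARD('n) / p - s)))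
       \<and> g1 \<in> borel_measurable borel \<and> Lpb p ((c1 + c2) * A * 2 powr (- real_of_int l * s)) g2"
      proof (rule exI[of _ "G1 l"], rule exI[of _ "G2 l"], intro conjI B1)
        show "AE x in lborel. G1 0 x + G2 0 x = G1 l x + G2 l x" by (rule represents_unique[OF rep rep])
        have "c1 * A * 2 powr (real_of_int l * \<alpha>) \<le> (c1 + c2) * A * 2 powr (real_of_int l * \<alpha>)"
          using c A by (intro mult_right_mono) auto
        then show "AE x in lborel. norm (G1 l x) \<le> (c1 + c2) * A * 2 powr (real_of_int l * (CARD('n) / p - s))"
          using B2[of l] unfolding \<alpha>_def[symmetric] by (auto elim!: eventually_mono)
        show "Lpb p ((c1 + c2) * A * 2 powr (- real_of_int l * s)) (G2 l)"
          by (rule Lpb_mono[OF B3]) (use c A p in \<open>auto intro!: mult_right_mono\<close>)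
      qed
    qed
  qed
qed

end

section \<open>Besov spaces of distributions\<close>

lemma represents_deq:
  assumes "represents g T" "\<And>\<psi>. \<psi> \<in> schwartz \<Longrightarrow> S \<psi> = T \<psi>" shows "represents g S"
  using assms by (auto simp: represents_def)

lemma represents_measurable: "represents g T \<Longrightarrow> g \<in> borel_measurable borel"
  by (simp add: represents_def)

lemma represents_dlin:
  assumes "represents g T" shows "dlin T"
  unfolding dlin_def
proof (intro ballI allI)
  fix f h :: "real^'a \<Rightarrow> complex" and a b assume fh: "f \<in> schwartz" "h \<in> schwartz"
  have "(\<lambda>x. a * f x + b * h x) \<in> schwartz" by (intro schwartz_add schwartz_cmult fh)
  then have "T (\<lambda>x. a * f x + b * h x) = (\<integral>x. a * (g x * f x) + b * (g x * h x) \<partial>lborel)"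
    using assms by (simp add: represents_def algebra_simps)
  then show "T (\<lambda>x. a * f x + b * h x) = a * T f + b * T h"
    using assms fh by (simp add: represents_def)
qed

lemma represents_lincomb:
  assumes "represents g T" "represents h S" shows "represents (\<lambda>x. a * g x + b * h x) (\<lambda>\<psi>. a * T \<psi> + b * S \<psi>)"
  unfolding represents_def
proof (intro conjI ballI)
  have [measurable]: "g \<in> borel_measurable borel" "h \<in> borel_measurable borel" using assms represents_measurable by auto
  show "(\<lambda>x. a * g x + b * h x) \<in> borel_measurable lborel" by measurable
  fix \<psi> :: "real^'a \<Rightarrow> complex" assume \<psi>: "\<psi> \<in> schwartz"
  have e: "(a * g x + b * h x) * \<psi> x = a * (g x * \<psi> x) + b * (h x * \<psi> x)" for x by (simp add: algebra_simps)
  show "integrable lborel (\<lambda>x. (a * g x + b * h x) * \<psi> x)" "a * T \<psi> + b * S \<psi> = (\<integral>x. (a * g x + b * h x) * \<psi> x \<partial>lborel)"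
    using assms \<psi> unfolding e by (auto simp: represents_def)
qed

lemma Lpn_le_iff:
  fixes g :: "real^'n::finite \<Rightarrow> complex"
  assumes "g \<in> borel_measurable borel" "p > 0" "B \<ge> 0"
  shows "Lpn p g \<le> ereal B \<longleftrightarrow> Lpb p B g"
proof (cases "integrable lborel (\<lambda>x. norm (g x) powr p)")
  case True
  define I where "I = (\<integral>x. norm (g x) powr p \<partial>lborel)"
  have I: "I \<ge> 0" unfolding I_def by (rule integral_nonneg_AE) simp
  have "I powr (1/p) \<le> B \<longleftrightarrow> I \<le> B powr p"
  proof
    assume "I powr (1/p) \<le> B"
    then have "(I powr (1/p)) powr p \<le> B powr p" using assms by (intro powr_mono2) auto
    then show "I \<le> B powr p" using I assms by (simp add: powr_powr)
  next
    assume "I \<le> B powr p"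
    then have "I powr (1/p) \<le> (B powr p) powr (1/p)" using assms I by (intro powr_mono2) auto
    then show "I powr (1/p) \<le> B" using assms by (simp add: powr_powr)
  qed
  then show ?thesis using True assms by (simp add: Lpn_def Lpb_iff_integral I_def)
qed (simp add: Lpn_def Lpb_iff_integral)

text \<open>The weighted integral of \<open>g\<close> bounds the pairing by a single seminorm of
  \<open>\<psi>\<close>, the one with weight exponent \<open>2 * n\<close> and no
  derivative.\<close>

lemma moderate_tempered:
  fixes g :: "real^'n::finite \<Rightarrow> complex"
  assumes g: "moderate g" and T: "represents g T" shows "tempered T"
proof -
  define I where "I = (\<integral>x. wgt x * norm (g x) \<partial>lborel)"
  have I: "I \<ge> 0" unfolding I_def by (rule integral_nonneg_AE) simp
  let ?n = "2 * CARD('n)"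
  have "norm (T \<psi>) \<le> I * (\<Sum>k\<le>?n. \<Sum>ds\<in>{ds::'n list. length ds \<le> ?n}. seminorm k ds \<psi>)" if \<psi>: "\<psi> \<in> schwartz" for \<psi>
  proof -
    have b: "(1 + norm x) ^ ?n * norm (\<psi> x) \<le> seminorm ?n [] \<psi>" for x
    proof -
      have "bdd_above (range (\<lambda>x. (1 + norm x) ^ ?n * norm (dpart [] \<psi> x)))"
        using \<psi> unfolding schwartz_def by (intro bounded_imp_bdd_above) blast
      then show ?thesis using cSUP_upper[of x UNIV "\<lambda>x. (1 + norm x) ^ ?n * norm (dpart [] \<psi> x)"] by (simp add: seminorm_def)
    qed
    have "norm (T \<psi>) = norm (\<integral>x. g x * \<psi> x \<partial>lborel)" using T \<psi> by (simp add: represents_def)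
    also have "\<dots> \<le> (\<integral>x. seminorm ?n [] \<psi> * (wgt x * norm (g x)) \<partial>lborel)"
    proof (rule Bochner_Integration.integral_norm_bound_integral)
      show "integrable lborel (\<lambda>x. g x * \<psi> x)" by (rule moderate_schwartz_integrable[OF g \<psi>])
      show "integrable lborel (\<lambda>x. seminorm ?n [] \<psi> * (wgt x * norm (g x)))" using g by (simp add: moderate_def)
      fix x
      have "norm (\<psi> x) \<le> seminorm ?n [] \<psi> * wgt x" using b[of x] by (simp add: wgt_bound)
      then have "norm (g x) * norm (\<psi> x) \<le> norm (g x) * (seminorm ?n [] \<psi> * wgt x)" by (rule mult_left_mono) simp
      then show "norm (g x * \<psi> x) \<le> seminorm ?n [] \<psi> * (wgt x * norm (g x))" by (simp add: norm_mult mult_ac)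
    qed
    also have "\<dots> = I * seminorm ?n [] \<psi>" by (simp add: I_def)
    also have "\<dots> \<le> I * (\<Sum>k\<le>?n. \<Sum>ds\<in>{ds::'n list. length ds \<le> ?n}. seminorm k ds \<psi>)"
    proof (rule mult_left_mono[OF _ I])
      have fin: "finite {ds::'n list. length ds \<le> ?n}" using finite_lists_length_le[of "UNIV :: 'n set" ?n] by simp
      have "seminorm ?n [] \<psi> \<le> (\<Sum>ds\<in>{ds::'n list. length ds \<le> ?n}. seminorm ?n ds \<psi>)"
        by (rule member_le_sum[OF _ _ fin]) (auto intro: seminorm_nonneg \<psi>)
      also have "\<dots> \<le> (\<Sum>k\<le>?n. \<Sum>ds\<in>{ds::'n list. length ds \<le> ?n}. seminorm k ds \<psi>)"
        by (rule member_le_sum[of ?n "{..?n}" "\<lambda>k. \<Sum>ds\<in>{ds::'n list. length ds \<le> ?n}. seminorm k ds \<psi>"]) (auto intro!: sum_nonneg seminorm_nonneg \<psi>)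
      finally show "seminorm ?n [] \<psi> \<le> (\<Sum>k\<le>?n. \<Sum>ds\<in>{ds::'n list. length ds \<le> ?n}. seminorm k ds \<psi>)" .
    qed
    finally show ?thesis .
  qed
  then show ?thesis using represents_dlin[OF T] unfolding tempered_def dlin_def by blast
qed

context littlewood_paley
begin

text \<open>\<open>dnorm\<close> looks at the density chosen by \<open>rep\<close>; uniqueness
  almost everywhere makes the bound independent of that choice.\<close>

lemma dnorm_le_iff:
  fixes T :: "'n distr"
  assumes "p > 0" "B \<ge> 0" shows "dnorm p T \<le> ereal B \<longleftrightarrow> (\<exists>w. represents w T \<and> Lpb p B w)"
proof
  assume le: "dnorm p T \<le> ereal B"
  then have ex: "\<exists>g. represents g T" by (auto simp: dnorm_def split: if_splits)
  then have r: "represents (rep T) T" using represents_rep by blast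
  have "Lpn p (rep T) \<le> ereal B" using le ex by (simp add: dnorm_def)
  then have "Lpb p B (rep T)" using Lpn_le_iff[OF represents_measurable[OF r] assms] by simp
  with r show "\<exists>w. represents w T \<and> Lpb p B w" by blast
next
  assume "\<exists>w. represents w T \<and> Lpb p B w"
  then obtain w where w: "represents w T" "Lpb p B w" by blast
  have r: "represents (rep T) T" using represents_rep[OF w(1)] .
  have "Lpb p B (rep T)"
    by (rule Lpb_cong_AE[OF w(2) represents_unique[OF r w(1)] represents_measurable[OF r]]) (use assms in simp)
  then show "dnorm p T \<le> ereal B"
    using Lpn_le_iff[OF represents_measurable[OF r] assms] w(1) by (auto simp: dnorm_def)
qed

definition block_bound :: "real \<Rightarrow> real \<Rightarrow> real \<Rightarrow> 'n distr \<Rightarrow> bool" where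
  "block_bound p s A T \<longleftrightarrow> (\<forall>j. \<exists>w. represents w (fmult (phi j) T) \<and> Lpb p (A * 2 powr (- real_of_int j * s)) w)"

lemma bnorm_le_iff:
  assumes "p > 0" "A \<ge> 0" shows "bnorm \<phi> s p T \<le> ereal A \<longleftrightarrow> block_bound p s A T"
proof -
  have "ereal (2 powr (real_of_int j * s)) * d \<le> ereal A \<longleftrightarrow> d \<le> ereal (A * 2 powr (- real_of_int j * s))" for d j
  proof (cases d)
    case (real r)
    then show ?thesis by (simp add: powr_minus field_simps)
  qed auto
  then show ?thesis
    unfolding bnorm_def SUP_le_iff block_bound_def LPblock_eq using assms by (simp add: dnorm_le_iff del: mult_minus_left)
qed

text \<open>Working form of membership in the Besov space with norm at most \<open>A\<close>. The
  clause \<open>rec\<close> stands in for S'_h because it passes directly to series; for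
  \<open>0 < s < n / p\<close> nothing is lost, by \<open>bd_besov\<close>.\<close>

definition bd :: "real \<Rightarrow> real \<Rightarrow> real \<Rightarrow> 'n distr \<Rightarrow> bool" where
  "bd p s A T \<longleftrightarrow> rec T \<and> block_bound p s A T"

lemma bd_dlin: "bd p s A T \<Longrightarrow> dlin T"
  by (simp add: bd_def rec_def)

lemma besov_bd: "besov \<phi> s p T \<Longrightarrow> bnorm \<phi> s p T \<le> ereal A \<Longrightarrow> p > 0 \<Longrightarrow> A \<ge> 0 \<Longrightarrow> bd p s A T"
  by (simp add: bd_def besov_def Sh_rec bnorm_le_iff)

text \<open>\<open>phit j\<close> is one wherever \<open>phi j\<close> is nonzero, so applying it
  leaves the block unchanged; uniqueness of densities turns this into the reproducing
  identity.\<close>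

lemma block_bound_blocks:
  assumes T: "block_bound p s A T" and p: "p \<ge> 1"
  obtains w where "\<And>j. represents (w j) (fmult (phi j) T)" "blocks p s A w" "band w"
proof -
  obtain w where w: "\<And>j. represents (w j) (fmult (phi j) T)" "\<And>j. Lpb p (A * 2 powr (- real_of_int j * s)) (w j)"
    using T unfolding block_bound_def by metis
  have "band w"
    unfolding band_def
  proof
    fix j
    have "represents (cnv (ift (phit j)) (w j)) (fmult (phit j) (fmult (phi j) T))"
      by (rule represents_fmult[OF phit_schwartz Lpb_moderate[OF w(2) p] w(1)])
    then have "represents (cnv (ift (phit j)) (w j)) (fmult (phi j) T)"
      by (rule represents_deq) (simp add: fmult_fmult phit_schwartz phi_schwartz phit_phi mult.commute[of "phi j _"])
    then show "AE x in lborel. w j x = cnv (ift (phit j)) (w j) x"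
      by (rule represents_unique[OF w(1)])
  qed
  then show ?thesis using that w by (auto simp: blocks_def)
qed

lemma bd_mono:
  assumes "bd p s A T" "A \<le> B" "0 \<le> A" "0 \<le> p" shows "bd p s B T"
proof -
  have "Lpb p (B * 2 powr (- real_of_int j * s)) w" if "Lpb p (A * 2 powr (- real_of_int j * s)) w" for j and w :: "real^'n \<Rightarrow> complex"
    by (rule Lpb_mono[OF that]) (use assms in \<open>auto intro!: mult_right_mono\<close>)
  then show ?thesis using assms(1) unfolding bd_def block_bound_def by blast
qed

text \<open>Identities between distributions hold on Schwartz functions only, so bounds have to be
  transferred along agreement there rather than along equality of functionals.\<close>

lemma bd_deq:
  assumes "bd p s A T" and eq: "\<And>\<psi>. \<psi> \<in> schwartz \<Longrightarrow> S \<psi> = T \<psi>" shows "bd p s A S"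
proof -
  have f: "fmult (phi j) S \<psi> = fmult (phi j) T \<psi>" if "\<psi> \<in> schwartz" for j \<psi>
    using eq[OF schwartz_ft_mult_ift[OF phi_schwartz that]] by (simp add: fmult_eq)
  have "dlin S"
    unfolding dlin_def
  proof (intro ballI allI)
    fix f g :: "real^'n \<Rightarrow> complex" and a b assume fg: "f \<in> schwartz" "g \<in> schwartz"
    show "S (\<lambda>x. a * f x + b * g x) = a * S f + b * S g"
      using eq[OF fg(1)] eq[OF fg(2)] eq[OF schwartz_add[OF schwartz_cmult[OF fg(1)] schwartz_cmult[OF fg(2)], of a b]]
        dlinD[OF bd_dlin[OF assms(1)] fg] by simp
  qed
  moreover have "\<forall>\<psi>\<in>schwartz. (\<lambda>N. \<Sum>j\<in>{- int N..int N}. fmult (phi j) S \<psi>) \<longlonglongrightarrow> S \<psi>"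
    using assms(1) f eq by (simp add: bd_def rec_def)
  moreover have "block_bound p s A S"
    unfolding block_bound_def
  proof
    fix j
    obtain w where w: "represents w (fmult (phi j) T)" "Lpb p (A * 2 powr (- real_of_int j * s)) w"
      using assms(1) unfolding bd_def block_bound_def by blast
    show "\<exists>w. represents w (fmult (phi j) S) \<and> Lpb p (A * 2 powr (- real_of_int j * s)) w"
      using represents_deq[OF w(1) f] w(2) by blast
  qed
  ultimately show ?thesis by (simp add: bd_def rec_def)
qed

lemma bd_lincomb:
  assumes T: "bd p s A T" and S: "bd p s B S" and AB: "A \<ge> 0" "B \<ge> 0" "p \<ge> 1"
  shows "bd p s (norm a * A + norm b * B) (\<lambda>\<psi>. a * T \<psi> + b * S \<psi>)"
  unfolding bd_def
proof
  have f: "fmult (phi j) (\<lambda>\<psi>. a * T \<psi> + b * S \<psi>) = (\<lambda>\<psi>. a * fmult (phi j) T \<psi> + b * fmult (phi j) S \<psi>)" for j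
    by (simp add: fmult_eq fun_eq_iff)
  have "dlin (\<lambda>\<psi>. a * T \<psi> + b * S \<psi>)"
    using bd_dlin[OF T] bd_dlin[OF S] unfolding dlin_def by (simp add: algebra_simps)
  moreover have "(\<lambda>N. \<Sum>j\<in>{- int N..int N}. a * fmult (phi j) T \<psi> + b * fmult (phi j) S \<psi>) \<longlonglongrightarrow> a * T \<psi> + b * S \<psi>"
    if "\<psi> \<in> schwartz" for \<psi>
    unfolding sum.distrib sum_distrib_left[symmetric]
    using T S that by (intro tendsto_add tendsto_mult tendsto_const) (auto simp: bd_def rec_def)
  ultimately show "rec (\<lambda>\<psi>. a * T \<psi> + b * S \<psi>)" unfolding rec_def f by simp
  show "block_bound p s (norm a * A + norm b * B) (\<lambda>\<psi>. a * T \<psi> + b * S \<psi>)"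
    unfolding block_bound_def f
  proof
    fix j
    let ?c = "2 powr (- real_of_int j * s)"
    obtain w v where w: "represents w (fmult (phi j) T)" "Lpb p (A * ?c) w"
      and v: "represents v (fmult (phi j) S)" "Lpb p (B * ?c) v"
      using T S unfolding bd_def block_bound_def by blast
    have "Lpb p (norm a * (A * ?c) + norm b * (B * ?c)) (\<lambda>x. a * w x + b * v x)"
      by (intro Lpb_add Lpb_cmult w v) (use AB in auto)
    moreover have "norm a * (A * ?c) + norm b * (B * ?c) = (norm a * A + norm b * B) * ?c" by (simp add: algebra_simps)
    ultimately show "\<exists>w. represents w (\<lambda>\<psi>. a * fmult (phi j) T \<psi> + b * fmult (phi j) S \<psi>) \<and> Lpb p ((norm a * A + norm b * B) * ?c) w"
      using represents_lincomb[OF w(1) v(1), of a b] by (metis (no_types, lifting))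
  qed
qed

lemma bd_diff:
  "bd p s A T \<Longrightarrow> bd p s B S \<Longrightarrow> A \<ge> 0 \<Longrightarrow> B \<ge> 0 \<Longrightarrow> p \<ge> 1 \<Longrightarrow> bd p s (A + B) (\<lambda>\<psi>. T \<psi> - S \<psi>)"
  using bd_lincomb[of p s A T B S 1 "-1"] by simp

lemma bd_add:
  "bd p s A T \<Longrightarrow> bd p s B S \<Longrightarrow> A \<ge> 0 \<Longrightarrow> B \<ge> 0 \<Longrightarrow> p \<ge> 1 \<Longrightarrow> bd p s (A + B) (\<lambda>\<psi>. T \<psi> + S \<psi>)"
  using bd_lincomb[of p s A T B S 1 "1"] by simp

lemma bd_zero: "bd p s A (\<lambda>\<psi>. 0)"
proof -
  have "represents (\<lambda>x. 0) (\<lambda>\<psi>::real^'n \<Rightarrow> complex. 0)" by (simp add: represents_def)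
  moreover have f: "fmult (phi j) (\<lambda>\<psi>. 0) = (\<lambda>\<psi>. 0)" for j by (simp add: fmult_eq fun_eq_iff)
  ultimately show ?thesis
    unfolding bd_def rec_def block_bound_def dlin_def f using Lpb_zero by auto
qed

text \<open>Letting \<open>N\<close> grow in the uniform bound gives a continuous embedding into
  distributions. The bound on the partial sums is exported as well, for
  \<open>bd_series\<close>.\<close>

lemma bd_pairing_bound:
  assumes p: "p \<ge> 1" and s: "0 < s" "s < CARD('n) / p" and \<psi>: "\<psi> \<in> schwartz"
  obtains c where "c > 0" "\<And>A T N. A > 0 \<Longrightarrow> bd p s A T \<Longrightarrow> norm (\<Sum>j\<in>{- int N..int N}. fmult (phi j) T \<psi>) \<le> c * A"
    "\<And>A T. A > 0 \<Longrightarrow> bd p s A T \<Longrightarrow> norm (T \<psi>) \<le> c * A"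
proof -
  obtain c where c: "c > 0" "\<And>A w N. A > 0 \<Longrightarrow> blocks p s A w \<Longrightarrow> band w \<Longrightarrow>
     norm (\<Sum>j\<in>{- int N..int N}. \<integral>x. w j x * \<psi> x \<partial>lborel) \<le> c * A"
    using pairing_uniform_bound[OF p s \<psi>] by blast
  have 1: "norm (\<Sum>j\<in>{- int N..int N}. fmult (phi j) T \<psi>) \<le> c * A" if A: "A > 0" and T: "bd p s A T" for A T N
  proof -
    obtain w where w: "\<And>j. represents (w j) (fmult (phi j) T)" "blocks p s A w" "band w"
      using block_bound_blocks[OF _ p] T unfolding bd_def by metis
    have "fmult (phi j) T \<psi> = (\<integral>x. w j x * \<psi> x \<partial>lborel)" for j using w(1) \<psi> by (simp add: represents_def)
    then show ?thesis using c(2)[OF A w(2,3)] by simp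
  qed
  have "norm (T \<psi>) \<le> c * A" if A: "A > 0" and T: "bd p s A T" for A T
  proof (rule Lim_bounded[OF tendsto_norm])
    show "(\<lambda>N. \<Sum>j\<in>{- int N..int N}. fmult (phi j) T \<psi>) \<longlonglongrightarrow> T \<psi>" using T \<psi> by (simp add: bd_def rec_def)
    show "\<forall>N\<ge>0. norm (\<Sum>j\<in>{- int N..int N}. fmult (phi j) T \<psi>) \<le> c * A" using 1[OF A T] by blast
  qed
  note 2 = this
  show ?thesis by (rule that[OF c(1)]) (fact 1, fact 2)
qed

text \<open>This turns estimates by arbitrarily small constants into equations; it closes both the
  verification of the fixed point and uniqueness.\<close>

lemma bd_small_zero:
  assumes p: "p \<ge> 1" and s: "0 < s" "s < CARD('n) / p" and T: "\<And>e. e > 0 \<Longrightarrow> bd p s e T" and \<psi>: "\<psi> \<in> schwartz"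
  shows "T \<psi> = 0"
proof -
  obtain c where c: "c > 0" "\<And>A T. A > 0 \<Longrightarrow> bd p s A T \<Longrightarrow> norm (T \<psi>) \<le> c * A"
    by (rule bd_pairing_bound[OF p s \<psi>], rule that)
  have "norm (T \<psi>) \<le> 0 + e" if "e > 0" for e
    using c(2)[OF _ T, of "e / c"] that c(1) by simp
  then have "norm (T \<psi>) \<le> 0" by (rule field_le_epsilon)
  then show ?thesis by simp
qed

text \<open>The kernels \<open>kl l\<close> all have the same \<open>L\<^sup>1\<close> norm, so the
  bounded part, small for very negative splits, stays small under them. The remaining
  \<open>L\<^sup>p\<close> part is driven to 0 by their sup norm, which decays like the
  \<open>n\<close>-th power of the inverse dilation.\<close>

lemma Sh_of_decomposition:
  fixes g :: "real^'n \<Rightarrow> complex"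
  assumes p: "p \<ge> 1" and \<alpha>: "\<alpha> > 0" and g: "moderate g" and T: "represents g T" and C: "C > 0"
    and dec: "\<And>l::int. \<exists>g1 g2. (AE x in lborel. g x = g1 x + g2 x) \<and> (AE x in lborel. norm (g1 x) \<le> C * 2 powr (real_of_int l * \<alpha>))
       \<and> g1 \<in> borel_measurable borel \<and> Lpb p (B l) g2"
  shows "Sh T"
  unfolding Sh_def
proof (intro conjI ballI)
  show "tempered T" by (rule moderate_tempered[OF g T])
  fix \<psi> :: "real^'n \<Rightarrow> complex" assume \<psi>: "\<psi> \<in> schwartz"
  define k where "k = ift \<psi>"
  have k: "k \<in> schwartz" unfolding k_def by (rule schwartz_ift[OF \<psi>])
  obtain M where M: "M > 0" "\<And>x. norm (k x) \<le> M" using schwartz_bound[OF k, of 0] by auto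
  define J where "J = (\<integral>x. norm (k x) \<partial>lborel)"
  have J: "J \<ge> 0" unfolding J_def by (rule integral_nonneg_AE) simp
  define kl where "kl l = ift (\<lambda>\<xi>. \<psi> (l *\<^sub>R \<xi>))" for l :: real
  have kl: "kl l \<in> schwartz" "(\<integral>x. norm (kl l x) \<partial>lborel) = J" "\<And>x. norm (kl l x) \<le> M / l ^ CARD('n)" if l: "l > 0" for l
  proof -
    show "kl l \<in> schwartz" unfolding kl_def by (intro schwartz_ift schwartz_scale \<psi>) (use l in simp)
    have e: "kl l x = complex_of_real (1 / l ^ CARD('n)) * k ((1 / l) *\<^sub>R x)" for x
      unfolding kl_def k_def by (rule ift_scale[OF l])
    show "norm (kl l x) \<le> M / l ^ CARD('n)" for x
      using M(2)[of "(1 / l) *\<^sub>R x"] l by (simp add: e norm_mult norm_divide norm_power divide_right_mono)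
    show "(\<integral>x. norm (kl l x) \<partial>lborel) = J"
      using l lborel_affine_integral_eq[of "1 / l" "\<lambda>x. norm (k x)" 0]
      by (simp add: e norm_mult norm_divide norm_power J_def power_divide)
  qed
  have rep: "represents (cnv (kl l) g) (fmult (\<lambda>\<xi>. \<psi> (l *\<^sub>R \<xi>)) T)" if "l > 0" for l
    unfolding kl_def by (rule represents_fmult[OF schwartz_scale[OF \<psi>] g T]) (use that in simp)
  have small: "\<forall>\<^sub>F l in at_top. \<forall>y. norm (cnv (kl l) g y) \<le> \<eta>" if \<eta>: "\<eta> > 0" for \<eta>
  proof -
    define \<delta> where "\<delta> = \<eta> / (3 * (J + 1))"
    have \<delta>: "\<delta> > 0" "\<delta> * J \<le> \<eta> / 3" using \<eta> J by (auto simp: \<delta>_def field_simps)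
    \<comment> \<open>Any split making the bounded part at most \<open>\<delta>\<close> would do; it
      is fixed before the dilation tends to infinity.\<close>
    define L where "L = \<lfloor>log 2 (\<delta> / C) / \<alpha>\<rfloor>"
    have "real_of_int L * \<alpha> \<le> log 2 (\<delta> / C)" using \<alpha> by (simp add: L_def pos_le_divide_eq[symmetric])
    then have "2 powr (real_of_int L * \<alpha>) \<le> 2 powr (log 2 (\<delta> / C))" by simp
    also have "\<dots> = \<delta> / C" using \<delta> C by simp
    finally have L: "C * 2 powr (real_of_int L * \<alpha>) \<le> \<delta>" using C by (simp add: field_simps)
    obtain g1 g2 where d: "AE x in lborel. g x = g1 x + g2 x" "AE x in lborel. norm (g1 x) \<le> C * 2 powr (real_of_int L * \<alpha>)"
      "g1 \<in> borel_measurable borel" "Lpb p (B L) g2" using dec by blast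
    have [measurable]: "g1 \<in> borel_measurable borel" "g2 \<in> borel_measurable borel" "g \<in> borel_measurable borel"
      using d Lpb_measurable moderate_measurable[OF g] by auto
    have m: "moderate g1" "moderate g2" using moderate_bounded[OF d(3,2)] Lpb_moderate[OF d(4) p] by auto
    define R where "R = \<delta> powr (1 - p) * M * B L powr p"
    have R: "R \<ge> 0" using M by (simp add: R_def)
    have "((\<lambda>l::real. R / l ^ CARD('n)) \<longlongrightarrow> 0) at_top"
      by (intro tendsto_divide_0[OF tendsto_const] filterlim_at_top_imp_at_infinity filterlim_pow_at_top filterlim_ident) simp
    then have "\<forall>\<^sub>F l::real in at_top. R / l ^ CARD('n) < \<eta> / 3" by (rule order_tendstoD(2)) (use \<eta> in simp)
    moreover have "\<forall>\<^sub>F l::real in at_top. l > 0" by (rule eventually_gt_at_top)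
    ultimately show ?thesis
    proof eventually_elim
      case (elim l)
      show ?case
      proof
        fix y
        have "cnv (kl l) g y = cnv (kl l) (\<lambda>x. g1 x + g2 x) y"
          by (rule cnv_cong_AE) (use d(1) schwartz_measurable[OF kl(1)[OF elim(2)]] in auto)
        also have "\<dots> = cnv (kl l) g1 y + cnv (kl l) g2 y" by (rule cnv_add[OF kl(1)[OF elim(2)] m])
        finally have "norm (cnv (kl l) g y) \<le> norm (cnv (kl l) g1 y) + norm (cnv (kl l) g2 y)" by (simp add: norm_triangle_ineq)
        also have "norm (cnv (kl l) g1 y) \<le> C * 2 powr (real_of_int L * \<alpha>) * J"
          using cnv_bounded[OF kl(1)[OF elim(2)] d(3,2)] kl(2)[OF elim(2)] by simp
        also have "\<dots> \<le> \<delta> * J" by (rule mult_right_mono[OF L J])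
        \<comment> \<open>The height in \<open>cnv_sup_bound\<close> is the fixed
          \<open>\<delta>\<close>, so the dilation enters through the sup norm of the kernel
          alone.\<close>
        also have "norm (cnv (kl l) g2 y) \<le> \<delta> * J + \<delta> powr (1 - p) * (M / l ^ CARD('n)) * B L powr p"
          using cnv_sup_bound[OF kl(1)[OF elim(2)] kl(3)[OF elim(2)] d(4) p \<delta>(1)] kl(2)[OF elim(2)] by simp
        also have "\<delta> powr (1 - p) * (M / l ^ CARD('n)) * B L powr p = R / l ^ CARD('n)" by (simp add: R_def)
        finally show "norm (cnv (kl l) g y) \<le> \<eta>" using elim(1) \<delta>(2) by linarith
      qed
    qed
  qed
  show "((\<lambda>l::real. dnorm_inf (fmult (\<lambda>\<xi>. \<psi> (l *\<^sub>R \<xi>)) T)) \<longlongrightarrow> 0) at_top"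
  proof (rule order_tendstoI)
    fix a :: ereal assume a: "a < 0"
    show "\<forall>\<^sub>F l in at_top. a < dnorm_inf (fmult (\<lambda>\<xi>. \<psi> (l *\<^sub>R \<xi>)) T)"
    proof (rule always_eventually, rule allI)
      fix l
      let ?r = "rep (fmult (\<lambda>\<xi>. \<psi> (l *\<^sub>R \<xi>)) T)"
      have "0 = esssup (lborel :: (real^'n) measure) (\<lambda>x. 0 :: ereal)" by (rule esssup_const[symmetric]) simp
      also have "\<dots> \<le> esssup lborel (\<lambda>x. ereal (norm (?r x)))" by (rule esssup_mono) auto
      finally show "a < dnorm_inf (fmult (\<lambda>\<xi>. \<psi> (l *\<^sub>R \<xi>)) T)"
        using a by (auto simp: dnorm_inf_def)
    qed
  next
    fix a :: ereal assume "0 < a"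
    then obtain \<eta> where \<eta>: "\<eta> > 0" "ereal \<eta> < a" using ereal_dense2[of 0 a] by auto
    have "\<forall>\<^sub>F l::real in at_top. l > 0" by (rule eventually_gt_at_top)
    with small[OF \<eta>(1)] show "\<forall>\<^sub>F l in at_top. dnorm_inf (fmult (\<lambda>\<xi>. \<psi> (l *\<^sub>R \<xi>)) T) < a"
    proof eventually_elim
      case (elim l)
      let ?S = "fmult (\<lambda>\<xi>. \<psi> (l *\<^sub>R \<xi>)) T"
      note r = represents_rep[OF rep[OF elim(2)]]
      have "AE x in lborel. rep ?S x = cnv (kl l) g x" by (rule represents_unique[OF r rep[OF elim(2)]])
      then have "AE x in lborel. ereal (norm (rep ?S x)) \<le> ereal \<eta>"
        by eventually_elim (use elim(1) in simp)
      then have "esssup lborel (\<lambda>x. ereal (norm (rep ?S x))) \<le> ereal \<eta>"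
        using represents_measurable[OF r] by (intro esssup_I) auto
      then show ?case using rep[OF elim(2)] \<eta>(2) by (auto simp: dnorm_inf_def)
    qed
  qed
qed

lemma bd_function:
  assumes p: "p \<ge> 1" and s: "0 < s" "s < CARD('n) / p"
  obtains C where "C > 0" "\<And>A T. A > 0 \<Longrightarrow> bd p s A T \<Longrightarrow> Sh T \<and> (\<exists>g. represents g T)"
    "\<And>A T g. A > 0 \<Longrightarrow> bd p s A T \<Longrightarrow> represents g T \<Longrightarrow> WL (CARD('n) / (CARD('n) / p - s)) (C * A) g"
proof -
  define \<alpha> where "\<alpha> = CARD('n) / p - s"
  have \<alpha>: "\<alpha> > 0" using s by (simp add: \<alpha>_def)
  obtain C where C: "C > 0" "\<And>A w. A > 0 \<Longrightarrow> blocks p s A w \<Longrightarrow> band w \<Longrightarrow>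
    \<exists>g. moderate g \<and> (\<forall>\<psi>\<in>schwartz. (\<lambda>N. \<Sum>j\<in>{- int N..int N}. \<integral>x. w j x * \<psi> x \<partial>lborel) \<longlonglongrightarrow> (\<integral>x. g x * \<psi> x \<partial>lborel)) \<and>
     (\<forall>l. \<exists>g1 g2. (AE x in lborel. g x = g1 x + g2 x) \<and> (AE x in lborel. norm (g1 x) \<le> C * A * 2 powr (real_of_int l * \<alpha>))
       \<and> g1 \<in> borel_measurable borel \<and> Lpb p (C * A * 2 powr (- real_of_int l * s)) g2)"
    using block_sum_function[OF p s] unfolding \<alpha>_def by blast
  have main: "\<exists>g. moderate g \<and> represents g T \<and>
     (\<forall>l. \<exists>g1 g2. (AE x in lborel. g x = g1 x + g2 x) \<and> (AE x in lborel. norm (g1 x) \<le> C * A * 2 powr (real_of_int l * \<alpha>))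
       \<and> g1 \<in> borel_measurable borel \<and> Lpb p (C * A * 2 powr (- real_of_int l * s)) g2)"
    if A: "A > 0" and T: "bd p s A T" for A T
  proof -
    obtain w where w: "\<And>j. represents (w j) (fmult (phi j) T)" "blocks p s A w" "band w"
      using block_bound_blocks[OF _ p] T unfolding bd_def by metis
    obtain g where g: "moderate g" "\<And>\<psi>. \<psi> \<in> schwartz \<Longrightarrow> (\<lambda>N. \<Sum>j\<in>{- int N..int N}. \<integral>x. w j x * \<psi> x \<partial>lborel) \<longlonglongrightarrow> (\<integral>x. g x * \<psi> x \<partial>lborel)"
      "\<forall>l. \<exists>g1 g2. (AE x in lborel. g x = g1 x + g2 x) \<and> (AE x in lborel. norm (g1 x) \<le> C * A * 2 powr (real_of_int l * \<alpha>))
       \<and> g1 \<in> borel_measurable borel \<and> Lpb p (C * A * 2 powr (- real_of_int l * s)) g2"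
      using C(2)[OF A w(2,3)] by blast
    have "represents g T"
    proof (rule represents_moderate[OF g(1)])
      fix \<psi> :: "real^'n \<Rightarrow> complex" assume \<psi>: "\<psi> \<in> schwartz"
      have e: "fmult (phi j) T \<psi> = (\<integral>x. w j x * \<psi> x \<partial>lborel)" for j using w(1) \<psi> by (simp add: represents_def)
      have "(\<lambda>N. \<Sum>j\<in>{- int N..int N}. fmult (phi j) T \<psi>) \<longlonglongrightarrow> T \<psi>"
        using T \<psi> by (simp add: bd_def rec_def)
      then have "(\<lambda>N. \<Sum>j\<in>{- int N..int N}. \<integral>x. w j x * \<psi> x \<partial>lborel) \<longlonglongrightarrow> T \<psi>"
        unfolding e .
      then show "T \<psi> = (\<integral>x. g x * \<psi> x \<partial>lborel)" using g(2)[OF \<psi>] by (rule LIMSEQ_unique)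
    qed
    with g show ?thesis by blast
  qed
  \<comment> \<open>Since \<open>\<alpha> + s = n / p\<close>, the interpolation exponent simplifies
    to the embedding exponent \<open>n / (n / p - s)\<close>.\<close>
  have m: "p * (\<alpha> + s) / \<alpha> = CARD('n) / \<alpha>" using p by (simp add: \<alpha>_def)
  define C' where "C' = 2 powr (1 + s * p / (p * (\<alpha> + s) / \<alpha>)) * C"
  show ?thesis
  proof (rule that[of C'])
    show "C' > 0" using C by (simp add: C'_def)
    fix A T assume A: "A > 0" and T: "bd p s A T"
    obtain h where h: "moderate h" "represents h T" "\<And>l. \<exists>g1 g2. (AE x in lborel. h x = g1 x + g2 x) \<and> (AE x in lborel. norm (g1 x) \<le> C * A * 2 powr (real_of_int l * \<alpha>))
       \<and> g1 \<in> borel_measurable borel \<and> Lpb p (C * A * 2 powr (- real_of_int l * s)) g2"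
      using main[OF A T] by blast
    have CA: "C * A > 0" using C A by simp
    show "Sh T \<and> (\<exists>g. represents g T)"
      using Sh_of_decomposition[OF p \<alpha> h(1,2) CA h(3)] h(2) by blast
    fix g assume g: "represents g T"
    have "WL (p * (\<alpha> + s) / \<alpha>) (2 powr (1 + s * p / (p * (\<alpha> + s) / \<alpha>)) * (C * A)) h"
      by (rule WL_of_decomposition[OF moderate_measurable[OF h(1)] CA \<alpha> s(1) _ h(3)]) (use p in simp)
    then have "WL (CARD('n) / \<alpha>) (C' * A) h" by (simp only: C'_def m mult.assoc)
    then show "WL (CARD('n) / (CARD('n) / p - s)) (C' * A) g"
      unfolding \<alpha>_def[symmetric] by (rule WL_cong_AE[OF _ represents_unique[OF g h(2)] represents_measurable[OF g]])
  qed
qed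

lemma bd_besov:
  assumes "p \<ge> 1" "0 < s" "s < CARD('n) / p" "A > 0" "bd p s A T"
  shows "besov \<phi> s p T \<and> bnorm \<phi> s p T \<le> ereal A"
proof -
  have "Sh T" using bd_function[OF assms(1-3)] assms(4,5) by metis
  moreover have "bnorm \<phi> s p T \<le> ereal A" using assms by (simp add: bnorm_le_iff bd_def)
  ultimately show ?thesis by (auto simp: besov_def intro: le_less_trans)
qed

text \<open>Completeness in the form the iteration uses. The exchange of the series with the block
  expansion is Tannery's theorem, its majorant coming from the uniform bound on partial sums; each
  single block is summed in \<open>L\<^sup>p\<close>.\<close>

lemma bd_series:
  assumes p: "p \<ge> 1" and s: "0 < s" "s < CARD('n) / p"
    and D: "\<And>m. bd p s (a m) (D m)" and a: "\<And>m. a m > 0" "summable a"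
  shows "bd p s (\<Sum>m. a m) (\<lambda>\<psi>. \<Sum>m. D m \<psi>)" and "\<psi> \<in> schwartz \<Longrightarrow> summable (\<lambda>m. D m \<psi>)"
proof -
  have sm: "summable (\<lambda>m. D m \<psi>)" if \<psi>: "\<psi> \<in> schwartz" for \<psi>
  proof -
    obtain c where c: "c > 0" "\<And>A T. A > 0 \<Longrightarrow> bd p s A T \<Longrightarrow> norm (T \<psi>) \<le> c * A"
      by (rule bd_pairing_bound[OF p s \<psi>], rule that)
    show ?thesis
      by (rule summable_comparison_test[OF _ summable_mult[OF a(2), of c]]) (use c(2)[OF a(1) D] in blast)
  qed
  then show "\<psi> \<in> schwartz \<Longrightarrow> summable (\<lambda>m. D m \<psi>)" .
  let ?T = "\<lambda>\<psi>. \<Sum>m. D m \<psi>"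
  have f: "fmult (phi j) ?T = (\<lambda>\<psi>. \<Sum>m. fmult (phi j) (D m) \<psi>)" for j by (simp add: fmult_eq fun_eq_iff)
  have smf: "summable (\<lambda>m. fmult (phi j) (D m) \<psi>)" if "\<psi> \<in> schwartz" for j \<psi>
    unfolding fmult_eq by (rule sm[OF schwartz_ft_mult_ift[OF phi_schwartz that]])
  have "dlin ?T"
    unfolding dlin_def
  proof (intro ballI allI)
    fix f g :: "real^'n \<Rightarrow> complex" and x y assume fg: "f \<in> schwartz" "g \<in> schwartz"
    have "?T (\<lambda>z. x * f z + y * g z) = (\<Sum>m. x * D m f + y * D m g)"
      by (simp add: dlinD[OF bd_dlin[OF D] fg])
    also have "\<dots> = x * ?T f + y * ?T g"
      using sm[OF fg(1)] sm[OF fg(2)] by (simp add: suminf_add[symmetric] suminf_mult summable_mult)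
    finally show "?T (\<lambda>z. x * f z + y * g z) = x * ?T f + y * ?T g" .
  qed
  moreover have "(\<lambda>N. \<Sum>j\<in>{- int N..int N}. \<Sum>m. fmult (phi j) (D m) \<psi>) \<longlonglongrightarrow> ?T \<psi>" if \<psi>: "\<psi> \<in> schwartz" for \<psi>
  proof -
    obtain c where c: "c > 0" "\<And>A T N. A > 0 \<Longrightarrow> bd p s A T \<Longrightarrow> norm (\<Sum>j\<in>{- int N..int N}. fmult (phi j) T \<psi>) \<le> c * A"
      by (rule bd_pairing_bound[OF p s \<psi>], rule that)
    have e: "(\<Sum>j\<in>{- int N..int N}. \<Sum>m. fmult (phi j) (D m) \<psi>) = (\<Sum>m. \<Sum>j\<in>{- int N..int N}. fmult (phi j) (D m) \<psi>)" for N
      by (rule suminf_sum[symmetric]) (rule smf[OF \<psi>])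
    have "((\<lambda>N. \<Sum>m. \<Sum>j\<in>{- int N..int N}. fmult (phi j) (D m) \<psi>) \<longlongrightarrow> (\<Sum>m. D m \<psi>)) sequentially"
    proof (rule tannerys_theorem[THEN conjunct2, THEN conjunct2])
      show "(\<lambda>N. \<Sum>j\<in>{- int N..int N}. fmult (phi j) (D m) \<psi>) \<longlonglongrightarrow> D m \<psi>" for m
        using D[of m] \<psi> by (simp add: bd_def rec_def)
      show "\<forall>\<^sub>F (m, N) in sequentially \<times>\<^sub>F sequentially. norm (\<Sum>j\<in>{- int N..int N}. fmult (phi j) (D m) \<psi>) \<le> c * a m"
        using c(2)[OF a(1) D] by (intro always_eventually) auto
      show "summable (\<lambda>m. c * a m)" by (rule summable_mult[OF a(2)])
    qed simp
    then show ?thesis unfolding e .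
  qed
  ultimately have rec: "rec ?T" unfolding rec_def f by blast
  have "block_bound p s (\<Sum>m. a m) ?T"
    unfolding block_bound_def f
  proof
    fix j
    let ?c = "2 powr (- real_of_int j * s)"
    have "\<exists>w. represents w (fmult (phi j) (D m)) \<and> Lpb p (a m * ?c) w" for m
      using D[of m] unfolding bd_def block_bound_def by blast
    then obtain w where w: "\<And>m. represents (w m) (fmult (phi j) (D m))" "\<And>m. Lpb p (a m * ?c) (w m)" by metis
    have a0: "a m * ?c \<ge> 0" for m using a(1)[of m] by simp
    have ac: "summable (\<lambda>m. a m * ?c)" by (rule summable_mult2[OF a(2)])
    have L: "Lpb p (\<Sum>m. a m * ?c) (\<lambda>x. \<Sum>m. w m x)" by (rule Lpb_suminf(3)[OF w(2) a0 ac p])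
    have "represents (\<lambda>x. \<Sum>m. w m x) (\<lambda>\<psi>. \<Sum>m. fmult (phi j) (D m) \<psi>)"
    proof (rule represents_moderate[OF Lpb_moderate[OF L p]])
      fix \<psi> :: "real^'n \<Rightarrow> complex" assume \<psi>: "\<psi> \<in> schwartz"
      have "fmult (phi j) (D m) \<psi> = (\<integral>x. w m x * \<psi> x \<partial>lborel)" for m using w(1) \<psi> by (simp add: represents_def)
      then show "(\<Sum>m. fmult (phi j) (D m) \<psi>) = (\<integral>x. (\<Sum>m. w m x) * \<psi> x \<partial>lborel)"
        using sums_unique[OF Lpb_suminf_pairing[OF w(2) a0 ac p \<psi>]] by simp
    qed
    moreover have "(\<Sum>m. a m * ?c) = (\<Sum>m. a m) * ?c" by (rule suminf_mult2[OF a(2), symmetric])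
    ultimately show "\<exists>w. represents w (\<lambda>\<psi>. \<Sum>m. fmult (phi j) (D m) \<psi>) \<and> Lpb p ((\<Sum>m. a m) * ?c) w"
      using L by auto
  qed
  with rec show "bd p s (\<Sum>m. a m) ?T" by (simp add: bd_def)
qed

text \<open>For a fixed block the two regularities differ by a constant factor, so approximation in
  regularity \<open>r\<close> transports the bound in regularity \<open>s\<close> block by block,
  even if nothing converges in regularity \<open>s\<close>.\<close>

lemma block_bound_limit:
  assumes p: "p \<ge> 1" and B: "B \<ge> 0" and T: "bd p r A T"
    and approx: "\<And>e. e > 0 \<Longrightarrow> \<exists>S. bd p r e (\<lambda>\<psi>. T \<psi> - S \<psi>) \<and> block_bound p s B S"
  shows "block_bound p s B T"
  unfolding block_bound_def
proof
  fix j
  obtain w where w: "represents w (fmult (phi j) T)" using T unfolding bd_def block_bound_def by blast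
  let ?b = "2 powr (- real_of_int j * s)" and ?r = "2 powr (- real_of_int j * r)"
  have "Lpb p (B * ?b) w"
  proof (rule Lpb_closed)
    fix e :: real assume e: "e > 0"
    \<comment> \<open>This cancels the factor of block \<open>j\<close>, so that the error in that
      block is exactly \<open>e\<close>.\<close>
    define e' where "e' = e / ?r"
    have e': "e' > 0" using e by (simp add: e'_def)
    obtain S where S: "bd p r e' (\<lambda>\<psi>. T \<psi> - S \<psi>)" "block_bound p s B S" using approx[OF e'] by blast
    obtain d where d: "represents d (fmult (phi j) (\<lambda>\<psi>. T \<psi> - S \<psi>))" "Lpb p (e' * ?r) d"
      using S(1) unfolding bd_def block_bound_def by blast
    obtain v where v: "represents v (fmult (phi j) S)" "Lpb p (B * ?b) v"
      using S(2) unfolding block_bound_def by blast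
    have "represents (\<lambda>x. 1 * v x + 1 * d x) (fmult (phi j) T)"
      by (rule represents_deq[OF represents_lincomb[OF v(1) d(1)]]) (simp add: fmult_eq)
    then have ae: "AE x in lborel. w x = 1 * v x + 1 * d x" by (rule represents_unique[OF w])
    have "Lpb p (B * ?b + e' * ?r) (\<lambda>x. v x + d x)"
      by (rule Lpb_add[OF v(2) d(2)]) (use B e' p in auto)
    moreover have "e' * ?r = e" by (simp add: e'_def)
    ultimately show "Lpb p (B * ?b + e) w"
      using ae p by (intro Lpb_cong_AE[OF _ _ represents_measurable[OF w]]) auto
  qed (use B p in auto)
  with w show "\<exists>w. represents w (fmult (phi j) T) \<and> Lpb p (B * ?b) w" by blast
qed

end

section \<open>The inverse Laplacian and the Helmholtz projection on Besov spaces\<close>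

definition lap :: "real^'n::finite \<Rightarrow> complex" where
  "lap \<xi> = complex_of_real (1 / (norm \<xi>)\<^sup>2)"

definition hel :: "'n::finite \<Rightarrow> 'n \<Rightarrow> real^'n \<Rightarrow> complex" where
  "hel i j \<xi> = complex_of_real ((if i = j then 1 else 0) - (\<xi> $ i) * (\<xi> $ j) / (norm \<xi>)\<^sup>2)"

lemma hel_eq: "hel i j \<xi> = (if i = j then 1 else 0) - complex_of_real (\<xi> $ i) * (complex_of_real (\<xi> $ j) * lap \<xi>)"
  by (simp add: hel_def lap_def)

lemma lap_scale: "lap (c *\<^sub>R \<xi>) = complex_of_real (1 / c\<^sup>2) * lap \<xi>"
  by (simp add: lap_def power_mult_distrib)

lemma hel_scale: "c \<noteq> 0 \<Longrightarrow> hel i j (c *\<^sub>R \<xi>) = hel i j \<xi>"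
proof -
  assume c: "c \<noteq> 0"
  have "(c *\<^sub>R \<xi>) $ i * (c *\<^sub>R \<xi>) $ j / (norm (c *\<^sub>R \<xi>))\<^sup>2 = (c\<^sup>2 * (\<xi> $ i * \<xi> $ j)) / (c\<^sup>2 * (norm \<xi>)\<^sup>2)"
  proof -
    have n: "(norm (c *\<^sub>R \<xi>))\<^sup>2 = c\<^sup>2 * (norm \<xi>)\<^sup>2" by (simp add: power_mult_distrib)
    show ?thesis unfolding n by (simp add: power2_eq_square mult_ac)
  qed
  also have "\<dots> = \<xi> $ i * \<xi> $ j / (norm \<xi>)\<^sup>2" using c by simp
  finally show ?thesis by (simp only: hel_def)
qed

context littlewood_paley
begin

text \<open>Symbols living where a single block does: the singularities of \<open>lap\<close> and
  \<open>hel\<close> at the origin are invisible there, so multiplication by them preserves the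
  class.\<close>

definition ann :: "int \<Rightarrow> (real^'n \<Rightarrow> complex) \<Rightarrow> bool" where
  "ann j h \<longleftrightarrow> h \<in> schwartz \<and> (\<forall>\<xi>. phi j \<xi> = 0 \<longrightarrow> h \<xi> = 0)"

lemma ann_phi: "g \<in> schwartz \<Longrightarrow> ann j (\<lambda>\<xi>. phi j \<xi> * g \<xi>)" "ann j (phi j)"
  by (auto simp: ann_def intro!: schwartz_mult phi_schwartz)

lemma ann_lap: 
  assumes "ann j h" shows "ann j (\<lambda>\<xi>. lap \<xi> * h \<xi>)"
proof -
  have "(\<lambda>\<xi>. lap \<xi> * h \<xi>) \<in> schwartz"
    unfolding lap_def
  proof (rule schwartz_inverse_norm)
    fix \<xi> :: "real^'n" assume "norm \<xi> < 2 powr (real_of_int j - 1)"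
    then have "phi j \<xi> = 0" using phi_supp(1)[of j \<xi>] by linarith
    then show "h \<xi> = 0" using assms by (simp add: ann_def)
  qed (use assms in \<open>auto simp: ann_def\<close>)
  then show ?thesis using assms by (simp add: ann_def)
qed

lemma ann_coord: "ann j h \<Longrightarrow> ann j (\<lambda>\<xi>. complex_of_real (\<xi> $ k) * h \<xi>)"
  by (simp add: ann_def schwartz_coord)

lemma ann_cmult: "ann j h \<Longrightarrow> ann j (\<lambda>\<xi>. c * h \<xi>)"
  by (simp add: ann_def schwartz_cmult)

lemma ann_hel:
  assumes "ann j h" shows "ann j (\<lambda>\<xi>. hel i l \<xi> * h \<xi>)"
proof -
  have e: "(\<lambda>\<xi>. hel i l \<xi> * h \<xi>) = (\<lambda>\<xi>. (if i = l then 1 else 0) * h \<xi> - complex_of_real (\<xi> $ i) * (complex_of_real (\<xi> $ l) * (lap \<xi> * h \<xi>)))"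
    by (simp add: hel_eq fun_eq_iff algebra_simps)
  have "(\<lambda>\<xi>. hel i l \<xi> * h \<xi>) \<in> schwartz"
    unfolding e using assms ann_lap[OF assms] by (intro schwartz_diff schwartz_cmult schwartz_coord) (auto simp: ann_def)
  then show ?thesis using assms by (simp add: ann_def)
qed

lemma sum_phi_ann:
  assumes "ann k h" "int N \<ge> \<bar>k\<bar> + 2" shows "(\<Sum>j\<in>{- int N..int N}. phi j \<xi>) * h \<xi> = h \<xi>"
proof (cases "phi k \<xi> = 0")
  case False
  then show ?thesis using sum_phi_phi[OF assms(2), of \<xi>] by simp
qed (use assms in \<open>simp add: ann_def\<close>)

lemma ann_T_sum:
  assumes T: "dlin T" and h: "ann k h" and N: "int N \<ge> \<bar>k\<bar> + 2"
  shows "(\<Sum>j\<in>{- int N..int N}. T (ft (\<lambda>\<xi>. phi j \<xi> * h \<xi>))) = T (ft h)"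
proof -
  have S: "(\<lambda>\<xi>. phi j \<xi> * h \<xi>) \<in> schwartz" for j using h by (intro schwartz_mult phi_schwartz) (simp add: ann_def)
  have "(\<Sum>j\<in>{- int N..int N}. T (ft (\<lambda>\<xi>. phi j \<xi> * h \<xi>))) = T (\<lambda>x. \<Sum>j\<in>{- int N..int N}. ft (\<lambda>\<xi>. phi j \<xi> * h \<xi>) x)"
    by (rule dlin_sum[OF T, symmetric]) (intro schwartz_ft S)
  also have "(\<lambda>x. \<Sum>j\<in>{- int N..int N}. ft (\<lambda>\<xi>. phi j \<xi> * h \<xi>) x) = ft (\<lambda>\<xi>. \<Sum>j\<in>{- int N..int N}. phi j \<xi> * h \<xi>)"
    by (rule ft_sum[symmetric]) (rule S)
  also have "(\<lambda>\<xi>. \<Sum>j\<in>{- int N..int N}. phi j \<xi> * h \<xi>) = h"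
    by (rule ext) (simp only: sum_distrib_right[symmetric] sum_phi_ann[OF h N])
  finally show ?thesis .
qed

lemma eventually_ann_T_sum:
  assumes "dlin T" "ann k h"
  shows "\<forall>\<^sub>F N in sequentially. (\<Sum>j\<in>{- int N..int N}. T (ft (\<lambda>\<xi>. phi j \<xi> * h \<xi>))) = T (ft h)"
  unfolding eventually_sequentially
  by (rule exI[of _ "nat (\<bar>k\<bar> + 2)"]) (use ann_T_sum[OF assms] in auto)

text \<open>On a test function with annular spectrum all but finitely many blocks contribute zero.
  The partial sums in \<open>mD\<close> are eventually constant, and the operator is plain
  multiplication by \<open>m\<close>.\<close>

lemma mD_ann:
  assumes T: "dlin T" and h: "ann k h" and m: "ann k (\<lambda>\<xi>. m \<xi> * h \<xi>)"
  shows "mD \<phi> m T (ft h) = T (ft (\<lambda>\<xi>. m \<xi> * h \<xi>))"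
proof -
  have hS: "h \<in> schwartz" using h by (simp add: ann_def)
  have "fmult (\<lambda>\<xi>. m \<xi> * \<phi> ((2 powr - real_of_int j) *\<^sub>R \<xi>)) T (ft h) = T (ft (\<lambda>\<xi>. phi j \<xi> * (m \<xi> * h \<xi>)))" for j
    by (simp add: fmult_eq ift_ft[OF hS] phi_def[symmetric] mult_ac)
  then have "mD \<phi> m T (ft h) = lim (\<lambda>N. \<Sum>j\<in>{- int N..int N}. T (ft (\<lambda>\<xi>. phi j \<xi> * (m \<xi> * h \<xi>))))"
    by (simp add: mD_def)
  also have "\<dots> = T (ft (\<lambda>\<xi>. m \<xi> * h \<xi>))"
    by (rule limI, rule tendsto_eventually, rule eventually_ann_T_sum[OF T m])
  finally show ?thesis .
qed

text \<open>The common shape of both terms of the equation after localisation: a finite sum of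
  multipliers, indexed by a component for the forcing and by a pair of components for the divergence
  term.\<close>

definition opsum :: "'i set \<Rightarrow> ('i \<Rightarrow> real^'n \<Rightarrow> complex) \<Rightarrow> ('i \<Rightarrow> 'n distr) \<Rightarrow> int \<Rightarrow> 'n distr" where
  "opsum I \<mu> G j = (\<lambda>\<psi>. \<Sum>l\<in>I. fmult (\<lambda>\<xi>. \<mu> l \<xi> * phi j \<xi>) (G l) \<psi>)"

text \<open>Two nested limits collapse into one: the outer limit evaluates the inner one at annular
  test functions, where \<open>mD_ann\<close> replaces it by multiplication with the symbol.\<close>

lemma invlap_helmholtz:
  assumes G: "\<And>l. dlin (G l)" and \<psi>: "\<psi> \<in> schwartz"
  shows "invlap \<phi> (helmholtz \<phi> G i) \<psi> = lim (\<lambda>N. \<Sum>j\<in>{- int N..int N}. opsum UNIV (\<lambda>l \<xi>. hel i l \<xi> * lap \<xi>) G j \<psi>)"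
proof -
  have "fmult (\<lambda>\<xi>. complex_of_real (1 / (norm \<xi>)\<^sup>2) * \<phi> ((2 powr (- real_of_int j)) *\<^sub>R \<xi>)) (helmholtz \<phi> G i) \<psi>
     = opsum UNIV (\<lambda>l \<xi>. hel i l \<xi> * lap \<xi>) G j \<psi>" for j
  proof -
    let ?h = "\<lambda>\<xi>. lap \<xi> * (phi j \<xi> * ift \<psi> \<xi>)"
    have h: "ann j ?h" by (intro ann_lap ann_phi schwartz_ift \<psi>)
    have "fmult (\<lambda>\<xi>. complex_of_real (1 / (norm \<xi>)\<^sup>2) * \<phi> ((2 powr (- real_of_int j)) *\<^sub>R \<xi>)) (helmholtz \<phi> G i) \<psi> = helmholtz \<phi> G i (ft ?h)"
      by (simp add: fmult_eq lap_def phi_def mult.assoc)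
    also have "\<dots> = (\<Sum>l\<in>UNIV. mD \<phi> (hel i l) (G l) (ft ?h))"
      by (simp add: helmholtz_def hel_def[abs_def])
    also have "\<dots> = (\<Sum>l\<in>UNIV. G l (ft (\<lambda>\<xi>. hel i l \<xi> * ?h \<xi>)))"
      by (intro sum.cong refl mD_ann[OF G h] ann_hel[OF h])
    finally show ?thesis by (simp add: opsum_def fmult_eq mult.assoc)
  qed
  then show ?thesis by (simp add: invlap_def mD_def)
qed

text \<open>Bounds on the localised terms suffice. They are band limited, so
  \<open>block_sum_function\<close> shows that the limit exists and is a function. Its own blocks
  are again the localised terms, since on annular test functions the partial sums are eventually
  constant.\<close>

lemma operator_bd:
  assumes p: "p \<ge> 1" and s: "0 < s" "s < CARD('n) / p" and A: "A > 0"
    and G: "\<And>l. l \<in> I \<Longrightarrow> dlin (G l)" and \<mu>: "\<And>l j h. l \<in> I \<Longrightarrow> ann j h \<Longrightarrow> ann j (\<lambda>\<xi>. \<mu> l \<xi> * h \<xi>)"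
    and w: "\<And>j. represents (w j) (opsum I \<mu> G j)" "blocks p s A w"
    and Q: "\<And>\<psi>. \<psi> \<in> schwartz \<Longrightarrow> Q \<psi> = lim (\<lambda>N. \<Sum>j\<in>{- int N..int N}. opsum I \<mu> G j \<psi>)"
  shows "bd p s A Q" and "\<psi> \<in> schwartz \<Longrightarrow> (\<lambda>N. \<Sum>j\<in>{- int N..int N}. opsum I \<mu> G j \<psi>) \<longlonglongrightarrow> Q \<psi>"
proof -
  have S: "(\<lambda>\<xi>. \<mu> l \<xi> * phi j \<xi>) \<in> schwartz" if "l \<in> I" for l j
    using \<mu>[OF that ann_phi(2)] by (simp add: ann_def)
  have "band w"
    unfolding band_def
  proof
    fix j
    have "Lpb p (A * 2 powr (- real_of_int j * s)) (w j)" using w(2) by (simp add: blocks_def)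
    then have "represents (cnv (ift (phit j)) (w j)) (fmult (phit j) (opsum I \<mu> G j))"
      using represents_fmult[OF phit_schwartz Lpb_moderate[OF _ p] w(1)] by blast
    then have "represents (cnv (ift (phit j)) (w j)) (opsum I \<mu> G j)"
    proof (rule represents_deq)
      fix \<psi> :: "real^'n \<Rightarrow> complex" assume \<psi>: "\<psi> \<in> schwartz"
      have "fmult (\<lambda>\<xi>. \<mu> l \<xi> * phi j \<xi>) (G l) (ft (\<lambda>\<xi>. phit j \<xi> * ift \<psi> \<xi>)) = fmult (\<lambda>\<xi>. \<mu> l \<xi> * phi j \<xi>) (G l) \<psi>" for l
      proof -
        have "ift (ft (\<lambda>\<xi>. phit j \<xi> * ift \<psi> \<xi>)) = (\<lambda>\<xi>. phit j \<xi> * ift \<psi> \<xi>)"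
          by (intro ext ift_ft schwartz_mult phit_schwartz schwartz_ift \<psi>)
        then have "fmult (\<lambda>\<xi>. \<mu> l \<xi> * phi j \<xi>) (G l) (ft (\<lambda>\<xi>. phit j \<xi> * ift \<psi> \<xi>)) = G l (ft (\<lambda>\<xi>. \<mu> l \<xi> * (phit j \<xi> * phi j \<xi>) * ift \<psi> \<xi>))"
          by (simp add: fmult_eq mult_ac)
        then show ?thesis by (simp add: fmult_eq phit_phi)
      qed
      then show "opsum I \<mu> G j \<psi> = fmult (phit j) (opsum I \<mu> G j) \<psi>"
        by (simp add: fmult_eq[of "phit j"] opsum_def)
    qed
    then show "AE x in lborel. w j x = cnv (ift (phit j)) (w j) x" by (rule represents_unique[OF w(1)])
  qed
  obtain C where C: "C > 0" "\<And>A w. A > 0 \<Longrightarrow> blocks p s A w \<Longrightarrow> band w \<Longrightarrow>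
    \<exists>g. moderate g \<and> (\<forall>\<psi>\<in>schwartz. (\<lambda>N. \<Sum>j\<in>{- int N..int N}. \<integral>x. w j x * \<psi> x \<partial>lborel) \<longlonglongrightarrow> (\<integral>x. g x * \<psi> x \<partial>lborel)) \<and>
     (\<forall>l. \<exists>g1 g2. (AE x in lborel. g x = g1 x + g2 x) \<and> (AE x in lborel. norm (g1 x) \<le> C * A * 2 powr (real_of_int l * (CARD('n) / p - s)))
       \<and> g1 \<in> borel_measurable borel \<and> Lpb p (C * A * 2 powr (- real_of_int l * s)) g2)"
    by (rule block_sum_function[OF p s], rule that)
  obtain g where g: "moderate g" "\<And>\<psi>. \<psi> \<in> schwartz \<Longrightarrow> (\<lambda>N. \<Sum>j\<in>{- int N..int N}. \<integral>x. w j x * \<psi> x \<partial>lborel) \<longlonglongrightarrow> (\<integral>x. g x * \<psi> x \<partial>lborel)"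
    using C(2)[OF A w(2) \<open>band w\<close>] by blast
  have wo: "(\<integral>x. w j x * \<psi> x \<partial>lborel) = opsum I \<mu> G j \<psi>" if "\<psi> \<in> schwartz" for j \<psi>
    using w(1)[of j] that by (simp add: represents_def)
  have lim: "(\<lambda>N. \<Sum>j\<in>{- int N..int N}. opsum I \<mu> G j \<psi>) \<longlonglongrightarrow> Q \<psi>" and Qg: "Q \<psi> = (\<integral>x. g x * \<psi> x \<partial>lborel)"
    if \<psi>: "\<psi> \<in> schwartz" for \<psi>
  proof -
    have l: "(\<lambda>N. \<Sum>j\<in>{- int N..int N}. opsum I \<mu> G j \<psi>) \<longlonglongrightarrow> (\<integral>x. g x * \<psi> x \<partial>lborel)"
      using g(2)[OF \<psi>] unfolding wo[OF \<psi>] .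
    then show "Q \<psi> = (\<integral>x. g x * \<psi> x \<partial>lborel)" unfolding Q[OF \<psi>] by (rule limI)
    with l show "(\<lambda>N. \<Sum>j\<in>{- int N..int N}. opsum I \<mu> G j \<psi>) \<longlonglongrightarrow> Q \<psi>" by simp
  qed
  show "\<psi> \<in> schwartz \<Longrightarrow> (\<lambda>N. \<Sum>j\<in>{- int N..int N}. opsum I \<mu> G j \<psi>) \<longlonglongrightarrow> Q \<psi>" by (rule lim)
  have Qrep: "represents g Q" by (rule represents_moderate[OF g(1) Qg])
  have block: "fmult (phi k) Q \<psi> = opsum I \<mu> G k \<psi>" if \<psi>: "\<psi> \<in> schwartz" for k \<psi>
  proof -
    have tS: "ft (\<lambda>\<xi>. phi k \<xi> * ift \<psi> \<xi>) \<in> schwartz" by (rule schwartz_ft_mult_ift[OF phi_schwartz \<psi>])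
    have i: "ift (ft (\<lambda>\<xi>. phi k \<xi> * ift \<psi> \<xi>)) = (\<lambda>\<xi>. phi k \<xi> * ift \<psi> \<xi>)"
      by (intro ext ift_ft schwartz_mult phi_schwartz schwartz_ift \<psi>)
    have "(\<lambda>N. \<Sum>j\<in>{- int N..int N}. opsum I \<mu> G j (ft (\<lambda>\<xi>. phi k \<xi> * ift \<psi> \<xi>))) \<longlonglongrightarrow> fmult (phi k) Q \<psi>"
      unfolding fmult_eq[of "phi k"] by (rule lim[OF tS])
    moreover have "(\<lambda>N. \<Sum>j\<in>{- int N..int N}. opsum I \<mu> G j (ft (\<lambda>\<xi>. phi k \<xi> * ift \<psi> \<xi>))) \<longlonglongrightarrow> opsum I \<mu> G k \<psi>"
    proof (rule tendsto_eventually)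
      show "\<forall>\<^sub>F N in sequentially. (\<Sum>j\<in>{- int N..int N}. opsum I \<mu> G j (ft (\<lambda>\<xi>. phi k \<xi> * ift \<psi> \<xi>))) = opsum I \<mu> G k \<psi>"
        unfolding eventually_sequentially
      proof (intro exI[of _ "nat (\<bar>k\<bar> + 2)"] allI impI)
        fix N assume "nat (\<bar>k\<bar> + 2) \<le> N"
        then have N: "int N \<ge> \<bar>k\<bar> + 2" by simp
        have "(\<Sum>j\<in>{- int N..int N}. opsum I \<mu> G j (ft (\<lambda>\<xi>. phi k \<xi> * ift \<psi> \<xi>))) =
           (\<Sum>l\<in>I. \<Sum>j\<in>{- int N..int N}. G l (ft (\<lambda>\<xi>. phi j \<xi> * (\<mu> l \<xi> * (phi k \<xi> * ift \<psi> \<xi>)))))"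
          unfolding opsum_def fmult_eq i by (subst sum.swap) (simp add: mult_ac)
        also have "\<dots> = (\<Sum>l\<in>I. G l (ft (\<lambda>\<xi>. \<mu> l \<xi> * (phi k \<xi> * ift \<psi> \<xi>))))"
          by (intro sum.cong refl ann_T_sum[OF G _ N] \<mu> ann_phi schwartz_ift \<psi>)
        finally show "(\<Sum>j\<in>{- int N..int N}. opsum I \<mu> G j (ft (\<lambda>\<xi>. phi k \<xi> * ift \<psi> \<xi>))) = opsum I \<mu> G k \<psi>"
          by (simp add: opsum_def fmult_eq mult.assoc)
      qed
    qed
    ultimately show ?thesis by (rule LIMSEQ_unique)
  qed
  have "rec Q"
    unfolding rec_def using represents_dlin[OF Qrep] lim by (auto simp: block)
  moreover have "block_bound p s A Q"
    unfolding block_bound_def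
  proof
    fix j
    show "\<exists>w. represents w (fmult (phi j) Q) \<and> Lpb p (A * 2 powr (- real_of_int j * s)) w"
      using represents_deq[OF w(1) block, of j] w(2) unfolding blocks_def by blast
  qed
  ultimately show "bd p s A Q" by (simp add: bd_def)
qed

section \<open>Homogeneous symbols acting on blocks\<close>

lemma represents_sum:
  assumes "finite I" "\<And>l. l \<in> I \<Longrightarrow> represents (g l) (T l)"
  shows "represents (\<lambda>x. \<Sum>l\<in>I. g l x) (\<lambda>\<psi>. \<Sum>l\<in>I. T l \<psi>)"
  using assms
proof (induction I)
  case (insert l I)
  then show ?case using represents_lincomb[of "g l" "T l" "\<lambda>x. \<Sum>l\<in>I. g l x" "\<lambda>\<psi>. \<Sum>l\<in>I. T l \<psi>" 1 1] by simp
qed (simp add: represents_def)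

lemma Lpb_cnv_dil:
  assumes K: "K \<in> schwartz" and p: "p \<ge> 1" and B: "B \<ge> 0" and g: "Lpb p B g"
  shows "Lpb p (((\<integral>x. norm (K x) \<partial>lborel) + 1) * B) (cnv (dil j K) g)"
proof (rule Lpb_cnv_L1[OF dil_schwartz[OF K] _ _ g p B])
  show "0 < (\<integral>x. norm (K x) \<partial>lborel) + 1" by (intro add_nonneg_pos integral_nonneg_AE) auto
qed (simp add: dil_integral)

lemma ift_cmult: "ift (\<lambda>\<xi>. c * m \<xi>) x = c * ift m x"
  by (simp add: ift_conv_ft ft_cmult)

text \<open>Homogeneity makes every block kernel a dilate of the kernel of block 0, so one Schwartz
  estimate serves all \<open>j\<close>, up to the factor \<open>2 powr (j * a)\<close>.\<close>

lemma symbol_kernel: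
  assumes h: "\<And>c \<xi>. c > 0 \<Longrightarrow> \<mu> (c *\<^sub>R \<xi>) = complex_of_real (c powr a) * \<mu> \<xi>"
  shows "ift (\<lambda>\<xi>. \<mu> \<xi> * phi j \<xi>) = (\<lambda>x. complex_of_real (2 powr (real_of_int j * a)) * dil j (ift (\<lambda>\<xi>. \<mu> \<xi> * phi 0 \<xi>)) x)"
proof
  fix x
  have "\<mu> \<xi> * phi j \<xi> = complex_of_real (2 powr (real_of_int j * a)) * (\<mu> ((2 powr (- real_of_int j)) *\<^sub>R \<xi>) * phi 0 ((2 powr (- real_of_int j)) *\<^sub>R \<xi>))" for \<xi>
  proof -
    have "phi j \<xi> = phi 0 ((2 powr (- real_of_int j)) *\<^sub>R \<xi>)" using phi_add[of 0 j \<xi>] by simp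
    moreover have "(2 powr (real_of_int j * a)) * ((2 powr (- real_of_int j)) powr a) = 1"
      by (simp add: powr_powr powr_add[symmetric])
    then have "complex_of_real (2 powr (real_of_int j * a)) * complex_of_real ((2 powr (- real_of_int j)) powr a) = 1"
      by (simp only: of_real_mult[symmetric] of_real_1)
    ultimately show ?thesis using h[of "2 powr (- real_of_int j)" \<xi>] by (simp add: mult.assoc[symmetric])
  qed
  then have "ift (\<lambda>\<xi>. \<mu> \<xi> * phi j \<xi>) x = complex_of_real (2 powr (real_of_int j * a)) * ift (\<lambda>\<xi>. \<mu> ((2 powr (- real_of_int j)) *\<^sub>R \<xi>) * phi 0 ((2 powr (- real_of_int j)) *\<^sub>R \<xi>)) x"
    by (simp add: ift_cmult)
  also have "ift (\<lambda>\<xi>. \<mu> ((2 powr (- real_of_int j)) *\<^sub>R \<xi>) * phi 0 ((2 powr (- real_of_int j)) *\<^sub>R \<xi>)) = dil j (ift (\<lambda>\<xi>. \<mu> \<xi> * phi 0 \<xi>))"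
    using ift_dil[of "\<lambda>\<xi>. \<mu> \<xi> * phi 0 \<xi>" j] .
  finally show "ift (\<lambda>\<xi>. \<mu> \<xi> * phi j \<xi>) x = complex_of_real (2 powr (real_of_int j * a)) * dil j (ift (\<lambda>\<xi>. \<mu> \<xi> * phi 0 \<xi>)) x" .
qed

lemma cnv_cmult: "cnv (\<lambda>x. c * K x) g = (\<lambda>y. c * cnv K g y)"
  by (simp add: cnv_def fun_eq_iff mult.assoc)

text \<open>Block \<open>j\<close> of the output sees the five blocks of \<open>G\<close> within
  distance two. Replacing \<open>j + k\<close> by \<open>j\<close> in their weights costs
  \<open>2 powr (- k * r)\<close>, and these costs sum to the constant.\<close>

lemma multiplier_block:
  assumes p: "p \<ge> 1" and \<mu>: "ann 0 (\<lambda>\<xi>. \<mu> \<xi> * phi 0 \<xi>)" "\<And>j. (\<lambda>\<xi>. \<mu> \<xi> * phi j \<xi>) \<in> schwartz"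
    and h: "\<And>c \<xi>. c > 0 \<Longrightarrow> \<mu> (c *\<^sub>R \<xi>) = complex_of_real (c powr a) * \<mu> \<xi>"
  obtains C where "C > 0" "\<And>A G j. A \<ge> 0 \<Longrightarrow> dlin G \<Longrightarrow> block_bound p r A G \<Longrightarrow>
     \<exists>w. represents w (fmult (\<lambda>\<xi>. \<mu> \<xi> * phi j \<xi>) G) \<and> Lpb p (C * A * 2 powr (- real_of_int j * (r - a))) w"
proof -
  define K where "K = ift (\<lambda>\<xi>. \<mu> \<xi> * phi 0 \<xi>)"
  have K: "K \<in> schwartz" unfolding K_def using \<mu>(2) by (rule schwartz_ift)
  define J where "J = (\<integral>x. norm (K x) \<partial>lborel) + 1"
  have J: "J > 0" unfolding J_def by (intro add_nonneg_pos integral_nonneg_AE) auto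
  define C where "C = (\<Sum>k\<in>{-2..2::int}. J * 2 powr (- real_of_int k * r))"
  have C0: "C > 0" unfolding C_def using J by (intro sum_pos) auto
  have main: "\<exists>w. represents w (fmult (\<lambda>\<xi>. \<mu> \<xi> * phi j \<xi>) G) \<and> Lpb p (C * A * 2 powr (- real_of_int j * (r - a))) w"
    if A: "A \<ge> 0" and G: "dlin G" and b: "block_bound p r A G" for A G j
  proof -
    obtain v where v: "\<And>k. represents (v k) (fmult (phi k) G)" "\<And>k. Lpb p (A * 2 powr (- real_of_int k * r)) (v k)"
      using b unfolding block_bound_def by metis
    let ?m = "\<lambda>\<xi>. \<mu> \<xi> * phi j \<xi>"
    have rep: "represents (cnv (ift ?m) (v k)) (fmult ?m (fmult (phi k) G))" for k
      by (rule represents_fmult[OF \<mu>(2) Lpb_moderate[OF v(2) p] v(1)])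
    have "represents (\<lambda>x. \<Sum>k\<in>{-2..2}. cnv (ift ?m) (v (j + k)) x) (\<lambda>\<psi>. \<Sum>k\<in>{-2..2}. fmult ?m (fmult (phi (j + k)) G) \<psi>)"
      by (rule represents_sum) (use rep in auto)
    then have R: "represents (\<lambda>x. \<Sum>k\<in>{-2..2}. cnv (ift ?m) (v (j + k)) x) (fmult ?m G)"
    proof (rule represents_deq)
      fix \<psi> :: "real^'n \<Rightarrow> complex" assume \<psi>: "\<psi> \<in> schwartz"
      have S: "(\<lambda>\<xi>. phi k \<xi> * ?m \<xi> * ift \<psi> \<xi>) \<in> schwartz" for k
        by (intro schwartz_mult[OF schwartz_mult] phi_schwartz \<mu> schwartz_ift \<psi>)
      have "(\<Sum>k\<in>{-2..2}. fmult ?m (fmult (phi (j + k)) G) \<psi>) = (\<Sum>k\<in>{j-2..j+2}. fmult ?m (fmult (phi k) G) \<psi>)"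
        by (rule sum.reindex_bij_witness[of _ "\<lambda>k. k - j" "\<lambda>k. j + k"]) auto
      also have "\<dots> = (\<Sum>k\<in>{j-2..j+2}. G (ft (\<lambda>\<xi>. phi k \<xi> * ?m \<xi> * ift \<psi> \<xi>)))"
        by (intro sum.cong refl) (simp only: fmult_fmult[OF \<mu>(2) phi_schwartz \<psi>], simp only: fmult_eq)
      also have "\<dots> = G (\<lambda>x. \<Sum>k\<in>{j-2..j+2}. ft (\<lambda>\<xi>. phi k \<xi> * ?m \<xi> * ift \<psi> \<xi>) x)"
        by (rule dlin_sum[OF G, symmetric]) (intro schwartz_ft S)
      also have "(\<lambda>x. \<Sum>k\<in>{j-2..j+2}. ft (\<lambda>\<xi>. phi k \<xi> * ?m \<xi> * ift \<psi> \<xi>) x) = ft (\<lambda>\<xi>. \<Sum>k\<in>{j-2..j+2}. phi k \<xi> * ?m \<xi> * ift \<psi> \<xi>)"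
        by (rule ft_sum[symmetric]) (rule S)
      also have "(\<lambda>\<xi>. \<Sum>k\<in>{j-2..j+2}. phi k \<xi> * ?m \<xi> * ift \<psi> \<xi>) = (\<lambda>\<xi>. ?m \<xi> * ift \<psi> \<xi>)"
      proof
        fix \<xi>
        have "(\<Sum>k\<in>{j-2..j+2}. phi k \<xi> * ?m \<xi> * ift \<psi> \<xi>) = \<mu> \<xi> * (phit j \<xi> * phi j \<xi>) * ift \<psi> \<xi>"
          unfolding phit_def sum_distrib_right sum_distrib_left by (intro sum.cong refl) (simp only: mult_ac)
        then show "(\<Sum>k\<in>{j-2..j+2}. phi k \<xi> * ?m \<xi> * ift \<psi> \<xi>) = ?m \<xi> * ift \<psi> \<xi>" by (simp add: phit_phi)
      qed
      finally show "fmult ?m G \<psi> = (\<Sum>k\<in>{-2..2}. fmult ?m (fmult (phi (j + k)) G) \<psi>)" by (simp add: fmult_eq)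
    qed
    have "Lpb p (\<Sum>k\<in>{-2..2}. J * 2 powr (- real_of_int k * r) * A * 2 powr (- real_of_int j * (r - a))) (\<lambda>x. \<Sum>k\<in>{-2..2}. cnv (ift ?m) (v (j + k)) x)"
    proof (rule Lpb_sum)
      fix k
      have "Lpb p (norm (complex_of_real (2 powr (real_of_int j * a))) * (J * (A * 2 powr (- real_of_int (j + k) * r)))) (\<lambda>y. complex_of_real (2 powr (real_of_int j * a)) * cnv (dil j K) (v (j + k)) y)"
        unfolding J_def by (intro Lpb_cmult Lpb_cnv_dil[OF K p _ v(2)] mult_nonneg_nonneg add_nonneg_nonneg integral_nonneg_AE) (use A in auto)
      moreover have "cnv (ift ?m) (v (j + k)) = (\<lambda>y. complex_of_real (2 powr (real_of_int j * a)) * cnv (dil j K) (v (j + k)) y)"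
      proof -
        have "ift ?m = (\<lambda>x. complex_of_real (2 powr (real_of_int j * a)) * dil j K x)"
          unfolding K_def by (rule symbol_kernel) (rule h)
        then show ?thesis by (simp only: cnv_cmult)
      qed
      moreover have "norm (complex_of_real (2 powr (real_of_int j * a))) * (J * (A * 2 powr (- real_of_int (j + k) * r))) = J * 2 powr (- real_of_int k * r) * A * 2 powr (- real_of_int j * (r - a))"
      proof -
        have "2 powr (real_of_int j * a) * 2 powr (- real_of_int (j + k) * r) = 2 powr (- real_of_int k * r) * 2 powr (- real_of_int j * (r - a))"
          unfolding powr_add[symmetric] by (simp add: algebra_simps)
        then show ?thesis by (simp add: mult_ac)
      qed
      ultimately show "Lpb p (J * 2 powr (- real_of_int k * r) * A * 2 powr (- real_of_int j * (r - a))) (cnv (ift ?m) (v (j + k)))"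
        by (simp only:)
    qed (use J A p in auto)
    moreover have "(\<Sum>k\<in>{-2..2::int}. J * 2 powr (- real_of_int k * r) * A * 2 powr (- real_of_int j * (r - a))) = C * A * 2 powr (- real_of_int j * (r - a))"
      by (simp only: C_def sum_distrib_right)
    ultimately show ?thesis using R by auto
  qed
  show ?thesis by (rule that[OF C0]) (rule main)
qed

end

section \<open>The linear and the bilinear term\<close>

lemma dlin_dderiv:
  assumes "dlin T" shows "dlin (dderiv k T)"
  unfolding dlin_def dderiv_def
proof (intro ballI allI)
  fix f g :: "real^'a \<Rightarrow> complex" and a b assume fg: "f \<in> schwartz" "g \<in> schwartz"
  have "pd k (\<lambda>x. a * f x + b * g x) = (\<lambda>x. a * pd k f x + b * pd k g x)"
    using fg by (simp add: pd_add pd_cmult schwartz_cmult)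
  then show "- T (pd k (\<lambda>x. a * f x + b * g x)) = a * - T (pd k f) + b * - T (pd k g)"
    using dlinD[OF assms schwartz_pd[OF fg(1)] schwartz_pd[OF fg(2)]] by simp
qed

lemma dlin_sum_distr: "(\<And>i. i \<in> I \<Longrightarrow> dlin (T i)) \<Longrightarrow> dlin (\<lambda>\<psi>. \<Sum>i\<in>I. T i \<psi>)"
  by (simp add: dlin_def sum.distrib sum_distrib_left)

lemma dlin_divg: "(\<And>l k. dlin (F l k)) \<Longrightarrow> dlin (divg F l)"
  unfolding divg_def by (intro dlin_sum_distr dlin_dderiv)

text \<open>The minus sign in \<open>dderiv\<close> meets the \<open>- \<i>\<close> from
  differentiating \<open>ft\<close>, which leaves the usual symbol of a derivative.\<close>

lemma dderiv_ft:
  assumes T: "dlin T" and h: "h \<in> schwartz"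
  shows "dderiv k T (ft h) = T (ft (\<lambda>\<xi>. \<i> * (complex_of_real (\<xi> $ k) * h \<xi>)))"
proof -
  let ?g = "ft (\<lambda>\<xi>. complex_of_real (\<xi> $ k) * h \<xi>)"
  have g: "?g \<in> schwartz" by (intro schwartz_ft schwartz_coord h)
  have "dderiv k T (ft h) = - T (\<lambda>x. - \<i> * ?g x)"
    unfolding dderiv_def pd_ft[OF h] by (simp only: ft_cmult[abs_def])
  also have "\<dots> = \<i> * T ?g" using dlin_cmult[OF T g, of "- \<i>"] by simp
  also have "\<dots> = T (\<lambda>x. \<i> * ?g x)" using dlin_cmult[OF T g, of \<i>] by simp
  also have "(\<lambda>x. \<i> * ?g x) = ft (\<lambda>\<xi>. \<i> * (complex_of_real (\<xi> $ k) * h \<xi>))"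
    by (rule ext) (simp only: ft_cmult)
  finally show ?thesis .
qed

context littlewood_paley
begin

text \<open>The symbol of the inverse Laplacian composed with the Helmholtz projection, homogeneous
  of degree \<open>- 2\<close>.\<close>

definition hsym :: "'n \<Rightarrow> 'n \<Rightarrow> real^'n \<Rightarrow> complex" where
  "hsym i l \<xi> = hel i l \<xi> * lap \<xi>"

lemma ann_hsym: "ann j h \<Longrightarrow> ann j (\<lambda>\<xi>. hsym i l \<xi> * h \<xi>)"
  unfolding hsym_def mult.assoc by (intro ann_hel ann_lap)

lemma hsym_scale: "c > 0 \<Longrightarrow> hsym i l (c *\<^sub>R \<xi>) = complex_of_real (c powr (- 2)) * hsym i l \<xi>"
proof -
  assume c: "c > 0"
  then have "c powr (- 2) = 1 / c\<^sup>2" by (simp add: powr_minus_divide)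
  then show ?thesis using c by (simp add: hsym_def hel_scale lap_scale)
qed

lemma ann_mult_phi: "ann j (\<lambda>\<xi>. \<mu> \<xi> * phi j \<xi>) \<Longrightarrow> (\<lambda>\<xi>. \<mu> \<xi> * phi j \<xi>) \<in> schwartz"
  by (simp add: ann_def)

text \<open>The degree \<open>- 2\<close> of \<open>hsym\<close> raises regularity from
  \<open>s - 2\<close> to \<open>s\<close>. The data have negative regularity when
  \<open>s < 2\<close>, so they enter through linearity and block bounds rather than as
  functions.\<close>

lemma forcing_bd:
  assumes p: "p \<ge> 1" and s: "0 < s" "s < CARD('n) / p"
  obtains C where "C > 0" "\<And>A f i. A > 0 \<Longrightarrow> (\<And>l. dlin (f l)) \<Longrightarrow> (\<And>l. block_bound p (s - 2) A (f l)) \<Longrightarrow>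
     bd p s (C * A) (invlap \<phi> (helmholtz \<phi> f i))"
proof -
  \<comment> \<open>\<open>P\<close> packages one constant per pair of components, so that all of
    them can be chosen at once and then summed into a single one.\<close>
  define P where "P i l C \<longleftrightarrow> C > 0 \<and> (\<forall>A G j. A \<ge> 0 \<longrightarrow> dlin G \<longrightarrow> block_bound p (s - 2) A G \<longrightarrow>
     (\<exists>w. represents w (fmult (\<lambda>\<xi>. hsym i l \<xi> * phi j \<xi>) G) \<and> Lpb p (C * A * 2 powr (- real_of_int j * s)) w))" for i l C
  have "\<exists>C. P i l C" for i l
  proof -
    obtain C where C: "C > 0" "\<And>A G j. A \<ge> 0 \<Longrightarrow> dlin G \<Longrightarrow> block_bound p (s - 2) A G \<Longrightarrow>
       \<exists>w. represents w (fmult (\<lambda>\<xi>. hsym i l \<xi> * phi j \<xi>) G) \<and> Lpb p (C * A * 2 powr (- real_of_int j * ((s - 2) - (- 2)))) w"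
      by (rule multiplier_block[where \<mu> = "hsym i l" and a = "- 2" and r = "s - 2",
            OF p ann_hsym[OF ann_phi(2)] ann_mult_phi[OF ann_hsym[OF ann_phi(2)]] hsym_scale], assumption, rule that)
    then have "P i l C" by (simp add: P_def)
    then show ?thesis ..
  qed
  then obtain C where P: "\<And>i l. P i l (C i l)" by metis
  have C: "C i l > 0" "\<And>A G j. A \<ge> 0 \<Longrightarrow> dlin G \<Longrightarrow> block_bound p (s - 2) A G \<Longrightarrow>
       \<exists>w. represents w (fmult (\<lambda>\<xi>. hsym i l \<xi> * phi j \<xi>) G) \<and> Lpb p (C i l * A * 2 powr (- real_of_int j * s)) w" for i l
    using P[of i l] unfolding P_def by blast+
  define C0 where "C0 = (\<Sum>i\<in>UNIV. \<Sum>l\<in>UNIV. C i l)"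
  have C0: "C0 > 0" unfolding C0_def by (intro sum_pos C) auto
  show ?thesis
  proof (rule that[OF C0])
    fix A :: real and f :: "'n \<Rightarrow> 'n distr" and i :: 'n assume A: "A > 0" and f: "\<And>l. dlin (f l)" and b: "\<And>l. block_bound p (s - 2) A (f l)"
    have "\<exists>w. represents w (fmult (\<lambda>\<xi>. hsym i l \<xi> * phi j \<xi>) (f l)) \<and> Lpb p (C i l * A * 2 powr (- real_of_int j * s)) w" for l j
      by (rule C(2)[OF _ f b]) (use A in simp)
    then obtain w where w: "\<And>l j. represents (w l j) (fmult (\<lambda>\<xi>. hsym i l \<xi> * phi j \<xi>) (f l))"
      "\<And>l j. Lpb p (C i l * A * 2 powr (- real_of_int j * s)) (w l j)" by metis
    have CA: "C i l * A * 2 powr (- real_of_int j * s) \<ge> 0" for l j using C(1)[of i l] A by simp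
    have "bd p s ((\<Sum>l\<in>UNIV. C i l) * A) (invlap \<phi> (helmholtz \<phi> f i))"
    proof (rule operator_bd(1)[OF p s _ f, where I = UNIV and \<mu> = "hsym i" and w = "\<lambda>j x. \<Sum>l\<in>UNIV. w l j x"])
      show "(\<Sum>l\<in>UNIV. C i l) * A > 0" by (intro mult_pos_pos sum_pos C(1) A) auto
      show "represents (\<lambda>x. \<Sum>l\<in>UNIV. w l j x) (opsum UNIV (hsym i) f j)" for j
        unfolding opsum_def by (rule represents_sum[OF _ w(1)]) simp
      show "blocks p s ((\<Sum>l\<in>UNIV. C i l) * A) (\<lambda>j x. \<Sum>l\<in>UNIV. w l j x)"
        unfolding blocks_def sum_distrib_right by (intro allI Lpb_sum w(2) CA p)
      show "invlap \<phi> (helmholtz \<phi> f i) \<psi> = lim (\<lambda>N. \<Sum>j\<in>{- int N..int N}. opsum UNIV (hsym i) f j \<psi>)" if "\<psi> \<in> schwartz" for \<psi>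
        using invlap_helmholtz[OF f that] by (simp add: hsym_def[abs_def])
    qed (rule ann_hsym)
    moreover have "(\<Sum>l\<in>UNIV. C i l) * A \<le> C0 * A"
      unfolding C0_def using A
      by (intro mult_right_mono member_le_sum[of i UNIV "\<lambda>i. \<Sum>l\<in>UNIV. C i l"] sum_nonneg less_imp_le[OF C(1)]) auto
    ultimately show "bd p s (C0 * A) (invlap \<phi> (helmholtz \<phi> f i))"
      by (rule bd_mono) (use A p C(1) in \<open>auto intro!: mult_nonneg_nonneg sum_nonneg intro: less_imp_le\<close>)
  qed
qed

text \<open>For the pair \<open>(l, k)\<close>: the symbol of the \<open>k\<close>-th derivative
  followed by the projection and the inverse Laplacian, homogeneous of degree
  \<open>- 1\<close>.\<close>

definition nsym :: "'n \<Rightarrow> 'n \<times> 'n \<Rightarrow> real^'n \<Rightarrow> complex" where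
  "nsym i lk \<xi> = \<i> * (complex_of_real (\<xi> $ snd lk) * hsym i (fst lk) \<xi>)"

lemma ann_nsym: "ann j h \<Longrightarrow> ann j (\<lambda>\<xi>. nsym i lk \<xi> * h \<xi>)"
  unfolding nsym_def mult.assoc by (intro ann_cmult ann_coord ann_hsym)

lemma nsym_scale: "c > 0 \<Longrightarrow> nsym i lk (c *\<^sub>R \<xi>) = complex_of_real (c powr (- 1)) * nsym i lk \<xi>"
proof -
  assume c: "c > 0"
  then have "c * c powr (- 2) = c powr (- 1)"
    by (simp add: powr_minus_divide power2_eq_square)
  then have "complex_of_real c * complex_of_real (c powr (- 2)) = complex_of_real (c powr (- 1))"
    by (simp only: of_real_mult[symmetric])
  moreover have "nsym i lk (c *\<^sub>R \<xi>) = complex_of_real c * complex_of_real (c powr (- 2)) * nsym i lk \<xi>"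
    unfolding nsym_def hsym_scale[OF c] vector_scaleR_component of_real_mult real_scaleR_def by (simp only: mult_ac)
  ultimately show ?thesis by (simp only:)
qed

text \<open>The nonlinear operator on an arbitrary matrix of densities. A difference of two tensor
  squares is no longer a tensor square, so the difference estimates need this generality.\<close>

definition quad :: "('n \<Rightarrow> 'n \<Rightarrow> real^'n \<Rightarrow> complex) \<Rightarrow> 'n \<Rightarrow> 'n distr" where
  "quad h i = invlap \<phi> (helmholtz \<phi> (divg (\<lambda>l k. fdist (h l k))) i)"

definition quad_sum :: "('n \<Rightarrow> 'n \<Rightarrow> real^'n \<Rightarrow> complex) \<Rightarrow> 'n \<Rightarrow> int \<Rightarrow> 'n distr" where
  "quad_sum h i = opsum UNIV (nsym i) (\<lambda>lk. fdist (h (fst lk) (snd lk)))"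

lemma fdist_represents: "moderate g \<Longrightarrow> represents g (fdist g)"
  by (rule represents_moderate) (simp_all add: fdist_def)

text \<open>The divergence is absorbed into the symbol, and the double sum over components becomes a
  single sum over pairs, as \<open>operator_bd\<close> expects.\<close>

lemma quad_eq:
  assumes h: "\<And>l k. moderate (h l k)" and \<psi>: "\<psi> \<in> schwartz"
  shows "quad h i \<psi> = lim (\<lambda>N. \<Sum>j\<in>{- int N..int N}. quad_sum h i j \<psi>)"
proof -
  have F: "dlin (fdist (h l k))" for l k by (rule represents_dlin[OF fdist_represents[OF h]])
  have "opsum UNIV (hsym i) (divg (\<lambda>l k. fdist (h l k))) j \<psi> = quad_sum h i j \<psi>" for j
  proof -
    have S: "(\<lambda>\<xi>. hsym i l \<xi> * phi j \<xi> * ift \<psi> \<xi>) \<in> schwartz" for l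
      by (intro schwartz_mult schwartz_ift \<psi> ann_mult_phi ann_hsym ann_phi)
    have "opsum UNIV (hsym i) (divg (\<lambda>l k. fdist (h l k))) j \<psi> = (\<Sum>l\<in>UNIV. \<Sum>k\<in>UNIV. fmult (\<lambda>\<xi>. nsym i (l, k) \<xi> * phi j \<xi>) (fdist (h l k)) \<psi>)"
    proof -
      have "dderiv k (fdist (h l k)) (ft (\<lambda>\<xi>. hsym i l \<xi> * phi j \<xi> * ift \<psi> \<xi>)) = fdist (h l k) (ft (\<lambda>\<xi>. nsym i (l, k) \<xi> * phi j \<xi> * ift \<psi> \<xi>))" for l k
        unfolding dderiv_ft[OF F S] by (simp add: nsym_def mult.assoc)
      then show ?thesis unfolding opsum_def fmult_eq divg_def by (simp only:)
    qed
    also have "\<dots> = (\<Sum>lk\<in>UNIV. fmult (\<lambda>\<xi>. nsym i lk \<xi> * phi j \<xi>) (fdist (h (fst lk) (snd lk))) \<psi>)"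
      unfolding UNIV_Times_UNIV[symmetric] by (subst sum.cartesian_product) (auto intro!: sum.cong)
    finally show ?thesis by (simp add: quad_sum_def opsum_def)
  qed
  then show ?thesis
    unfolding quad_def using invlap_helmholtz[where i = i, OF dlin_divg[OF F] \<psi>] by (simp add: hsym_def[abs_def])
qed

text \<open>In block \<open>j\<close> the symbol contributes the exponent \<open>- j\<close> and the
  embedding of weak \<open>L\<^sup>q\<close> the exponent \<open>j * (1 - s)\<close>, leaving
  \<open>- j * s\<close>. Convergence of the partial sums is part of the result because
  \<open>quad\<close> is a \<open>lim\<close>, whose value alone says nothing.\<close>

lemma nonlinear_bd:
  assumes p: "p \<ge> 1" and s: "0 < s" "s < CARD('n) / p" and q: "1 < q" "q < p" "CARD('n) * (1 / q - 1 / p) = 1 - s"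
  obtains C where "C > 0" "\<And>B h i. B > 0 \<Longrightarrow> (\<And>l k. WL q B (h l k)) \<Longrightarrow> bd p s (C * B) (quad h i)"
    "\<And>B h i \<psi>. B > 0 \<Longrightarrow> (\<And>l k. WL q B (h l k)) \<Longrightarrow> \<psi> \<in> schwartz \<Longrightarrow>
       (\<lambda>N. \<Sum>j\<in>{- int N..int N}. quad_sum h i j \<psi>) \<longlonglongrightarrow> quad h i \<psi>"
proof -
  define K where "K i lk = ift (\<lambda>\<xi>. nsym i lk \<xi> * phi 0 \<xi>)" for i lk
  have K: "K i lk \<in> schwartz" for i lk
    unfolding K_def by (intro schwartz_ift ann_mult_phi ann_nsym ann_phi)
  define P where "P i lk C \<longleftrightarrow> C > 0 \<and> (\<forall>A h j. A > 0 \<longrightarrow> WL q A h \<longrightarrow>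
    Lpb p (C * A * 2 powr (real_of_int j * CARD('n) * (1 / q - 1 / p))) (cnv (dil j (K i lk)) h))" for i lk C
  have "\<exists>C. P i lk C" for i lk using WL_cnv[OF K q(1,2), of i lk] unfolding P_def by blast
  then obtain C where P: "\<And>i lk. P i lk (C i lk)" by metis
  have C: "C i lk > 0" "\<And>A h j. A > 0 \<Longrightarrow> WL q A h \<Longrightarrow>
    Lpb p (C i lk * A * 2 powr (real_of_int j * CARD('n) * (1 / q - 1 / p))) (cnv (dil j (K i lk)) h)" for i lk
    using P[of i lk] unfolding P_def by blast+
  define C0 where "C0 = (\<Sum>i\<in>UNIV. \<Sum>lk\<in>UNIV. C i lk)"
  have C0: "C0 > 0" unfolding C0_def by (intro sum_pos C) auto
  have main: "bd p s ((\<Sum>lk\<in>UNIV. C i lk) * B) (quad h i) \<and> (\<forall>\<psi>\<in>schwartz. (\<lambda>N. \<Sum>j\<in>{- int N..int N}. quad_sum h i j \<psi>) \<longlonglongrightarrow> quad h i \<psi>)"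
    if B: "B > 0" and h: "\<And>l k. WL q B (h l k)" for B and h :: "'n \<Rightarrow> 'n \<Rightarrow> real^'n \<Rightarrow> complex" and i :: 'n
  proof -
    have mod: "moderate (h l k)" for l k by (rule WL_moderate[OF h q(1) B])
    define m where "m lk j = (\<lambda>\<xi>. nsym i lk \<xi> * phi j \<xi>)" for lk j
    define w where "w lk j = cnv (ift (m lk j)) (h (fst lk) (snd lk))" for lk j
    have mS: "m lk j \<in> schwartz" for lk j unfolding m_def by (intro ann_mult_phi ann_nsym ann_phi)
    have w1: "represents (w lk j) (fmult (m lk j) (fdist (h (fst lk) (snd lk))))" for lk j
      unfolding w_def by (rule represents_fmult[OF mS mod fdist_represents[OF mod]])
    have w2: "Lpb p (C i lk * B * 2 powr (- real_of_int j * s)) (w lk j)" for lk j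
    proof -
      have "ift (m lk j) = (\<lambda>x. complex_of_real (2 powr (real_of_int j * (- 1))) * dil j (K i lk) x)"
        unfolding m_def K_def by (rule symbol_kernel) (rule nsym_scale)
      then have "w lk j = (\<lambda>y. complex_of_real (2 powr (real_of_int j * (- 1))) * cnv (dil j (K i lk)) (h (fst lk) (snd lk)) y)"
        by (simp only: w_def cnv_cmult)
      moreover have "Lpb p (norm (complex_of_real (2 powr (real_of_int j * (- 1)))) * (C i lk * B * 2 powr (real_of_int j * CARD('n) * (1 / q - 1 / p))))
         (\<lambda>y. complex_of_real (2 powr (real_of_int j * (- 1))) * cnv (dil j (K i lk)) (h (fst lk) (snd lk)) y)"
        by (rule Lpb_cmult[OF C(2)[OF B h]]) (use B C(1)[of i lk] in simp)
      moreover have "norm (complex_of_real (2 powr (real_of_int j * (- 1)))) * (C i lk * B * 2 powr (real_of_int j * CARD('n) * (1 / q - 1 / p))) = C i lk * B * 2 powr (- real_of_int j * s)"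
      proof -
        have "real_of_int j * CARD('n) * (1 / q - 1 / p) = real_of_int j * (1 - s)" by (simp only: mult.assoc q(3))
        then have "2 powr (real_of_int j * (- 1)) * 2 powr (real_of_int j * CARD('n) * (1 / q - 1 / p)) = 2 powr (- real_of_int j * s)"
          by (simp only: powr_add[symmetric]) (simp add: algebra_simps)
        then show ?thesis by (simp add: mult_ac)
      qed
      ultimately show ?thesis by (simp only:)
    qed
    have CB: "C i lk * B * 2 powr (- real_of_int j * s) \<ge> 0" for lk j using C(1)[of i lk] B by simp
    have SB: "(\<Sum>lk\<in>UNIV. C i lk) * B > 0" using C(1) B by (intro mult_pos_pos sum_pos) auto
    have G: "dlin (fdist (h (fst lk) (snd lk)))" for lk by (rule represents_dlin[OF fdist_represents[OF mod]])
    have rep: "represents (\<lambda>x. \<Sum>lk\<in>UNIV. w lk j x) (opsum UNIV (nsym i) (\<lambda>lk. fdist (h (fst lk) (snd lk))) j)" for j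
      unfolding opsum_def by (rule represents_sum[OF _ w1[unfolded m_def]]) simp
    have bl: "blocks p s ((\<Sum>lk\<in>UNIV. C i lk) * B) (\<lambda>j x. \<Sum>lk\<in>UNIV. w lk j x)"
      unfolding blocks_def sum_distrib_right by (intro allI Lpb_sum w2 CB p)
    have Q: "quad h i \<psi> = lim (\<lambda>N. \<Sum>j\<in>{- int N..int N}. opsum UNIV (nsym i) (\<lambda>lk. fdist (h (fst lk) (snd lk))) j \<psi>)" if "\<psi> \<in> schwartz" for \<psi>
      using quad_eq[where h = h, OF mod that] by (simp add: quad_sum_def)
    note O = operator_bd[OF p s SB G ann_nsym rep bl Q]
    show ?thesis unfolding quad_sum_def using O by blast
  qed
  show ?thesis
  proof (rule that[OF C0])
    fix B :: real and h :: "'n \<Rightarrow> 'n \<Rightarrow> real^'n \<Rightarrow> complex" and i :: 'n assume B: "B > 0" and h: "\<And>l k. WL q B (h l k)"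
    have le: "(\<Sum>lk\<in>UNIV. C i lk) * B \<le> C0 * B"
      unfolding C0_def using B
      by (intro mult_right_mono member_le_sum[of i UNIV "\<lambda>i. \<Sum>lk\<in>UNIV. C i lk"] sum_nonneg less_imp_le[OF C(1)]) auto
    have "bd p s ((\<Sum>lk\<in>UNIV. C i lk) * B) (quad h i)" by (rule main[THEN conjunct1]) (rule B, rule h)
    then show "bd p s (C0 * B) (quad h i)"
      by (rule bd_mono[OF _ le]) (use B p C(1) in \<open>auto intro!: mult_nonneg_nonneg sum_nonneg intro: less_imp_le\<close>)
  next
    fix B :: real and h :: "'n \<Rightarrow> 'n \<Rightarrow> real^'n \<Rightarrow> complex" and i :: 'n and \<psi> :: "real^'n \<Rightarrow> complex" assume "B > 0" "\<And>l k. WL q B (h l k)" "\<psi> \<in> schwartz"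
    then show "(\<lambda>N. \<Sum>j\<in>{- int N..int N}. quad_sum h i j \<psi>) \<longlonglongrightarrow> quad h i \<psi>" using main by blast
  qed
qed

text \<open>Additivity is stated for the localised terms, where it is elementary. It passes to
  \<open>quad\<close> once the limits involved are known to exist.\<close>

lemma quad_sum_add:
  assumes h: "\<And>l k x. h0 l k x = h1 l k x + h2 l k x + h3 l k x"
    and m: "\<And>l k. moderate (h1 l k)" "\<And>l k. moderate (h2 l k)" "\<And>l k. moderate (h3 l k)" and \<psi>: "\<psi> \<in> schwartz"
  shows "quad_sum h0 i j \<psi> = quad_sum h1 i j \<psi> + quad_sum h2 i j \<psi> + quad_sum h3 i j \<psi>"
proof -
  have "fdist (h0 l k) \<eta> = fdist (h1 l k) \<eta> + fdist (h2 l k) \<eta> + fdist (h3 l k) \<eta>" if "\<eta> \<in> schwartz" for l k \<eta>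
    using moderate_schwartz_integrable[OF m(1) that] moderate_schwartz_integrable[OF m(2) that] moderate_schwartz_integrable[OF m(3) that]
    by (simp add: fdist_def h distrib_right)
  moreover have "ft (\<lambda>\<xi>. nsym i lk \<xi> * phi j \<xi> * ift \<psi> \<xi>) \<in> schwartz" for lk
    by (intro schwartz_ft schwartz_mult[OF ann_mult_phi[OF ann_nsym[OF ann_phi(2)]]] schwartz_ift \<psi>)
  ultimately show ?thesis by (simp add: quad_sum_def opsum_def fmult_eq sum.distrib)
qed

end

section \<open>Picard iteration\<close>

text \<open>Estimates are proved for every admissible positive upper bound \<open>a\<close> of a
  norm; this turns them into an inequality with the norm itself. A vanishing norm is reached through
  arbitrarily small \<open>a\<close>.\<close>

lemma le_cmult_of_upper:
  fixes x v :: ereal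
  assumes v: "0 \<le> v" "v \<le> ereal d" and d: "d > 0" and C: "C > 0"
    and x: "\<And>a. a > 0 \<Longrightarrow> v \<le> ereal a \<Longrightarrow> a \<le> d \<Longrightarrow> x \<le> ereal (C * a)"
  shows "x \<le> ereal C * v"
proof -
  obtain r where r: "v = ereal r" "r \<ge> 0" "r \<le> d" using v by (cases v) auto
  show ?thesis
  proof (cases "r = 0")
    case True
    have "x \<le> 0 + ereal e" if e: "e > 0" for e
    proof -
      define a where "a = min d (e / C)"
      have a: "a > 0" "a \<le> d" "C * a \<le> e" using d C e by (auto simp: a_def min_def field_simps)
      have "x \<le> ereal (C * a)" by (rule x) (use a r True in auto)
      also have "\<dots> \<le> ereal e" using a by simp
      finally show ?thesis by simp
    qed
    then have "x \<le> 0" by (rule ereal_le_epsilon2)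
    then show ?thesis using r True by (simp add: zero_ereal_def[symmetric])
  next
    case False
    then show ?thesis using x[of r] r by simp
  qed
qed

lemma eventually_geometric_le:
  fixes c e :: real
  assumes "e > 0"
  obtains m where "c * (1 / 2) ^ m \<le> e"
proof -
  have "(\<lambda>m. c * (1 / 2 :: real) ^ m) \<longlonglongrightarrow> c * 0" by (intro tendsto_mult tendsto_const LIMSEQ_realpow_zero) auto
  then have "\<forall>\<^sub>F m in sequentially. c * (1 / 2) ^ m < e" using assms by (intro order_tendstoD) auto
  then obtain m where "c * (1 / 2) ^ m < e" by (auto simp: eventually_sequentially)
  then show ?thesis using that by (meson less_imp_le)
qed

section \<open>Norms of vector fields\<close>

lemma Lpn_nonneg: "Lpn p g \<ge> 0"
  by (simp add: Lpn_def)

lemma bnorm_nonneg: "bnorm \<phi> s p T \<ge> 0"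
  unfolding bnorm_def by (rule SUP_upper2[of 0]) (auto simp: dnorm_def Lpn_nonneg)

lemma bnorm_le_vbnorm: "bnorm \<phi> s p (F i) \<le> vbnorm \<phi> s p F"
  unfolding vbnorm_def
  by (simp add: sum.remove[of UNIV i "\<lambda>i. bnorm \<phi> s p (F i)"] add_increasing2 sum_nonneg bnorm_nonneg)

lemma vbnorm_nonneg: "vbnorm \<phi> s p F \<ge> 0"
  unfolding vbnorm_def by (intro sum_nonneg bnorm_nonneg)

lemma vbnorm_le:
  fixes F :: "'n::finite \<Rightarrow> 'n distr"
  assumes "\<And>i. bnorm \<phi> s p (F i) \<le> ereal B" shows "vbnorm \<phi> s p F \<le> ereal (real CARD('n) * B)"
proof -
  have "vbnorm \<phi> s p F \<le> (\<Sum>i::'n\<in>UNIV. ereal B)" unfolding vbnorm_def by (intro sum_mono assms)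
  also have "\<dots> = ereal (real CARD('n) * B)" by (simp only: sum_ereal) simp
  finally show ?thesis .
qed

lemma vbesov_vbnorm_finite: "vbesov \<phi> s p F \<Longrightarrow> vbnorm \<phi> s p F < \<infinity>"
  by (auto simp: vbesov_def besov_def vbnorm_def less_top[symmetric] sum_Pinfty top_ereal_def)

locale stationary_ns = littlewood_paley \<phi> for \<phi> :: "real^'n::finite \<Rightarrow> complex" +
  fixes p :: real
  assumes dim: "CARD('n) \<ge> 3" and p: "real CARD('n) / 2 < p" "p < real CARD('n)"
begin

definition crit :: real where "crit = - 1 + CARD('n) / p"

lemma p1: "p \<ge> 1" using dim p by linarith

lemma np: "1 < CARD('n) / p" "CARD('n) / p < 2"
  using p p1 by (auto simp: field_simps)

text \<open>The range of \<open>p\<close> is exactly what puts the critical regularity strictly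
  between 0 and 1. The last identity makes its embedding exponent equal to \<open>n\<close>.\<close>

lemma crit: "0 < crit" "crit < 1" "crit < CARD('n) / p" "CARD('n) / p - crit = 1"
  using np by (auto simp: crit_def)

definition nl :: "('n \<Rightarrow> 'n distr) \<Rightarrow> 'n \<Rightarrow> 'n distr" where
  "nl U i = invlap \<phi> (helmholtz \<phi> (divg (tens U)) i)"

definition fc :: "('n \<Rightarrow> 'n distr) \<Rightarrow> 'n \<Rightarrow> 'n distr" where
  "fc f i = invlap \<phi> (helmholtz \<phi> f i)"

lemma nl_quad: "nl U i = quad (\<lambda>l k x. rep (U l) x * rep (U k) x) i"
  by (simp add: nl_def quad_def tens_def[abs_def])

lemma product_WL:
  assumes s: "0 < s" "s < 1"
  obtains C where "C > 0" "\<And>A B T S g f. A > 0 \<Longrightarrow> B > 0 \<Longrightarrow> bd p crit A T \<Longrightarrow> bd p s B S \<Longrightarrow> represents g T \<Longrightarrow> represents f S \<Longrightarrow>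
     WL (CARD('n) / (1 + CARD('n) / p - s)) (C * A * B) (\<lambda>x. g x * f x)"
proof -
  have sn: "s < CARD('n) / p" using s np by linarith
  obtain C1 where C1: "C1 > 0" "\<And>A T g. A > 0 \<Longrightarrow> bd p crit A T \<Longrightarrow> represents g T \<Longrightarrow> WL (CARD('n) / (CARD('n) / p - crit)) (C1 * A) g"
    by (rule bd_function[OF p1 crit(1,3)], rule that)
  obtain C2 where C2: "C2 > 0" "\<And>A T g. A > 0 \<Longrightarrow> bd p s A T \<Longrightarrow> represents g T \<Longrightarrow> WL (CARD('n) / (CARD('n) / p - s)) (C2 * A) g"
    by (rule bd_function[OF p1 s(1) sn], rule that)
  define q where "q = CARD('n) / (1 + CARD('n) / p - s)"
  define m where "m = CARD('n) / (CARD('n) / p - s)"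
  have m: "m > 0" using sn by (simp add: m_def)
  have q: "1 / q = 1 / real CARD('n) + 1 / m" by (simp add: q_def m_def add_divide_distrib diff_divide_distrib)
  have c: "2 powr (1 / q) * C1 * C2 > 0" using C1 C2 by simp
  have main: "WL q (2 powr (1 / q) * C1 * C2 * A * B) (\<lambda>x. g x * f x)"
    if AB: "A > 0" "B > 0" and b: "bd p crit A T" "bd p s B S" and r: "represents g T" "represents f S" for A B T S g f
  proof -
    have "WL (real CARD('n)) (C1 * A) g" using C1(2)[OF AB(1) b(1) r(1)] by (simp add: crit(4))
    moreover have "WL m (C2 * B) f" using C2(2)[OF AB(2) b(2) r(2)] by (simp add: m_def)
    ultimately have "WL q (2 powr (1 / q) * (C1 * A) * (C2 * B)) (\<lambda>x. g x * f x)"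
      by (rule WL_mult) (use AB C1 C2 m q in auto)
    then show ?thesis by (simp add: mult_ac)
  qed
  show ?thesis by (rule that[OF c]) (fold q_def, rule main)
qed

lemma rep_represents:
  assumes s: "0 < s" "s < CARD('n) / p" and "A > 0" "bd p s A T" shows "represents (rep T) T"
  using bd_function[OF p1 s] assms(3,4) represents_rep by metis

text \<open>Both clauses measure one factor in the critical norm only. The second accordingly
  estimates a difference in regularity \<open>s\<close> for fields of which critical bounds alone
  are known, and it is linear in the bound \<open>D\<close> of their difference.\<close>

definition bilinear_const :: "real \<Rightarrow> real \<Rightarrow> bool" where
  "bilinear_const s K \<longleftrightarrow> K > 0 \<and>
    (\<forall>A B U i. A > 0 \<longrightarrow> B > 0 \<longrightarrow> (\<forall>i. bd p crit A (U i)) \<longrightarrow> (\<forall>i. bd p s B (U i)) \<longrightarrow> bd p s (K * A * B) (nl U i)) \<and>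
    (\<forall>A B D U V i. A > 0 \<longrightarrow> B > 0 \<longrightarrow> D > 0 \<longrightarrow> (\<forall>i. bd p crit A (U i)) \<longrightarrow> (\<forall>i. bd p crit B (V i)) \<longrightarrow>
       (\<forall>i. bd p s D (\<lambda>\<psi>. U i \<psi> - V i \<psi>)) \<longrightarrow> bd p s (K * (A + B) * D) (\<lambda>\<psi>. nl U i \<psi> - nl V i \<psi>))"

lemma bilinear_constD:
  assumes "bilinear_const s K"
  shows "K > 0"
    and "A > 0 \<Longrightarrow> B > 0 \<Longrightarrow> (\<And>i. bd p crit A (U i)) \<Longrightarrow> (\<And>i. bd p s B (U i)) \<Longrightarrow> bd p s (K * A * B) (nl U i)"
    and "A > 0 \<Longrightarrow> B > 0 \<Longrightarrow> D > 0 \<Longrightarrow> (\<And>i. bd p crit A (U i)) \<Longrightarrow> (\<And>i. bd p crit B (V i)) \<Longrightarrow>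
       (\<And>i. bd p s D (\<lambda>\<psi>. U i \<psi> - V i \<psi>)) \<Longrightarrow> bd p s (K * (A + B) * D) (\<lambda>\<psi>. nl U i \<psi> - nl V i \<psi>)"
  using assms unfolding bilinear_const_def by blast+

text \<open>The difference of products splits as
  \<open>g k * (g l - f l) + f l * (g k - f k)\<close>, so that each summand has one critical factor
  and one factor of regularity \<open>s\<close>.\<close>

lemma nonlinear_term:
  assumes s: "0 < s" "s < 1" shows "\<exists>K. bilinear_const s K"
proof -
  define Q where "Q r = CARD('n) / (1 + CARD('n) / p - r)" for r
  \<comment> \<open>\<open>n / p < 2\<close> and \<open>r > 0\<close> keep the denominator below 3,
    hence below \<open>n\<close>, and so \<open>Q r\<close> above 1; \<open>Q r < p\<close> amounts
    to \<open>r < 1\<close>.\<close>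
  have Q: "1 < Q r" "Q r < p" "CARD('n) * (1 / Q r - 1 / p) = 1 - r" "0 < r" "r < CARD('n) / p" if r: "0 < r" "r < 1" for r
  proof -
    have pos: "1 + CARD('n) / p - r > 0" using np r by linarith
    have "1 + CARD('n) / p - r < CARD('n)" using np r dim by linarith
    then show "1 < Q r" unfolding Q_def using pos by (simp only: less_divide_eq) simp
    have "p * (1 + CARD('n) / p - r) = CARD('n) + p * (1 - r)" using p1 by (simp add: algebra_simps)
    moreover have "p * (1 - r) > 0" using p1 r by simp
    ultimately show "Q r < p" unfolding Q_def using pos by (simp add: divide_less_eq)
    have "CARD('n) * (1 / Q r) = 1 + CARD('n) / p - r" by (simp add: Q_def)
    then show "CARD('n) * (1 / Q r - 1 / p) = 1 - r" by (simp only: right_diff_distrib) simp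
    show "0 < r" "r < CARD('n) / p" using r np by linarith+
  qed
  note Qs = Q[OF s] and Qp = Q[OF crit(1,2)]
  define P where "P r C \<longleftrightarrow> C > 0 \<and> (\<forall>A B T S g f. A > 0 \<longrightarrow> B > 0 \<longrightarrow> bd p crit A T \<longrightarrow> bd p r B S \<longrightarrow> represents g T \<longrightarrow> represents f S \<longrightarrow>
     WL (Q r) (C * A * B) (\<lambda>x. g x * f x))" for r C
  have "\<exists>C. P r C" if r: "0 < r" "r < 1" for r
  proof -
    obtain C where "C > 0" "\<And>A B T S g f. A > 0 \<Longrightarrow> B > 0 \<Longrightarrow> bd p crit A T \<Longrightarrow> bd p r B S \<Longrightarrow> represents g T \<Longrightarrow> represents f S \<Longrightarrow>
     WL (Q r) (C * A * B) (\<lambda>x. g x * f x)"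
      by (rule product_WL[OF r, folded Q_def], rule that)
    then show ?thesis unfolding P_def by blast
  qed
  then obtain Cs Cp where "P s Cs" "P crit Cp" using s crit by metis
  then have Cs: "Cs > 0" "\<And>A B T S g f. A > 0 \<Longrightarrow> B > 0 \<Longrightarrow> bd p crit A T \<Longrightarrow> bd p s B S \<Longrightarrow> represents g T \<Longrightarrow> represents f S \<Longrightarrow>
     WL (Q s) (Cs * A * B) (\<lambda>x. g x * f x)"
    and Cp: "Cp > 0" "\<And>A B T S g f. A > 0 \<Longrightarrow> B > 0 \<Longrightarrow> bd p crit A T \<Longrightarrow> bd p crit B S \<Longrightarrow> represents g T \<Longrightarrow> represents f S \<Longrightarrow>
     WL (Q crit) (Cp * A * B) (\<lambda>x. g x * f x)"
    unfolding P_def by blast+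
  obtain K where K: "K > 0" "\<And>B h i. B > 0 \<Longrightarrow> (\<And>l k. WL (Q s) B (h l k)) \<Longrightarrow> bd p s (K * B) (quad h i)"
    "\<And>B h i \<psi>. B > 0 \<Longrightarrow> (\<And>l k. WL (Q s) B (h l k)) \<Longrightarrow> \<psi> \<in> schwartz \<Longrightarrow>
       (\<lambda>N. \<Sum>j\<in>{- int N..int N}. quad_sum h i j \<psi>) \<longlonglongrightarrow> quad h i \<psi>"
    by (rule nonlinear_bd[OF p1 Qs(4,5) Qs(1-3)], rule that, assumption, blast, blast)
  \<comment> \<open>The critical exponent is treated besides \<open>s\<close>, because it is there
    that the products of each field with itself are controlled.\<close>
  obtain Kp where Kp: "\<And>B h i \<psi>. B > 0 \<Longrightarrow> (\<And>l k. WL (Q crit) B (h l k)) \<Longrightarrow> \<psi> \<in> schwartz \<Longrightarrow>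
       (\<lambda>N. \<Sum>j\<in>{- int N..int N}. quad_sum h i j \<psi>) \<longlonglongrightarrow> quad h i \<psi>"
    by (rule nonlinear_bd[OF p1 Qp(4,5) Qp(1-3)], rule that, blast)
  have KC: "K * Cs > 0" using K Cs by simp
  have one: "bd p s (K * Cs * A * B) (nl U i)"
    if AB: "A > 0" "B > 0" and U: "\<And>i. bd p crit A (U i)" "\<And>i. bd p s B (U i)" for A B and U :: "'n \<Rightarrow> 'n distr" and i
  proof -
    have r: "represents (rep (U l)) (U l)" for l by (rule rep_represents[OF crit(1,3) AB(1) U(1)])
    have CAB: "Cs * A * B > 0" using Cs AB by simp
    have "WL (Q s) (Cs * A * B) (\<lambda>x. rep (U l) x * rep (U k) x)" for l k by (rule Cs(2)[OF AB U r r])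
    then have "bd p s (K * (Cs * A * B)) (nl U i)" unfolding nl_quad by (rule K(2)[OF CAB])
    then show ?thesis by (simp add: mult.assoc)
  qed
  have two: "bd p s (K * Cs * (A + B) * D) (\<lambda>\<psi>. nl U i \<psi> - nl V i \<psi>)"
    if pos: "A > 0" "B > 0" "D > 0" and U: "\<And>i. bd p crit A (U i)" and V: "\<And>i. bd p crit B (V i)"
      and UV: "\<And>i. bd p s D (\<lambda>\<psi>. U i \<psi> - V i \<psi>)" for A B D and U V :: "'n \<Rightarrow> 'n distr" and i
  proof -
    have rU: "represents (rep (U l)) (U l)" for l by (rule rep_represents[OF crit(1,3) pos(1) U])
    have rV: "represents (rep (V l)) (V l)" for l by (rule rep_represents[OF crit(1,3) pos(2) V])
    define g where "g l x = rep (U l) x" for l x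
    define f where "f l x = rep (V l) x" for l x
    define d where "d l x = g l x - f l x" for l x
    have rg: "represents (g l) (U l)" and rf: "represents (f l) (V l)" for l
      using rU[of l] rV[of l] by (simp_all add: g_def[abs_def] f_def[abs_def])
    have rd: "represents (d l) (\<lambda>\<psi>. U l \<psi> - V l \<psi>)" for l
      using represents_lincomb[where a = 1 and b = "- 1", OF rg rf, of l l] by (simp add: d_def[abs_def])
    define h0 h1 h2 h3 where "h0 l k x = g l x * g k x" and "h1 l k x = f l x * f k x"
      and "h2 l k x = g k x * d l x" and "h3 l k x = f l x * d k x" for l k x
    have w0: "WL (Q crit) (Cp * A * A) (h0 l k)" for l k unfolding h0_def by (rule Cp(2)[OF pos(1,1) U U rg rg])
    have w1: "WL (Q crit) (Cp * B * B) (h1 l k)" for l k unfolding h1_def by (rule Cp(2)[OF pos(2,2) V V rf rf])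
    have w2: "WL (Q s) (Cs * A * D) (h2 l k)" for l k unfolding h2_def by (rule Cs(2)[OF pos(1,3) U UV rg rd])
    have w3: "WL (Q s) (Cs * B * D) (h3 l k)" for l k unfolding h3_def by (rule Cs(2)[OF pos(2,3) V UV rf rd])
    have c: "Cp * A * A > 0" "Cp * B * B > 0" "Cs * A * D > 0" "Cs * B * D > 0" using Cs Cp pos by auto
    have split: "h0 l k x = h1 l k x + h2 l k x + h3 l k x" for l k x
      by (simp add: h0_def h1_def h2_def h3_def d_def algebra_simps)
    have m: "moderate (h1 l k)" "moderate (h2 l k)" "moderate (h3 l k)" for l k
      using WL_moderate[OF w1 Qp(1) c(2)] WL_moderate[OF w2 Qs(1) c(3)] WL_moderate[OF w3 Qs(1) c(4)] by auto
    \<comment> \<open>The four limits exist at two different exponents, the full products at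
      \<open>Q crit\<close> and the mixed ones at \<open>Q s\<close>. Only their existence lets the
      identity of partial sums pass to \<open>quad\<close>.\<close>
    have eq: "nl U i \<psi> - nl V i \<psi> = quad h2 i \<psi> + quad h3 i \<psi>" if \<psi>: "\<psi> \<in> schwartz" for \<psi>
    proof -
      have "(\<lambda>N. (\<Sum>j\<in>{- int N..int N}. quad_sum h1 i j \<psi>) + (\<Sum>j\<in>{- int N..int N}. quad_sum h2 i j \<psi>) + (\<Sum>j\<in>{- int N..int N}. quad_sum h3 i j \<psi>))
         \<longlonglongrightarrow> quad h1 i \<psi> + quad h2 i \<psi> + quad h3 i \<psi>"
        by (intro tendsto_add Kp[OF c(2) w1 \<psi>] K(3)[OF c(3) w2 \<psi>] K(3)[OF c(4) w3 \<psi>])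
      then have "(\<lambda>N. \<Sum>j\<in>{- int N..int N}. quad_sum h0 i j \<psi>) \<longlonglongrightarrow> quad h1 i \<psi> + quad h2 i \<psi> + quad h3 i \<psi>"
        by (simp only: quad_sum_add[OF split m \<psi>] sum.distrib)
      with Kp[OF c(1) w0 \<psi>] have "quad h0 i \<psi> = quad h1 i \<psi> + quad h2 i \<psi> + quad h3 i \<psi>" by (rule LIMSEQ_unique)
      moreover have "nl U i = quad h0 i" "nl V i = quad h1 i"
        by (simp_all add: nl_quad h0_def[abs_def] h1_def[abs_def] g_def f_def)
      ultimately show ?thesis by simp
    qed
    have "bd p s (K * (Cs * A * D) + K * (Cs * B * D)) (\<lambda>\<psi>. quad h2 i \<psi> + quad h3 i \<psi>)"
      by (intro bd_add K(2)[OF c(3) w2] K(2)[OF c(4) w3] p1) (use K(1) c in auto)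
    then have "bd p s (K * (Cs * A * D) + K * (Cs * B * D)) (\<lambda>\<psi>. nl U i \<psi> - nl V i \<psi>)"
      by (rule bd_deq) (rule eq)
    then show ?thesis by (simp add: algebra_simps)
  qed
  show ?thesis unfolding bilinear_const_def using KC one two by (intro exI[of _ "K * Cs"]) blast
qed

text \<open>The zero field satisfies every bound, so it starts all the inductions below, in the
  critical norm as well as in regularity \<open>s\<close>.\<close>

fun iter :: "('n \<Rightarrow> 'n distr) \<Rightarrow> nat \<Rightarrow> 'n \<Rightarrow> 'n distr" where
  "iter f 0 = (\<lambda>i \<psi>. 0)"
| "iter f (Suc m) = (\<lambda>i \<psi>. fc f i \<psi> - nl (iter f m) i \<psi>)"

text \<open>The limit of the iterates as a telescoping series on each test function, so that
  \<open>bd_series\<close> applies to it.\<close>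

definition sol :: "('n \<Rightarrow> 'n distr) \<Rightarrow> 'n \<Rightarrow> 'n distr" where
  "sol f i \<psi> = (\<Sum>m. iter f (Suc m) i \<psi> - iter f m i \<psi>)"

lemma bd_swap:
  assumes "bd p s A (\<lambda>\<psi>. T \<psi> - S \<psi>)" "A \<ge> 0" shows "bd p s A (\<lambda>\<psi>. S \<psi> - T \<psi>)"
  using bd_diff[OF bd_zero[of p s 0] assms(1) order_refl assms(2) p1] by simp

lemma ns_eq_iff: "ns_eq \<phi> f U \<longleftrightarrow> (\<forall>i. \<forall>\<psi>\<in>schwartz. U i \<psi> = fc f i \<psi> - nl U i \<psi>)"
  by (simp add: ns_eq_def deq_def fc_def nl_def)

section \<open>The contraction argument at critical regularity\<close>

context
  fixes K b :: real and f :: "'n \<Rightarrow> 'n distr"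
  assumes K: "bilinear_const crit K" and b: "b > 0" "8 * K * b \<le> 1" and f: "\<And>i. bd p crit b (fc f i)"
begin

lemma K0: "K > 0" by (rule bilinear_constD(1)[OF K])

text \<open>The ball of radius \<open>2 * b\<close> is invariant: the linear term takes up
  \<open>b\<close>, and smallness keeps the quadratic term \<open>K * (2 * b) * (2 * b)\<close>
  below another \<open>b\<close>.\<close>

lemma iter_bd: "bd p crit (2 * b) (iter f m i)"
proof (induction m arbitrary: i)
  case 0
  show ?case by (simp add: bd_zero)
next
  case (Suc m)
  have "bd p crit (b + K * (2 * b) * (2 * b)) (iter f (Suc m) i)"
    unfolding iter.simps
    by (intro bd_diff f bilinear_constD(2)[OF K] Suc p1) (use b K0 in auto)
  moreover have "K * (2 * b) * (2 * b) \<le> b"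
    using mult_right_mono[of "8 * K * b" 1 b] b K0 by (simp add: algebra_simps)
  ultimately show ?case by (elim bd_mono) (use b K0 p1 in auto)
qed

text \<open>Here \<open>8 * K * b \<le> 1\<close> is used in full: on the ball of radius
  \<open>2 * b\<close> the Lipschitz constant of \<open>nl\<close> is \<open>K * (4 * b)\<close>, at
  most one half.\<close>

lemma iter_step_bd: "bd p crit (2 * b * (1 / 2) ^ m) (\<lambda>\<psi>. iter f (Suc m) i \<psi> - iter f m i \<psi>)"
proof (induction m arbitrary: i)
  case 0
  show ?case using iter_bd[of 1 i] by simp
next
  case (Suc m)
  have e: "(\<lambda>\<psi>. iter f (Suc (Suc m)) i \<psi> - iter f (Suc m) i \<psi>) = (\<lambda>\<psi>. nl (iter f m) i \<psi> - nl (iter f (Suc m)) i \<psi>)"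
    by (simp add: fun_eq_iff)
  have "bd p crit (K * (2 * b + 2 * b) * (2 * b * (1 / 2) ^ m)) (\<lambda>\<psi>. nl (iter f m) i \<psi> - nl (iter f (Suc m)) i \<psi>)"
    by (intro bilinear_constD(3)[OF K] iter_bd bd_swap[OF Suc]) (use b in auto)
  moreover have "K * (2 * b + 2 * b) * (2 * b * (1 / 2) ^ m) \<le> 2 * b * (1 / 2) ^ Suc m"
  proof -
    have "(8 * K * b) * (b * (1 / 2) ^ m) \<le> 1 * (b * (1 / 2) ^ m)" by (rule mult_right_mono) (use b in auto)
    then show ?thesis by (simp add: algebra_simps)
  qed
  ultimately show ?case unfolding e by (elim bd_mono) (use b K0 p1 in auto)
qed

text \<open>This is the tail of the telescoping series from index \<open>m\<close> on; its bounds
  form a geometric series of ratio one half.\<close>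

lemma sol_minus_iter_bd: "bd p crit (4 * b * (1 / 2) ^ m) (\<lambda>\<psi>. sol f i \<psi> - iter f m i \<psi>)"
proof -
  let ?D = "\<lambda>k \<psi>. iter f (Suc k) i \<psi> - iter f k i \<psi>"
  have g: "(\<lambda>k. 2 * b * (1 / 2) ^ (k + m)) sums (4 * b * (1 / 2) ^ m)"
    using sums_mult[OF geometric_sums[of "1 / 2 :: real"], of "2 * b * (1 / 2) ^ m"] by (simp add: power_add mult_ac)
  have "bd p crit (\<Sum>k. 2 * b * (1 / 2) ^ (k + m)) (\<lambda>\<psi>. \<Sum>k. ?D (k + m) \<psi>)"
    by (rule bd_series(1)[OF p1 crit(1,3) iter_step_bd _ sums_summable[OF g]]) (use b in simp)
  then have 1: "bd p crit (4 * b * (1 / 2) ^ m) (\<lambda>\<psi>. \<Sum>k. ?D (k + m) \<psi>)" using sums_unique[OF g] by simp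
  have sm: "summable (\<lambda>k. ?D k \<psi>)" if "\<psi> \<in> schwartz" for \<psi>
  proof -
    have g0: "summable (\<lambda>k. 2 * b * (1 / 2 :: real) ^ k)" by (intro summable_mult summable_geometric) simp
    show ?thesis by (rule bd_series(2)[OF p1 crit(1,3) iter_step_bd _ g0 that]) (use b in simp)
  qed
  from 1 show ?thesis
  proof (rule bd_deq)
    fix \<psi> :: "real^'n \<Rightarrow> complex" assume "\<psi> \<in> schwartz"
    then have "(\<Sum>k. ?D (k + m) \<psi>) = sol f i \<psi> - (\<Sum>k<m. ?D k \<psi>)"
      unfolding sol_def by (intro suminf_minus_initial_segment sm)
    then show "sol f i \<psi> - iter f m i \<psi> = (\<Sum>k. ?D (k + m) \<psi>)"
      using sum_lessThan_telescope[of "\<lambda>k. iter f k i \<psi>" m] by simp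
  qed
qed

lemma sol_bd: "bd p crit (4 * b) (sol f i)"
  using sol_minus_iter_bd[of 0 i] by simp

text \<open>The residual can be written, for any \<open>m\<close>, as the error of
  \<open>sol\<close> at iterate \<open>m + 1\<close> minus the change of \<open>nl\<close> between
  iterate \<open>m\<close> and \<open>sol\<close>. Both decay geometrically in \<open>m\<close>, so
  the residual is zero.\<close>

lemma sol_ns_eq: "ns_eq \<phi> f (sol f)"
  unfolding ns_eq_iff
proof (intro allI ballI)
  fix i and \<psi> :: "real^'n \<Rightarrow> complex" assume \<psi>: "\<psi> \<in> schwartz"
  have "bd p crit e (\<lambda>\<psi>. sol f i \<psi> - (fc f i \<psi> - nl (sol f) i \<psi>))" if e: "e > 0" for e
  proof -
    \<comment> \<open>The common factor in front of \<open>(1 / 2) ^ m\<close> in the two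
      errors.\<close>
    define c where "c = 2 * b + K * (2 * b + 4 * b) * (4 * b)"
    obtain m where m: "c * (1 / 2) ^ m \<le> e" by (rule eventually_geometric_le[OF e])
    have "bd p crit (4 * b * (1 / 2) ^ Suc m + K * (2 * b + 4 * b) * (4 * b * (1 / 2) ^ m))
       (\<lambda>\<psi>. (sol f i \<psi> - iter f (Suc m) i \<psi>) - (nl (iter f m) i \<psi> - nl (sol f) i \<psi>))"
      by (intro bd_diff sol_minus_iter_bd bilinear_constD(3)[OF K] iter_bd sol_bd bd_swap[OF sol_minus_iter_bd] p1)
        (use b K0 in auto)
    moreover have "(\<lambda>\<psi>. (sol f i \<psi> - iter f (Suc m) i \<psi>) - (nl (iter f m) i \<psi> - nl (sol f) i \<psi>)) =
       (\<lambda>\<psi>. sol f i \<psi> - (fc f i \<psi> - nl (sol f) i \<psi>))" by (simp add: fun_eq_iff)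
    moreover have "4 * b * (1 / 2) ^ Suc m + K * (2 * b + 4 * b) * (4 * b * (1 / 2) ^ m) = c * (1 / 2) ^ m"
      by (simp add: c_def algebra_simps)
    ultimately have "bd p crit (c * (1 / 2) ^ m) (\<lambda>\<psi>. sol f i \<psi> - (fc f i \<psi> - nl (sol f) i \<psi>))" by simp
    then show ?thesis by (rule bd_mono[OF _ m]) (use b K0 p1 in \<open>auto simp: c_def\<close>)
  qed
  from bd_small_zero[OF p1 crit(1,3) this \<psi>] show "sol f i \<psi> = fc f i \<psi> - nl (sol f) i \<psi>" by simp
qed

text \<open>An arbitrary small solution is compared with the same iterates. The condition on
  \<open>E\<close> gives \<open>nl\<close> the Lipschitz constant one half between the ball of the
  iterates and that of \<open>V\<close>, so the iterates converge to \<open>V\<close>. Uniqueness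
  and regularity both follow from this.\<close>

lemma solution_minus_iter_bd:
  assumes V: "ns_eq \<phi> f V" "\<And>i. bd p crit E (V i)" and E: "E > 0" "K * (2 * b + E) \<le> 1 / 2"
  shows "bd p crit (E * (1 / 2) ^ m) (\<lambda>\<psi>. V i \<psi> - iter f m i \<psi>)"
proof (induction m arbitrary: i)
  case 0
  show ?case using V(2) by simp
next
  case (Suc m)
  have "bd p crit (K * (2 * b + E) * (E * (1 / 2) ^ m)) (\<lambda>\<psi>. nl (iter f m) i \<psi> - nl V i \<psi>)"
    by (intro bilinear_constD(3)[OF K] iter_bd V(2) bd_swap[OF Suc]) (use b E in auto)
  then have "bd p crit (K * (2 * b + E) * (E * (1 / 2) ^ m)) (\<lambda>\<psi>. V i \<psi> - iter f (Suc m) i \<psi>)"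
    by (rule bd_deq) (use V(1) in \<open>simp add: ns_eq_iff\<close>)
  moreover have "K * (2 * b + E) * (E * (1 / 2) ^ m) \<le> E * (1 / 2) ^ Suc m"
    using mult_right_mono[OF E(2), of "E * (1 / 2) ^ m"] E by simp
  ultimately show ?case by (rule bd_mono) (use b E K0 p1 in auto)
qed

lemma solution_unique:
  assumes V: "ns_eq \<phi> f V" "\<And>i. bd p crit E (V i)" and W: "ns_eq \<phi> f W" "\<And>i. bd p crit E (W i)"
    and E: "E > 0" "K * (2 * b + E) \<le> 1 / 2"
  shows "deq (V i) (W i)"
  unfolding deq_def
proof
  fix \<psi> :: "real^'n \<Rightarrow> complex" assume \<psi>: "\<psi> \<in> schwartz"
  have "bd p crit e (\<lambda>\<psi>. V i \<psi> - W i \<psi>)" if e: "e > 0" for e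
  proof -
    obtain m where m: "(2 * E) * (1 / 2) ^ m \<le> e" by (rule eventually_geometric_le[OF e])
    have "bd p crit (E * (1 / 2) ^ m + E * (1 / 2) ^ m) (\<lambda>\<psi>. (V i \<psi> - iter f m i \<psi>) - (W i \<psi> - iter f m i \<psi>))"
      by (intro bd_diff solution_minus_iter_bd V W E p1) (use E in auto)
    then have "bd p crit ((2 * E) * (1 / 2) ^ m) (\<lambda>\<psi>. V i \<psi> - W i \<psi>)" by (simp add: mult.assoc)
    then show ?thesis by (rule bd_mono[OF _ m]) (use E p1 in auto)
  qed
  from bd_small_zero[OF p1 crit(1,3) this \<psi>] show "V i \<psi> = W i \<psi>" by simp
qed

text \<open>With the other factor bounded critically, \<open>nl\<close> is linear in the bound of
  regularity \<open>s\<close>, so the iterates stay below \<open>2 * c\<close> whatever the size of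
  \<open>c\<close>; smallness concerns the product \<open>Ks * b\<close>. The bound reaches
  \<open>V\<close> through \<open>block_bound_limit\<close>.\<close>

lemma solution_regularity:
  assumes V: "ns_eq \<phi> f V" "\<And>i. bd p crit E (V i)" and E: "E > 0" "K * (2 * b + E) \<le> 1 / 2"
    and Ks: "bilinear_const s Ks" "Ks * (4 * b) \<le> 1" and c: "c > 0" "\<And>i. bd p s c (fc f i)"
  shows "block_bound p s (2 * c) (V i)"
proof -
  have it: "bd p s (2 * c) (iter f m i)" for m i
  proof (induction m arbitrary: i)
    case 0
    show ?case by (simp add: bd_zero)
  next
    case (Suc m)
    have K0: "Ks > 0" by (rule bilinear_constD(1)[OF Ks(1)])
    have "bd p s (c + Ks * (2 * b) * (2 * c)) (iter f (Suc m) i)"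
      unfolding iter.simps
      by (intro bd_diff c(2) bilinear_constD(2)[OF Ks(1)] iter_bd Suc p1) (use b c(1) K0 in auto)
    moreover have "c + Ks * (2 * b) * (2 * c) \<le> 2 * c"
      using mult_right_mono[OF Ks(2), of c] c(1) by (simp add: algebra_simps)
    ultimately show ?case by (rule bd_mono) (use b c(1) K0 p1 in auto)
  qed
  show ?thesis
  proof (rule block_bound_limit[OF p1 _ V(2)])
    fix e :: real assume e: "e > 0"
    obtain m where m: "E * (1 / 2) ^ m \<le> e" by (rule eventually_geometric_le[OF e])
    have "bd p crit e (\<lambda>\<psi>. V i \<psi> - iter f m i \<psi>)"
      by (rule bd_mono[OF solution_minus_iter_bd[OF V E] m]) (use E p1 in auto)
    then show "\<exists>S. bd p crit e (\<lambda>\<psi>. V i \<psi> - S \<psi>) \<and> block_bound p s (2 * c) S"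
      using it[of m i] unfolding bd_def by blast
  qed (use c(1) in simp)
qed

end

section \<open>From norms to working bounds\<close>

lemma forcing_const:
  assumes s: "0 < s" "s < 1"
  obtains C where "C > 0"
    "\<And>a f i. vbesov \<phi> (s - 2) p f \<Longrightarrow> vbnorm \<phi> (s - 2) p f \<le> ereal a \<Longrightarrow> a > 0 \<Longrightarrow> bd p s (C * a) (fc f i)"
proof -
  have sn: "s < CARD('n) / p" using s np by linarith
  obtain C where C: "C > 0" "\<And>A f i. A > 0 \<Longrightarrow> (\<And>l. dlin (f l)) \<Longrightarrow> (\<And>l. block_bound p (s - 2) A (f l)) \<Longrightarrow>
     bd p s (C * A) (invlap \<phi> (helmholtz \<phi> f i))"
    by (rule forcing_bd[OF p1 s(1) sn], rule that, assumption, blast)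
  have main: "bd p s (C * a) (fc f i)"
    if f: "vbesov \<phi> (s - 2) p f" "vbnorm \<phi> (s - 2) p f \<le> ereal a" and a: "a > 0" for a f i
  proof -
    have "bd p (s - 2) a (f l)" for l
      by (rule besov_bd[OF _ order_trans[OF bnorm_le_vbnorm f(2)]]) (use f(1) a p1 in \<open>auto simp: vbesov_def\<close>)
    then show ?thesis unfolding fc_def by (intro C(2) a) (auto simp: bd_def rec_def)
  qed
  show ?thesis by (rule that[OF C(1)]) (rule main)
qed

lemma vbesov_bd:
  assumes "vbesov \<phi> s p V" "vbnorm \<phi> s p V \<le> ereal a" "a \<ge> 0" shows "bd p s a (V i)"
  by (rule besov_bd[OF _ order_trans[OF bnorm_le_vbnorm assms(2)]]) (use assms p1 in \<open>auto simp: vbesov_def\<close>)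

end

theorem theorem1p1:
  fixes \<phi> :: "real^'n::finite \<Rightarrow> complex" and p :: real
  assumes "CARD('n) \<ge> 3" and "real CARD('n) / 2 < p" and "p < real CARD('n)"
    and "LP_function \<phi>"
  defines "sp \<equiv> -1 + real CARD('n) / p"
  shows "\<exists>\<delta>>0. \<exists>\<epsilon>>0. \<exists>C>0.
    (\<forall>f. vbesov \<phi> (sp - 2) p f \<and> vbnorm \<phi> (sp - 2) p f \<le> ereal \<delta> \<longrightarrow>
       (\<exists>U. vbesov \<phi> sp p U \<and> vbnorm \<phi> sp p U \<le> ereal \<epsilon> \<and> ns_eq \<phi> f U
            \<and> vbnorm \<phi> sp p U \<le> ereal C * vbnorm \<phi> (sp - 2) p f
            \<and> (\<forall>V. vbesov \<phi> sp p V \<and> vbnorm \<phi> sp p V \<le> ereal \<epsilon> \<and> ns_eq \<phi> f V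
                   \<longrightarrow> (\<forall>i. deq (V i) (U i)))))
    \<and> (\<forall>s. 0 < s \<and> s < 1 \<longrightarrow> (\<exists>\<delta>'>0. \<exists>C'>0. \<forall>f U.
          vbesov \<phi> (sp - 2) p f \<and> vbnorm \<phi> (sp - 2) p f \<le> ereal \<delta>' \<and> vbesov \<phi> (s - 2) p f
          \<and> vbesov \<phi> sp p U \<and> vbnorm \<phi> sp p U \<le> ereal \<epsilon> \<and> ns_eq \<phi> f U
          \<longrightarrow> vbesov \<phi> s p U \<and> vbnorm \<phi> s p U \<le> ereal C' * vbnorm \<phi> (s - 2) p f))"
proof -
  interpret stationary_ns \<phi> p
    by standard (use assms in auto)
  have sp_crit: "sp = crit" by (simp only: assms(5) crit_def)
  obtain K where K: "bilinear_const crit K" using nonlinear_term[OF crit(1,2)] by blast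
  have K0: "K > 0" by (rule bilinear_constD(1)[OF K])
  obtain F where F: "F > 0"
    "\<And>a f i. vbesov \<phi> (crit - 2) p f \<Longrightarrow> vbnorm \<phi> (crit - 2) p f \<le> ereal a \<Longrightarrow> a > 0 \<Longrightarrow> bd p crit (F * a) (fc f i)"
    by (rule forcing_const[OF crit(1,2)], rule that)
  define n where "n = real CARD('n)"
  have n: "n \<ge> 3" using dim by (simp add: n_def)
  \<comment> \<open>Since \<open>K * \<epsilon> = 1 / 4\<close>, any \<open>b\<close> with
    \<open>2 * K * b \<le> 1 / 4\<close> meets the condition
    \<open>K * (2 * b + \<epsilon>) \<le> 1 / 2\<close> for uniqueness in the ball of radius
    \<open>\<epsilon>\<close>.\<close>
  define \<epsilon> where "\<epsilon> = 1 / (4 * K)"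
  define \<delta> where "\<delta> = \<epsilon> / (4 * n * F)"
  \<comment> \<open>\<open>4 * F\<close> comes from \<open>sol_bd\<close> in each component, and
    \<open>n\<close> components are summed in \<open>vbnorm\<close>. Then
    \<open>\<delta> = \<epsilon> / C\<close> puts the solution itself into the ball of radius
    \<open>\<epsilon>\<close>.\<close>
  define C where "C = 4 * n * F"
  have \<epsilon>: "\<epsilon> > 0" using K0 by (simp add: \<epsilon>_def)
  have C: "C > 0" using F n by (simp add: C_def)
  have \<delta>: "\<delta> > 0" using \<epsilon> C by (simp add: \<delta>_def C_def)
  have small: "F * a > 0 \<and> 8 * K * (F * a) \<le> 1 \<and> K * (2 * (F * a) + \<epsilon>) \<le> 1 / 2 \<and> C * a \<le> \<epsilon>" if a: "a > 0" "a \<le> \<delta>" for a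
  proof -
    have "\<delta> = \<epsilon> / C" by (simp add: \<delta>_def C_def)
    then have Ca: "C * a \<le> \<epsilon>" using a C by (simp add: le_divide_eq mult.commute)
    \<comment> \<open>As \<open>n \<ge> 3\<close>, the requirement on the size of the solution
      already yields the factor 12, more than the 8 of the contraction condition.\<close>
    have "12 * (F * a) \<le> C * a" using mult_right_mono[OF n, of "4 * F * a"] F a by (simp add: C_def algebra_simps)
    with Ca have "12 * (F * a) \<le> \<epsilon>" by linarith
    then have "K * (12 * (F * a)) \<le> 1 / 4" using K0 mult_left_mono[of "12 * (F * a)" \<epsilon> K] by (simp add: \<epsilon>_def)
    moreover have "K * \<epsilon> = 1 / 4" using K0 by (simp add: \<epsilon>_def)
    moreover have "F * a > 0" using F a by simp
    moreover have "K * (F * a) > 0" using F a K0 by simp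
    ultimately show ?thesis using Ca by (auto simp: algebra_simps)
  qed
  have part1: "\<exists>U. vbesov \<phi> crit p U \<and> vbnorm \<phi> crit p U \<le> ereal \<epsilon> \<and> ns_eq \<phi> f U
            \<and> vbnorm \<phi> crit p U \<le> ereal C * vbnorm \<phi> (crit - 2) p f
            \<and> (\<forall>V. vbesov \<phi> crit p V \<and> vbnorm \<phi> crit p V \<le> ereal \<epsilon> \<and> ns_eq \<phi> f V
                   \<longrightarrow> (\<forall>i. deq (V i) (U i)))"
    if f: "vbesov \<phi> (crit - 2) p f" "vbnorm \<phi> (crit - 2) p f \<le> ereal \<delta>" for f
  proof -
    \<comment> \<open>\<open>sol f\<close> does not depend on \<open>a\<close>, so the bound holds
      for every admissible upper bound \<open>a\<close> of the norm of \<open>f\<close>, as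
      \<open>le_cmult_of_upper\<close> requires.\<close>
    have sb: "bd p crit (4 * (F * a)) (sol f i)" if a: "a > 0" "vbnorm \<phi> (crit - 2) p f \<le> ereal a" "a \<le> \<delta>" for a i
      by (rule sol_bd[OF K _ _ F(2)[OF f(1) a(2,1)]]) (use small[OF a(1,3)] in auto)
    have sbes: "besov \<phi> crit p (sol f i) \<and> bnorm \<phi> crit p (sol f i) \<le> ereal (4 * (F * a))"
      if a: "a > 0" "vbnorm \<phi> (crit - 2) p f \<le> ereal a" "a \<le> \<delta>" for a i
      by (rule bd_besov[OF p1 crit(1,3) _ sb[OF a]]) (use F a in simp)
    have norm: "vbnorm \<phi> crit p (sol f) \<le> ereal (C * a)"
      if a: "a > 0" "vbnorm \<phi> (crit - 2) p f \<le> ereal a" "a \<le> \<delta>" for a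
      using vbnorm_le[of \<phi> crit p "sol f" "4 * (F * a)"] sbes[OF a] by (simp add: C_def n_def mult_ac)
    note d = \<delta> f(2) order_refl
    note sd = small[OF \<delta> order_refl]
    have bes: "vbesov \<phi> crit p (sol f)" using sbes[OF d] by (simp add: vbesov_def)
    have le: "vbnorm \<phi> crit p (sol f) \<le> ereal \<epsilon>" using order_trans[OF norm[OF d]] sd by simp
    have eq: "ns_eq \<phi> f (sol f)" by (rule sol_ns_eq[OF K _ _ F(2)[OF f \<delta>]]) (use sd in auto)
    have lip: "vbnorm \<phi> crit p (sol f) \<le> ereal C * vbnorm \<phi> (crit - 2) p f"
      by (rule le_cmult_of_upper[OF vbnorm_nonneg f(2) \<delta> C norm])
    have unique: "deq (V i) (sol f i)" if V: "vbesov \<phi> crit p V" "vbnorm \<phi> crit p V \<le> ereal \<epsilon>" "ns_eq \<phi> f V" for V i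
      by (rule solution_unique[OF K _ _ F(2)[OF f \<delta>] V(3) vbesov_bd[OF V(1,2)] eq vbesov_bd[OF bes le] \<epsilon>]) (use sd \<epsilon> in auto)
    show ?thesis using bes le eq lip unique by blast
  qed
  have part2: "\<exists>\<delta>'>0. \<exists>C'>0. \<forall>f U.
          vbesov \<phi> (crit - 2) p f \<and> vbnorm \<phi> (crit - 2) p f \<le> ereal \<delta>' \<and> vbesov \<phi> (s - 2) p f
          \<and> vbesov \<phi> crit p U \<and> vbnorm \<phi> crit p U \<le> ereal \<epsilon> \<and> ns_eq \<phi> f U
          \<longrightarrow> vbesov \<phi> s p U \<and> vbnorm \<phi> s p U \<le> ereal C' * vbnorm \<phi> (s - 2) p f"
    if s: "0 < s" "s < 1" for s
  proof -
    obtain Ks where Ks: "bilinear_const s Ks" using nonlinear_term[OF s] by blast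
    have Ks0: "Ks > 0" by (rule bilinear_constD(1)[OF Ks])
    obtain G where G: "G > 0"
      "\<And>a f i. vbesov \<phi> (s - 2) p f \<Longrightarrow> vbnorm \<phi> (s - 2) p f \<le> ereal a \<Longrightarrow> a > 0 \<Longrightarrow> bd p s (G * a) (fc f i)"
      by (rule forcing_const[OF s], rule that)
    \<comment> \<open>The second entry ensures \<open>Ks * (4 * b) \<le> 1\<close> for
      \<open>b = F * \<delta>'\<close>; the radius \<open>\<epsilon>\<close> is kept from the first
      part.\<close>
    define \<delta>' where "\<delta>' = min \<delta> (1 / (4 * Ks * F))"
    define C' where "C' = 2 * n * G"
    have C': "C' > 0" using G n by (simp add: C'_def)
    have \<delta>': "\<delta>' > 0" "\<delta>' \<le> \<delta>" using \<delta> Ks0 F by (auto simp: \<delta>'_def)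
    have "\<delta>' \<le> 1 / (4 * Ks * F)" by (simp add: \<delta>'_def)
    then have KsF: "Ks * (4 * (F * \<delta>')) \<le> 1" using Ks0 F by (simp add: le_divide_eq mult_ac)
    note sd = small[OF \<delta>']
    have main: "vbesov \<phi> s p U \<and> vbnorm \<phi> s p U \<le> ereal C' * vbnorm \<phi> (s - 2) p f"
      if f: "vbesov \<phi> (crit - 2) p f" "vbnorm \<phi> (crit - 2) p f \<le> ereal \<delta>'" "vbesov \<phi> (s - 2) p f"
        and U: "vbesov \<phi> crit p U" "vbnorm \<phi> crit p U \<le> ereal \<epsilon>" "ns_eq \<phi> f U" for f U
    proof -
      have bb: "bnorm \<phi> s p (U i) \<le> ereal (2 * (G * a))" if a: "a > 0" "vbnorm \<phi> (s - 2) p f \<le> ereal a" for a i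
      proof -
        have Ga: "G * a > 0" using G a by simp
        have "block_bound p s (2 * (G * a)) (U i)"
          by (rule solution_regularity[OF K _ _ F(2)[OF f(1,2) \<delta>'(1)] U(3) vbesov_bd[OF U(1,2)] \<epsilon> _ Ks KsF Ga G(2)[OF f(3) a(2,1)]])
            (use sd \<epsilon> in auto)
        then show ?thesis using bnorm_le_iff[of p "2 * (G * a)" s "U i"] p1 Ga by simp
      qed
      have norm: "vbnorm \<phi> s p U \<le> ereal (C' * a)" if a: "a > 0" "vbnorm \<phi> (s - 2) p f \<le> ereal a" for a
        using vbnorm_le[of \<phi> s p U "2 * (G * a)"] bb[OF a] by (simp add: C'_def n_def mult_ac)
      obtain v where v: "vbnorm \<phi> (s - 2) p f = ereal v" "v \<ge> 0"
        using vbesov_vbnorm_finite[OF f(3)] vbnorm_nonneg[of \<phi> "s - 2" p f] by (cases "vbnorm \<phi> (s - 2) p f") auto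
      \<comment> \<open>The norm of \<open>f\<close> in regularity \<open>s - 2\<close> is finite
        but not small, so any number above it can serve as the range of \<open>a\<close>.\<close>
      have "vbnorm \<phi> s p U \<le> ereal C' * vbnorm \<phi> (s - 2) p f"
        by (rule le_cmult_of_upper[where d = "v + 1", OF vbnorm_nonneg _ _ C' norm]) (use v in auto)
      \<comment> \<open>Membership in S'_h is inherited from the critical space; what remains is
        finiteness of the new norm.\<close>
      moreover have "besov \<phi> s p (U i)" for i
      proof -
        have "bnorm \<phi> s p (U i) \<le> ereal (2 * (G * (v + 1)))" by (rule bb) (use v in auto)
        then have "bnorm \<phi> s p (U i) < \<infinity>" by (rule le_less_trans) simp
        then show ?thesis using U(1) by (simp add: besov_def vbesov_def)
      qed
      ultimately show ?thesis by (simp add: vbesov_def)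
    qed
    show ?thesis using \<delta>'(1) C' main by blast
  qed
  show ?thesis
    unfolding sp_crit
    by (rule exI[of _ \<delta>], rule conjI[OF \<delta>], rule exI[of _ \<epsilon>], rule conjI[OF \<epsilon>], rule exI[of _ C], rule conjI[OF C], rule conjI)
      (intro allI impI, elim conjE, rule part1, assumption+, intro allI impI, elim conjE, rule part2, assumption+)
qed

end
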